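(* Let $\nabla K\in L^\infty(\mathbb{R}^d)$ and assume additionally that $e^{-\Phi}\in L^1(\mathbb{R}^d)$. Let $T>0$ and for each $\gamma\ge1$ let $(\mu_t^\gamma)_{t\in[0,T]}$ be a weak solution of the kinetic Vlasov--Fokker--Planck equation with parameter $\gamma$, such that \[\sup_{\gamma\ge1}\sup_{t\in[0,T]}\Big\{\|\nabla_x\mu_t^\gamma\|_{L^2_H}+\iint|v|^2\mu_t^\gamma(dxdv)\Big\}<\infty.\] If $(\rho_t)_{t\in[0,T]}$ is the unique $\mathscr{E}$-regular solution of the aggregation-diffusion equation (with initial datum $\rho_0$), then \[\sup_{t\in[0,T]}\mathrm{d}_{BL}^2(\rho_t^\gamma,\rho_t)\le C\Big(\mathsf{Ent}\big((\pi^x\circ\Gamma^\gamma)_\#\mu_0^\gamma\,\big|\,\rho_0\big)+\frac1{\gamma^2}\Big)\] for some constant $C>0$ independent of $\gamma\ge1$, where $\rho_t^\gamma=\pi^x_\#\mu_t^\gamma$.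
   Context: $\Gamma^\gamma(x,v)=(x+v/\gamma,v)$, $\pi^x(x,v)=x$. Bounded Lipschitz distance: $\mathrm{d}_{BL}(\mu,\nu)=\sup\{|\langle f,\mu-\nu\rangle|:\|f\|_{\mathrm{Lip}}\le1,\|f\|_{L^\infty}\le1\}$. $\mathsf{Ent}(\mu|\nu)=\int(d\mu/d\nu)\log(d\mu/d\nu)d\nu$ if $\mu\ll\nu$, else $+\infty$. Standing assumptions on $\Phi:\mathbb{R}^d\to[0,\infty)$: locally Lipschitz; $|\nabla\Phi(x)|\le c_\Phi(1+|x|)$, $\nabla\Phi$ Lipschitz with constant $\le c_\Phi$; for all $r\in[1,\infty)$, $\sup_x|\nabla\Phi|^re^{-\Phi}<\infty$. $H(x,v)=\Phi(x)+|v|^2/2$, $\|f\|_{L^2_H}=(\iint|f|^2e^{H}dxdv)^{1/2}$. $\mathsf{F}(x,\rho)=-\nabla\Phi(x)-(\nabla K\star\rho)(x)$. Kinetic equation: $\partial_t\mu_t+\gamma v\cdot\nabla_x\mu_t+\gamma\nabla_v\cdot(\mu_t(\mathsf{F}(x,\rho_t)-\gamma v))=\gamma^2\Delta_v\mu_t$, $\rho_t=\pi^x_\#\mu_t$; a weak solution is $\mu\in\mathcal{C}([0,T];\mathcal{P}_2(\mathbb{R}^{2d}))$ with $\langle\varphi,\mu_t\rangle-\langle\varphi,\mu_s\rangle=\gamma\int_s^t\iint(v\cdot\nabla_x\varphi+(\mathsf{F}(x,\rho_r)-\gamma v)\cdot\nabla_v\varphi+\gamma\Delta_v\varphi)d\mu_rdr$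 for all $s,t\in(0,T)$, $\varphi\in\mathcal{C}_c^\infty$. Aggregation-diffusion equation $\partial_t\rho+\nabla\cdot(\rho\mathsf{F}(\cdot,\rho))=\Delta\rho$, weak solutions in $\mathcal{C}([0,T];\mathcal{P}_2(\mathbb{R}^d))$ defined analogously in duality with $\mathcal{C}_c^\infty$. $\mathscr{E}(\rho)=\mathsf{Ent}(\rho|\mathscr{L}^d)+\int\Phi d\rho+\frac12\int K\star\rho\,d\rho$. An $\mathscr{E}$-regular solution is a weak solution with $\rho_0\in\mathcal{P}_2\cap\mathrm{dom}(\mathscr{E})$, $\rho\in L^1((0,T);W^{1,1})$ and $\sup_t\mathscr{E}(\rho_t)+\sup_t\|\mathsf{F}(\cdot,\rho_t)\|_{L^\infty}+\int_0^T\int|\nabla\rho_t|^2/\rho_t<\infty$. *)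

theory Defs
  imports "HOL-Probability.Probability"
begin

definition dd :: "'b::euclidean_space \<Rightarrow> ('b \<Rightarrow> real) \<Rightarrow> 'b \<Rightarrow> real" where
  "dd u f x = frechet_derivative f (at x) u"

fun iter_dd :: "'b::euclidean_space list \<Rightarrow> ('b \<Rightarrow> real) \<Rightarrow> 'b \<Rightarrow> real" where
  "iter_dd [] f = f"
| "iter_dd (u # us) f = dd u (iter_dd us f)"

definition smooth :: "('b::euclidean_space \<Rightarrow> real) \<Rightarrow> bool" where
  "smooth f \<longleftrightarrow> (\<forall>us x. iter_dd us f differentiable (at x))"

definition test_fun :: "('b::euclidean_space \<Rightarrow> real) \<Rightarrow> bool" where
  "test_fun f \<longleftrightarrow> smooth f \<and> compact (closure {x. f x \<noteq> 0})"

definition grad :: "('a::euclidean_space \<Rightarrow> real) \<Rightarrow> 'a \<Rightarrow> 'a" where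
  "grad f x = (\<Sum>b\<in>Basis. dd b f x *\<^sub>R b)"

definition lap :: "('a::euclidean_space \<Rightarrow> real) \<Rightarrow> 'a \<Rightarrow> real" where
  "lap f x = (\<Sum>b\<in>Basis. dd b (dd b f) x)"

definition grad_x :: "('a::euclidean_space \<times> 'a \<Rightarrow> real) \<Rightarrow> 'a \<times> 'a \<Rightarrow> 'a" where
  "grad_x f p = (\<Sum>b\<in>Basis. dd (b, 0) f p *\<^sub>R b)"

definition grad_v :: "('a::euclidean_space \<times> 'a \<Rightarrow> real) \<Rightarrow> 'a \<times> 'a \<Rightarrow> 'a" where
  "grad_v f p = (\<Sum>b\<in>Basis. dd (0, b) f p *\<^sub>R b)"

definition lap_v :: "('a::euclidean_space \<times> 'a \<Rightarrow> real) \<Rightarrow> 'a \<times> 'a \<Rightarrow> real" where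
  "lap_v f p = (\<Sum>b\<in>Basis. dd (0, b) (dd (0, b) f) p)"

definition loc_integrable :: "('b::euclidean_space \<Rightarrow> 'c::{banach,second_countable_topology}) \<Rightarrow> bool" where
  "loc_integrable f \<longleftrightarrow> (\<forall>C. compact C \<longrightarrow> set_integrable lborel C f)"

definition weak_grad :: "('a::euclidean_space \<Rightarrow> real) \<Rightarrow> ('a \<Rightarrow> 'a) \<Rightarrow> bool" where
  "weak_grad f g \<longleftrightarrow> loc_integrable f \<and> loc_integrable g \<and>
     (\<forall>\<phi>. test_fun \<phi> \<longrightarrow> (\<forall>b\<in>Basis.
        (\<integral>x. f x * dd b \<phi> x \<partial>lborel) = - (\<integral>x. (g x \<bullet> b) * \<phi> x \<partial>lborel)))"

definition weak_grad_x :: "('a::euclidean_space \<times> 'a \<Rightarrow> real) \<Rightarrow> ('a \<times> 'a \<Rightarrow> 'a) \<Rightarrow> bool" where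
  "weak_grad_x f g \<longleftrightarrow> loc_integrable f \<and> loc_integrable g \<and>
     (\<forall>\<phi>. test_fun \<phi> \<longrightarrow> (\<forall>b\<in>Basis.
        (\<integral>p. f p * dd (b, 0) \<phi> p \<partial>lborel) = - (\<integral>p. (g p \<bullet> b) * \<phi> p \<partial>lborel)))"

text \<open>Squared weighted norm of the x-gradient of (the density of) mu in L^2_H;
  infinite if mu has no density with a weak x-gradient.\<close>
definition grad_x_L2H_sq :: "('a::euclidean_space \<Rightarrow> real) \<Rightarrow> ('a \<times> 'a) measure \<Rightarrow> ennreal" where
  "grad_x_L2H_sq Phi \<mu> = (INF g \<in> {g. \<exists>f. f \<in> borel_measurable borel \<and> (\<forall>p. 0 \<le> f p) \<and>
        \<mu> = density lborel (\<lambda>p. ennreal (f p)) \<and> weak_grad_x f g}.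
      \<integral>\<^sup>+ p. ennreal ((norm (g p))\<^sup>2 * exp (Phi (fst p) + (norm (snd p))\<^sup>2 / 2)) \<partial>lborel)"

definition P2 :: "'b::euclidean_space measure \<Rightarrow> bool" where
  "P2 M \<longleftrightarrow> prob_space M \<and> sets M = sets borel \<and> integrable M (\<lambda>x. (norm x)\<^sup>2)"

definition couplings :: "'b::euclidean_space measure \<Rightarrow> 'b measure \<Rightarrow> ('b \<times> 'b) measure set" where
  "couplings \<mu> \<nu> = {\<pi>. prob_space \<pi> \<and> sets \<pi> = sets borel \<and>
      distr \<pi> borel fst = \<mu> \<and> distr \<pi> borel snd = \<nu>}"

definition W2 :: "'b::euclidean_space measure \<Rightarrow> 'b measure \<Rightarrow> real" where
  "W2 \<mu> \<nu> = sqrt (Inf ((\<lambda>\<pi>. \<integral>p. (dist (fst p) (snd p))\<^sup>2 \<partial>\<pi>) ` couplings \<mu> \<nu>))"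

definition P2_curve :: "real \<Rightarrow> (real \<Rightarrow> 'b::euclidean_space measure) \<Rightarrow> bool" where
  "P2_curve T \<mu> \<longleftrightarrow> (\<forall>t\<in>{0..T}. P2 (\<mu> t)) \<and>
     (\<forall>t\<in>{0..T}. \<forall>e>0. \<exists>\<delta>>0. \<forall>s\<in>{0..T}. \<bar>s - t\<bar> < \<delta> \<longrightarrow> W2 (\<mu> s) (\<mu> t) < e)"

definition dBL :: "'b::euclidean_space measure \<Rightarrow> 'b measure \<Rightarrow> real" where
  "dBL \<mu> \<nu> = Sup {\<bar>(\<integral>x. f x \<partial>\<mu>) - (\<integral>x. f x \<partial>\<nu>)\<bar> | f.
       1-lipschitz_on UNIV f \<and> (\<forall>x. \<bar>f x\<bar> \<le> 1)}"

definition Ent :: "'b measure \<Rightarrow> 'b measure \<Rightarrow> ereal" where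
  "Ent \<mu> \<nu> = (if sets \<mu> = sets \<nu> \<and> absolutely_continuous \<nu> \<mu> then
      (let r = (\<lambda>x. enn2real (RN_deriv \<nu> \<mu> x)) in
        enn2ereal (\<integral>\<^sup>+ x. ennreal (max 0 (r x * ln (r x))) \<partial>\<nu>)
        - enn2ereal (\<integral>\<^sup>+ x. ennreal (max 0 (- (r x * ln (r x)))) \<partial>\<nu>))
    else \<infinity>)"

definition Fforce :: "('a::euclidean_space \<Rightarrow> 'a) \<Rightarrow> ('a \<Rightarrow> 'a) \<Rightarrow> 'a measure \<Rightarrow> 'a \<Rightarrow> 'a" where
  "Fforce gradPhi gradK \<rho> x = - gradPhi x - (\<integral>y. gradK (x - y) \<partial>\<rho>)"

definition kin_weak_sol ::
  "('a::euclidean_space \<Rightarrow> 'a) \<Rightarrow> ('a \<Rightarrow> 'a) \<Rightarrow> real \<Rightarrow> real \<Rightarrow> (real \<Rightarrow> ('a \<times> 'a) measure) \<Rightarrow> bool" where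
  "kin_weak_sol gradPhi gradK \<gamma> T \<mu> \<longleftrightarrow> P2_curve T \<mu> \<and>
     (\<forall>s t \<phi>. s \<in> {0<..<T} \<longrightarrow> t \<in> {0<..<T} \<longrightarrow> test_fun \<phi> \<longrightarrow>
        (let I = (\<lambda>r. \<integral>p. (snd p \<bullet> grad_x \<phi> p
                  + (Fforce gradPhi gradK (distr (\<mu> r) borel fst) (fst p) - \<gamma> *\<^sub>R snd p) \<bullet> grad_v \<phi> p
                  + \<gamma> * lap_v \<phi> p) \<partial>(\<mu> r)) in
         interval_lebesgue_integrable lborel (ereal s) (ereal t) I \<and>
         (\<integral>p. \<phi> p \<partial>(\<mu> t)) - (\<integral>p. \<phi> p \<partial>(\<mu> s))
           = \<gamma> * interval_lebesgue_integral lborel (ereal s) (ereal t) I))"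

definition agg_weak_sol ::
  "('a::euclidean_space \<Rightarrow> 'a) \<Rightarrow> ('a \<Rightarrow> 'a) \<Rightarrow> real \<Rightarrow> (real \<Rightarrow> 'a measure) \<Rightarrow> bool" where
  "agg_weak_sol gradPhi gradK T \<rho> \<longleftrightarrow> P2_curve T \<rho> \<and>
     (\<forall>s t \<phi>. s \<in> {0<..<T} \<longrightarrow> t \<in> {0<..<T} \<longrightarrow> test_fun \<phi> \<longrightarrow>
        (let I = (\<lambda>r. \<integral>x. (Fforce gradPhi gradK (\<rho> r) x \<bullet> grad \<phi> x + lap \<phi> x) \<partial>(\<rho> r)) in
         interval_lebesgue_integrable lborel (ereal s) (ereal t) I \<and>
         (\<integral>x. \<phi> x \<partial>(\<rho> t)) - (\<integral>x. \<phi> x \<partial>(\<rho> s))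
           = interval_lebesgue_integral lborel (ereal s) (ereal t) I))"

definition Energy :: "('a::euclidean_space \<Rightarrow> real) \<Rightarrow> ('a \<Rightarrow> real) \<Rightarrow> 'a measure \<Rightarrow> ereal" where
  "Energy Phi K \<rho> = Ent \<rho> lborel + enn2ereal (\<integral>\<^sup>+ x. ennreal (Phi x) \<partial>\<rho>)
      + ereal (1/2 * (\<integral>x. (\<integral>y. K (x - y) \<partial>\<rho>) \<partial>\<rho>))"

definition E_regular ::
  "('a::euclidean_space \<Rightarrow> real) \<Rightarrow> ('a \<Rightarrow> 'a) \<Rightarrow> ('a \<Rightarrow> real) \<Rightarrow> ('a \<Rightarrow> 'a) \<Rightarrow> real
     \<Rightarrow> (real \<Rightarrow> 'a measure) \<Rightarrow> bool" where
  "E_regular Phi gradPhi K gradK T \<rho> \<longleftrightarrow>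
     agg_weak_sol gradPhi gradK T \<rho> \<and>
     P2 (\<rho> 0) \<and> Energy Phi K (\<rho> 0) < \<infinity> \<and>
     \<comment> \<open>rho in L^1((0,T); W^{1,1}) together with finite Fisher information\<close>
     (\<exists>f g. (\<lambda>(t, x). f t x) \<in> borel_measurable borel \<and>
            (\<lambda>(t, x). g t x) \<in> borel_measurable borel \<and>
            (AE t in lborel. t \<in> {0..T} \<longrightarrow>
               (\<forall>x. 0 \<le> f t x) \<and> \<rho> t = density lborel (\<lambda>x. ennreal (f t x)) \<and>
               weak_grad (f t) (g t)) \<and>
            (\<integral>\<^sup>+ t. indicator {0..T} t * (\<integral>\<^sup>+ x. ennreal (\<bar>f t x\<bar> + norm (g t x)) \<partial>lborel) \<partial>lborel) < \<infinity> \<and>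
            (\<integral>\<^sup>+ t. indicator {0..T} t * (\<integral>\<^sup>+ x. ennreal ((norm (g t x))\<^sup>2 / f t x) \<partial>lborel) \<partial>lborel) < \<infinity>) \<and>
     (\<exists>B. \<forall>t\<in>{0..T}. Energy Phi K (\<rho> t) \<le> ereal B) \<and>
     (\<exists>B. \<forall>t\<in>{0..T}. AE x in lborel. norm (Fforce gradPhi gradK (\<rho> t) x) \<le> B)"

end

theory Submission
  imports Defs
begin

text \<open>The force bound of the \<open>\<E>\<close>-regular solution makes the drift globally bounded, so
  instead of estimating relative entropies one can compare both equations in total variation.
  In the coarse-grained variable \<open>y = x + v / \<gamma>\<close> the kinetic equation becomes a heat equation with
  drift \<open>F(x, \<rho>\<^sup>\<gamma>)\<close>, while \<open>\<rho>\<close> solves it with drift \<open>F(y, \<rho>)\<close>. Testing both with the backward heat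
  flow of a bounded function gives Duhamel formulas whose difference is controlled by the singular
  kernel \<open>(t - r) powr (-1/2)\<close>, and Gronwall's lemma bounds the total variation distance at time
  \<open>t\<close> by the initial one plus the drift error. Since \<open>K\<close> has no regularity beyond a
  bounded gradient, the error in the interaction force is estimated by moving the shear
  \<open>x \<mapsto> x + (w - v) / \<gamma>\<close> onto the density, which costs \<open>1 / \<gamma>\<close> times a weighted
  \<open>L\<^sup>1\<close> norm of its \<open>x\<close>-gradient; that norm is finite by Cauchy-Schwarz against
  \<open>exp (- H)\<close>. Pinsker's inequality handles the initial datum, and passing from \<open>y\<close> back to \<open>x\<close>
  costs \<open>1 / \<gamma>\<close> times the mean speed.\<close>

section \<open>Directional derivatives and smooth functions\<close>

text \<open>The hypotheses bound only the force generated by \<open>\<rho>\<close>, and only almost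
  everywhere. Since \<open>gradK\<close> is bounded, this bound at one time already forces
  \<open>gradPhi\<close> to be bounded, and continuity removes the null set; the kinetic forces then
  obey one bound for all \<gamma>. Total variation is the natural distance because the interaction
  error pairs the merely bounded \<open>gradK\<close> with a difference of measures, which the
  bounded Lipschitz distance does not control. Three obstacles shape the rest. The weak equations
  hold only for compactly supported test functions and at interior times, so cutoffs and
  W2-continuity are needed to reach heat kernels and the endpoints. The backward heat flow is
  singular at the final time, so that time is shifted by \<delta> > 0, which is sent to 0 at the
  end. Bounded measurable functions are limits of smooth ones only up to Lebesgue null sets, which
  is why absolute continuity of both curves is carried along. The square in the conclusion matches
  the two rates: the total variation error is of order sqrt (entropy) + 1 / \<gamma>.\<close>

lemma dd_eq: "(f has_derivative f') (at x) \<Longrightarrow> dd u f x = f' u"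
  unfolding dd_def by (metis frechet_derivative_at)

text \<open>\<open>iter_dd\<close> strips the outermost derivative, whereas this recursion
  differentiates the function itself first. The induction hypothesis is then available for
  \<open>dd u f\<close>, which is what the product and chain rules produce.\<close>

primrec diff_upto :: "nat \<Rightarrow> ('b::euclidean_space \<Rightarrow> real) \<Rightarrow> bool" where
  "diff_upto 0 f \<longleftrightarrow> (\<forall>x. f differentiable (at x))"
| "diff_upto (Suc n) f \<longleftrightarrow> (\<forall>x. f differentiable (at x)) \<and> (\<forall>u. diff_upto n (dd u f))"

lemma iter_dd_snoc: "iter_dd (us @ [u]) f = iter_dd us (dd u f)"
  by (induction us) auto

lemma diff_upto_iff_iter_dd:
  "diff_upto n f \<longleftrightarrow> (\<forall>us x. length us \<le> n \<longrightarrow> iter_dd us f differentiable (at x))"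
proof (induction n arbitrary: f)
  case (Suc n)
  show ?case
  proof
    assume L: "diff_upto (Suc n) f"
    show "\<forall>us x. length us \<le> Suc n \<longrightarrow> iter_dd us f differentiable (at x)"
    proof (intro allI impI)
      fix us :: "'a list" and x assume "length us \<le> Suc n"
      then show "iter_dd us f differentiable (at x)"
        using L Suc.IH by (cases us rule: rev_cases) (auto simp: iter_dd_snoc)
    qed
  next
    assume R: "\<forall>us x. length us \<le> Suc n \<longrightarrow> iter_dd us f differentiable (at x)"
    have "diff_upto n (dd u f)" for u :: 'a
      unfolding Suc.IH using R[rule_format, of "_ @ [u]"] by (auto simp: iter_dd_snoc)
    moreover have "f differentiable (at x)" for x
      using R[rule_format, of "[]"] by simp
    ultimately show "diff_upto (Suc n) f" by simp
  qed
qed simp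

lemma smooth_iff_diff_upto: "smooth f \<longleftrightarrow> (\<forall>n. diff_upto n f)"
  by (auto simp: smooth_def diff_upto_iff_iter_dd)

lemma diff_upto_differentiable: "diff_upto n f \<Longrightarrow> f differentiable (at x)"
  by (cases n) auto

lemma diff_upto_Suc_D: "diff_upto (Suc n) f \<Longrightarrow> diff_upto n f"
  by (simp add: diff_upto_iff_iter_dd)

lemma differentiable_has_dd:
  "f differentiable (at x) \<Longrightarrow> (f has_derivative (\<lambda>u. dd u f x)) (at x)"
  unfolding dd_def by (metis frechet_derivative_works)

lemma dd_add:
  assumes "f differentiable (at x)" "g differentiable (at x)"
  shows "dd u (\<lambda>x. f x + g x) x = dd u f x + dd u g x"
  by (rule dd_eq) (intro has_derivative_add differentiable_has_dd assms)

lemma dd_mult: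
  assumes "f differentiable (at x)" "g differentiable (at x)"
  shows "dd u (\<lambda>x. f x * g x) x = f x * dd u g x + dd u f x * g x"
  by (rule dd_eq) (intro has_derivative_mult differentiable_has_dd assms)

lemma dd_cmult:
  "f differentiable (at x) \<Longrightarrow> dd u (\<lambda>x. c * f x) x = c * dd u f x" for c :: real
  by (rule dd_eq) (intro has_derivative_mult_right differentiable_has_dd)

lemma dd_comp:
  assumes "f differentiable (at x)" "(h has_real_derivative d) (at (f x))"
  shows "dd u (\<lambda>x. h (f x)) x = d * dd u f x"
  by (rule dd_eq)
    (rule has_derivative_compose[OF differentiable_has_dd[OF assms(1)]
        assms(2)[unfolded has_field_derivative_def]])

lemma affine_has_derivative:
  "bounded_linear L \<Longrightarrow> ((\<lambda>x. L x + c) has_derivative L) (at x)"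
  using has_derivative_add[OF bounded_linear_imp_has_derivative has_derivative_const] by simp

lemma dd_affine:
  assumes "bounded_linear L" "f differentiable (at (L x + c))"
  shows "dd u (\<lambda>x. f (L x + c)) x = dd (L u) f (L x + c)"
proof (rule dd_eq)
  show "((\<lambda>x. f (L x + c)) has_derivative (\<lambda>u. dd (L u) f (L x + c))) (at x)"
    using affine_has_derivative[OF assms(1)] differentiable_has_dd[OF assms(2)]
    by (rule has_derivative_compose)
qed

lemma diff_upto_const: "diff_upto n (\<lambda>_. c)"
proof (induction n arbitrary: c)
  case (Suc n)
  have "dd u (\<lambda>_. c) = (\<lambda>_. 0)" for u :: 'a
    by (intro ext dd_eq) (rule has_derivative_const)
  with Suc show ?case by simp
qed simp

lemma diff_upto_linear:
  assumes "bounded_linear f" shows "diff_upto n f"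
proof (cases n)
  case (Suc m)
  have d: "(f has_derivative f) (at x)" for x
    by (rule bounded_linear_imp_has_derivative[OF assms])
  then have "dd u f = (\<lambda>_. f u)" for u
    by (intro ext dd_eq)
  with d Suc show ?thesis by (auto simp: diff_upto_const differentiable_def)
qed (use assms bounded_linear_imp_differentiable in auto)

lemma diff_upto_add: "diff_upto n f \<Longrightarrow> diff_upto n g \<Longrightarrow> diff_upto n (\<lambda>x. f x + g x)"
proof (induction n arbitrary: f g)
  case (Suc n)
  then have "dd u (\<lambda>x. f x + g x) = (\<lambda>x. dd u f x + dd u g x)" for u
    by (auto intro!: ext dd_add)
  with Suc show ?case by auto
qed auto

lemma diff_upto_mult: "diff_upto n f \<Longrightarrow> diff_upto n g \<Longrightarrow> diff_upto n (\<lambda>x. f x * g x)"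
proof (induction n arbitrary: f g)
  case (Suc n)
  then have "dd u (\<lambda>x. f x * g x) = (\<lambda>x. f x * dd u g x + dd u f x * g x)" for u
    by (auto intro!: ext dd_mult)
  moreover have "diff_upto n f" "diff_upto n g"
    using Suc.prems diff_upto_Suc_D by blast+
  ultimately show ?case using Suc by (auto intro: diff_upto_add)
qed auto

text \<open>Differentiating \<open>h (f x)\<close> produces \<open>h' (f x)\<close>, so the
  induction has to run over a whole family of outer functions closed under differentiation. The
  instances are \<open>{exp}\<close> and the range of \<open>flat_exp\<close>.\<close>

lemma diff_upto_comp:
  fixes f :: "'b::euclidean_space \<Rightarrow> real"
  assumes H: "\<And>h. h \<in> H \<Longrightarrow> \<exists>h'\<in>H. \<forall>t. (h has_real_derivative h' t) (at t)"
  shows "h \<in> H \<Longrightarrow> diff_upto n f \<Longrightarrow> diff_upto n (\<lambda>x. h (f x))"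
proof (induction n arbitrary: h)
  case 0
  obtain h' where "\<And>t. (h has_real_derivative h' t) (at t)"
    using H[OF 0(1)] by blast
  then have "h differentiable (at t)" for t
    using real_differentiable_def by blast
  with 0(2) show ?case
    by (simp add: differentiable_compose[of h])
next
  case (Suc n)
  obtain h' where h': "h' \<in> H" "\<And>t. (h has_real_derivative h' t) (at t)"
    using H[OF Suc.prems(1)] by blast
  have hd: "h differentiable (at t)" for t
    using h'(2) real_differentiable_def by blast
  have "dd u (\<lambda>x. h (f x)) = (\<lambda>x. h' (f x) * dd u f x)" for u
    using Suc.prems(2) by (intro ext dd_comp h'(2)) auto
  moreover have "diff_upto n (\<lambda>x. h' (f x))"
    using Suc.IH[OF h'(1)] Suc.prems(2) diff_upto_Suc_D by blast
  ultimately show ?case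
    using Suc.prems(2) hd by (simp add: diff_upto_mult differentiable_compose[of h])
qed

lemma diff_upto_affine:
  assumes L: "bounded_linear L"
  shows "diff_upto n f \<Longrightarrow> diff_upto n (\<lambda>x. f (L x + c))"
proof (induction n arbitrary: f)
  case 0
  have "(\<lambda>x. L x + c) differentiable (at x)" for x
    using affine_has_derivative[OF L] by (auto simp: differentiable_def)
  with 0 show ?case by (simp add: differentiable_compose[of f "\<lambda>x. L x + c"])
next
  case (Suc n)
  have "(\<lambda>x. L x + c) differentiable (at x)" for x
    using affine_has_derivative[OF L] by (auto simp: differentiable_def)
  then have 1: "(\<lambda>x. f (L x + c)) differentiable (at x)" for x
    using Suc.prems by (simp add: differentiable_compose[of f "\<lambda>x. L x + c"])
  have "dd u (\<lambda>x. f (L x + c)) = (\<lambda>x. dd (L u) f (L x + c))" for u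
    using Suc.prems by (intro ext dd_affine L) auto
  with 1 Suc show ?case by auto
qed

lemma smooth_differentiable: "smooth f \<Longrightarrow> f differentiable (at x)"
  using diff_upto_differentiable[of 0 f] by (metis smooth_iff_diff_upto)

lemma smooth_dd: "smooth f \<Longrightarrow> smooth (dd u f)"
  unfolding smooth_iff_diff_upto
proof
  fix n assume "\<forall>n. diff_upto n f"
  then have "diff_upto (Suc n) f" ..
  then show "diff_upto n (dd u f)" by simp
qed

lemma smooth_const: "smooth (\<lambda>_. c)"
  by (simp add: smooth_iff_diff_upto diff_upto_const)

lemma smooth_linear: "bounded_linear f \<Longrightarrow> smooth f"
  by (simp add: smooth_iff_diff_upto diff_upto_linear)

lemma smooth_add: "smooth f \<Longrightarrow> smooth g \<Longrightarrow> smooth (\<lambda>x. f x + g x)"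
  by (simp add: smooth_iff_diff_upto diff_upto_add)

lemma smooth_mult: "smooth f \<Longrightarrow> smooth g \<Longrightarrow> smooth (\<lambda>x. f x * g x)"
  by (simp add: smooth_iff_diff_upto diff_upto_mult)

lemma smooth_affine: "smooth f \<Longrightarrow> bounded_linear L \<Longrightarrow> smooth (\<lambda>x. f (L x + c))"
  by (simp add: smooth_iff_diff_upto diff_upto_affine)

lemma smooth_sum: "finite I \<Longrightarrow> (\<And>i. i \<in> I \<Longrightarrow> smooth (f i)) \<Longrightarrow> smooth (\<lambda>x. \<Sum>i\<in>I. f i x)"
  by (induction I rule: finite_induct) (auto intro: smooth_const smooth_add)

lemma smooth_exp:
  assumes "smooth f" shows "smooth (\<lambda>x. exp (f x))"
proof -
  have "diff_upto n (\<lambda>x. exp (f x))" for n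
  proof (rule diff_upto_comp[of "{exp}" exp])
    fix h :: "real \<Rightarrow> real" assume "h \<in> {exp}"
    then show "\<exists>h'\<in>{exp}. \<forall>t. (h has_real_derivative h' t) (at t)" by simp
  qed (use assms in \<open>simp_all add: smooth_iff_diff_upto\<close>)
  then show ?thesis by (simp add: smooth_iff_diff_upto)
qed

lemma smooth_norm_sq: "smooth (\<lambda>x. (norm (x - c))\<^sup>2)"
proof -
  have "(\<lambda>x. (norm (x - c))\<^sup>2) = (\<lambda>x. \<Sum>b\<in>Basis. (x \<bullet> b + - (c \<bullet> b)) * (x \<bullet> b + - (c \<bullet> b)))"
  proof
    fix x
    show "(norm (x - c))\<^sup>2 = (\<Sum>b\<in>Basis. (x \<bullet> b + - (c \<bullet> b)) * (x \<bullet> b + - (c \<bullet> b)))"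
      unfolding power2_norm_eq_inner euclidean_inner[of "x - c" "x - c"]
      by (simp add: inner_diff_left)
  qed
  moreover have "smooth (\<lambda>x::'a. (x \<bullet> b + - (c \<bullet> b)) * (x \<bullet> b + - (c \<bullet> b)))" for b
    by (intro smooth_mult smooth_add smooth_const smooth_linear bounded_linear_inner_left)
  ultimately show ?thesis by (simp add: smooth_sum)
qed

lemma smooth_real_polynomial: "real_polynomial_function f \<Longrightarrow> smooth f"
  by (induction rule: real_polynomial_function.induct)
    (auto intro: smooth_linear smooth_const smooth_add smooth_mult)

lemma smooth_has_dd: "smooth f \<Longrightarrow> (f has_derivative (\<lambda>u. dd u f x)) (at x)"
  by (intro differentiable_has_dd smooth_differentiable)

lemma smooth_continuous: "smooth f \<Longrightarrow> continuous_on A f"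
  by (meson continuous_at_imp_continuous_on differentiable_imp_continuous_within smooth_differentiable)

lemma smooth_borel: "smooth f \<Longrightarrow> f \<in> borel_measurable borel"
  by (intro borel_measurable_continuous_onI smooth_continuous)

section \<open>Smooth bump functions and rescaled cutoffs\<close>

lemma poly_times_exp_minus_tendsto_0:
  "((\<lambda>s::real. poly p s * exp (- s)) \<longlongrightarrow> 0) at_top"
proof -
  have "((\<lambda>s::real. \<Sum>i\<le>degree p. coeff p i * (s ^ i / exp s)) \<longlongrightarrow> (\<Sum>i\<le>degree p. coeff p i * 0)) at_top"
    by (intro tendsto_intros tendsto_power_div_exp_0)
  moreover have "(\<Sum>i\<le>degree p. coeff p i * (s ^ i / exp s)) = poly p s * exp (- s)" for s
    unfolding poly_altdef sum_distrib_right
    by (intro sum.cong refl) (simp add: exp_minus divide_inverse)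
  ultimately show ?thesis by simp
qed

text \<open>The classical flat function exp (- 1 / t), multiplied by a polynomial in 1 / t: with
  this factor the family is closed under differentiation, as \<open>diff_upto_comp\<close>
  requires.\<close>

definition flat_exp :: "real poly \<Rightarrow> real \<Rightarrow> real" where
  "flat_exp p t = (if 0 < t then poly p (1 / t) * exp (- (1 / t)) else 0)"

text \<open>For t > 0 the exponential contributes \<open>p\<close> and the polynomial factor
  contributes \<open>- pderiv p\<close>, both multiplied by 1 / t^2 from the chain rule; this factor
  is the polynomial \<open>[:0, 0, 1:]\<close> at 1 / t. At 0 the exponential decay beats every
  power of 1 / t.\<close>

lemma flat_exp_deriv:
  "(flat_exp p has_real_derivative flat_exp ((p - pderiv p) * [:0, 0, 1:]) t) (at t)"
proof -
  consider "t < 0" | "t > 0" | "t = 0" by linarith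
  then show ?thesis
  proof cases
    case 1
    have "((\<lambda>_. 0) has_real_derivative 0) (at t)" by simp
    then have "(flat_exp p has_real_derivative 0) (at t)"
      by (rule has_field_derivative_transform_within_open[where S="{..<0}"])
        (use 1 in \<open>auto simp: flat_exp_def\<close>)
    with 1 show ?thesis by (simp add: flat_exp_def)
  next
    case 2
    have "((\<lambda>t. poly p (1 / t) * exp (- (1 / t))) has_real_derivative
        flat_exp ((p - pderiv p) * [:0, 0, 1:]) t) (at t)"
      using 2 unfolding flat_exp_def
      by (auto intro!: derivative_eq_intros DERIV_chain2[OF poly_DERIV]
          simp: field_simps power2_eq_square)
    then show ?thesis
      by (rule has_field_derivative_transform_within_open[where S="{0<..}"])
        (use 2 in \<open>auto simp: flat_exp_def\<close>)
  next
    case 3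
    \<comment> \<open>The substitution s = 1 / h turns the difference quotient at 0 into s p(s) exp
      (- s), hence the extra factor \<open>[:0, 1:]\<close>.\<close>
    have "((\<lambda>h. poly ([:0, 1:] * p) (inverse h) * exp (- (inverse h))) \<longlongrightarrow> 0) (at_right (0::real))"
      using filterlim_compose[OF poly_times_exp_minus_tendsto_0 filterlim_inverse_at_top_right] .
    then have "((\<lambda>h. flat_exp p h / h) \<longlongrightarrow> 0) (at_right 0)"
      by (rule Lim_transform_eventually)
        (auto simp: eventually_at_right_field flat_exp_def field_simps intro!: exI[of _ 1])
    moreover have "((\<lambda>h. flat_exp p h / h) \<longlongrightarrow> 0) (at_left 0)"
      by (rule Lim_transform_eventually[OF tendsto_const])
        (auto simp: eventually_at_left_field flat_exp_def intro!: exI[of _ "-1"])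
    ultimately have "((\<lambda>h. flat_exp p h / h) \<longlongrightarrow> 0) (at 0)"
      using filterlim_split_at by blast
    then have "(flat_exp p has_real_derivative 0) (at 0)"
      unfolding DERIV_def by (simp add: flat_exp_def)
    with 3 show ?thesis by (simp add: flat_exp_def)
  qed
qed

lemma smooth_flat_exp:
  assumes "smooth f" shows "smooth (\<lambda>x. flat_exp p (f x))"
proof -
  have H: "\<exists>h'\<in>range flat_exp. \<forall>t. (h has_real_derivative h' t) (at t)"
    if "h \<in> range flat_exp" for h
  proof -
    obtain q where "h = flat_exp q" using \<open>h \<in> range flat_exp\<close> by blast
    with flat_exp_deriv show ?thesis
      by (intro bexI[of _ "flat_exp ((q - pderiv q) * [:0, 0, 1:])"]) auto
  qed
  have "diff_upto n (\<lambda>x. flat_exp p (f x))" for n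
    by (rule diff_upto_comp[of "range flat_exp", OF H rangeI])
      (use assms in \<open>simp_all add: smooth_iff_diff_upto\<close>)
  then show ?thesis by (simp add: smooth_iff_diff_upto)
qed

text \<open>The factor \<open>exp 1\<close> normalises the value at the origin to 1, so that the
  rescaled copies converge pointwise to the constant 1.\<close>

definition bump :: "'b::euclidean_space \<Rightarrow> real" where
  "bump x = exp 1 * flat_exp 1 (1 - (norm x)\<^sup>2)"

lemma smooth_bump: "smooth bump"
proof -
  have "smooth (\<lambda>x::'a. 1 + (- 1) * (norm (x - 0))\<^sup>2)"
    by (rule smooth_add[OF smooth_const smooth_mult[OF smooth_const smooth_norm_sq]])
  from smooth_mult[OF smooth_const smooth_flat_exp[OF this], of "exp 1" 1]
  show ?thesis unfolding bump_def[abs_def] by simp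
qed

lemma bump_0: "bump 0 = 1"
  by (simp add: bump_def flat_exp_def exp_minus)

lemma bump_nonneg: "0 \<le> bump x"
  by (simp add: bump_def flat_exp_def)

lemma bump_le_1: "bump x \<le> 1"
proof (cases "norm x < 1")
  case True
  then have "(norm x)\<^sup>2 < 1" by (simp add: abs_square_less_1)
  then have "1 \<le> 1 / (1 - (norm x)\<^sup>2)" by (simp add: field_simps)
  then have "exp (1 + - (1 / (1 - (norm x)\<^sup>2))) \<le> 1"
    by (simp only: exp_le_one_iff)
  then show ?thesis
    using \<open>(norm x)\<^sup>2 < 1\<close> by (simp add: bump_def flat_exp_def flip: exp_add)
next
  case False
  then have "1 \<le> (norm x)\<^sup>2" by simp
  then show ?thesis by (simp add: bump_def flat_exp_def)
qed

lemma bump_support: "bump x \<noteq> 0 \<Longrightarrow> norm x < 1"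
  by (auto simp: bump_def flat_exp_def abs_square_less_1 split: if_splits)

definition cutoff :: "real \<Rightarrow> 'b::euclidean_space \<Rightarrow> real" where
  "cutoff R x = bump (x /\<^sub>R R)"

lemma smooth_cutoff: "smooth (cutoff R)"
  using smooth_affine[OF smooth_bump, of "\<lambda>x. x /\<^sub>R R" 0]
  by (simp add: cutoff_def[abs_def] bounded_linear_scaleR_right)

lemma cutoff_nonneg: "0 \<le> cutoff R x" and cutoff_le_1: "cutoff R x \<le> 1"
  by (simp_all add: cutoff_def bump_nonneg bump_le_1)

lemma cutoff_support: "0 < R \<Longrightarrow> cutoff R x \<noteq> 0 \<Longrightarrow> norm x < R"
  using bump_support[of "x /\<^sub>R R"] by (auto simp: cutoff_def field_simps)

lemma dd_cutoff: "dd u (cutoff R) x = dd u bump (x /\<^sub>R R) / R"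
proof -
  interpret bounded_linear "\<lambda>u. dd u bump (x /\<^sub>R R)"
    using smooth_has_dd[OF smooth_bump] by (rule has_derivative_bounded_linear)
  have "dd u (\<lambda>x. bump (x /\<^sub>R R + 0)) x = dd (u /\<^sub>R R) bump (x /\<^sub>R R + 0)"
    by (intro dd_affine bounded_linear_scaleR_right smooth_differentiable smooth_bump)
  then show ?thesis
    by (simp add: cutoff_def[abs_def] scaleR divide_inverse)
qed

lemma dd_dd_cutoff: "dd u (dd w (cutoff R)) x = dd u (dd w bump) (x /\<^sub>R R) / R\<^sup>2"
proof -
  interpret bounded_linear "\<lambda>u. dd u (dd w bump) (x /\<^sub>R R)"
    using smooth_has_dd[OF smooth_dd[OF smooth_bump]] by (rule has_derivative_bounded_linear)
  have "dd u (\<lambda>x. dd w bump (x /\<^sub>R R + 0)) x = dd (u /\<^sub>R R) (dd w bump) (x /\<^sub>R R + 0)"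
    by (intro dd_affine bounded_linear_scaleR_right smooth_differentiable smooth_bump smooth_dd)
  moreover have "dd u (\<lambda>x. inverse R * dd w bump (x /\<^sub>R R)) x
      = inverse R * dd u (\<lambda>x. dd w bump (x /\<^sub>R R)) x"
    using smooth_affine[OF smooth_dd[OF smooth_bump], of "\<lambda>x. x /\<^sub>R R" w 0]
    by (intro dd_cmult smooth_differentiable) (simp add: bounded_linear_scaleR_right)
  ultimately show ?thesis
    by (simp add: dd_cutoff[abs_def] scaleR divide_inverse power2_eq_square mult.commute)
qed

lemma cutoff_tendsto: "(\<lambda>n. cutoff (real (Suc n)) x) \<longlonglongrightarrow> 1"
proof -
  have "(\<lambda>n. x /\<^sub>R (real (Suc n))) \<longlonglongrightarrow> 0 *\<^sub>R x"
    by (rule tendsto_scaleR[OF LIMSEQ_inverse_real_of_nat tendsto_const])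
  moreover have "isCont bump (0::'a)"
    by (rule differentiable_imp_continuous_within[OF smooth_differentiable[OF smooth_bump]])
  ultimately have "(\<lambda>n. bump (x /\<^sub>R (real (Suc n)))) \<longlonglongrightarrow> bump (0::'a)"
    using isCont_tendsto_compose[of 0 bump] by simp
  then show ?thesis by (simp add: cutoff_def bump_0)
qed

section \<open>Test functions and their supports\<close>

lemma test_funI:
  assumes "smooth f" "\<And>x. f x \<noteq> 0 \<Longrightarrow> norm x \<le> R"
  shows "test_fun f"
proof -
  have "closure {x. f x \<noteq> 0} \<subseteq> cball 0 R"
    by (rule closure_minimal) (use assms(2) in auto)
  then show ?thesis
    using assms(1) compact_cball by (metis closed_closure compact_Int_closed inf.absorb2 test_fun_def)
qed

lemma test_funE:
  assumes "test_fun f"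
  obtains R where "\<And>x. f x \<noteq> 0 \<Longrightarrow> norm x \<le> R"
proof -
  have "bounded {x. f x \<noteq> 0}"
    using assms by (auto simp: test_fun_def dest!: compact_imp_bounded intro: bounded_subset closure_subset)
  then show thesis using that by (auto simp: bounded_iff)
qed

lemma test_fun_smooth: "test_fun f \<Longrightarrow> smooth f"
  by (simp add: test_fun_def)

lemma test_fun_dd:
  assumes "test_fun f" shows "test_fun (dd u f)"
proof -
  obtain R where R: "\<And>x. f x \<noteq> 0 \<Longrightarrow> norm x \<le> R" using test_funE[OF assms] by blast
  have 0: "dd u f x = 0" if "R < norm x" for x
  proof (rule dd_eq)
    have z: "((\<lambda>_. 0) has_derivative (\<lambda>_. 0)) (at x)" by simp
    show "(f has_derivative (\<lambda>_. 0)) (at x)"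
    proof (rule has_derivative_transform_within_open[OF z, of "- cball 0 R"])
      show "0 = f y" if "y \<in> - cball 0 R" for y
        using R[of y] that by force
      show "x \<in> - cball 0 R" using that by simp
      show "open (- cball (0::'a) R)" by (simp add: open_Compl)
    qed
  qed
  show ?thesis
  proof (rule test_funI)
    show "smooth (dd u f)" by (rule smooth_dd[OF test_fun_smooth[OF assms]])
    show "norm x \<le> R" if "dd u f x \<noteq> 0" for x using 0[of x] that by linarith
  qed
qed

lemma test_fun_mult:
  assumes "test_fun f" "smooth g" shows "test_fun (\<lambda>x. f x * g x)"
proof -
  obtain R where R: "\<And>x. f x \<noteq> 0 \<Longrightarrow> norm x \<le> R" using test_funE[OF assms(1)] by blast
  show ?thesis
  proof (rule test_funI)
    show "smooth (\<lambda>x. f x * g x)" by (rule smooth_mult[OF test_fun_smooth[OF assms(1)] assms(2)])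
    show "norm x \<le> R" if "f x * g x \<noteq> 0" for x using R[of x] that by simp
  qed
qed

lemma test_fun_mult': "smooth f \<Longrightarrow> test_fun g \<Longrightarrow> test_fun (\<lambda>x. f x * g x)"
  using test_fun_mult[of g f] by (simp add: mult.commute)

lemma test_fun_bounded:
  assumes "test_fun f" obtains C where "0 \<le> C" "\<And>x. \<bar>f x\<bar> \<le> C"
proof -
  have "compact (f ` closure {x. f x \<noteq> 0})"
    using assms by (intro compact_continuous_image smooth_continuous) (auto simp: test_fun_def)
  then obtain C where C: "\<And>x. x \<in> closure {x. f x \<noteq> 0} \<Longrightarrow> \<bar>f x\<bar> \<le> C"
    using compact_imp_bounded bounded_iff by (metis imageI real_norm_def)
  have "\<bar>f x\<bar> \<le> max 0 C" for x
    using C[of x] closure_subset[of "{x. f x \<noteq> 0}"] by (cases "f x = 0") auto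
  then show thesis by (intro that[of "max 0 C"]) auto
qed

lemma test_fun_cutoff: "0 < R \<Longrightarrow> test_fun (cutoff R)"
  by (rule test_funI[of _ R]) (auto intro: smooth_cutoff less_imp_le dest: cutoff_support)

lemma test_fun_bump: "test_fun bump"
  by (rule test_funI[of _ 1]) (auto intro: smooth_bump less_imp_le dest: bump_support)

lemma dd_dd_mult:
  assumes f: "smooth f" and g: "smooth g"
  shows "dd w (dd u (\<lambda>x. f x * g x)) x
    = f x * dd w (dd u g) x + dd w f x * dd u g x + dd u f x * dd w g x + dd w (dd u f) x * g x"
proof -
  note d = smooth_differentiable
  have 1: "dd u (\<lambda>x. f x * g x) = (\<lambda>x. f x * dd u g x + dd u f x * g x)"
    by (rule ext, rule dd_mult[OF d[OF f] d[OF g]])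
  have 2: "dd w (dd u (\<lambda>x. f x * g x)) x
      = dd w (\<lambda>x. f x * dd u g x) x + dd w (\<lambda>x. dd u f x * g x) x"
    unfolding 1
    by (rule dd_add[OF d[OF smooth_mult[OF f smooth_dd[OF g]]] d[OF smooth_mult[OF smooth_dd[OF f] g]]])
  have 3: "dd w (\<lambda>x. f x * dd u g x) x = f x * dd w (dd u g) x + dd w f x * dd u g x"
    by (rule dd_mult[OF d[OF f] d[OF smooth_dd[OF g]]])
  have 4: "dd w (\<lambda>x. dd u f x * g x) x = dd u f x * dd w g x + dd w (dd u f) x * g x"
    by (rule dd_mult[OF d[OF smooth_dd[OF f]] d[OF g]])
  show ?thesis unfolding 2 3 4 by simp
qed

section \<open>The heat kernel\<close>

lemma integrable_exp_minus_norm_sq: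
  assumes "0 < c"
  shows "integrable lborel (\<lambda>x::'a::euclidean_space. exp (- c * (norm x)\<^sup>2))"
proof (rule integrableI_nonneg)
  \<comment> \<open>The standard deviation for which 1 / (2 s^2) = c, so that the one-dimensional
    factor is a multiple of \<open>normal_density\<close>.\<close>
  define s where "s = sqrt (1 / (2 * c))"
  have s: "s > 0" "2 * s\<^sup>2 = 1 / c" using assms by (auto simp: s_def)
  have 1: "exp (- c * t\<^sup>2) = sqrt (2 * pi * s\<^sup>2) * normal_density 0 s t" for t
    using s assms by (simp add: normal_density_def mult.assoc field_simps)
  have "integrable lborel (\<lambda>t. exp (- c * t\<^sup>2))"
    unfolding 1 using s by (intro integrable_mult_right integrable_normal_density)
  then have fin: "(\<integral>\<^sup>+t. ennreal (exp (- c * t\<^sup>2)) \<partial>lborel) < \<infinity>"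
    by (simp add: integrable_iff_bounded)
  have "ennreal (exp (- c * (norm x)\<^sup>2)) = (\<Prod>b\<in>Basis. ennreal (exp (- c * (x \<bullet> b)\<^sup>2)))" for x :: 'a
  proof -
    have "exp (- c * (norm x)\<^sup>2) = exp (\<Sum>b\<in>Basis. - c * (x \<bullet> b)\<^sup>2)"
      unfolding power2_norm_eq_inner euclidean_inner[of x x] sum_distrib_left
      by (simp add: power2_eq_square)
    also have "\<dots> = (\<Prod>b\<in>Basis. exp (- c * (x \<bullet> b)\<^sup>2))"
      by (simp add: exp_sum)
    finally show ?thesis by (simp add: prod_ennreal)
  qed
  then have eq: "(\<integral>\<^sup>+x. ennreal (exp (- c * (norm (x::'a))\<^sup>2)) \<partial>lborel)
      = (\<integral>\<^sup>+x. (\<Prod>b\<in>Basis. ennreal (exp (- c * ((x::'a) \<bullet> b)\<^sup>2))) \<partial>lborel)"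
    by (intro nn_integral_cong) simp
  have "(\<integral>\<^sup>+x. (\<Prod>b\<in>Basis. ennreal (exp (- c * ((x::'a) \<bullet> b)\<^sup>2))) \<partial>lborel)
      = (\<Prod>b\<in>(Basis::'a set). (\<integral>\<^sup>+t. ennreal (exp (- c * t\<^sup>2)) \<partial>lborel))"
    by (rule nn_integral_lborel_prod) auto
  moreover have "(\<Prod>b\<in>(Basis::'a set). (\<integral>\<^sup>+t. ennreal (exp (- c * t\<^sup>2)) \<partial>lborel)) < \<infinity>"
    using fin by (simp add: power_less_top_ennreal)
  ultimately show "(\<integral>\<^sup>+x. ennreal (exp (- c * (norm (x::'a))\<^sup>2)) \<partial>lborel) < \<infinity>"
    unfolding eq by simp
qed auto

text \<open>Half of the Gaussian decay pays for the polynomial: (1 + y)^4 \<le> exp (4 y), and 4 y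
  \<le> 4 / c + c y^2 because (2 - c y)^2 / c is nonnegative.\<close>

lemma poly_exp_bound:
  fixes y :: real
  assumes "0 \<le> y" "0 < c"
  shows "(1 + y) ^ 4 * exp (- 2 * c * y\<^sup>2) \<le> exp (4 / c) * exp (- c * y\<^sup>2)"
proof -
  have "(1 + y) ^ 4 \<le> exp y ^ 4"
    using assms by (intro power_mono exp_ge_add_one_self) auto
  also have "\<dots> = exp (4 * y)" by (simp flip: exp_of_nat_mult)
  also have "4 * y \<le> 4 / c + c * y\<^sup>2"
  proof -
    have "0 \<le> (2 - c * y)\<^sup>2 / c" using assms by simp
    also have "\<dots> = 4 / c + c * y\<^sup>2 - 4 * y"
      using assms by (simp add: power2_eq_square field_simps)
    finally show ?thesis by simp
  qed
  then have "exp (4 * y) \<le> exp (4 / c + c * y\<^sup>2)" by simp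
  finally have "(1 + y) ^ 4 * exp (- 2 * c * y\<^sup>2) \<le> exp (4 / c + c * y\<^sup>2) * exp (- 2 * c * y\<^sup>2)"
    by (intro mult_right_mono) auto
  also have "\<dots> = exp (4 / c) * exp (- c * y\<^sup>2)"
    by (simp add: algebra_simps flip: exp_add)
  finally show ?thesis .
qed

lemma integrable_poly_exp:
  assumes "0 < c"
  shows "integrable lborel (\<lambda>x::'a::euclidean_space. (1 + norm x) ^ 4 * exp (- c * (norm x)\<^sup>2))"
proof (rule Bochner_Integration.integrable_bound)
  show "integrable lborel (\<lambda>x::'a. exp (4 / (c / 2)) * exp (- (c / 2) * (norm x)\<^sup>2))"
    using assms by (intro integrable_mult_right integrable_exp_minus_norm_sq) auto
  show "AE x in lborel. norm ((1 + norm x) ^ 4 * exp (- c * (norm (x::'a))\<^sup>2))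
    \<le> norm (exp (4 / (c / 2)) * exp (- (c / 2) * (norm x)\<^sup>2))"
    using poly_exp_bound[of "norm (x::'a)" "c / 2" for x] assms by auto
qed auto

text \<open>The normalising constant (4 pi)^(d/2) of the heat kernel, defined by the integral
  itself, so that unit mass at time 1 holds by construction and scaling carries it to all other
  times.\<close>

definition heat_mass :: "'a::euclidean_space itself \<Rightarrow> real" where
  "heat_mass _ = (\<integral>x. exp (- (1 / 4) * (norm (x::'a))\<^sup>2) \<partial>lborel)"

definition heat :: "real \<Rightarrow> 'a::euclidean_space \<Rightarrow> real" where
  "heat \<tau> x = \<tau> powr (- (real DIM('a) / 2)) / heat_mass TYPE('a) * exp (- (x \<bullet> x) / (4 * \<tau>))"

definition heat_grad :: "real \<Rightarrow> 'a::euclidean_space \<Rightarrow> 'a" where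
  "heat_grad \<tau> x = - (heat \<tau> x / (2 * \<tau>)) *\<^sub>R x"

definition heat_lap :: "real \<Rightarrow> 'a::euclidean_space \<Rightarrow> real" where
  "heat_lap \<tau> x = ((x \<bullet> x) / (4 * \<tau>\<^sup>2) - real DIM('a) / (2 * \<tau>)) * heat \<tau> x"

lemma heat_mass_pos: "0 < heat_mass TYPE('a::euclidean_space)"
proof -
  have int: "integrable lborel (\<lambda>x::'a. exp (- (1 / 4) * (norm x)\<^sup>2))"
    by (rule integrable_exp_minus_norm_sq) simp
  have "heat_mass TYPE('a) \<noteq> 0"
  proof
    assume "heat_mass TYPE('a) = 0"
    then have "AE x::'a in lborel. exp (- (1 / 4) * (norm x)\<^sup>2) = 0"
      unfolding heat_mass_def using integral_nonneg_eq_0_iff_AE[OF int] by simp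
    then show False by (simp add: eventually_False ae_filter_eq_bot_iff)
  qed
  moreover have "0 \<le> heat_mass TYPE('a)" unfolding heat_mass_def by simp
  ultimately show ?thesis by simp
qed

lemma heat_nonneg: "0 \<le> heat \<tau> x"
  unfolding heat_def using heat_mass_pos[where 'a='a] by simp

lemma heat_borel [measurable]:
  "heat \<tau> \<in> borel_measurable borel" "heat_grad \<tau> \<in> borel_measurable borel" "heat_lap \<tau> \<in> borel_measurable borel"
  unfolding heat_def[abs_def] heat_grad_def[abs_def] heat_lap_def[abs_def] by measurable

lemma heat_has_derivative:
  assumes "0 < \<tau>"
  shows "((\<lambda>x. heat \<tau> (x - z)) has_derivative (\<lambda>u. heat_grad \<tau> (x - z) \<bullet> u)) (at x)"
proof -
  define A where "A = \<tau> powr (- (real DIM('a) / 2)) / heat_mass TYPE('a)"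
  have "((\<lambda>x. A * exp (- ((x - z) \<bullet> (x - z)) / (4 * \<tau>))) has_derivative
    (\<lambda>u. A * (exp (- ((x - z) \<bullet> (x - z)) / (4 * \<tau>)) * (- ((x - z) \<bullet> u + u \<bullet> (x - z)) / (4 * \<tau>))))) (at x)"
    using assms by (auto intro!: derivative_eq_intros simp: field_simps)
  moreover have "A * (exp (- ((x - z) \<bullet> (x - z)) / (4 * \<tau>)) * (- ((x - z) \<bullet> u + u \<bullet> (x - z)) / (4 * \<tau>)))
    = heat_grad \<tau> (x - z) \<bullet> u" for u
    using assms by (simp add: heat_grad_def heat_def A_def[symmetric] inner_commute[of u])
  ultimately show ?thesis by (simp add: heat_def A_def)
qed

lemma dd_heat: "0 < \<tau> \<Longrightarrow> dd u (\<lambda>x. heat \<tau> (x - z)) x = heat_grad \<tau> (x - z) \<bullet> u"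
  by (rule dd_eq[OF heat_has_derivative])

lemma dd_dd_heat:
  assumes "0 < \<tau>"
  shows "dd u (dd u (\<lambda>x. heat \<tau> (x - z))) x
    = (((x - z) \<bullet> u)\<^sup>2 / (4 * \<tau>\<^sup>2) - (u \<bullet> u) / (2 * \<tau>)) * heat \<tau> (x - z)"
proof -
  have "dd u (\<lambda>x. heat \<tau> (x - z)) = (\<lambda>x. - (1 / (2 * \<tau>)) * (heat \<tau> (x - z) * ((x - z) \<bullet> u)))"
    using assms by (intro ext) (simp add: dd_heat heat_grad_def)
  moreover have "dd u (\<lambda>x. - (1 / (2 * \<tau>)) * (heat \<tau> (x - z) * ((x - z) \<bullet> u))) x
      = - (1 / (2 * \<tau>)) * (heat \<tau> (x - z) * (u \<bullet> u) + (heat_grad \<tau> (x - z) \<bullet> u) * ((x - z) \<bullet> u))"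
  proof (rule dd_eq[where f'="\<lambda>w. - (1 / (2 * \<tau>)) * (heat \<tau> (x - z) * (w \<bullet> u) + (heat_grad \<tau> (x - z) \<bullet> w) * ((x - z) \<bullet> u))"])
    have "((\<lambda>x. (x - z) \<bullet> u) has_derivative (\<lambda>w. w \<bullet> u)) (at x)"
      by (auto intro!: derivative_eq_intros)
    from has_derivative_mult_right[OF has_derivative_mult[OF heat_has_derivative[OF assms] this], of "- (1 / (2 * \<tau>))"]
    show "((\<lambda>x. - (1 / (2 * \<tau>)) * (heat \<tau> (x - z) * ((x - z) \<bullet> u))) has_derivative
      (\<lambda>w. - (1 / (2 * \<tau>)) * (heat \<tau> (x - z) * (w \<bullet> u) + (heat_grad \<tau> (x - z) \<bullet> w) * ((x - z) \<bullet> u)))) (at x)" .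
  qed
  ultimately have eq: "dd u (dd u (\<lambda>x. heat \<tau> (x - z))) x
      = - (1 / (2 * \<tau>)) * (heat \<tau> (x - z) * (u \<bullet> u) + (heat_grad \<tau> (x - z) \<bullet> u) * ((x - z) \<bullet> u))"
    by (rule trans[OF arg_cong[where f="\<lambda>f. dd u f x"]])
  define p where "p = (x - z) \<bullet> u"
  have g: "heat_grad \<tau> (x - z) \<bullet> u = - (heat \<tau> (x - z) / (2 * \<tau>)) * p"
    by (simp add: heat_grad_def p_def)
  show ?thesis
    unfolding eq g p_def[symmetric] using assms by (simp add: field_simps power2_eq_square)
qed

lemma lap_heat: "0 < \<tau> \<Longrightarrow> lap (\<lambda>x. heat \<tau> (x - z)) x = heat_lap \<tau> (x - z)"
  unfolding lap_def heat_lap_def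
  by (simp add: dd_dd_heat euclidean_inner[of "x - z" "x - z"] sum_divide_distrib sum_subtractf
      power2_eq_square flip: sum_distrib_right)

lemma smooth_heat: "smooth (\<lambda>x. heat \<tau> (x - z))"
proof -
  have "smooth (\<lambda>x::'a. - (1 / (4 * \<tau>)) * (norm (x - z))\<^sup>2)"
    by (rule smooth_mult[OF smooth_const smooth_norm_sq])
  from smooth_mult[OF smooth_const smooth_exp[OF this],
      of "\<tau> powr (- (real DIM('a) / 2)) / heat_mass TYPE('a)"]
  show ?thesis by (simp add: heat_def power2_norm_eq_inner)
qed

text \<open>The time derivative is the same function that \<open>lap_heat\<close> identifies as the
  Laplacian: the kernel solves the heat equation. This is the cancellation behind
  \<open>mild_pointwise\<close>.\<close>

lemma heat_has_derivative_time:
  assumes "0 < \<tau>"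
  shows "((\<lambda>\<tau>. heat \<tau> x) has_real_derivative heat_lap \<tau> x) (at \<tau>)"
proof -
  define d where "d = real DIM('a) / 2"
  define A where "A = 1 / heat_mass TYPE('a)"
  have "((\<lambda>\<tau>. A * (\<tau> powr (- d) * exp (- (x \<bullet> x) / (4 * \<tau>))))
    has_real_derivative
      A * (- d * \<tau> powr (- d - 1) * exp (- (x \<bullet> x) / (4 * \<tau>))
      + \<tau> powr (- d) * (exp (- (x \<bullet> x) / (4 * \<tau>)) * ((x \<bullet> x) / (4 * \<tau>\<^sup>2))))) (at \<tau>)"
    using assms by (auto intro!: derivative_eq_intros simp: power2_eq_square)
  moreover have "\<tau> powr (- d - 1) = \<tau> powr (- d) / \<tau>"
    using assms by (simp add: powr_diff)
  moreover have "heat t x = A * (t powr (- d) * exp (- (x \<bullet> x) / (4 * t)))" for t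
    by (simp add: heat_def A_def d_def)
  moreover have "heat_lap t x = ((x \<bullet> x) / (4 * t\<^sup>2) - d / t) * heat t x" for t
    by (simp add: heat_lap_def d_def)
  ultimately have "((\<lambda>\<tau>. heat \<tau> x) has_real_derivative A * (- d * (\<tau> powr (- d) / \<tau>) * exp (- (x \<bullet> x) / (4 * \<tau>))
      + \<tau> powr (- d) * (exp (- (x \<bullet> x) / (4 * \<tau>)) * ((x \<bullet> x) / (4 * \<tau>\<^sup>2))))) (at \<tau>)"
    by simp
  moreover have "A * (- d * (\<tau> powr (- d) / \<tau>) * exp (- (x \<bullet> x) / (4 * \<tau>))
      + \<tau> powr (- d) * (exp (- (x \<bullet> x) / (4 * \<tau>)) * ((x \<bullet> x) / (4 * \<tau>\<^sup>2)))) = heat_lap \<tau> x"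
    unfolding heat_lap_def heat_def A_def d_def using assms heat_mass_pos[where 'a='a]
    by (simp add: field_simps power2_eq_square)
  ultimately show ?thesis by simp
qed

text \<open>Every derivative of the heat kernel used below is a sum of terms of this size, uniformly for
  times in a compact subset of the positive half-line.\<close>

lemma heat_moment_bound:
  assumes "0 < \<delta>" "0 < D"
  obtains M where "0 < M" "\<And>\<tau> (x::'a::euclidean_space). \<delta> \<le> \<tau> \<Longrightarrow> \<tau> \<le> D \<Longrightarrow> (1 + norm x) ^ 4 * heat \<tau> x \<le> M"
proof -
  define c where "c = 1 / (8 * D)"
  define M where "M = \<delta> powr (- (real DIM('a) / 2)) / heat_mass TYPE('a) * exp (4 / c)"
  have "0 < M" using assms heat_mass_pos[where 'a='a] by (simp add: M_def)
  moreover have "(1 + norm x) ^ 4 * heat \<tau> x \<le> M" if "\<delta> \<le> \<tau>" "\<tau> \<le> D" for \<tau> and x :: 'a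
  proof -
    have "(x \<bullet> x) / (4 * D) \<le> (x \<bullet> x) / (4 * \<tau>)"
      using that assms by (intro divide_left_mono) auto
    then have "(1 + norm x) ^ 4 * exp (- (x \<bullet> x) / (4 * \<tau>)) \<le> (1 + norm x) ^ 4 * exp (- 2 * c * (norm x)\<^sup>2)"
      unfolding c_def power2_norm_eq_inner by (intro mult_left_mono) auto
    also have "\<dots> \<le> exp (4 / c) * exp (- c * (norm x)\<^sup>2)"
      using assms by (intro poly_exp_bound) (auto simp: c_def)
    also have "\<dots> \<le> exp (4 / c) * 1"
      using assms by (intro mult_left_mono) (auto simp: c_def)
    finally have 1: "(1 + norm x) ^ 4 * exp (- (x \<bullet> x) / (4 * \<tau>)) \<le> exp (4 / c)" by simp
    have 2: "\<tau> powr (- (real DIM('a) / 2)) / heat_mass TYPE('a) \<le> \<delta> powr (- (real DIM('a) / 2)) / heat_mass TYPE('a)"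
      using that assms heat_mass_pos[where 'a='a] by (intro divide_right_mono powr_mono2') auto
    have "(1 + norm x) ^ 4 * heat \<tau> x
      = \<tau> powr (- (real DIM('a) / 2)) / heat_mass TYPE('a) * ((1 + norm x) ^ 4 * exp (- (x \<bullet> x) / (4 * \<tau>)))"
      by (simp add: heat_def)
    also have "\<dots> \<le> M"
      unfolding M_def using heat_mass_pos[where 'a='a] by (intro mult_mono 1 2) auto
    finally show ?thesis .
  qed
  ultimately show thesis by (rule that)
qed

lemma heat_moment_le:
  assumes "(1 + norm x) ^ 4 * heat \<tau> x \<le> M" "k \<le> 4"
  shows "norm x ^ k * heat \<tau> x \<le> M"
proof -
  have "norm x ^ k \<le> (1 + norm x) ^ k" by (intro power_mono) auto
  also have "\<dots> \<le> (1 + norm x) ^ 4" using assms by (intro power_increasing) auto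
  finally show ?thesis
    using assms(1) heat_nonneg[of \<tau> x] by (meson mult_right_mono order_trans)
qed

text \<open>Except that the roles of the letters stay fixed, these are pure algebra:
  \<open>w\<close> stands for 1 / \<tau>, \<open>n\<close> for the norm of the point,
  \<open>d\<close> for the dimension and \<open>h\<close> for the value of the kernel. Each right
  side is a sum of monomials that the bound \<open>tb\<close> in \<open>heat_regularity\<close>
  handles one by one. The left sides are, in order, the time derivative of \<open>heat_lap\<close>,
  the time derivative of the norm of \<open>heat_grad\<close>, and, up to sign, the norm of the
  spatial gradient of \<open>heat_lap\<close>.\<close>

lemma heat_derivative_identities:
  fixes w n d h :: real
  shows heat_lap_time_identity: "(n\<^sup>2 * w\<^sup>2 / 4 - d * w / 2) * ((n\<^sup>2 * w\<^sup>2 / 4 - d * w / 2) * h)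
      + (n\<^sup>2 * (- 2 * w ^ 3) / 4 - d * (- w\<^sup>2) / 2) * h
    = (1/16) * d ^ 0 * w ^ 4 * (n ^ 4 * h) - (1/2) * d ^ 0 * w ^ 3 * (n ^ 2 * h)
      - (1/4) * d ^ 1 * w ^ 3 * (n ^ 2 * h) + (1/2) * d ^ 1 * w ^ 2 * (n ^ 0 * h)
      + (1/4) * d ^ 2 * w ^ 2 * (n ^ 0 * h)"
    and heat_lap_space_identity: "n * (((1/4) * d ^ 0 * w ^ 2 * (n ^ 2 * h) - (1/2) * d ^ 1 * w ^ 1 * (n ^ 0 * h)) * w + - w\<^sup>2 * h) / 2
    = (1/8) * d ^ 0 * w ^ 3 * (n ^ 3 * h) - (1/4) * d ^ 1 * w ^ 2 * (n ^ 1 * h)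
      - (1/2) * d ^ 0 * w ^ 2 * (n ^ 1 * h)"
    and heat_grad_time_identity: "(w\<^sup>2 / 2 * h - (n\<^sup>2 * w\<^sup>2 / 4 - d * w / 2) * (h * w / 2)) * n
    = (1/2) * d ^ 0 * w ^ 2 * (n ^ 1 * h) + (1/4) * d ^ 1 * w ^ 2 * (n ^ 1 * h)
      - (1/8) * d ^ 0 * w ^ 3 * (n ^ 3 * h)"
  by (simp_all add: field_simps power2_eq_square power3_eq_cube power4_eq_xxxx)

lemma abs_combination_le:
  fixes a b c d e :: real
  shows abs_combination5_le: "\<bar>a\<bar> \<le> A \<Longrightarrow> \<bar>b\<bar> \<le> B \<Longrightarrow> \<bar>c\<bar> \<le> C \<Longrightarrow> \<bar>d\<bar> \<le> D \<Longrightarrow> \<bar>e\<bar> \<le> E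
      \<Longrightarrow> \<bar>a - b - c + d + e\<bar> \<le> A + B + C + D + E"
    and abs_combination3_le: "\<bar>a\<bar> \<le> A \<Longrightarrow> \<bar>b\<bar> \<le> B \<Longrightarrow> \<bar>c\<bar> \<le> C \<Longrightarrow> \<bar>a - b - c\<bar> \<le> A + B + C"
    and abs_combination3_le': "\<bar>a\<bar> \<le> A \<Longrightarrow> \<bar>b\<bar> \<le> B \<Longrightarrow> \<bar>c\<bar> \<le> C \<Longrightarrow> \<bar>a + b - c\<bar> \<le> A + B + C"
  by linarith+

text \<open>On a time interval away from 0 every quantity is a combination of terms d^i \<tau>^(-j)
  |x|^k \<open>heat \<tau> x\<close> with k \<le> 4, and \<open>heat_moment_bound\<close> controls
  each of them. The Lipschitz clauses follow from the mean value inequality once the relevant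
  derivative has been brought into this form.\<close>

lemma heat_regularity:
  assumes "0 < \<delta>" "\<delta> \<le> D"
  obtains M where "0 < M"
    "\<And>\<tau> x::'a::euclidean_space. \<delta> \<le> \<tau> \<Longrightarrow> \<tau> \<le> D \<Longrightarrow> \<bar>heat \<tau> x\<bar> \<le> M"
    "\<And>\<tau> x::'a. \<delta> \<le> \<tau> \<Longrightarrow> \<tau> \<le> D \<Longrightarrow> norm (heat_grad \<tau> x) \<le> M"
    "\<And>\<tau> x::'a. \<delta> \<le> \<tau> \<Longrightarrow> \<tau> \<le> D \<Longrightarrow> \<bar>heat_lap \<tau> x\<bar> \<le> M"
    "\<And>\<tau> \<sigma> x::'a. \<delta> \<le> \<tau> \<Longrightarrow> \<tau> \<le> D \<Longrightarrow> \<delta> \<le> \<sigma> \<Longrightarrow> \<sigma> \<le> D \<Longrightarrow> \<bar>heat_lap \<tau> x - heat_lap \<sigma> x\<bar> \<le> M * \<bar>\<tau> - \<sigma>\<bar>"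
    "\<And>\<tau> \<sigma> x::'a. \<delta> \<le> \<tau> \<Longrightarrow> \<tau> \<le> D \<Longrightarrow> \<delta> \<le> \<sigma> \<Longrightarrow> \<sigma> \<le> D \<Longrightarrow> norm (heat_grad \<tau> x - heat_grad \<sigma> x) \<le> M * \<bar>\<tau> - \<sigma>\<bar>"
    "\<And>\<tau> (x::'a) y. \<delta> \<le> \<tau> \<Longrightarrow> \<tau> \<le> D \<Longrightarrow> \<bar>heat_lap \<tau> x - heat_lap \<tau> y\<bar> \<le> M * norm (x - y)"
    "\<And>\<tau> (x::'a) y. \<delta> \<le> \<tau> \<Longrightarrow> \<tau> \<le> D \<Longrightarrow> \<bar>heat \<tau> x - heat \<tau> y\<bar> \<le> M * norm (x - y)"
proof -
  obtain m where m: "0 < m" and mb: "\<And>\<tau> (x::'a). \<delta> \<le> \<tau> \<Longrightarrow> \<tau> \<le> D \<Longrightarrow> (1 + norm x) ^ 4 * heat \<tau> x \<le> m"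
    using heat_moment_bound[OF assms(1), of D, where 'a='a] assms by auto
  define d where "d = real DIM('a)"
  define e where "e = 1 / \<delta>"
  have d: "0 \<le> d" and e: "0 < e" using assms by (auto simp: d_def e_def)
  have inv: "0 < 1 / \<tau>" "1 / \<tau> \<le> e" if "\<delta> \<le> \<tau>" for \<tau>
    using that assms by (auto simp: e_def field_simps)
  \<comment> \<open>\<open>P\<close> dominates every product e^j d^i with j \<le> 4 and i \<le> 2.
    Each monomial is later charged its coefficient times \<open>M / 8\<close>, and the factor 8 in
    \<open>M\<close> leaves room for the sum of the coefficients in every identity.\<close>
  define P where "P = (1 + e + e\<^sup>2 + e ^ 3 + e ^ 4) * (1 + d + d\<^sup>2)"
  define M where "M = m * P * 8"
  have mm: "norm x ^ k * heat \<tau> x \<le> m" if "\<delta> \<le> \<tau>" "\<tau> \<le> D" "k \<le> 4" for \<tau> k and x :: 'a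
    using heat_moment_le[OF mb] that by auto
  have term_bound: "\<bar>a * (1 / \<tau>) ^ j * (norm x ^ k * heat \<tau> x)\<bar> \<le> a * e ^ j * m"
    if "\<delta> \<le> \<tau>" "\<tau> \<le> D" "k \<le> 4" "0 \<le> a" for a \<tau> j k and x :: 'a
    using that inv[of \<tau>] mm[of \<tau> k x] m e heat_nonneg[of \<tau> x]
    by (auto simp: abs_mult intro!: mult_mono power_mono)
  have poly: "1 \<le> P"
    "e ^ j * d ^ i \<le> P" if "j \<le> 4" "i \<le> 2" for i j
  proof -
    have "e ^ j \<le> 1 + e + e\<^sup>2 + e ^ 3 + e ^ 4"
    proof -
      have "j = 0 \<or> j = 1 \<or> j = 2 \<or> j = 3 \<or> j = 4" using that by auto
      then show ?thesis using e by (auto simp: add_nonneg_nonneg)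
    qed
    moreover have "d ^ i \<le> 1 + d + d\<^sup>2"
    proof -
      have "i = 0 \<or> i = 1 \<or> i = 2" using that by auto
      then show ?thesis using d by (auto simp: add_nonneg_nonneg)
    qed
    ultimately show "e ^ j * d ^ i \<le> P"
      unfolding P_def using e d by (intro mult_mono) auto
    have "1 * 1 \<le> P"
      unfolding P_def using e d by (intro mult_mono) auto
    then show "1 \<le> P" by simp
  qed
  have tb: "\<bar>a * d ^ i * (1 / \<tau>) ^ j * (norm x ^ k * heat \<tau> x)\<bar> \<le> a * (M / 8)"
    if "\<delta> \<le> \<tau>" "\<tau> \<le> D" "k \<le> 4" "0 \<le> a" "j \<le> 4" "i \<le> 2" for a \<tau> i j k and x :: 'a
  proof -
    have "\<bar>(a * d ^ i) * (1 / \<tau>) ^ j * (norm x ^ k * heat \<tau> x)\<bar> \<le> (a * d ^ i) * e ^ j * m"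
      using that d by (intro term_bound) auto
    also have "\<dots> = a * (m * (e ^ j * d ^ i))" by simp
    also have "\<dots> \<le> a * (m * P)"
      using that m by (intro mult_left_mono poly) auto
    finally show ?thesis by (simp add: M_def mult.assoc)
  qed
  have M: "0 < M" using m poly(1)[of 0 0] by (simp add: M_def zero_less_mult_iff)
  have lap_eq: "heat_lap \<tau> x = (1/4) * d ^ 0 * (1 / \<tau>) ^ 2 * (norm x ^ 2 * heat \<tau> x)
      - (1/2) * d ^ 1 * (1 / \<tau>) ^ 1 * (norm x ^ 0 * heat \<tau> x)" for \<tau> and x :: 'a
    by (simp add: heat_lap_def d_def power2_norm_eq_inner power_divide left_diff_distrib)
  have b1: "\<bar>heat \<tau> x\<bar> \<le> M" if "\<delta> \<le> \<tau>" "\<tau> \<le> D" for \<tau> and x :: 'a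
    using tb[OF that, of 0 1 0 0 x] M by simp
  have ng: "norm (heat_grad \<tau> x) = \<bar>(1/2) * d ^ 0 * (1 / \<tau>) ^ 1 * (norm x ^ 1 * heat \<tau> x)\<bar>"
    if "\<delta> \<le> \<tau>" for \<tau> and x :: 'a
    using that assms by (simp add: heat_grad_def abs_mult)
  have b2: "norm (heat_grad \<tau> x) \<le> M" if "\<delta> \<le> \<tau>" "\<tau> \<le> D" for \<tau> and x :: 'a
    using tb[OF that, of 1 "1/2" 1 0 x] M ng[OF that(1), of x] by simp
  have b3: "\<bar>heat_lap \<tau> x\<bar> \<le> M" if "\<delta> \<le> \<tau>" "\<tau> \<le> D" for \<tau> and x :: 'a
    using tb[OF that, of 2 "1/4" 2 0 x] tb[OF that, of 0 "1/2" 1 1 x] M unfolding lap_eq by linarith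
  have b4: "\<bar>heat_lap \<tau> x - heat_lap \<sigma> x\<bar> \<le> M * \<bar>\<tau> - \<sigma>\<bar>"
    if "\<delta> \<le> \<tau>" "\<tau> \<le> D" "\<delta> \<le> \<sigma>" "\<sigma> \<le> D" for \<tau> \<sigma> and x :: 'a
  proof -
    define q where "q t = (norm x)\<^sup>2 * (1 / t)\<^sup>2 / 4 - d * (1 / t) / 2" for t
    define q' where "q' t = (norm x)\<^sup>2 * (- 2 * (1 / t) ^ 3) / 4 - d * (- (1 / t)\<^sup>2) / 2" for t
    have lap_q: "heat_lap t x = q t * heat t x" for t
      unfolding lap_eq q_def by (simp add: algebra_simps)
    have "norm (heat_lap \<tau> x - heat_lap \<sigma> x) \<le> M * norm (\<tau> - \<sigma>)"
    proof (rule field_differentiable_bound[where S="{\<delta>..D}" and f'="\<lambda>t. q t * heat_lap t x + q' t * heat t x"])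
      fix t assume "t \<in> {\<delta>..D}"
      then have t: "\<delta> \<le> t" "t \<le> D" "0 < t" using assms by auto
      have inv: "((\<lambda>t. 1 / t) has_real_derivative - (1 / t)\<^sup>2) (at t)"
        using t(3) by (auto intro!: derivative_eq_intros simp: power2_eq_square)
      have q: "(q has_real_derivative q' t) (at t)"
        unfolding q_def[abs_def] q'_def
        by (rule DERIV_cong[OF DERIV_diff[OF DERIV_cdivide[OF DERIV_cmult[OF DERIV_power[OF inv]]]
              DERIV_cdivide[OF DERIV_cmult[OF inv]]]])
          (simp add: power2_eq_square power3_eq_cube)
      have "((\<lambda>t. q t * heat t x) has_real_derivative q t * heat_lap t x + q' t * heat t x) (at t)"
        using DERIV_mult[OF q heat_has_derivative_time[OF t(3), of x]] by (simp add: mult.commute add.commute)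
      then show "((\<lambda>t. heat_lap t x) has_field_derivative q t * heat_lap t x + q' t * heat t x) (at t within {\<delta>..D})"
        unfolding ext[of "\<lambda>t. heat_lap t x", OF lap_q] by (rule has_field_derivative_at_within)
      have eq: "q t * heat_lap t x + q' t * heat t x = (1/16) * d ^ 0 * (1 / t) ^ 4 * (norm x ^ 4 * heat t x)
        - (1/2) * d ^ 0 * (1 / t) ^ 3 * (norm x ^ 2 * heat t x)
        - (1/4) * d ^ 1 * (1 / t) ^ 3 * (norm x ^ 2 * heat t x)
        + (1/2) * d ^ 1 * (1 / t) ^ 2 * (norm x ^ 0 * heat t x)
        + (1/4) * d ^ 2 * (1 / t) ^ 2 * (norm x ^ 0 * heat t x)"
        unfolding lap_q q_def q'_def using heat_lap_time_identity[of "norm x" "1 / t" d "heat t x"] .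
      show "norm (q t * heat_lap t x + q' t * heat t x) \<le> M"
        unfolding eq real_norm_def
        by (rule order_trans[OF abs_combination5_le[OF tb[OF t(1,2)] tb[OF t(1,2)] tb[OF t(1,2)] tb[OF t(1,2)] tb[OF t(1,2)]]])
          (use M in simp_all)
    qed (use that in auto)
    then show ?thesis by simp
  qed
  have b5: "norm (heat_grad \<tau> x - heat_grad \<sigma> x) \<le> M * \<bar>\<tau> - \<sigma>\<bar>"
    if "\<delta> \<le> \<tau>" "\<tau> \<le> D" "\<delta> \<le> \<sigma>" "\<sigma> \<le> D" for \<tau> \<sigma> and x :: 'a
  proof -
    define g where "g t = norm x * (heat t x * (1 / t)) / 2" for t
    define g' where "g' t = norm x * (heat_lap t x * (1 / t) + - (1 / t)\<^sup>2 * heat t x) / 2" for t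
    have "norm (g \<tau> - g \<sigma>) \<le> M * norm (\<tau> - \<sigma>)"
    proof (rule field_differentiable_bound[where S="{\<delta>..D}" and f'=g'])
      fix t assume "t \<in> {\<delta>..D}"
      then have t: "\<delta> \<le> t" "t \<le> D" "0 < t" using assms by auto
      have inv: "((\<lambda>t. 1 / t) has_real_derivative - (1 / t)\<^sup>2) (at t)"
        using t(3) by (auto intro!: derivative_eq_intros simp: power2_eq_square)
      have "(g has_real_derivative g' t) (at t)"
        unfolding g_def[abs_def] g'_def
        by (rule DERIV_cdivide[OF DERIV_cmult[OF DERIV_mult[OF heat_has_derivative_time[OF t(3)] inv]]])
      then show "(g has_field_derivative g' t) (at t within {\<delta>..D})"
        by (rule has_field_derivative_at_within)
      have eq: "g' t = (1/8) * d ^ 0 * (1 / t) ^ 3 * (norm x ^ 3 * heat t x)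
        - (1/4) * d ^ 1 * (1 / t) ^ 2 * (norm x ^ 1 * heat t x)
        - (1/2) * d ^ 0 * (1 / t) ^ 2 * (norm x ^ 1 * heat t x)"
        unfolding g'_def lap_eq using heat_lap_space_identity[of "norm x" d "1 / t" "heat t x"] .
      show "norm (g' t) \<le> M"
        unfolding eq real_norm_def
        by (rule order_trans[OF abs_combination3_le[OF tb[OF t(1,2)] tb[OF t(1,2)] tb[OF t(1,2)]]])
          (use M in simp_all)
    qed (use that in auto)
    moreover have "norm (heat_grad \<tau> x - heat_grad \<sigma> x) = norm (g \<tau> - g \<sigma>)"
    proof -
      have "heat_grad \<tau> x - heat_grad \<sigma> x = (heat \<sigma> x / (2 * \<sigma>) - heat \<tau> x / (2 * \<tau>)) *\<^sub>R x"
        by (simp add: heat_grad_def scaleR_diff_left)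
      then have "norm (heat_grad \<tau> x - heat_grad \<sigma> x) = \<bar>heat \<sigma> x / (2 * \<sigma>) - heat \<tau> x / (2 * \<tau>)\<bar> * norm x"
        by simp
      also have "\<dots> = \<bar>(heat \<sigma> x / (2 * \<sigma>) - heat \<tau> x / (2 * \<tau>)) * norm x\<bar>" by (simp add: abs_mult)
      also have "(heat \<sigma> x / (2 * \<sigma>) - heat \<tau> x / (2 * \<tau>)) * norm x = - (g \<tau> - g \<sigma>)"
        by (simp add: g_def algebra_simps)
      finally show ?thesis by simp
    qed
    ultimately show ?thesis by simp
  qed
  have b6: "\<bar>heat_lap \<tau> x - heat_lap \<tau> y\<bar> \<le> M * norm (x - y)"
    if "\<delta> \<le> \<tau>" "\<tau> \<le> D" for \<tau> and x y :: 'a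
  proof -
    have t: "0 < \<tau>" using that assms by simp
    define k where "k w = (w \<bullet> w) * (1 / \<tau>)\<^sup>2 / 4 - d * (1 / \<tau>) / 2" for w :: 'a
    have lap_k: "heat_lap \<tau> w = k w * heat \<tau> w" for w
      unfolding lap_eq k_def by (simp add: algebra_simps power2_norm_eq_inner)
    define c where "c w = (1 / \<tau>)\<^sup>2 / 2 * heat \<tau> w - k w * (heat \<tau> w * (1 / \<tau>) / 2)" for w :: 'a
    have "norm (heat_lap \<tau> x - heat_lap \<tau> y) \<le> M * norm (x - y)"
    proof (rule differentiable_bound[where S=UNIV and f'="\<lambda>w u. c w * (w \<bullet> u)"])
      fix w :: 'a
      have "(k has_derivative (\<lambda>u. (w \<bullet> u + u \<bullet> w) * (1 / \<tau>)\<^sup>2 / 4)) (at w)"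
        unfolding k_def[abs_def] by (auto intro!: derivative_eq_intros)
      from has_derivative_mult[OF this heat_has_derivative[OF t, of 0 w, unfolded diff_0_right]]
      have "(heat_lap \<tau> has_derivative (\<lambda>u. k w * (heat_grad \<tau> w \<bullet> u) + (w \<bullet> u + u \<bullet> w) * (1 / \<tau>)\<^sup>2 / 4 * heat \<tau> w)) (at w)"
        unfolding lap_k[abs_def] .
      moreover have "k w * (heat_grad \<tau> w \<bullet> u) + (w \<bullet> u + u \<bullet> w) * (1 / \<tau>)\<^sup>2 / 4 * heat \<tau> w = c w * (w \<bullet> u)" for u
        by (simp add: c_def heat_grad_def inner_commute[of u] algebra_simps)
      ultimately show "(heat_lap \<tau> has_derivative (\<lambda>u. c w * (w \<bullet> u))) (at w within UNIV)" by simp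
      have e1: "c w * norm w = (1/2) * d ^ 0 * (1 / \<tau>) ^ 2 * (norm w ^ 1 * heat \<tau> w)
        + (1/4) * d ^ 1 * (1 / \<tau>) ^ 2 * (norm w ^ 1 * heat \<tau> w)
        - (1/8) * d ^ 0 * (1 / \<tau>) ^ 3 * (norm w ^ 3 * heat \<tau> w)"
        unfolding c_def k_def power2_norm_eq_inner[symmetric] using heat_grad_time_identity[of "1 / \<tau>" "heat \<tau> w" "norm w" d] .
      have e2: "\<bar>c w * norm w\<bar> \<le> M"
        unfolding e1
        by (rule order_trans[OF abs_combination3_le'[OF tb[OF that] tb[OF that] tb[OF that]]])
          (use M in simp_all)
      show "onorm (\<lambda>u. c w * (w \<bullet> u)) \<le> M"
      proof (rule onorm_le)
        fix u
        have "norm (c w * (w \<bullet> u)) \<le> \<bar>c w\<bar> * (norm w * norm u)"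
          by (simp add: abs_mult mult_left_mono Cauchy_Schwarz_ineq2)
        also have "\<dots> \<le> M * norm u"
          using e2 by (simp add: abs_mult mult_right_mono flip: mult.assoc)
        finally show "norm (c w * (w \<bullet> u)) \<le> M * norm u" .
      qed
    qed auto
    then show ?thesis by simp
  qed
  have b7: "\<bar>heat \<tau> x - heat \<tau> y\<bar> \<le> M * norm (x - y)"
    if "\<delta> \<le> \<tau>" "\<tau> \<le> D" for \<tau> and x y :: 'a
  proof -
    have t: "0 < \<tau>" using that assms by simp
    have "norm (heat \<tau> x - heat \<tau> y) \<le> M * norm (x - y)"
    proof (rule differentiable_bound[where S=UNIV and f'="\<lambda>w u. heat_grad \<tau> w \<bullet> u"])
      fix w :: 'a
      show "(heat \<tau> has_derivative (\<lambda>u. heat_grad \<tau> w \<bullet> u)) (at w within UNIV)"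
        using heat_has_derivative[OF t, of 0 w] by simp
      show "onorm (\<lambda>u. heat_grad \<tau> w \<bullet> u) \<le> M"
      proof (rule onorm_le)
        fix u
        have "norm (heat_grad \<tau> w \<bullet> u) \<le> norm (heat_grad \<tau> w) * norm u"
          by (simp add: Cauchy_Schwarz_ineq2)
        also have "\<dots> \<le> M * norm u" using b2[OF that] by (intro mult_right_mono) auto
        finally show "norm (heat_grad \<tau> w \<bullet> u) \<le> M * norm u" .
      qed
    qed auto
    then show ?thesis by simp
  qed
  show thesis by (rule that[OF M b1 b2 b3 b4 b5 b6 b7])
qed

section \<open>Scaling, mass and gradient mass of the heat kernel\<close>

lemma lborel_scaling:
  fixes f :: "'a::euclidean_space \<Rightarrow> 'b::{banach, second_countable_topology}"
  assumes "c \<noteq> 0" "f \<in> borel_measurable borel"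
  shows "(\<integral>x. f x \<partial>lborel) = \<bar>c\<bar> ^ DIM('a) *\<^sub>R (\<integral>x. f (t + c *\<^sub>R x) \<partial>lborel)"
    and "integrable lborel (\<lambda>x. f (t + c *\<^sub>R x)) \<Longrightarrow> integrable lborel f"
proof -
  note [measurable] = assms(2)
  have *: "lborel = density (distr lborel borel (\<lambda>x. t + c *\<^sub>R x)) (\<lambda>_. ennreal (\<bar>c\<bar> ^ DIM('a)))"
    using lborel_affine[OF assms(1), of t] by (simp add: ennreal_power)
  show "(\<integral>x. f x \<partial>lborel) = \<bar>c\<bar> ^ DIM('a) *\<^sub>R (\<integral>x. f (t + c *\<^sub>R x) \<partial>lborel)"
    by (subst *) (simp add: integral_density integral_distr)
  show "integrable lborel f" if "integrable lborel (\<lambda>x. f (t + c *\<^sub>R x))"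
    using that by (subst *) (simp add: integrable_density integrable_distr_eq)
qed

lemma heat_scaling:
  assumes "0 < \<tau>"
  shows "sqrt \<tau> ^ DIM('a) * heat \<tau> (sqrt \<tau> *\<^sub>R x) = heat 1 (x::'a::euclidean_space)"
proof -
  have "\<tau> powr (real DIM('a) / 2) = sqrt \<tau> ^ DIM('a)"
    using assms by (simp add: powr_half_sqrt[symmetric] powr_powr flip: powr_realpow)
  then have "sqrt \<tau> ^ DIM('a) * \<tau> powr (- (real DIM('a) / 2)) = 1"
    using assms by (simp add: powr_minus)
  then show ?thesis
    using assms by (simp add: heat_def mult.assoc[symmetric])
qed

lemma heat_1_eq: "heat 1 (x::'a::euclidean_space) = exp (- (1 / 4) * (norm x)\<^sup>2) / heat_mass TYPE('a)"
  by (simp add: heat_def power2_norm_eq_inner)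

lemma heat_1_integral: "integrable lborel (heat 1 :: 'a::euclidean_space \<Rightarrow> real)"
  "(\<integral>x. heat 1 (x::'a) \<partial>lborel) = 1"
proof -
  have int: "integrable lborel (\<lambda>x::'a. exp (- (1 / 4) * (norm x)\<^sup>2))"
    by (rule integrable_exp_minus_norm_sq) simp
  have eq: "heat 1 = (\<lambda>x::'a. exp (- (1 / 4) * (norm x)\<^sup>2) / heat_mass TYPE('a))"
    by (rule ext) (rule heat_1_eq)
  show "integrable lborel (heat 1 :: 'a \<Rightarrow> real)"
    unfolding eq by (intro integrable_divide int)
  show "(\<integral>x. heat 1 (x::'a) \<partial>lborel) = 1"
    unfolding eq integral_divide_zero heat_mass_def[where 'a='a, of "TYPE('a)", symmetric]
    using heat_mass_pos[where 'a='a] by simp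
qed

lemma heat_at_scaled_point:
  fixes x w :: "'a::euclidean_space"
  assumes "0 < \<tau>"
  shows "heat \<tau> (x - (x + sqrt \<tau> *\<^sub>R w)) = heat 1 w / sqrt \<tau> ^ DIM('a)"
proof -
  have "x - (x + sqrt \<tau> *\<^sub>R w) = - (sqrt \<tau> *\<^sub>R w)" by simp
  then have "heat \<tau> (x - (x + sqrt \<tau> *\<^sub>R w)) = heat \<tau> (sqrt \<tau> *\<^sub>R w)"
    unfolding heat_def by (simp only: inner_minus_left inner_minus_right minus_minus)
  also have "\<dots> = heat 1 w / sqrt \<tau> ^ DIM('a)"
    unfolding heat_scaling[OF assms, of w, symmetric] using assms by simp
  finally show ?thesis .
qed

text \<open>The substitution z = x + sqrt \<tau> w moves the time parameter from the kernel into the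
  function and leaves a fixed Gaussian weight, so that the limit \<tau> \<rightarrow> 0 becomes a
  matter of dominated convergence.\<close>

lemma heat_convolution:
  fixes h :: "'a::euclidean_space \<Rightarrow> real"
  assumes "0 < \<tau>" and [measurable]: "h \<in> borel_measurable borel"
  shows "(\<integral>z. h z * heat \<tau> (x - z) \<partial>lborel) = (\<integral>w. h (x + sqrt \<tau> *\<^sub>R w) * heat 1 w \<partial>lborel)"
proof -
  have "(\<integral>z. h z * heat \<tau> (x - z) \<partial>lborel)
    = \<bar>sqrt \<tau>\<bar> ^ DIM('a) *\<^sub>R (\<integral>w. h (x + sqrt \<tau> *\<^sub>R w) * heat \<tau> (x - (x + sqrt \<tau> *\<^sub>R w)) \<partial>lborel)"
    using assms(1) by (intro lborel_scaling(1)) auto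
  also have "\<dots> = (\<integral>w. sqrt \<tau> ^ DIM('a) * (h (x + sqrt \<tau> *\<^sub>R w) * heat \<tau> (x - (x + sqrt \<tau> *\<^sub>R w))) \<partial>lborel)"
    unfolding real_scaleR_def integral_mult_right_zero using assms(1) by simp
  also have "\<dots> = (\<integral>w. h (x + sqrt \<tau> *\<^sub>R w) * heat 1 w \<partial>lborel)"
    unfolding heat_at_scaled_point[OF assms(1)] using assms(1)
    by (intro Bochner_Integration.integral_cong refl) simp
  finally show ?thesis .
qed

lemma heat_integral:
  assumes "0 < \<tau>"
  shows "integrable lborel (\<lambda>z::'a::euclidean_space. heat \<tau> (x - z))" "(\<integral>z. heat \<tau> (x - z) \<partial>lborel) = 1"
proof -
  have "integrable lborel (\<lambda>w. heat \<tau> (x - (x + sqrt \<tau> *\<^sub>R w)))"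
    unfolding heat_at_scaled_point[OF assms] by (intro integrable_divide heat_1_integral)
  then show "integrable lborel (\<lambda>z::'a. heat \<tau> (x - z))"
    by (rule lborel_scaling(2)[rotated 2]) (use assms in auto)
  show "(\<integral>z. heat \<tau> (x - z) \<partial>lborel) = 1"
    using heat_convolution[OF assms, of "\<lambda>_. 1" x] heat_1_integral(2)[where 'a='a] by simp
qed

text \<open>By the same scaling one derivative of the kernel costs a factor 1 / sqrt \<tau>. This is
  the singular kernel in the comparison of the two Duhamel formulas.\<close>

lemma heat_grad_integral:
  obtains C where "0 < C"
    "\<And>\<tau> x. 0 < \<tau> \<Longrightarrow> integrable lborel (\<lambda>z::'a::euclidean_space. norm (heat_grad \<tau> (x - z)))
      \<and> (\<integral>z. norm (heat_grad \<tau> (x - z)) \<partial>lborel) \<le> C / sqrt \<tau>"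
proof -
  define I where "I = (\<integral>w. norm (w::'a) * heat 1 w / 2 \<partial>lborel)"
  have int: "integrable lborel (\<lambda>w::'a. norm w * heat 1 w / 2)"
  proof (rule Bochner_Integration.integrable_bound)
    show "integrable lborel (\<lambda>x::'a. (1 + norm x) ^ 4 * exp (- (1/4) * (norm x)\<^sup>2) / heat_mass TYPE('a))"
      by (intro integrable_divide integrable_poly_exp) auto
    have "norm x / 2 \<le> (1 + norm x) ^ 4" for x :: 'a
      using self_le_power[of "1 + norm x" 4] norm_ge_zero[of x] by linarith
    then have "norm x / 2 * heat 1 x \<le> (1 + norm x) ^ 4 * heat 1 x" for x :: 'a
      by (intro mult_right_mono heat_nonneg)
    then have "norm (norm x * heat 1 x / 2) \<le>
        norm ((1 + norm x) ^ 4 * exp (- (1/4) * (norm x)\<^sup>2) / heat_mass TYPE('a))" for x :: 'a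
      using heat_nonneg[of 1 x] abs_ge_self order_trans unfolding heat_1_eq[symmetric] times_divide_eq_right[symmetric]
      by (simp add: abs_mult)
    then show "AE x::'a in lborel. norm (norm x * heat 1 x / 2) \<le>
        norm ((1 + norm x) ^ 4 * exp (- (1/4) * (norm x)\<^sup>2) / heat_mass TYPE('a))" by simp
  qed auto
  have "0 \<le> I" unfolding I_def by (intro integral_nonneg_AE) (auto simp: heat_nonneg)
  show thesis
  \<comment> \<open>Adding 1 makes the constant positive without evaluating the moment
    \<open>I\<close>.\<close>
  proof (rule that[of "I + 1"])
    fix \<tau> :: real and x :: 'a assume t: "0 < \<tau>"
    have eq: "norm (heat_grad \<tau> (x - (x + sqrt \<tau> *\<^sub>R w)))
        = norm w * heat 1 w / 2 / (sqrt \<tau> ^ DIM('a) * sqrt \<tau>)" for w :: 'a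
    proof -
      have "norm (heat_grad \<tau> (x - (x + sqrt \<tau> *\<^sub>R w)))
        = heat 1 w / sqrt \<tau> ^ DIM('a) / (2 * \<tau>) * norm (x - (x + sqrt \<tau> *\<^sub>R w))"
        unfolding heat_grad_def heat_at_scaled_point[OF t] using t heat_nonneg[of 1 w] by simp
      also have "\<dots> = heat 1 w / sqrt \<tau> ^ DIM('a) / (2 * \<tau>) * (sqrt \<tau> * norm w)" using t by simp
      also have "\<dots> = norm w * heat 1 w / 2 / (sqrt \<tau> ^ DIM('a) * sqrt \<tau>)"
        using t by (simp add: field_simps)
      finally show ?thesis .
    qed
    have 1: "integrable lborel (\<lambda>z::'a. norm (heat_grad \<tau> (x - z)))"
    proof (rule lborel_scaling(2))
      show "integrable lborel (\<lambda>w. norm (heat_grad \<tau> (x - (x + sqrt \<tau> *\<^sub>R w))))"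
        unfolding eq by (intro integrable_divide int)
    qed (use t in auto)
    have "(\<integral>z. norm (heat_grad \<tau> (x - z)) \<partial>lborel) = I / sqrt \<tau>"
    proof -
      have "(\<integral>z. norm (heat_grad \<tau> (x - z)) \<partial>lborel)
        = \<bar>sqrt \<tau>\<bar> ^ DIM('a) *\<^sub>R (\<integral>w. norm (heat_grad \<tau> (x - (x + sqrt \<tau> *\<^sub>R w))) \<partial>lborel)"
        by (rule lborel_scaling(1)) (use t in auto)
      also have "\<dots> = I / sqrt \<tau>"
        unfolding eq integral_divide_zero I_def using t by simp
      finally show ?thesis .
    qed
    also have "\<dots> \<le> (I + 1) / sqrt \<tau>" using t by (intro divide_right_mono) auto
    finally have 2: "(\<integral>z. norm (heat_grad \<tau> (x - z)) \<partial>lborel) \<le> (I + 1) / sqrt \<tau>" .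
    show "integrable lborel (\<lambda>z::'a. norm (heat_grad \<tau> (x - z))) \<and>
      (\<integral>z. norm (heat_grad \<tau> (x - z)) \<partial>lborel) \<le> (I + 1) / sqrt \<tau>"
      by (rule conjI[OF 1 2])
  qed (use \<open>0 \<le> I\<close> in simp)
qed

section \<open>Total variation and entropy\<close>

text \<open>A measurable function is almost everywhere a limit of continuous functions. These are
  truncated to [-1, 1], approximated by polynomials on growing balls and multiplied by cutoffs; the
  polynomials supply the smoothness.\<close>

lemma bounded_measurable_approx:
  fixes f :: "'a::euclidean_space \<Rightarrow> real"
  assumes "f \<in> borel_measurable borel" "\<And>x. \<bar>f x\<bar> \<le> 1"
  obtains h where "\<And>n. test_fun (h n)" "\<And>n x. \<bar>h n x\<bar> \<le> 1"
    "AE x in lborel. (\<lambda>n. h n x) \<longlonglongrightarrow> f x"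
proof -
  have "f measurable_on UNIV"
    using assms(1) by (intro lebesgue_measurable_imp_measurable_on_real) (auto simp: measurable_completion)
  then obtain N g where N: "negligible N" and g: "\<And>n. continuous_on UNIV (g n)"
    and gf: "\<And>x. x \<notin> N \<Longrightarrow> (\<lambda>n. g n x) \<longlonglongrightarrow> f x"
    unfolding measurable_on_def by auto
  define g' where "g' n x = max (- 1) (min 1 (g n x))" for n x
  have "\<exists>q. real_polynomial_function q \<and> (\<forall>x\<in>cball 0 (real (Suc n)). \<bar>g' n x - q x\<bar> < 1 / real (Suc n))" for n
  proof -
    have "continuous_on (cball 0 (real (Suc n))) (g' n)"
      unfolding g'_def by (intro continuous_intros continuous_on_subset[OF g]) auto
    then show ?thesis
      using Stone_Weierstrass_real_polynomial_function[OF compact_cball, of 0 "real (Suc n)" "g' n" "1 / real (Suc n)"]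
      by (metis of_nat_0_less_iff zero_less_Suc zero_less_divide_1_iff)
  qed
  then obtain q where q: "\<And>n. real_polynomial_function (q n)"
    "\<And>n x. x \<in> cball 0 (real (Suc n)) \<Longrightarrow> \<bar>g' n x - q n x\<bar> < 1 / real (Suc n)"
    by metis
  \<comment> \<open>On its ball the polynomial may exceed 1 in modulus by 1 / real (Suc n). The
    prefactor restores the bound 1 and tends to 1.\<close>
  define h where "h n x = 1 / (1 + 1 / real (Suc n)) * q n x * cutoff (real (Suc n)) x" for n x
  have "test_fun (h n)" for n
    unfolding h_def[abs_def]
    by (intro test_fun_mult' smooth_mult smooth_const smooth_real_polynomial q(1) test_fun_cutoff) simp
  moreover have "\<bar>h n x\<bar> \<le> 1" for n x
  proof (cases "cutoff (real (Suc n)) x = 0")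
    case False
    then have "x \<in> cball 0 (real (Suc n))" using cutoff_support[of "real (Suc n)" x] by auto
    from q(2)[OF this] have "\<bar>q n x\<bar> \<le> 1 + 1 / real (Suc n)"
      unfolding g'_def by linarith
    moreover have "0 < 1 + 1 / real (Suc n)" by (simp add: add_pos_pos)
    ultimately have "\<bar>1 / (1 + 1 / real (Suc n)) * q n x\<bar> \<le> 1" by (simp add: abs_mult)
    then have "\<bar>1 / (1 + 1 / real (Suc n)) * q n x\<bar> * cutoff (real (Suc n)) x \<le> 1 * 1"
      by (intro mult_mono cutoff_le_1 cutoff_nonneg) auto
    then show ?thesis by (simp add: h_def abs_mult cutoff_nonneg)
  qed (simp add: h_def)
  moreover have "AE x in lborel. (\<lambda>n. h n x) \<longlonglongrightarrow> f x"
  proof -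
    have lim: "(\<lambda>n. h n x) \<longlonglongrightarrow> f x" if "x \<notin> N" for x
    proof -
      have "(\<lambda>n. g' n x) \<longlonglongrightarrow> max (- 1) (min 1 (f x))"
        unfolding g'_def by (intro tendsto_intros gf that)
      also have "max (- 1) (min 1 (f x)) = f x" using assms(2)[of x] by (auto simp: max_def min_def abs_le_iff)
      finally have 1: "(\<lambda>n. g' n x) \<longlonglongrightarrow> f x" .
      have "eventually (\<lambda>n. norm x \<le> real (Suc n)) sequentially"
      proof -
        obtain k where "norm x \<le> real k" using real_arch_simple by blast
        then show ?thesis by (auto simp: eventually_sequentially intro!: exI[of _ k])
      qed
      then have "eventually (\<lambda>n. norm (g' n x - q n x) \<le> 1 / real (Suc n)) sequentially"
        by eventually_elim (use q(2)[of x] in \<open>auto intro: less_imp_le\<close>)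
      then have 2: "(\<lambda>n. g' n x - q n x) \<longlonglongrightarrow> 0"
        by (rule Lim_null_comparison) (use LIMSEQ_inverse_real_of_nat in \<open>simp add: inverse_eq_divide\<close>)
      have "(\<lambda>n. 1 / (1 + 1 / real (Suc n)) * (g' n x - (g' n x - q n x)) * cutoff (real (Suc n)) x)
        \<longlonglongrightarrow> 1 / (1 + 0) * (f x - 0) * 1"
        using LIMSEQ_inverse_real_of_nat
        by (intro tendsto_intros 1 2 cutoff_tendsto) (auto simp: inverse_eq_divide)
      then show ?thesis by (simp add: h_def)
    qed
    have "N \<in> null_sets lebesgue" using N by (simp add: negligible_iff_null_sets)
    then have "AE x in lebesgue. x \<notin> N" by (rule AE_not_in)
    then have "AE x in lebesgue. (\<lambda>n. h n x) \<longlonglongrightarrow> f x"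
      by eventually_elim (rule lim)
    then show ?thesis
      by (simp add: AE_completion_iff)
  qed
  ultimately show thesis by (rule that)
qed

text \<open>Total variation by duality, normalised so that two probability measures are at distance
  at most 2. Stating a bound \<open>c\<close> instead of a supremum keeps the finiteness of the
  supremum out of every later argument.\<close>

definition tv_le :: "'a::euclidean_space measure \<Rightarrow> 'a measure \<Rightarrow> real \<Rightarrow> bool" where
  "tv_le M N c \<longleftrightarrow> (\<forall>h. h \<in> borel_measurable borel \<longrightarrow> (\<forall>x. \<bar>h x\<bar> \<le> 1) \<longrightarrow>
     \<bar>(\<integral>x. h x \<partial>M) - (\<integral>x. h x \<partial>N)\<bar> \<le> c)"

lemma tv_leD:
  assumes "tv_le M N c" "h \<in> borel_measurable borel" "\<And>x. \<bar>h x\<bar> \<le> B"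
  shows "\<bar>(\<integral>x. h x \<partial>M) - (\<integral>x. h x \<partial>N)\<bar> \<le> B * c"
proof (cases "B = 0")
  case True
  have "h = (\<lambda>_. 0)"
  proof
    fix x show "h x = 0" using assms(3)[of x] True by linarith
  qed
  then show ?thesis unfolding True by simp
next
  case False
  then have B: "0 < B" using assms(3)[of undefined] by linarith
  have "\<bar>(\<integral>x. h x / B \<partial>M) - (\<integral>x. h x / B \<partial>N)\<bar> \<le> c"
  proof (rule assms(1)[unfolded tv_le_def, rule_format])
    show "(\<lambda>x. h x / B) \<in> borel_measurable borel" using assms(2) by measurable
    show "\<bar>h x / B\<bar> \<le> 1" for x using assms(3)[of x] B by simp
  qed
  then show ?thesis
    unfolding integral_divide_zero diff_divide_distrib[symmetric] using B
    by (simp add: divide_le_eq mult.commute)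
qed

lemma tv_le_nonneg: "tv_le M N c \<Longrightarrow> 0 \<le> c"
  using tv_leD[of M N c "\<lambda>_. 0" 1] by simp

text \<open>The approximating test functions converge only Lebesgue almost everywhere, so both
  measures must ignore Lebesgue null sets for dominated convergence to apply. This is the origin of
  the absolute continuity conditions on the two curves.\<close>

lemma tv_leI_test_fun:
  assumes M: "prob_space M" "sets M = sets borel" "absolutely_continuous lborel M"
    and N: "prob_space N" "sets N = sets borel" "absolutely_continuous lborel N"
    and le: "\<And>h. test_fun h \<Longrightarrow> (\<And>x. \<bar>h x\<bar> \<le> 1) \<Longrightarrow> \<bar>(\<integral>x. h x \<partial>M) - (\<integral>x. h x \<partial>N)\<bar> \<le> c"
  shows "tv_le M N c"
  unfolding tv_le_def
proof (intro allI impI)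
  fix f :: "'a \<Rightarrow> real" assume f: "f \<in> borel_measurable borel" and f1: "\<forall>x. \<bar>f x\<bar> \<le> 1"
  obtain h where h: "\<And>n. test_fun (h n)" "\<And>n x. \<bar>h n x\<bar> \<le> 1"
    "AE x in lborel. (\<lambda>n. h n x) \<longlonglongrightarrow> f x"
    using bounded_measurable_approx[OF f] f1 by metis
  have hb: "h n \<in> borel_measurable borel" for n
    using h(1) by (intro smooth_borel test_fun_smooth)
  have lim: "(\<lambda>n. \<integral>x. h n x \<partial>L) \<longlonglongrightarrow> (\<integral>x. f x \<partial>L)"
    if "prob_space L" "sets L = sets borel" "absolutely_continuous lborel L" for L
  proof (rule integral_dominated_convergence[where w="\<lambda>_. 1"])
    interpret prob_space L by fact
    show "integrable L (\<lambda>_. 1 :: real)" by simp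
    show "AE x in L. (\<lambda>n. h n x) \<longlonglongrightarrow> f x"
      by (rule absolutely_continuous_AE[OF _ that(3) h(3)]) (simp add: that)
  qed (use that f hb h(2) in \<open>auto cong: measurable_cong_sets\<close>)
  have "(\<lambda>n. \<bar>(\<integral>x. h n x \<partial>M) - (\<integral>x. h n x \<partial>N)\<bar>) \<longlonglongrightarrow> \<bar>(\<integral>x. f x \<partial>M) - (\<integral>x. f x \<partial>N)\<bar>"
    by (intro tendsto_intros lim M N)
  then show "\<bar>(\<integral>x. f x \<partial>M) - (\<integral>x. f x \<partial>N)\<bar> \<le> c"
    by (rule LIMSEQ_le_const2) (use le h in blast)
qed

text \<open>With s = sqrt r it amounts to ln s \<ge> 1 - 1 / s, multiplied by 2 s^2. If r is a
  probability density, the terms - r + 1 integrate to 0 and the squared Hellinger distance is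
  bounded by the entropy.\<close>

lemma hellinger_entropy_le:
  assumes "0 \<le> r" shows "(sqrt r - 1)\<^sup>2 \<le> r * ln r - r + 1"
proof (cases "r = 0")
  case False
  with assms have r: "0 < r" by simp
  define s where "s = sqrt r"
  have s: "0 < s" "r = s\<^sup>2" using r by (auto simp: s_def)
  have "ln (1 / s) \<le> 1 / s - 1" using s by (intro ln_le_minus_one) simp
  then have "1 - 1 / s \<le> ln s" using s by (simp add: ln_div)
  then have "2 * s\<^sup>2 * (1 - 1 / s) \<le> 2 * s\<^sup>2 * ln s" using s by (intro mult_left_mono) auto
  moreover have "r * ln r = 2 * s\<^sup>2 * ln s"
    using s by (simp add: ln_realpow)
  moreover have "2 * s\<^sup>2 * (1 - 1 / s) = 2 * s\<^sup>2 - 2 * s"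
    using s by (simp add: field_simps power2_eq_square)
  moreover have "(s - 1)\<^sup>2 = s\<^sup>2 - 2 * s + 1"
    by (simp add: power2_eq_square algebra_simps)
  ultimately show ?thesis
    using s by (simp add: s_def[symmetric])
qed simp

text \<open>A form of Pinsker's inequality obtained through the Hellinger distance. The first
  disjunct covers both a missing density and a density of infinite entropy.\<close>

lemma tv_le_Ent:
  assumes M: "prob_space M" and N: "prob_space N" and sN: "sets N = sets borel"
  shows "Ent M N = \<infinity> \<or> (\<exists>e\<ge>0. Ent M N = ereal e \<and> tv_le M N (2 * sqrt e))"
proof (cases "sets M = sets N \<and> absolutely_continuous N M")
  case True
  then have sM: "sets M = sets N" and ac: "absolutely_continuous N M" by auto
  interpret M: prob_space M by fact
  interpret N: prob_space N by fact
  define r where "r x = enn2real (RN_deriv N M x)" for x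
  have r0: "0 \<le> r x" for x by (simp add: r_def)
  have [measurable]: "r \<in> borel_measurable N" unfolding r_def[abs_def] by measurable
  have fin: "AE x in N. RN_deriv N M x \<noteq> \<infinity>"
    by (rule N.RN_deriv_finite[OF _ ac sM]) unfold_locales
  have "M = density N (RN_deriv N M)" using N.density_RN_deriv[OF ac sM] by simp
  also have "\<dots> = density N (\<lambda>x. ennreal (r x))"
    using fin by (intro density_cong) (auto simp: r_def less_top)
  finally have Md: "M = density N (\<lambda>x. ennreal (r x))" .
  have intM: "(\<integral>x. h x \<partial>M) = (\<integral>x. r x * h x \<partial>N)" if "h \<in> borel_measurable N" for h :: "'a \<Rightarrow> real"
    using that by (subst Md) (simp add: integral_density r0)
  have intr: "integrable N r"
  proof (rule integrableI_nonneg)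
    have "(\<integral>\<^sup>+ x. ennreal (r x) \<partial>N) = emeasure M (space M)"
      by (subst (1) Md) (simp add: emeasure_density Md cong: nn_integral_cong)
    then show "(\<integral>\<^sup>+ x. ennreal (r x) \<partial>N) < \<infinity>" using M.emeasure_space_1 by simp
  qed (auto simp: r0)
  have r1: "(\<integral>x. r x \<partial>N) = 1" using intM[of "\<lambda>_. 1"] M.prob_space by simp
  \<comment> \<open>From r ln r \<ge> r - 1 the negative part stays below 1, so the difference of
    the two integrals in \<open>Ent\<close> is never \<infinity> - \<infinity>.\<close>
  have low: "max 0 (- (r x * ln (r x))) \<le> 1" for x
    using order_trans[OF zero_le_power2 hellinger_entropy_le[OF r0[of x]]] r0[of x] by linarith
  have "(\<integral>\<^sup>+ x. ennreal (max 0 (- (r x * ln (r x)))) \<partial>N) \<le> (\<integral>\<^sup>+ x. 1 \<partial>N)"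
    using low by (intro nn_integral_mono) auto
  then have negfin: "(\<integral>\<^sup>+ x. ennreal (max 0 (- (r x * ln (r x)))) \<partial>N) < \<infinity>"
    using N.emeasure_space_1 by (auto simp: le_less_trans)
  have Ent_eq: "Ent M N = enn2ereal (\<integral>\<^sup>+ x. ennreal (max 0 (r x * ln (r x))) \<partial>N)
     - enn2ereal (\<integral>\<^sup>+ x. ennreal (max 0 (- (r x * ln (r x)))) \<partial>N)"
    using True by (simp add: Ent_def Let_def r_def)
  show ?thesis
  proof (cases "(\<integral>\<^sup>+ x. ennreal (max 0 (r x * ln (r x))) \<partial>N) = \<infinity>")
    case True
    with negfin have "Ent M N = \<infinity>"
      unfolding Ent_eq by (cases "\<integral>\<^sup>+ x. ennreal (max 0 (- (r x * ln (r x)))) \<partial>N") (auto simp: enn2ereal_ennreal)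
    then show ?thesis ..
  next
    case False
    then have posfin: "(\<integral>\<^sup>+ x. ennreal (max 0 (r x * ln (r x))) \<partial>N) < \<infinity>" by (simp add: less_top)
    have ip: "integrable N (\<lambda>x. max 0 (r x * ln (r x)))"
      using posfin by (intro integrableI_nonneg) auto
    have im: "integrable N (\<lambda>x. max 0 (- (r x * ln (r x))))"
      using negfin by (intro integrableI_nonneg) auto
    define e where "e = (\<integral>x. r x * ln (r x) \<partial>N)"
    have split: "r x * ln (r x) = max 0 (r x * ln (r x)) - max 0 (- (r x * ln (r x)))" for x by simp
    have ie: "integrable N (\<lambda>x. r x * ln (r x))"
      by (subst split) (intro Bochner_Integration.integrable_diff ip im)
    have Ee: "Ent M N = ereal e"
    proof -
      have "e = (\<integral>x. max 0 (r x * ln (r x)) \<partial>N) - (\<integral>x. max 0 (- (r x * ln (r x))) \<partial>N)"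
        unfolding e_def by (subst split) (intro Bochner_Integration.integral_diff ip im)
      moreover have "(\<integral>\<^sup>+ x. ennreal (max 0 (r x * ln (r x))) \<partial>N) = ennreal (\<integral>x. max 0 (r x * ln (r x)) \<partial>N)"
        by (rule nn_integral_eq_integral[OF ip]) auto
      moreover have "(\<integral>\<^sup>+ x. ennreal (max 0 (- (r x * ln (r x)))) \<partial>N) = ennreal (\<integral>x. max 0 (- (r x * ln (r x))) \<partial>N)"
        by (rule nn_integral_eq_integral[OF im]) auto
      moreover have "0 \<le> (\<integral>x. max 0 (r x * ln (r x)) \<partial>N)" "0 \<le> (\<integral>x. max 0 (- (r x * ln (r x))) \<partial>N)"
        by (auto intro!: integral_nonneg_AE)
      ultimately show ?thesis
        unfolding Ent_eq by (simp only: enn2ereal_ennreal ereal_minus)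
    qed
    have iq: "integrable N (\<lambda>x. (sqrt (r x) - 1)\<^sup>2)"
      by (rule Bochner_Integration.integrable_bound[of _ "\<lambda>x. r x * ln (r x) - r x + 1"])
        (use ie intr hellinger_entropy_le[OF r0] in \<open>auto intro: order_trans[OF _ abs_ge_self]\<close>)
    have "(\<integral>x. (sqrt (r x) - 1)\<^sup>2 \<partial>N) \<le> (\<integral>x. r x * ln (r x) - r x + 1 \<partial>N)"
      using ie intr iq hellinger_entropy_le[OF r0] by (intro integral_mono) auto
    also have "\<dots> = e" using ie intr r1 N.prob_space by (simp add: e_def)
    finally have He: "(\<integral>x. (sqrt (r x) - 1)\<^sup>2 \<partial>N) \<le> e" .
    then have e0: "0 \<le> e" by (rule order_trans[rotated]) simp
    have "tv_le M N (2 * sqrt e)"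
      unfolding tv_le_def
    proof (intro allI impI)
      fix h :: "'a \<Rightarrow> real" assume h: "h \<in> borel_measurable borel" and h1: "\<forall>x. \<bar>h x\<bar> \<le> 1"
      have [measurable]: "h \<in> borel_measurable N" using h sN by (simp cong: measurable_cong_sets)
      define D where "D = \<bar>(\<integral>x. h x \<partial>M) - (\<integral>x. h x \<partial>N)\<bar>"
      have irh: "integrable N (\<lambda>x. r x * h x)"
        by (rule Bochner_Integration.integrable_bound[OF intr]) (use h1 r0 in \<open>auto simp: abs_mult intro!: mult_left_le\<close>)
      have ih: "integrable N h"
        using h1 by (intro N.integrable_const_bound[of _ 1]) auto
      \<comment> \<open>Young's inequality with a free weight \<open>t\<close>, applied to |r - 1| =
        |s - 1| (s + 1) with s = sqrt r, takes the place of Cauchy-Schwarz. The term 2 t comes from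
        (s + 1)^2 \<le> 2 (r + 1) and the mass of \<open>r\<close>.\<close>
      have key: "D \<le> 2 * t + e / (2 * t)" if "0 < t" for t
      proof -
        have pw: "\<bar>r x * h x - h x\<bar> \<le> t * (r x + 1) + (sqrt (r x) - 1)\<^sup>2 / (2 * t)" for x
        proof -
          define s where "s = sqrt (r x)"
          have s: "r x = s\<^sup>2" "0 \<le> s" using r0[of x] by (auto simp: s_def)
          have "\<bar>r x * h x - h x\<bar> = \<bar>r x - 1\<bar> * \<bar>h x\<bar>" by (simp add: abs_mult[symmetric] algebra_simps)
          also have "\<dots> \<le> \<bar>r x - 1\<bar>" using h1 by (intro mult_left_le) auto
          also have "\<dots> = \<bar>s - 1\<bar> * (s + 1)"
          proof -
            have "r x - 1 = (s - 1) * (s + 1)" using s by (simp add: power2_eq_square algebra_simps)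
            then show ?thesis using s by (simp add: abs_mult)
          qed
          also have "\<dots> \<le> t * (s + 1)\<^sup>2 / 2 + (s - 1)\<^sup>2 / (2 * t)"
          proof -
            have "0 \<le> (t * (s + 1) - \<bar>s - 1\<bar>)\<^sup>2 / (2 * t)" using that by simp
            also have "\<dots> = t * (s + 1)\<^sup>2 / 2 + \<bar>s - 1\<bar>\<^sup>2 / (2 * t) - \<bar>s - 1\<bar> * (s + 1)"
              using that by (simp add: field_simps power2_eq_square)
            finally show ?thesis by simp
          qed
          also have "t * (s + 1)\<^sup>2 / 2 \<le> t * (r x + 1)"
          proof -
            have "(s + 1)\<^sup>2 \<le> 2 * (s\<^sup>2 + 1)" using zero_le_power2[of "s - 1"] by (simp add: power2_eq_square algebra_simps)
            then show ?thesis using that s by simp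
          qed
          finally show ?thesis by (simp add: s_def)
        qed
        have "D = \<bar>\<integral>x. r x * h x - h x \<partial>N\<bar>"
          unfolding D_def using irh ih by (simp add: intM)
        also have "\<dots> \<le> (\<integral>x. \<bar>r x * h x - h x\<bar> \<partial>N)" by (rule integral_abs_bound)
        also have "\<dots> \<le> (\<integral>x. t * (r x + 1) + (sqrt (r x) - 1)\<^sup>2 / (2 * t) \<partial>N)"
          using irh ih intr iq pw by (intro integral_mono) auto
        also have "\<dots> = t * 2 + (\<integral>x. (sqrt (r x) - 1)\<^sup>2 \<partial>N) / (2 * t)"
          using intr iq r1 N.prob_space by simp
        also have "\<dots> \<le> t * 2 + e / (2 * t)"
          using He that by (intro add_left_mono divide_right_mono) auto
        finally show ?thesis by simp
      qed
      have "D \<le> 2 * sqrt e"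
      proof (cases "D = 0")
        case False
        then have D: "0 < D" by (simp add: D_def)
        \<comment> \<open>The weight \<open>D / 4\<close> gives D^2 \<le> D^2 / 2 + 2 e and hence
          the factor 2. Unlike a weight proportional to sqrt e it stays positive when
          \<open>e\<close> is 0.\<close>
        have "D * D \<le> (2 * (D / 4) + e / (2 * (D / 4))) * D"
          using key[of "D / 4"] D by (intro mult_right_mono) auto
        also have "\<dots> = D * D / 2 + 2 * e" using D by (simp add: field_simps)
        finally have "(D / 2)\<^sup>2 \<le> e" by (simp add: power2_eq_square)
        then have "D / 2 \<le> sqrt e" by (rule real_le_rsqrt)
        then show ?thesis by simp
      qed (use e0 in simp)
      then show "\<bar>(\<integral>x. h x \<partial>M) - (\<integral>x. h x \<partial>N)\<bar> \<le> 2 * sqrt e" by (simp add: D_def)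
    qed
    with Ee e0 show ?thesis by blast
  qed
next
  case False
  then show ?thesis by (auto simp: Ent_def)
qed

section \<open>Continuous curves of measures\<close>

text \<open>Solutions are only constrained on \<open>{0..T}\<close>; precomposing with this clamp extends them to
  the whole line, so that measurability in time can be stated on \<open>borel\<close>.\<close>

definition clamp_time :: "real \<Rightarrow> real \<Rightarrow> real" where
  "clamp_time T t = max 0 (min T t)"

lemma clamp_time_in: "0 \<le> T \<Longrightarrow> clamp_time T t \<in> {0..T}"
  by (auto simp: clamp_time_def)

lemma clamp_time_id: "t \<in> {0..T} \<Longrightarrow> clamp_time T t = t"
  by (auto simp: clamp_time_def)

lemma P2D:
  assumes "P2 M"
  shows "prob_space M" "sets M = sets borel" "space M = UNIV" "integrable M (\<lambda>x. (norm x)\<^sup>2)"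
  using assms sets_eq_imp_space_eq[of M borel] by (auto simp: P2_def)

text \<open>Each coupling bounds the difference by \<open>L\<close> times its mean distance, hence
  by \<open>L\<close> times the square root of its cost, since variances are nonnegative; the
  infimum over couplings is taken afterwards. The product measure shows that this infimum ranges
  over a nonempty set. The factor \<open>L + 1\<close> is positive even for L = 0 and can therefore
  be divided out.\<close>

lemma W2_bounds_integral_difference:
  fixes M N :: "'b::euclidean_space measure"
  assumes M: "P2 M" and N: "P2 N" and f: "L-lipschitz_on UNIV f" and fB: "\<And>x. \<bar>f x\<bar> \<le> (B::real)"
  shows "\<bar>(\<integral>x. f x \<partial>M) - (\<integral>x. f x \<partial>N)\<bar> \<le> (L + 1) * W2 M N"
proof -
  note M' = P2D[OF M] and N' = P2D[OF N]
  interpret M: prob_space M by (rule M')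
  interpret N: prob_space N by (rule N')
  have L: "0 \<le> L" using f by (rule lipschitz_on_nonneg)
  have [measurable]: "f \<in> borel_measurable borel"
    using f by (intro borel_measurable_continuous_onI lipschitz_on_continuous_on)
  define D where "D = \<bar>(\<integral>x. f x \<partial>M) - (\<integral>x. f x \<partial>N)\<bar>"
  define cost where "cost = (\<lambda>\<pi>::('b \<times> 'b) measure. \<integral>p. (dist (fst p) (snd p))\<^sup>2 \<partial>\<pi>)"
  have ne: "couplings M N \<noteq> {}"
  proof -
    interpret MN: pair_prob_space M N ..
    have "M \<Otimes>\<^sub>M N \<in> couplings M N"
      unfolding couplings_def
    proof (intro CollectI conjI)
      show s: "sets (M \<Otimes>\<^sub>M N) = sets borel"
        using M' N' by (metis borel_prod sets_pair_measure_cong)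
      have "distr (M \<Otimes>\<^sub>M N) borel fst = distr (M \<Otimes>\<^sub>M N) M fst"
        using M' by (intro distr_cong) auto
      then show "distr (M \<Otimes>\<^sub>M N) borel fst = M" using N.distr_pair_fst[of M] by simp
      have "distr (M \<Otimes>\<^sub>M N) borel snd = distr (M \<Otimes>\<^sub>M N) N snd"
        using N' by (intro distr_cong) auto
      moreover have "distr (M \<Otimes>\<^sub>M N) N snd = N"
      proof (rule measure_eqI)
        fix A assume "A \<in> sets (distr (M \<Otimes>\<^sub>M N) N snd)"
        then have A: "A \<in> sets N" by simp
        have "snd -` A \<inter> space (M \<Otimes>\<^sub>M N) = space M \<times> A"
          using sets.sets_into_space[OF A] by (auto simp: space_pair_measure)
        then show "emeasure (distr (M \<Otimes>\<^sub>M N) N snd) A = emeasure N A"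
          using A by (simp add: emeasure_distr N.emeasure_pair_measure_Times M.emeasure_space_1)
      qed simp
      ultimately show "distr (M \<Otimes>\<^sub>M N) borel snd = N" by simp
      show "prob_space (M \<Otimes>\<^sub>M N)" by (rule prob_space_pair[OF M'(1) N'(1)])
    qed
    then show ?thesis by (rule ex_in_conv[THEN iffD1, OF exI])
  qed
  have step: "D \<le> (L + 1) * sqrt (cost \<pi>)" if "\<pi> \<in> couplings M N" for \<pi>
  proof -
    from that have "prob_space \<pi> \<and> sets \<pi> = sets borel \<and> distr \<pi> borel fst = M \<and> distr \<pi> borel snd = N"
      unfolding couplings_def by (rule CollectD)
    then have pp: "prob_space \<pi>" and s0: "sets \<pi> = sets borel"
      and m1: "distr \<pi> borel fst = M" and m2: "distr \<pi> borel snd = N" by simp_all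
    interpret p: prob_space \<pi> by (rule pp)
    have s: "sets \<pi> = sets (borel \<Otimes>\<^sub>M borel)" unfolding s0 borel_prod ..
    note [measurable_cong] = s
    have i1: "integrable \<pi> (\<lambda>p. (norm (fst p))\<^sup>2)"
      using M'(4) unfolding m1[symmetric] by (subst (asm) integrable_distr_eq) auto
    have i2: "integrable \<pi> (\<lambda>p. (norm (snd p))\<^sup>2)"
      using N'(4) unfolding m2[symmetric] by (subst (asm) integrable_distr_eq) auto
    have i3: "integrable \<pi> (\<lambda>p. (dist (fst p) (snd p))\<^sup>2)"
    proof (rule Bochner_Integration.integrable_bound)
      show "integrable \<pi> (\<lambda>p. 2 * (norm (fst p))\<^sup>2 + 2 * (norm (snd p))\<^sup>2)" using i1 i2 by simp
      have "(dist (fst p) (snd p))\<^sup>2 \<le> 2 * (norm (fst p))\<^sup>2 + 2 * (norm (snd p))\<^sup>2" for p :: "'b \<times> 'b"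
      proof -
        have "(dist (fst p) (snd p))\<^sup>2 \<le> (norm (fst p) + norm (snd p))\<^sup>2"
          unfolding dist_norm by (intro power_mono norm_triangle_ineq4) auto
        also have "\<dots> \<le> 2 * (norm (fst p))\<^sup>2 + 2 * (norm (snd p))\<^sup>2"
          using zero_le_power2[of "norm (fst p) - norm (snd p)"] by (simp add: power2_eq_square algebra_simps)
        finally show ?thesis .
      qed
      then show "AE p in \<pi>. norm ((dist (fst p) (snd p))\<^sup>2) \<le> norm (2 * (norm (fst p))\<^sup>2 + 2 * (norm (snd p))\<^sup>2)"
        by (auto intro: order_trans[OF _ abs_ge_self])
    qed simp
    have i4: "integrable \<pi> (\<lambda>p. dist (fst p) (snd p))"
      by (rule p.square_integrable_imp_integrable[OF _ i3]) simp
    have if1: "integrable \<pi> (\<lambda>p. f (fst p))" "integrable \<pi> (\<lambda>p. f (snd p))"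
      using fB by (auto intro!: p.integrable_const_bound[of _ B])
    have "D = \<bar>\<integral>p. f (fst p) - f (snd p) \<partial>\<pi>\<bar>"
      unfolding D_def m1[symmetric] m2[symmetric] using if1 by (simp add: integral_distr)
    also have "\<dots> \<le> (\<integral>p. \<bar>f (fst p) - f (snd p)\<bar> \<partial>\<pi>)" by (rule integral_abs_bound)
    also have "\<dots> \<le> (\<integral>p. L * dist (fst p) (snd p) \<partial>\<pi>)"
      using lipschitz_onD[OF f] i4 if1 by (intro integral_mono) (auto simp: dist_real_def)
    also have "\<dots> = L * (\<integral>p. dist (fst p) (snd p) \<partial>\<pi>)" by simp
    also have "(\<integral>p. dist (fst p) (snd p) \<partial>\<pi>) \<le> sqrt (cost \<pi>)"
    proof (rule real_le_rsqrt)
      show "(\<integral>p. dist (fst p) (snd p) \<partial>\<pi>)\<^sup>2 \<le> cost \<pi>"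
        using p.variance_eq[OF i4 i3] p.variance_positive[of "\<lambda>p. dist (fst p) (snd p)"]
        by (simp add: cost_def)
    qed
    finally have "D \<le> L * sqrt (cost \<pi>)" using L by (simp add: mult_left_mono)
    also have "\<dots> \<le> (L + 1) * sqrt (cost \<pi>)"
      by (intro mult_right_mono) (auto simp: cost_def)
    finally show ?thesis .
  qed
  have "(D / (L + 1))\<^sup>2 \<le> Inf (cost ` couplings M N)"
  proof (rule cInf_greatest)
    fix c assume "c \<in> cost ` couplings M N"
    then obtain \<pi> where \<pi>: "\<pi> \<in> couplings M N" "c = cost \<pi>" by auto
    have "D / (L + 1) \<le> sqrt c" using step[OF \<pi>(1)] \<pi>(2) L by (simp add: divide_le_eq mult.commute)
    moreover have "0 \<le> D / (L + 1)" using L by (simp add: D_def)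
    moreover have "0 \<le> c" using \<pi> by (simp add: cost_def)
    ultimately show "(D / (L + 1))\<^sup>2 \<le> c" using power_mono[of "D / (L + 1)" "sqrt c" 2] by simp
  qed (use ne in auto)
  then have "D / (L + 1) \<le> W2 M N"
    unfolding W2_def cost_def by (rule real_le_rsqrt)
  then show ?thesis using L by (simp add: D_def divide_le_eq mult.commute)
qed

lemma P2_curve_continuous:
  fixes \<mu> :: "real \<Rightarrow> 'b::euclidean_space measure"
  assumes "P2_curve T \<mu>" "L-lipschitz_on UNIV f" "\<And>x. \<bar>f x\<bar> \<le> (B::real)"
  shows "continuous_on {0..T} (\<lambda>t. \<integral>x. f x \<partial>\<mu> t)"
  unfolding continuous_on_iff
proof (intro ballI allI impI)
  fix t e :: real assume t: "t \<in> {0..T}" and e: "0 < e"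
  have L: "0 \<le> L" using assms(2) by (rule lipschitz_on_nonneg)
  then have "0 < e / (L + 1)" using e by simp
  then obtain \<delta> where \<delta>: "0 < \<delta>" "\<And>s. s \<in> {0..T} \<Longrightarrow> \<bar>s - t\<bar> < \<delta> \<Longrightarrow> W2 (\<mu> s) (\<mu> t) < e / (L + 1)"
    using assms(1) t unfolding P2_curve_def by blast
  show "\<exists>d>0. \<forall>s\<in>{0..T}. dist s t < d \<longrightarrow> dist (\<integral>x. f x \<partial>\<mu> s) (\<integral>x. f x \<partial>\<mu> t) < e"
  proof (intro exI[of _ \<delta>] conjI ballI impI \<delta>(1))
    fix s assume s: "s \<in> {0..T}" "dist s t < \<delta>"
    have "dist (\<integral>x. f x \<partial>\<mu> s) (\<integral>x. f x \<partial>\<mu> t) \<le> (L + 1) * W2 (\<mu> s) (\<mu> t)"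
      unfolding dist_real_def
      using assms s t by (intro W2_bounds_integral_difference) (auto simp: P2_curve_def)
    also have "\<dots> < e" using \<delta>(2)[of s] s L by (simp add: dist_real_def less_divide_eq mult.commute)
    finally show "dist (\<integral>x. f x \<partial>\<mu> s) (\<integral>x. f x \<partial>\<mu> t) < e" .
  qed
qed

text \<open>Pairings with bounded Lipschitz functions are continuous in time. The indicator of a
  closed set is the limit of the Lipschitz functions max 0 (1 - n dist), so its mass is measurable
  in time, and closed sets form an intersection-stable generator. The kernel form is what parameter
  integrals and Fubini in time require.\<close>

lemma P2_curve_kernel:
  fixes \<mu> :: "real \<Rightarrow> 'b::euclidean_space measure"
  assumes \<mu>: "P2_curve T \<mu>" and T: "0 \<le> T"
  shows "(\<lambda>t. \<mu> (clamp_time T t)) \<in> borel \<rightarrow>\<^sub>M prob_algebra borel"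
proof (rule measurable_prob_algebra_generated[where \<Omega>=UNIV and G="Collect closed"])
  have P2: "P2 (\<mu> (clamp_time T t))" for t
    using \<mu> clamp_time_in[OF T] by (auto simp: P2_curve_def)
  show "sets borel = sigma_sets UNIV (Collect closed :: 'b set set)"
    by (simp add: borel_eq_closed)
  show "Int_stable (Collect closed :: 'b set set)" by (auto simp: Int_stable_def)
  show "prob_space (\<mu> (clamp_time T t))" "sets (\<mu> (clamp_time T t)) = sets borel" for t
    using P2D[OF P2] by auto
  fix A :: "'b set" assume "A \<in> Collect closed"
  then have A: "closed A" by simp
  show "(\<lambda>t. emeasure (\<mu> (clamp_time T t)) A) \<in> borel_measurable borel"
  proof (cases "A = {}")
    case False
    define f where "f n x = max 0 (1 - real n * infdist x A)" for n and x :: 'b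
    have fl: "(real n)-lipschitz_on UNIV (f n)" for n
    proof (rule lipschitz_onI)
      fix x y :: 'b
      have max_1: "\<bar>max 0 (1 - a) - max 0 (1 - b)\<bar> \<le> \<bar>a - b\<bar>" for a b :: real
        by linarith
      have "dist (f n x) (f n y) \<le> \<bar>real n * infdist x A - real n * infdist y A\<bar>"
        unfolding f_def dist_real_def by (rule max_1)
      also have "\<dots> = real n * \<bar>infdist x A - infdist y A\<bar>"
        by (simp add: abs_mult flip: right_diff_distrib)
      finally have "dist (f n x) (f n y) \<le> real n * \<bar>infdist x A - infdist y A\<bar>" .
      also have "\<dots> \<le> real n * dist x y" by (intro mult_left_mono infdist_triangle_abs) auto
      finally show "dist (f n x) (f n y) \<le> real n * dist x y" .
    qed simp
    have fB: "\<bar>f n x\<bar> \<le> 1" for n x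
      using infdist_nonneg[of x A] by (simp add: f_def)
    have [measurable]: "f n \<in> borel_measurable borel" for n
      using fl by (intro borel_measurable_continuous_onI lipschitz_on_continuous_on)
    have meas: "(\<lambda>t. \<integral>x. f n x \<partial>\<mu> (clamp_time T t)) \<in> borel_measurable borel" for n
    proof (rule borel_measurable_continuous_onI)
      have "continuous_on UNIV (clamp_time T)" unfolding clamp_time_def[abs_def] by (intro continuous_intros)
      then show "continuous_on UNIV (\<lambda>t. \<integral>x. f n x \<partial>\<mu> (clamp_time T t))"
        using continuous_on_compose2[OF P2_curve_continuous[OF \<mu> fl fB]] clamp_time_in[OF T] by blast
    qed
    have lim: "(\<lambda>n. f n x) \<longlonglongrightarrow> indicator A x" for x
    proof (cases "x \<in> A")
      case False
      then have d: "0 < infdist x A" using infdist_pos_not_in_closed A \<open>A \<noteq> {}\<close> by blast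
      obtain k where k: "1 / infdist x A \<le> real k" using real_arch_simple by blast
      have "f n x = 0" if "k \<le> n" for n
      proof -
        have "1 / infdist x A \<le> real n" using k that by linarith
        then show ?thesis using d by (simp add: f_def divide_le_eq)
      qed
      then have "eventually (\<lambda>n. f n x = 0) sequentially"
        by (auto simp: eventually_sequentially)
      then show ?thesis using False by (simp add: tendsto_eventually)
    qed (simp add: f_def)
    have "(\<lambda>t. measure (\<mu> (clamp_time T t)) A) \<in> borel_measurable borel"
    proof (rule borel_measurable_LIMSEQ_real[OF _ meas])
      fix t :: real
      note P = P2D[OF P2[of t]]
      interpret prob_space "\<mu> (clamp_time T t)" by (rule P)
      have "(\<lambda>n. \<integral>x. f n x \<partial>\<mu> (clamp_time T t)) \<longlonglongrightarrow> (\<integral>x. indicator A x \<partial>\<mu> (clamp_time T t))"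
        by (rule integral_dominated_convergence[where w="\<lambda>_. 1"])
          (use P A fB lim in \<open>auto cong: measurable_cong_sets\<close>)
      then show "(\<lambda>n. \<integral>x. f n x \<partial>\<mu> (clamp_time T t)) \<longlonglongrightarrow> measure (\<mu> (clamp_time T t)) A"
        using P by simp
    qed
    moreover have "emeasure (\<mu> (clamp_time T t)) A = ennreal (measure (\<mu> (clamp_time T t)) A)" for t
    proof -
      interpret prob_space "\<mu> (clamp_time T t)" by (rule P2D[OF P2])
      show ?thesis by (rule emeasure_eq_measure)
    qed
    ultimately show ?thesis by simp
  qed simp
qed auto

section \<open>A common weak form of both equations\<close>

text \<open>Dominated convergence is used twice, first in \<open>p\<close> at each fixed time and
  then in time. This enlarges the class of admissible test functions from compactly supported ones
  to their bounded limits.\<close>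

lemma weak_form_limit:
  fixes f :: "nat \<Rightarrow> 'b::euclidean_space \<Rightarrow> real" and g :: "nat \<Rightarrow> real \<Rightarrow> 'b \<Rightarrow> real"
  assumes st: "s \<le> t" and N: "\<And>r. r \<in> {s..t} \<Longrightarrow> prob_space (N r)" "\<And>r. r \<in> {s..t} \<Longrightarrow> sets (N r) = sets borel"
    and int: "\<And>n. set_integrable lborel {s<..<t} (\<lambda>r. \<integral>p. g n r p \<partial>N r)"
    and eq: "\<And>n. (\<integral>p. f n p \<partial>N t) - (\<integral>p. f n p \<partial>N s) = (LINT r:{s<..<t}|lborel. \<integral>p. g n r p \<partial>N r)"
    and f: "\<And>n. f n \<in> borel_measurable borel" "f' \<in> borel_measurable borel"
      "\<And>n p. \<bar>f n p\<bar> \<le> C" "\<And>p. (\<lambda>n. f n p) \<longlonglongrightarrow> f' p"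
    and g: "\<And>n r. r \<in> {s..t} \<Longrightarrow> g n r \<in> borel_measurable borel" "\<And>r. r \<in> {s..t} \<Longrightarrow> g' r \<in> borel_measurable borel"
      "\<And>n r p. r \<in> {s..t} \<Longrightarrow> \<bar>g n r p\<bar> \<le> D" "\<And>r p. r \<in> {s..t} \<Longrightarrow> (\<lambda>n. g n r p) \<longlonglongrightarrow> g' r p"
  shows "set_integrable lborel {s<..<t} (\<lambda>r. \<integral>p. g' r p \<partial>N r)" (is ?int)
    and "(\<integral>p. f' p \<partial>N t) - (\<integral>p. f' p \<partial>N s) = (LINT r:{s<..<t}|lborel. \<integral>p. g' r p \<partial>N r)" (is ?eq)
proof -
  have limf: "(\<lambda>n. \<integral>p. f n p \<partial>N r) \<longlonglongrightarrow> (\<integral>p. f' p \<partial>N r)" if r: "r \<in> {s..t}" for r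
  proof (rule integral_dominated_convergence[where w="\<lambda>_. C"])
    interpret prob_space "N r" by (rule N(1)[OF r])
    show "integrable (N r) (\<lambda>_. C)" by simp
    show "f' \<in> borel_measurable (N r)" "f n \<in> borel_measurable (N r)" for n
      using f N(2)[OF r] by (simp_all cong: measurable_cong_sets)
    show "AE x in N r. (\<lambda>n. f n x) \<longlonglongrightarrow> f' x" using f(4) by simp
    show "AE x in N r. norm (f n x) \<le> C" for n using f(3) by simp
  qed
  have limg: "(\<lambda>n. \<integral>p. g n r p \<partial>N r) \<longlonglongrightarrow> (\<integral>p. g' r p \<partial>N r)" if r: "r \<in> {s..t}" for r
  proof (rule integral_dominated_convergence[where w="\<lambda>_. D"])
    interpret prob_space "N r" by (rule N(1)[OF r])
    show "integrable (N r) (\<lambda>_. D)" by simp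
    show "g' r \<in> borel_measurable (N r)" "g n r \<in> borel_measurable (N r)" for n
      using g(1,2)[OF r] N(2)[OF r] by (simp_all cong: measurable_cong_sets)
    show "AE x in N r. (\<lambda>n. g n r x) \<longlonglongrightarrow> g' r x" using g(4)[OF r] by simp
    show "AE x in N r. norm (g n r x) \<le> D" for n using g(3)[OF r] by simp
  qed
  have bd: "\<bar>\<integral>p. g n r p \<partial>N r\<bar> \<le> D" if r: "r \<in> {s..t}" for n r
  proof -
    interpret prob_space "N r" by (rule N(1)[OF r])
    have D: "0 \<le> D" using g(3)[OF r, of 0 undefined] by linarith
    have "\<bar>\<integral>p. g n r p \<partial>N r\<bar> \<le> (\<integral>p. \<bar>g n r p\<bar> \<partial>N r)" by (rule integral_abs_bound)
    also have "\<dots> \<le> D"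
      using g(3)[OF r] by (intro integral_le_const[OF integrable_const_bound[of _ D]])
        (use g(1)[OF r] N(2)[OF r] in \<open>auto cong: measurable_cong_sets\<close>)
    finally show ?thesis .
  qed
  define i where "i n r = indicator {s<..<t} r *\<^sub>R (\<integral>p. g n r p \<partial>N r)" for n r
  define i' where "i' r = indicator {s<..<t} r *\<^sub>R (\<integral>p. g' r p \<partial>N r)" for r
  have mi: "i n \<in> borel_measurable lborel" for n
    using int[of n] unfolding set_integrable_def i_def[abs_def] by (rule borel_measurable_integrable)
  have lim: "(\<lambda>n. i n r) \<longlonglongrightarrow> i' r" for r
  proof (cases "r \<in> {s<..<t}")
    case True
    then have "r \<in> {s..t}" by simp
    from limg[OF this] True show ?thesis by (simp add: i_def i'_def)
  qed (simp add: i_def i'_def)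
  have mi': "i' \<in> borel_measurable lborel"
    using lim mi by (rule borel_measurable_LIMSEQ_metric[rotated])
  have wint: "integrable lborel (\<lambda>r. indicator {s<..<t} r * D)"
    using st by (intro integrable_mult_left integrable_real_indicator) auto
  have bi: "norm (i n r) \<le> indicator {s<..<t} r * D" for n r
    using bd[of r n] by (auto simp: i_def indicator_def)
  have "integrable lborel i'"
    by (rule integrable_dominated_convergence[where s=i and w="\<lambda>r. indicator {s<..<t} r * D"])
      (use mi' mi wint lim bi in auto)
  then show ?int unfolding set_integrable_def i'_def[abs_def] .
  have "(\<lambda>n. \<integral>r. i n r \<partial>lborel) \<longlonglongrightarrow> (\<integral>r. i' r \<partial>lborel)"
    by (rule integral_dominated_convergence[where w="\<lambda>r. indicator {s<..<t} r * D"])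
      (use mi' mi wint lim bi in auto)
  moreover have "(\<lambda>n. \<integral>r. i n r \<partial>lborel) \<longlonglongrightarrow> (\<integral>p. f' p \<partial>N t) - (\<integral>p. f' p \<partial>N s)"
  proof -
    have "(\<lambda>n. (\<integral>p. f n p \<partial>N t) - (\<integral>p. f n p \<partial>N s)) \<longlonglongrightarrow> (\<integral>p. f' p \<partial>N t) - (\<integral>p. f' p \<partial>N s)"
      using st by (intro tendsto_diff limf) auto
    then show ?thesis unfolding eq i_def set_lebesgue_integral_def .
  qed
  ultimately show ?eq
    unfolding set_lebesgue_integral_def i'_def by (rule LIMSEQ_unique[rotated])
qed

text \<open>Only pure second derivatives along the basis are bounded, because the second-order part
  of the common weak form is a Laplacian. One constant for all orders is enough to dominate the
  integrands.\<close>

definition C2_bounded :: "real \<Rightarrow> ('a::euclidean_space \<Rightarrow> real) \<Rightarrow> bool" where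
  "C2_bounded C \<psi> \<longleftrightarrow> smooth \<psi> \<and> (\<forall>x. \<bar>\<psi> x\<bar> \<le> C) \<and>
     (\<forall>x. \<forall>b\<in>Basis. \<bar>dd b \<psi> x\<bar> \<le> C \<and> \<bar>dd b (dd b \<psi>) x\<bar> \<le> C)"

text \<open>Common weak form of both equations, tested against functions of a smooth observable \<open>y\<close>:
  for the aggregation-diffusion equation \<open>y\<close> is the identity, for the kinetic equation it is the
  coarse-grained position \<open>x + v / \<gamma>\<close>, for which the terms \<open>\<gamma> v \<bullet> \<nabla>\<^sub>x\<close> and
  \<open>- \<gamma>\<^sup>2 v \<bullet> \<nabla>\<^sub>v\<close> cancel.\<close>

definition drift_diffusion ::
  "real \<Rightarrow> (real \<Rightarrow> 'b::euclidean_space measure) \<Rightarrow> ('b \<Rightarrow> 'a::euclidean_space) \<Rightarrow> (real \<Rightarrow> 'b \<Rightarrow> 'a) \<Rightarrow> bool" where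
  "drift_diffusion T N y V \<longleftrightarrow> (\<forall>s t \<psi> C. 0 < s \<longrightarrow> s \<le> t \<longrightarrow> t < T \<longrightarrow> C2_bounded C \<psi> \<longrightarrow>
     (let I = (\<lambda>r. \<integral>p. (\<Sum>b\<in>Basis. (V r p \<bullet> b) * dd b \<psi> (y p) + dd b (dd b \<psi>) (y p)) \<partial>N r) in
       set_integrable lborel {s<..<t} I \<and>
       (\<integral>p. \<psi> (y p) \<partial>N t) - (\<integral>p. \<psi> (y p) \<partial>N s) = (LINT r:{s<..<t}|lborel. I r)))"

lemma bump_derivatives_bounded:
  obtains C where "1 \<le> C" "\<And>u x. u \<in> Basis \<Longrightarrow> \<bar>dd u bump (x::'b::euclidean_space)\<bar> \<le> C"
    "\<And>u x. u \<in> Basis \<Longrightarrow> \<bar>dd u (dd u bump) (x::'b)\<bar> \<le> C"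
proof -
  have "\<exists>c\<ge>0. \<forall>x. \<bar>dd u bump (x::'b)\<bar> \<le> c" for u
    using test_fun_bounded[OF test_fun_dd[OF test_fun_bump]] by metis
  then obtain c where c: "\<And>u. 0 \<le> c u" "\<And>u x. \<bar>dd u bump (x::'b)\<bar> \<le> c u" by metis
  have "\<exists>c\<ge>0. \<forall>x. \<bar>dd u (dd u bump) (x::'b)\<bar> \<le> c" for u
    using test_fun_bounded[OF test_fun_dd[OF test_fun_dd[OF test_fun_bump]]] by metis
  then obtain c' where c': "\<And>u. 0 \<le> c' u" "\<And>u x. \<bar>dd u (dd u bump) (x::'b)\<bar> \<le> c' u" by metis
  define C where "C = 1 + (\<Sum>u\<in>Basis. c (u::'b)) + (\<Sum>u\<in>Basis. c' (u::'b))"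
  have s: "0 \<le> (\<Sum>u\<in>Basis. c (u::'b))" "0 \<le> (\<Sum>u\<in>Basis. c' (u::'b))"
    using c(1) c'(1) by (auto intro: sum_nonneg)
  have le: "c u \<le> (\<Sum>u\<in>Basis. c (u::'b))" "c' u \<le> (\<Sum>u\<in>Basis. c' (u::'b))" if "u \<in> Basis" for u
    using that c(1) c'(1) by (auto intro!: member_le_sum)
  show thesis
  proof (rule that[of C])
    show "1 \<le> C" using s by (simp add: C_def)
    show "\<bar>dd u bump x\<bar> \<le> C" if "u \<in> Basis" for u x :: 'b
      using c(2)[of u x] le(1)[OF that] s by (simp add: C_def)
    show "\<bar>dd u (dd u bump) x\<bar> \<le> C" if "u \<in> Basis" for u x :: 'b
      using c'(2)[of u x] le(2)[OF that] s by (simp add: C_def)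
  qed
qed

lemma norm_le_if_dd_bump_nonzero:
  assumes "dd u bump x \<noteq> 0" shows "norm x \<le> 1"
proof (rule ccontr)
  assume n: "\<not> norm x \<le> 1"
  have z: "((\<lambda>_. 0) has_derivative (\<lambda>_. 0)) (at x)" by simp
  have "(bump has_derivative (\<lambda>_. 0)) (at x)"
  proof (rule has_derivative_transform_within_open[OF z, of "- cball 0 1"])
    show "x \<in> - cball 0 1" using n by simp
    show "open (- cball (0::'a) 1)" by (simp add: open_Compl)
    show "0 = bump y" if "y \<in> - cball 0 1" for y :: 'a
      using bump_support[of y] that by force
  qed
  from dd_eq[OF this] assms show False by simp
qed

lemma tendsto_null_inverse_nat:
  fixes f :: "nat \<Rightarrow> real"
  assumes "\<And>n. \<bar>f n\<bar> \<le> c / real (Suc n)" shows "f \<longlonglongrightarrow> 0"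
proof (rule Lim_null_comparison)
  show "\<forall>\<^sub>F n in sequentially. norm (f n) \<le> c * inverse (real (Suc n))"
    using assms by (simp add: divide_inverse)
  show "(\<lambda>n. c * inverse (real (Suc n))) \<longlonglongrightarrow> 0"
    using tendsto_mult_left[OF LIMSEQ_inverse_real_of_nat, of c] by simp
qed


text \<open>The last bound holds because the first derivative of the cutoff at radius R has size C /
  R and lives where the norm is at most R. It absorbs the linear growth of the kinetic transport and
  friction terms in the velocity.\<close>

lemma cutoff_derivative_bounds:
  obtains C where "1 \<le> C"
    "\<And>n u x. u \<in> Basis \<Longrightarrow> \<bar>dd u (cutoff (real (Suc n))) (x::'b::euclidean_space)\<bar> \<le> C / real (Suc n)"
    "\<And>n u x. u \<in> Basis \<Longrightarrow> \<bar>dd u (dd u (cutoff (real (Suc n)))) (x::'b)\<bar> \<le> C / real (Suc n)"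
    "\<And>n u x. u \<in> Basis \<Longrightarrow> norm x * \<bar>dd u (cutoff (real (Suc n))) (x::'b)\<bar> \<le> C"
proof -
  obtain C where C: "1 \<le> C" "\<And>u x. u \<in> Basis \<Longrightarrow> \<bar>dd u bump (x::'b)\<bar> \<le> C"
    "\<And>u x. u \<in> Basis \<Longrightarrow> \<bar>dd u (dd u bump) (x::'b)\<bar> \<le> C"
    using bump_derivatives_bounded by (metis (no_types, lifting))
  have 1: "\<bar>dd u (cutoff (real (Suc n))) (x::'b)\<bar> \<le> C / real (Suc n)" if "u \<in> Basis" for n u x
    using C(2)[OF that] unfolding dd_cutoff by (simp add: divide_right_mono)
  have 2: "\<bar>dd u (dd u (cutoff (real (Suc n)))) (x::'b)\<bar> \<le> C / real (Suc n)" if "u \<in> Basis" for n u x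
  proof -
    have "\<bar>dd u (dd u (cutoff (real (Suc n)))) x\<bar> \<le> C / (real (Suc n))\<^sup>2"
      using C(3)[OF that] unfolding dd_dd_cutoff abs_divide by (simp add: divide_right_mono)
    also have "\<dots> \<le> C / real (Suc n)"
    proof (rule divide_left_mono)
      show "real (Suc n) \<le> (real (Suc n))\<^sup>2" by (rule self_le_power) auto
    qed (use C(1) in auto)
    finally show ?thesis .
  qed
  have 3: "norm x * \<bar>dd u (cutoff (real (Suc n))) (x::'b)\<bar> \<le> C" if "u \<in> Basis" for n u x
  proof (cases "dd u bump (x /\<^sub>R real (Suc n)) = 0")
    case True
    then show ?thesis using C(1) by (simp add: dd_cutoff)
  next
    case False
    from norm_le_if_dd_bump_nonzero[OF this] have "norm x \<le> real (Suc n)"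
      by (simp add: divide_le_eq inverse_eq_divide)
    then have "norm x * \<bar>dd u (cutoff (real (Suc n))) x\<bar> \<le> real (Suc n) * (C / real (Suc n))"
      using 1[OF that] by (intro mult_mono) auto
    then show ?thesis by simp
  qed
  show thesis by (rule that[OF C(1) 1 2 3])
qed


lemma Fforce_borel:
  assumes "gradPhi \<in> borel_measurable borel" "gradK \<in> borel_measurable borel"
    and \<sigma>: "prob_space \<sigma>" "sets \<sigma> = sets borel"
  shows "Fforce gradPhi gradK \<sigma> \<in> borel_measurable borel"
proof -
  interpret prob_space \<sigma> by (rule \<sigma>)
  note [measurable] = assms(1,2)
  note [measurable_cong] = \<sigma>(2)
  have "(\<lambda>x. \<integral>y. gradK (x - y) \<partial>\<sigma>) \<in> borel_measurable borel"
    by (rule borel_measurable_lebesgue_integral) measurable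
  then show ?thesis unfolding Fforce_def[abs_def] by measurable
qed

lemma inner_Basis_abs_le: "b \<in> Basis \<Longrightarrow> \<bar>x \<bullet> b\<bar> \<le> norm x"
  by (rule Basis_le_norm)

lemma smooth_times_cutoff_derivs:
  assumes "smooth \<phi>"
  shows "dd u (\<lambda>x. \<phi> x * cutoff R x) x = \<phi> x * dd u (cutoff R) x + dd u \<phi> x * cutoff R x"
    and "dd u (dd u (\<lambda>x. \<phi> x * cutoff R x)) x
      = \<phi> x * dd u (dd u (cutoff R)) x + 2 * (dd u \<phi> x * dd u (cutoff R) x) + dd u (dd u \<phi>) x * cutoff R x"
  using dd_dd_mult[OF assms smooth_cutoff, of u u R x]
    dd_mult[OF smooth_differentiable[OF assms] smooth_differentiable[OF smooth_cutoff], where u=u]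
  by simp_all

lemma abs_mult_le: "\<bar>a\<bar> \<le> A \<Longrightarrow> \<bar>b\<bar> \<le> B \<Longrightarrow> \<bar>a * b\<bar> \<le> A * B" for a b :: real
  unfolding abs_mult by (rule mult_mono) auto

text \<open>Cutoffs extend the weak equation from compactly supported functions to all of
  \<open>C2_bounded\<close>; the uniform force bound provides the dominating constant.\<close>

lemma agg_drift_diffusion:
  fixes \<rho> :: "real \<Rightarrow> 'a::euclidean_space measure"
  assumes sol: "agg_weak_sol gradPhi gradK T \<rho>"
    and m: "gradPhi \<in> borel_measurable borel" "gradK \<in> borel_measurable borel"
    and B: "\<And>r x. r \<in> {0..T} \<Longrightarrow> norm (Fforce gradPhi gradK (\<rho> r) x) \<le> B"
  shows "drift_diffusion T \<rho> (\<lambda>x. x) (\<lambda>r. Fforce gradPhi gradK (\<rho> r))"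
  unfolding drift_diffusion_def Let_def
proof (intro allI impI)
  fix s t C and \<psi> :: "'a \<Rightarrow> real"
  assume s: "0 < s" and st: "s \<le> t" and t: "t < T" and "C2_bounded C \<psi>"
  then have sm: "smooth \<psi>" and b0: "\<And>x. \<bar>\<psi> x\<bar> \<le> C"
    and b1: "\<And>x b. b \<in> Basis \<Longrightarrow> \<bar>dd b \<psi> x\<bar> \<le> C" and b2: "\<And>x b. b \<in> Basis \<Longrightarrow> \<bar>dd b (dd b \<psi>) x\<bar> \<le> C"
    by (auto simp: C2_bounded_def)
  obtain K where K: "1 \<le> K"
    "\<And>n u x. u \<in> Basis \<Longrightarrow> \<bar>dd u (cutoff (real (Suc n))) (x::'a)\<bar> \<le> K / real (Suc n)"
    "\<And>n u x. u \<in> Basis \<Longrightarrow> \<bar>dd u (dd u (cutoff (real (Suc n)))) (x::'a)\<bar> \<le> K / real (Suc n)"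
    using cutoff_derivative_bounds by (metis (no_types, lifting))
  have K': "\<bar>dd u (cutoff (real (Suc n))) (x::'a)\<bar> \<le> K" "\<bar>dd u (dd u (cutoff (real (Suc n)))) (x::'a)\<bar> \<le> K"
    if "u \<in> Basis" for n u x
  proof -
    have "K / real (Suc n) \<le> K / 1" using K(1) by (intro divide_left_mono) auto
    then show "\<bar>dd u (cutoff (real (Suc n))) x\<bar> \<le> K" "\<bar>dd u (dd u (cutoff (real (Suc n)))) x\<bar> \<le> K"
      using K(2,3)[OF that, where n=n and x=x] by auto
  qed
  have Kl: "(\<lambda>n. dd u (cutoff (real (Suc n))) (x::'a)) \<longlonglongrightarrow> 0" "(\<lambda>n. dd u (dd u (cutoff (real (Suc n)))) (x::'a)) \<longlonglongrightarrow> 0"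
    if "u \<in> Basis" for u x
    by (rule tendsto_null_inverse_nat[OF K(2)[OF that]], rule tendsto_null_inverse_nat[OF K(3)[OF that]])
  have C0: "0 \<le> C" using b0[of undefined] by linarith
  have B0: "0 \<le> B" using order_trans[OF norm_ge_zero B[of s undefined]] s st t by simp
  define f where "f n x = \<psi> x * cutoff (real (Suc n)) x" for n x
  define g where "g n r x = (\<Sum>b\<in>Basis. (Fforce gradPhi gradK (\<rho> r) x \<bullet> b) * dd b (f n) x + dd b (dd b (f n)) x)" for n r x
  have P2: "P2 (\<rho> r)" if "r \<in> {0..T}" for r using sol that by (auto simp: agg_weak_sol_def P2_curve_def)
  have tf: "test_fun (f n)" for n
    unfolding f_def[abs_def] by (rule test_fun_mult'[OF sm test_fun_cutoff]) simp
  have d1: "dd b (f n) x = \<psi> x * dd b (cutoff (real (Suc n))) x + dd b \<psi> x * cutoff (real (Suc n)) x" for b n x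
    unfolding f_def[abs_def] by (rule smooth_times_cutoff_derivs(1)[OF sm])
  have d2: "dd b (dd b (f n)) x = \<psi> x * dd b (dd b (cutoff (real (Suc n)))) x
      + 2 * (dd b \<psi> x * dd b (cutoff (real (Suc n))) x) + dd b (dd b \<psi>) x * cutoff (real (Suc n)) x" for b n x
    unfolding f_def[abs_def] by (rule smooth_times_cutoff_derivs(2)[OF sm])
  have c1: "\<bar>cutoff (real (Suc n)) x\<bar> \<le> 1" for n and x :: 'a
    using cutoff_nonneg[of "real (Suc n)" x] cutoff_le_1[of "real (Suc n)" x] by simp
  have F_borel: "Fforce gradPhi gradK (\<rho> r) \<in> borel_measurable borel" if "r \<in> {0..T}" for r
    using P2D[OF P2[OF that]] by (intro Fforce_borel m)
  have gI: "(\<integral>x. Fforce gradPhi gradK (\<rho> r) x \<bullet> grad (f n) x + lap (f n) x \<partial>\<rho> r) = (\<integral>x. g n r x \<partial>\<rho> r)" for n r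
    by (simp add: g_def grad_def lap_def inner_sum_right sum.distrib mult.commute)
  have wk: "interval_lebesgue_integrable lborel (ereal s) (ereal t) (\<lambda>r. \<integral>x. g n r x \<partial>\<rho> r) \<and>
      (\<integral>x. f n x \<partial>\<rho> t) - (\<integral>x. f n x \<partial>\<rho> s) = interval_lebesgue_integral lborel (ereal s) (ereal t) (\<lambda>r. \<integral>x. g n r x \<partial>\<rho> r)" for n
  proof -
    have "s \<in> {0<..<T}" "t \<in> {0<..<T}" using s st t by auto
    from sol[unfolded agg_weak_sol_def Let_def, THEN conjunct2, rule_format, OF this tf[of n], unfolded gI]
    show ?thesis .
  qed
  have "set_integrable lborel {s<..<t} (\<lambda>r. \<integral>x. g n r x \<partial>\<rho> r)"
    and "(\<integral>x. f n x \<partial>\<rho> t) - (\<integral>x. f n x \<partial>\<rho> s) = (LINT r:{s<..<t}|lborel. \<integral>x. g n r x \<partial>\<rho> r)" for n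
    using wk[of n] st by (auto simp: interval_lebesgue_integrable_def interval_lebesgue_integral_def)
  note * = weak_form_limit[OF st _ _ this, where f'=\<psi> and C="C * 1"
      and g'="\<lambda>r x. \<Sum>b\<in>Basis. (Fforce gradPhi gradK (\<rho> r) x \<bullet> b) * dd b \<psi> x + dd b (dd b \<psi>) x"
      and D="\<Sum>b\<in>(Basis::'a set). B * (C * K + C * 1) + (C * K + 2 * (C * K) + C * 1)"]
  have r0: "r \<in> {0..T}" if "r \<in> {s..t}" for r using that s t by auto
  have lim_f: "(\<lambda>n. f n x) \<longlonglongrightarrow> \<psi> x" for x
    using tendsto_mult[OF tendsto_const cutoff_tendsto, of "\<psi> x" x] by (simp add: f_def)
  have "(\<lambda>n. dd b (f n) x) \<longlonglongrightarrow> \<psi> x * 0 + dd b \<psi> x * 1" if "b \<in> Basis" for b x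
    unfolding d1 by (intro tendsto_intros Kl that cutoff_tendsto)
  moreover have "(\<lambda>n. dd b (dd b (f n)) x) \<longlonglongrightarrow> \<psi> x * 0 + 2 * (dd b \<psi> x * 0) + dd b (dd b \<psi>) x * 1"
    if "b \<in> Basis" for b x
    unfolding d2 by (intro tendsto_intros Kl that cutoff_tendsto)
  ultimately have lim_g: "(\<lambda>n. g n r x) \<longlonglongrightarrow>
      (\<Sum>b\<in>Basis. (Fforce gradPhi gradK (\<rho> r) x \<bullet> b) * dd b \<psi> x + dd b (dd b \<psi>) x)" for r x
    unfolding g_def by (auto intro!: tendsto_intros)
  have bound_g: "\<bar>g n r x\<bar> \<le> (\<Sum>b\<in>(Basis::'a set). B * (C * K + C * 1) + (C * K + 2 * (C * K) + C * 1))"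
    if "r \<in> {s..t}" for n r x
  proof -
    have F: "\<bar>Fforce gradPhi gradK (\<rho> r) x \<bullet> b\<bar> \<le> B" if "b \<in> Basis" for b
      using inner_Basis_abs_le[OF that] B[OF r0[OF \<open>r \<in> {s..t}\<close>]] by (rule order_trans)
    have "\<bar>(Fforce gradPhi gradK (\<rho> r) x \<bullet> b) * dd b (f n) x + dd b (dd b (f n)) x\<bar>
      \<le> B * (C * K + C * 1) + (C * K + 2 * (C * K) + C * 1)" if "b \<in> Basis" for b
      unfolding d1 d2
      by (intro order_trans[OF abs_triangle_ineq] add_mono abs_mult_le F b0 b1 b2 K' c1 that)
        simp_all
    then show ?thesis unfolding g_def by (intro order_trans[OF sum_abs] sum_mono)
  qed
  have dm: "dd b \<phi> \<in> borel_measurable borel" if "smooth \<phi>" for b and \<phi> :: "'a \<Rightarrow> real"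
    by (rule smooth_borel[OF smooth_dd[OF that]])
  have g_borel: "(\<lambda>x. \<Sum>b\<in>Basis. (Fforce gradPhi gradK (\<rho> r) x \<bullet> b) * dd b \<phi> x + dd b (dd b \<phi>) x) \<in> borel_measurable borel"
    if "smooth \<phi>" "r \<in> {s..t}" for r \<phi>
    using F_borel[OF r0[OF that(2)]] dm[OF that(1)] dm[OF smooth_dd[OF that(1)]] by measurable
  have pr: "prob_space (\<rho> r)" "sets (\<rho> r) = sets borel" if "r \<in> {s..t}" for r
    using P2D[OF P2[OF r0[OF that]]] by auto
  have fb: "\<bar>f n x\<bar> \<le> C * 1" for n x unfolding f_def by (intro abs_mult_le b0 c1)
  note concl = *[OF pr smooth_borel[OF test_fun_smooth[OF tf]] smooth_borel[OF sm] fb lim_f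
      g_borel[OF test_fun_smooth[OF tf], folded g_def] g_borel[OF sm] bound_g lim_g]
  show "set_integrable lborel {s<..<t} (\<lambda>r. \<integral>p. (\<Sum>b\<in>Basis. (Fforce gradPhi gradK (\<rho> r) p \<bullet> b) * dd b \<psi> p + dd b (dd b \<psi>) p) \<partial>\<rho> r) \<and>
    (\<integral>p. \<psi> p \<partial>\<rho> t) - (\<integral>p. \<psi> p \<partial>\<rho> s) =
    (LINT r:{s<..<t}|lborel. \<integral>p. (\<Sum>b\<in>Basis. (Fforce gradPhi gradK (\<rho> r) p \<bullet> b) * dd b \<psi> p + dd b (dd b \<psi>) p) \<partial>\<rho> r)"
    using concl by (intro conjI)
qed

lemma dd_scaleR: "f differentiable (at x) \<Longrightarrow> dd (c *\<^sub>R u) f x = c * dd u f x"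
proof -
  assume "f differentiable (at x)"
  then interpret bounded_linear "\<lambda>u. dd u f x"
    by (intro has_derivative_bounded_linear[OF differentiable_has_dd])
  show ?thesis using scaleR[of c u] by simp
qed

text \<open>A function of x + v / \<gamma> is constant along a whole subspace, so in general it is
  not compactly supported even if \<psi> is. It is therefore multiplied by a cutoff in both
  variables, and the cutoff is removed in the limit.\<close>

lemma kin_drift_diffusion:
  fixes \<mu> :: "real \<Rightarrow> ('a::euclidean_space \<times> 'a) measure"
  assumes sol: "kin_weak_sol gradPhi gradK \<gamma> T \<mu>" and \<gamma>: "1 \<le> \<gamma>"
    and m: "gradPhi \<in> borel_measurable borel" "gradK \<in> borel_measurable borel"
    and B: "\<And>r x. r \<in> {0..T} \<Longrightarrow> norm (Fforce gradPhi gradK (distr (\<mu> r) borel fst) x) \<le> B"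
  shows "drift_diffusion T \<mu> (\<lambda>p. fst p + snd p /\<^sub>R \<gamma>)
    (\<lambda>r p. Fforce gradPhi gradK (distr (\<mu> r) borel fst) (fst p))"
  unfolding drift_diffusion_def Let_def
proof (intro allI impI)
  fix s t C and \<psi> :: "'a \<Rightarrow> real"
  assume s: "0 < s" and st: "s \<le> t" and t: "t < T" and "C2_bounded C \<psi>"
  then have sm: "smooth \<psi>" and b0: "\<And>x. \<bar>\<psi> x\<bar> \<le> C"
    and b1: "\<And>x b. b \<in> Basis \<Longrightarrow> \<bar>dd b \<psi> x\<bar> \<le> C" and b2: "\<And>x b. b \<in> Basis \<Longrightarrow> \<bar>dd b (dd b \<psi>) x\<bar> \<le> C"
    by (auto simp: C2_bounded_def)
  define Y where "Y p = fst p + snd p /\<^sub>R \<gamma>" for p :: "'a \<times> 'a"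
  have Ylin: "bounded_linear Y"
    unfolding Y_def[abs_def]
    by (intro bounded_linear_add bounded_linear_fst bounded_linear_scaleR_right[THEN bounded_linear_compose] bounded_linear_snd)
  have Yb: "Y (b, 0) = b" "Y (0, b) = (1 / \<gamma>) *\<^sub>R b" for b
    by (simp_all add: Y_def inverse_eq_divide)
  define F where "F r = Fforce gradPhi gradK (distr (\<mu> r) borel fst)" for r
  obtain K where K: "1 \<le> K"
    "\<And>n u x. u \<in> Basis \<Longrightarrow> \<bar>dd u (cutoff (real (Suc n))) (x::'a \<times> 'a)\<bar> \<le> K / real (Suc n)"
    "\<And>n u x. u \<in> Basis \<Longrightarrow> \<bar>dd u (dd u (cutoff (real (Suc n)))) (x::'a \<times> 'a)\<bar> \<le> K / real (Suc n)"
    "\<And>n u x. u \<in> Basis \<Longrightarrow> norm x * \<bar>dd u (cutoff (real (Suc n))) (x::'a \<times> 'a)\<bar> \<le> K"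
    using cutoff_derivative_bounds by (metis (no_types, lifting))
  have K': "\<bar>dd u (cutoff (real (Suc n))) (x::'a \<times> 'a)\<bar> \<le> K" "\<bar>dd u (dd u (cutoff (real (Suc n)))) (x::'a \<times> 'a)\<bar> \<le> K"
    if "u \<in> Basis" for n u x
  proof -
    have "K / real (Suc n) \<le> K / 1" using K(1) by (intro divide_left_mono) auto
    then show "\<bar>dd u (cutoff (real (Suc n))) x\<bar> \<le> K" "\<bar>dd u (dd u (cutoff (real (Suc n)))) x\<bar> \<le> K"
      using K(2,3)[OF that, where n=n and x=x] by auto
  qed
  have Kl: "(\<lambda>n. dd u (cutoff (real (Suc n))) (x::'a \<times> 'a)) \<longlonglongrightarrow> 0"
    "(\<lambda>n. dd u (dd u (cutoff (real (Suc n)))) (x::'a \<times> 'a)) \<longlonglongrightarrow> 0" if "u \<in> Basis" for u x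
    by (rule tendsto_null_inverse_nat[OF K(2)[OF that]], rule tendsto_null_inverse_nat[OF K(3)[OF that]])
  \<comment> \<open>The unbounded velocity is compensated by the decay of the cutoff gradient on its
    support.\<close>
  have vK: "\<bar>(snd p \<bullet> b) * dd u (cutoff (real (Suc n))) p\<bar> \<le> K" if "u \<in> Basis" "b \<in> Basis" for n u b and p :: "'a \<times> 'a"
  proof -
    have "\<bar>snd p \<bullet> b\<bar> \<le> norm p"
      using inner_Basis_abs_le[OF that(2), of "snd p"] norm_snd_le[of "snd p" "fst p"] by simp
    then have "\<bar>(snd p \<bullet> b) * dd u (cutoff (real (Suc n))) p\<bar> \<le> norm p * \<bar>dd u (cutoff (real (Suc n))) p\<bar>"
      unfolding abs_mult by (rule mult_right_mono) simp
    then show ?thesis using K(4)[OF that(1), of p n] by (rule order_trans)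
  qed
  have Bs: "(b, 0) \<in> Basis" "(0, b) \<in> Basis" if "b \<in> Basis" for b :: 'a
    using that by (simp_all add: Basis_prod_def)
  define f where "f n p = \<psi> (Y p) * cutoff (real (Suc n)) p" for n p
  define g where "g n r p = \<gamma> * (snd p \<bullet> grad_x (f n) p + (F r (fst p) - \<gamma> *\<^sub>R snd p) \<bullet> grad_v (f n) p + \<gamma> * lap_v (f n) p)" for n r p
  have P2: "P2 (\<mu> r)" if "r \<in> {0..T}" for r using sol that by (auto simp: kin_weak_sol_def P2_curve_def)
  have smY: "smooth (\<lambda>p. \<phi> (Y p))" if "smooth \<phi>" for \<phi>
    using smooth_affine[OF that Ylin, of 0] by simp
  have ddY: "dd u (\<lambda>p. \<phi> (Y p)) p = dd (Y u) \<phi> (Y p)" if "smooth \<phi>" for \<phi> u p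
    using dd_affine[OF Ylin, of \<phi> p 0 u] smooth_differentiable[OF that] by simp
  have ddYx: "dd (b, 0) (\<lambda>p. \<phi> (Y p)) p = dd b \<phi> (Y p)" if "smooth \<phi>" for \<phi> b p
    unfolding ddY[OF that] Yb ..
  have ddYv: "dd (0, b) (\<lambda>p. \<phi> (Y p)) p = (1 / \<gamma>) * dd b \<phi> (Y p)" if "smooth \<phi>" for \<phi> b p
    unfolding ddY[OF that] Yb by (rule dd_scaleR[OF smooth_differentiable[OF that]])
  have ddYvv: "dd (0, b) (dd (0, b) (\<lambda>p. \<psi> (Y p))) p = (1 / \<gamma>) * ((1 / \<gamma>) * dd b (dd b \<psi>) (Y p))" for b p
  proof -
    have "dd (0, b) (\<lambda>p. \<psi> (Y p)) = (\<lambda>p. (1 / \<gamma>) * dd b \<psi> (Y p))"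
      by (rule ext) (rule ddYv[OF sm])
    moreover have "dd (0, b) (\<lambda>p. (1 / \<gamma>) * dd b \<psi> (Y p)) p = (1 / \<gamma>) * dd (0, b) (\<lambda>p. dd b \<psi> (Y p)) p"
      by (rule dd_cmult[OF smooth_differentiable[OF smY[OF smooth_dd[OF sm]]]])
    ultimately show ?thesis
      using ddYv[OF smooth_dd[OF sm], of b b p] by simp
  qed
  have tf: "test_fun (f n)" for n
    unfolding f_def[abs_def] by (rule test_fun_mult'[OF smY[OF sm] test_fun_cutoff]) simp
  have d1: "dd u (f n) p = \<psi> (Y p) * dd u (cutoff (real (Suc n))) p + dd u (\<lambda>p. \<psi> (Y p)) p * cutoff (real (Suc n)) p" for u n p
    unfolding f_def[abs_def] by (rule smooth_times_cutoff_derivs(1)[OF smY[OF sm]])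
  have d2: "dd u (dd u (f n)) p = \<psi> (Y p) * dd u (dd u (cutoff (real (Suc n)))) p
      + 2 * (dd u (\<lambda>p. \<psi> (Y p)) p * dd u (cutoff (real (Suc n))) p) + dd u (dd u (\<lambda>p. \<psi> (Y p))) p * cutoff (real (Suc n)) p" for u n p
    unfolding f_def[abs_def] by (rule smooth_times_cutoff_derivs(2)[OF smY[OF sm]])
  have c1: "\<bar>cutoff (real (Suc n)) p\<bar> \<le> 1" for n and p :: "'a \<times> 'a"
    using cutoff_nonneg[of "real (Suc n)" p] cutoff_le_1[of "real (Suc n)" p] by simp
  \<comment> \<open>In the first summand transport and friction have already cancelled. Every other
    summand carries a derivative of the cutoff and tends to 0 at fixed \<gamma>, so the powers of
    \<gamma> in front of it do no harm.\<close>
  have g_eq: "g n r p = (\<Sum>b\<in>Basis.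
      ((F r (fst p) \<bullet> b) * dd b \<psi> (Y p) + dd b (dd b \<psi>) (Y p)) * cutoff (real (Suc n)) p
      + \<gamma> * (\<psi> (Y p) * ((snd p \<bullet> b) * dd (b, 0) (cutoff (real (Suc n))) p))
      + \<gamma> * (\<psi> (Y p) * ((F r (fst p) \<bullet> b) * dd (0, b) (cutoff (real (Suc n))) p))
      + (- \<gamma>\<^sup>2) * (\<psi> (Y p) * ((snd p \<bullet> b) * dd (0, b) (cutoff (real (Suc n))) p))
      + 2 * \<gamma> * (dd b \<psi> (Y p) * dd (0, b) (cutoff (real (Suc n))) p)
      + \<gamma>\<^sup>2 * (\<psi> (Y p) * dd (0, b) (dd (0, b) (cutoff (real (Suc n)))) p))" for n r p
  proof -
    have 1: "\<gamma> * (v * (q * X + qb * c) + (w - \<gamma> * v) * (q * V + (1 / \<gamma>) * qb * c)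
        + \<gamma> * (q * VV + 2 * ((1 / \<gamma>) * qb * V) + (1 / \<gamma>) * ((1 / \<gamma>) * qbb) * c))
      = (w * qb + qbb) * c + \<gamma> * (q * (v * X)) + \<gamma> * (q * (w * V)) + (- \<gamma>\<^sup>2) * (q * (v * V))
        + 2 * \<gamma> * (qb * V) + \<gamma>\<^sup>2 * (q * VV)" for v q X qb c w V VV qbb :: real
      using \<gamma> by (simp add: field_simps power2_eq_square)
    have "g n r p = (\<Sum>b\<in>Basis. \<gamma> * ((snd p \<bullet> b) * dd (b, 0) (f n) p
      + ((F r (fst p) \<bullet> b) - \<gamma> * (snd p \<bullet> b)) * dd (0, b) (f n) p + \<gamma> * dd (0, b) (dd (0, b) (f n)) p))"
      by (simp add: g_def grad_x_def grad_v_def lap_v_def inner_sum_right inner_diff_left sum.distrib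
          sum_distrib_left ring_distribs mult_ac sum_subtractf)
    then show ?thesis unfolding d1 d2 ddYvv ddYv[OF sm] ddYx[OF sm] 1 .
  qed
  have fst_m [measurable]: "fst \<in> borel_measurable (borel :: ('a \<times> 'a) measure)"
    and snd_m [measurable]: "snd \<in> borel_measurable (borel :: ('a \<times> 'a) measure)"
    by (intro borel_measurable_continuous_onI continuous_intros)+
  have F_borel: "F r \<in> borel_measurable borel" if "r \<in> {0..T}" for r
    unfolding F_def
  proof (rule Fforce_borel[OF m])
    interpret prob_space "\<mu> r" by (rule P2D[OF P2[OF that]])
    have "fst \<in> measurable (\<mu> r) borel"
      using fst_m measurable_cong_sets[OF P2D(2)[OF P2[OF that]] refl] by blast
    then show "prob_space (distr (\<mu> r) borel fst)" by (rule prob_space_distr)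
  qed simp
  have wk: "interval_lebesgue_integrable lborel (ereal s) (ereal t) (\<lambda>r. \<integral>x. g n r x \<partial>\<mu> r) \<and>
      (\<integral>x. f n x \<partial>\<mu> t) - (\<integral>x. f n x \<partial>\<mu> s) = interval_lebesgue_integral lborel (ereal s) (ereal t) (\<lambda>r. \<integral>x. g n r x \<partial>\<mu> r)" for n
  proof -
    have "s \<in> {0<..<T}" "t \<in> {0<..<T}" using s st t by auto
    from sol[unfolded kin_weak_sol_def Let_def, THEN conjunct2, rule_format, OF this tf[of n]]
    show ?thesis
      unfolding g_def F_def integral_mult_right_zero
      by (simp add: interval_lebesgue_integral_mult_right)
  qed
  have "set_integrable lborel {s<..<t} (\<lambda>r. \<integral>x. g n r x \<partial>\<mu> r)"
    and "(\<integral>x. f n x \<partial>\<mu> t) - (\<integral>x. f n x \<partial>\<mu> s) = (LINT r:{s<..<t}|lborel. \<integral>x. g n r x \<partial>\<mu> r)" for n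
    using wk[of n] st by (auto simp: interval_lebesgue_integrable_def interval_lebesgue_integral_def)
  note * = weak_form_limit[OF st _ _ this, where f'="\<lambda>p. \<psi> (Y p)" and C="C * 1"
      and g'="\<lambda>r p. \<Sum>b\<in>Basis. (F r (fst p) \<bullet> b) * dd b \<psi> (Y p) + dd b (dd b \<psi>) (Y p)"
      and D="\<Sum>b\<in>(Basis::'a set). (B * C + C) * 1 + \<bar>\<gamma>\<bar> * (C * K) + \<bar>\<gamma>\<bar> * (C * (B * K))
        + \<bar>- \<gamma>\<^sup>2\<bar> * (C * K) + \<bar>2 * \<gamma>\<bar> * (C * K) + \<bar>\<gamma>\<^sup>2\<bar> * (C * K)"]
  have r0: "r \<in> {0..T}" if "r \<in> {s..t}" for r using that s t by auto
  have lim_f: "(\<lambda>n. f n p) \<longlonglongrightarrow> \<psi> (Y p)" for p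
    using tendsto_mult[OF tendsto_const cutoff_tendsto, of "\<psi> (Y p)" p] by (simp add: f_def)
  have lim_g: "(\<lambda>n. g n r p) \<longlonglongrightarrow>
      (\<Sum>b\<in>Basis. (F r (fst p) \<bullet> b) * dd b \<psi> (Y p) + dd b (dd b \<psi>) (Y p))" for r p
  proof -
    have "(\<lambda>n. g n r p) \<longlonglongrightarrow> (\<Sum>b\<in>Basis.
      ((F r (fst p) \<bullet> b) * dd b \<psi> (Y p) + dd b (dd b \<psi>) (Y p)) * 1
      + \<gamma> * (\<psi> (Y p) * ((snd p \<bullet> b) * 0)) + \<gamma> * (\<psi> (Y p) * ((F r (fst p) \<bullet> b) * 0))
      + (- \<gamma>\<^sup>2) * (\<psi> (Y p) * ((snd p \<bullet> b) * 0)) + 2 * \<gamma> * (dd b \<psi> (Y p) * 0) + \<gamma>\<^sup>2 * (\<psi> (Y p) * 0))"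
      unfolding g_eq by (intro tendsto_sum tendsto_add tendsto_mult tendsto_const cutoff_tendsto Kl Bs)
    then show ?thesis by simp
  qed
  have bound_g: "\<bar>g n r p\<bar> \<le> (\<Sum>b\<in>(Basis::'a set). (B * C + C) * 1 + \<bar>\<gamma>\<bar> * (C * K) + \<bar>\<gamma>\<bar> * (C * (B * K))
        + \<bar>- \<gamma>\<^sup>2\<bar> * (C * K) + \<bar>2 * \<gamma>\<bar> * (C * K) + \<bar>\<gamma>\<^sup>2\<bar> * (C * K))"
    if r: "r \<in> {s..t}" for n r p
    unfolding g_eq
  proof (intro order_trans[OF sum_abs] sum_mono)
    fix b :: 'a assume b: "b \<in> Basis"
    have Fb: "\<bar>F r (fst p) \<bullet> b\<bar> \<le> B"
      using inner_Basis_abs_le[OF b] B[OF r0[OF r], folded F_def] by (rule order_trans)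
    show "\<bar>((F r (fst p) \<bullet> b) * dd b \<psi> (Y p) + dd b (dd b \<psi>) (Y p)) * cutoff (real (Suc n)) p
      + \<gamma> * (\<psi> (Y p) * ((snd p \<bullet> b) * dd (b, 0) (cutoff (real (Suc n))) p))
      + \<gamma> * (\<psi> (Y p) * ((F r (fst p) \<bullet> b) * dd (0, b) (cutoff (real (Suc n))) p))
      + (- \<gamma>\<^sup>2) * (\<psi> (Y p) * ((snd p \<bullet> b) * dd (0, b) (cutoff (real (Suc n))) p))
      + 2 * \<gamma> * (dd b \<psi> (Y p) * dd (0, b) (cutoff (real (Suc n))) p)
      + \<gamma>\<^sup>2 * (\<psi> (Y p) * dd (0, b) (dd (0, b) (cutoff (real (Suc n)))) p)\<bar>
      \<le> (B * C + C) * 1 + \<bar>\<gamma>\<bar> * (C * K) + \<bar>\<gamma>\<bar> * (C * (B * K))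
        + \<bar>- \<gamma>\<^sup>2\<bar> * (C * K) + \<bar>2 * \<gamma>\<bar> * (C * K) + \<bar>\<gamma>\<^sup>2\<bar> * (C * K)"
      by (intro order_trans[OF abs_triangle_ineq] add_mono abs_mult_le[OF _ c1]
          abs_mult_le[OF order_refl] abs_mult_le[OF b0] abs_mult_le[OF b1[OF b]] abs_mult_le[OF Fb]
          abs_mult_le[OF Fb b1[OF b]] b2[OF b] vK Bs b K')
  qed
  have dm: "(\<lambda>p. dd b \<phi> (Y p)) \<in> borel_measurable borel" if "smooth \<phi>" for b and \<phi> :: "'a \<Rightarrow> real"
    by (rule smooth_borel[OF smY[OF smooth_dd[OF that]]])
  have dm': "dd u \<phi> \<in> borel_measurable borel" if "smooth \<phi>" for u and \<phi> :: "'a \<times> 'a \<Rightarrow> real"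
    by (rule smooth_borel[OF smooth_dd[OF that]])
  have F_borel': "(\<lambda>p::'a\<times>'a. F r (fst p)) \<in> borel_measurable borel" if "r \<in> {s..t}" for r
    by (rule measurable_compose[OF fst_m F_borel[OF r0[OF that]]])
  have g_borel': "(\<lambda>p. \<Sum>b\<in>Basis. (F r (fst p) \<bullet> b) * dd b \<psi> (Y p) + dd b (dd b \<psi>) (Y p)) \<in> borel_measurable borel"
    if "r \<in> {s..t}" for r
    using F_borel'[OF that] dm[OF sm] dm[OF smooth_dd[OF sm]] by measurable
  have g_borel: "g n r \<in> borel_measurable borel" if "r \<in> {s..t}" for n r
    unfolding g_def[abs_def] grad_x_def grad_v_def lap_v_def
    using F_borel'[OF that] dm'[OF test_fun_smooth[OF tf[of n]]] dm'[OF smooth_dd[OF test_fun_smooth[OF tf[of n]]]]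
    by measurable
  have pr: "prob_space (\<mu> r)" "sets (\<mu> r) = sets borel" if "r \<in> {s..t}" for r
    using P2D[OF P2[OF r0[OF that]]] by auto
  have fb: "\<bar>f n x\<bar> \<le> C * 1" for n x unfolding f_def by (intro abs_mult_le b0 c1)
  note concl = *[OF pr smooth_borel[OF test_fun_smooth[OF tf]] smooth_borel[OF smY[OF sm]] fb lim_f
      g_borel g_borel' bound_g lim_g]
  show "set_integrable lborel {s<..<t} (\<lambda>r. \<integral>p. (\<Sum>b\<in>Basis. (Fforce gradPhi gradK (distr (\<mu> r) borel fst) (fst p) \<bullet> b) * dd b \<psi> (fst p + snd p /\<^sub>R \<gamma>) + dd b (dd b \<psi>) (fst p + snd p /\<^sub>R \<gamma>)) \<partial>\<mu> r) \<and>
    (\<integral>p. \<psi> (fst p + snd p /\<^sub>R \<gamma>) \<partial>\<mu> t) - (\<integral>p. \<psi> (fst p + snd p /\<^sub>R \<gamma>) \<partial>\<mu> s) =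
    (LINT r:{s<..<t}|lborel. \<integral>p. (\<Sum>b\<in>Basis. (Fforce gradPhi gradK (distr (\<mu> r) borel fst) (fst p) \<bullet> b) * dd b \<psi> (fst p + snd p /\<^sub>R \<gamma>) + dd b (dd b \<psi>) (fst p + snd p /\<^sub>R \<gamma>)) \<partial>\<mu> r)"
    using concl unfolding Y_def F_def by (intro conjI)
qed

section \<open>Mild formulation\<close>

text \<open>Both the integrand and the measure vary with the parameter. Measurability is taken from
  the integrals of the positive and negative parts; the case distinction on integrability reflects
  the default value 0 of a Bochner integral that does not exist.\<close>

lemma integral_measurable_kernel:
  fixes f :: "'b \<Rightarrow> 'c \<Rightarrow> real"
  assumes f: "(\<lambda>(x, y). f x y) \<in> borel_measurable (M \<Otimes>\<^sub>M N)" and L: "L \<in> measurable M (subprob_algebra N)"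
  shows "(\<lambda>x. \<integral>y. f x y \<partial>L x) \<in> borel_measurable M"
proof -
  note [measurable] = f L
  have 1: "(\<lambda>x. \<integral>\<^sup>+y. ennreal (f x y) \<partial>L x) \<in> borel_measurable M"
    by (rule nn_integral_measurable_subprob_algebra2[OF _ L]) measurable
  have 2: "(\<lambda>x. \<integral>\<^sup>+y. ennreal (- f x y) \<partial>L x) \<in> borel_measurable M"
    by (rule nn_integral_measurable_subprob_algebra2[OF _ L]) measurable
  have 3: "(\<lambda>x. \<integral>\<^sup>+y. ennreal (norm (f x y)) \<partial>L x) \<in> borel_measurable M"
    by (rule nn_integral_measurable_subprob_algebra2[OF _ L]) measurable
  define P where "P x \<longleftrightarrow> (\<integral>\<^sup>+y. ennreal (norm (f x y)) \<partial>L x) < \<infinity>" for x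
  have fm: "f x \<in> borel_measurable (L x)" if x: "x \<in> space M" for x
  proof -
    have "sets (L x) = sets N" using measurable_space[OF L x] by (simp add: space_subprob_algebra)
    moreover have "f x \<in> borel_measurable N"
      using measurable_compose[OF measurable_Pair1'[OF x] f] by simp
    ultimately show ?thesis by (simp cong: measurable_cong_sets)
  qed
  have "(\<lambda>x. if P x then enn2real (\<integral>\<^sup>+y. ennreal (f x y) \<partial>L x) - enn2real (\<integral>\<^sup>+y. ennreal (- f x y) \<partial>L x) else 0)
    \<in> borel_measurable M"
    unfolding P_def using 1 2 3 by measurable
  moreover have "(\<integral>y. f x y \<partial>L x)
    = (if P x then enn2real (\<integral>\<^sup>+y. ennreal (f x y) \<partial>L x) - enn2real (\<integral>\<^sup>+y. ennreal (- f x y) \<partial>L x) else 0)"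
    if x: "x \<in> space M" for x
  proof (cases "P x")
    case True
    then have "integrable (L x) (f x)"
      using fm[OF x] by (simp add: P_def integrable_iff_bounded)
    then show ?thesis using True real_lebesgue_integral_def by simp
  next
    case False
    then have "\<not> integrable (L x) (f x)" by (simp add: P_def integrable_iff_bounded)
    then show ?thesis using False by (simp add: not_integrable_integral_eq)
  qed
  ultimately show ?thesis by (simp cong: measurable_cong)
qed

text \<open>A majorant depending on the second variable alone, times the integrable weight
  \<open>h\<close> in the first, makes the product integrable. All exchanges of integrals in
  \<open>mild_dual\<close> have this shape.\<close>

lemma Fubini_bounded_kernel:
  fixes h :: "'a::euclidean_space \<Rightarrow> real" and k :: "'a \<Rightarrow> 'c \<Rightarrow> real"
  assumes Q: "sigma_finite_measure Q" and h: "integrable lborel h" and w: "integrable Q w"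
    and k: "(\<lambda>(z, q). k z q) \<in> borel_measurable (lborel \<Otimes>\<^sub>M Q)"
    and kw: "\<And>z q. q \<in> space Q \<Longrightarrow> \<bar>k z q\<bar> \<le> w q"
  shows "(\<integral>z. h z * (\<integral>q. k z q \<partial>Q) \<partial>lborel) = (\<integral>q. (\<integral>z. h z * k z q \<partial>lborel) \<partial>Q)"
    and "integrable Q (\<lambda>q. \<integral>z. h z * k z q \<partial>lborel)"
proof -
  interpret Q: sigma_finite_measure Q by (rule Q)
  interpret pair_sigma_finite lborel Q ..
  note [measurable] = borel_measurable_integrable[OF h] borel_measurable_integrable[OF w] k
  have km: "k z \<in> borel_measurable Q" for z
    using measurable_compose[OF measurable_Pair1'[of z lborel Q] k] by simp
  have ik: "integrable Q (k z)" for z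
    by (rule Bochner_Integration.integrable_bound[OF w km])
      (auto intro!: AE_I2 order_trans[OF kw abs_ge_self])
  have prod: "integrable (lborel \<Otimes>\<^sub>M Q) (\<lambda>(z, q). h z * k z q)"
  proof (rule Fubini_integrable)
    show "(\<lambda>(z, q). h z * k z q) \<in> borel_measurable (lborel \<Otimes>\<^sub>M Q)" by measurable
    show "AE z in lborel. integrable Q (\<lambda>q. case (z, q) of (z, q) \<Rightarrow> h z * k z q)"
      using ik by simp
    show "integrable lborel (\<lambda>z. \<integral>q. norm (case (z, q) of (z, q) \<Rightarrow> h z * k z q) \<partial>Q)"
    proof (rule Bochner_Integration.integrable_bound)
      show "integrable lborel (\<lambda>z. \<bar>h z\<bar> * (\<integral>q. w q \<partial>Q))" using h by simp
      show "(\<lambda>z. \<integral>q. norm (case (z, q) of (z, q) \<Rightarrow> h z * k z q) \<partial>Q) \<in> borel_measurable lborel"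
        by (rule Q.borel_measurable_lebesgue_integral) measurable
      have "(\<integral>q. \<bar>h z * k z q\<bar> \<partial>Q) \<le> \<bar>h z\<bar> * (\<integral>q. w q \<partial>Q)" for z
        unfolding abs_mult integral_mult_right_zero
        using ik w kw by (intro mult_left_mono integral_mono) auto
      then show "AE z in lborel. norm (\<integral>q. norm (case (z, q) of (z, q) \<Rightarrow> h z * k z q) \<partial>Q)
          \<le> norm (\<bar>h z\<bar> * (\<integral>q. w q \<partial>Q))"
        by (intro AE_I2) (auto intro: order_trans[OF _ abs_ge_self])
    qed
  qed
  from Fubini_integral[OF prod]
  show "(\<integral>z. h z * (\<integral>q. k z q \<partial>Q) \<partial>lborel) = (\<integral>q. (\<integral>z. h z * k z q \<partial>lborel) \<partial>Q)" by simp
  show "integrable Q (\<lambda>q. \<integral>z. h z * k z q \<partial>lborel)"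
    using integrable_snd[OF prod] by simp
qed

text \<open>The weak equation integrates over open intervals and the Duhamel formula over closed
  ones. The last clause reconciles them, the endpoint being a null set.\<close>

lemma bounded_interval_integral:
  fixes c :: "real \<Rightarrow> real"
  assumes [measurable]: "c \<in> borel_measurable borel" and K: "\<And>r. \<bar>c r\<bar> \<le> K" and uv: "u \<le> v"
  shows "set_integrable lborel {u..v} c" "set_integrable lborel {u<..<v} c"
    "\<bar>LINT r:{u<..<v}|lborel. c r\<bar> \<le> K * (v - u)"
    "0 \<le> u \<Longrightarrow> (LINT r:{0..v}|lborel. c r) - (LINT r:{0..u}|lborel. c r) = (LINT r:{u<..<v}|lborel. c r)"
proof -
  have i: "set_integrable lborel {a..b} c" for a b
    unfolding set_integrable_def
  proof (rule Bochner_Integration.integrable_bound)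
    show "integrable lborel (\<lambda>r. indicator {a..b} r * K)"
      by (intro integrable_mult_left integrable_real_indicator) (auto simp: emeasure_lborel_Icc_eq)
    have "norm (indicator {a..b} r *\<^sub>R c r) \<le> norm (indicator {a..b} r * K)" for r
      using order_trans[OF K abs_ge_self, of r] by (simp add: indicator_def)
    then show "AE r in lborel. norm (indicator {a..b} r *\<^sub>R c r) \<le> norm (indicator {a..b} r * K)"
      by simp
  qed simp
  then show "set_integrable lborel {u..v} c" .
  show o: "set_integrable lborel {u<..<v} c"
    by (rule set_integrable_subset[OF i[of u v]]) auto
  have "\<bar>LINT r:{u<..<v}|lborel. c r\<bar> \<le> (\<integral>r. \<bar>indicator {u<..<v} r *\<^sub>R c r\<bar> \<partial>lborel)"
    unfolding set_lebesgue_integral_def by (rule integral_abs_bound)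
  also have "\<dots> \<le> (\<integral>r. indicator {u<..<v} r * K \<partial>lborel)"
  proof (rule integral_mono)
    show "integrable lborel (\<lambda>r. \<bar>indicator {u<..<v} r *\<^sub>R c r\<bar>)"
      using o unfolding set_integrable_def by (rule integrable_abs)
    show "integrable lborel (\<lambda>r. indicator {u<..<v} r * K)"
      using uv by (intro integrable_mult_left integrable_real_indicator) auto
  qed (use K in \<open>auto simp: indicator_def\<close>)
  also have "\<dots> = K * (v - u)" using uv by simp
  finally show "\<bar>LINT r:{u<..<v}|lborel. c r\<bar> \<le> K * (v - u)" .
  assume u: "0 \<le> u"
  have "(LINT r:{0..v}|lborel. c r) = (\<integral>r. indicator {0..u} r *\<^sub>R c r + indicator {u<..<v} r *\<^sub>R c r \<partial>lborel)"
    unfolding set_lebesgue_integral_def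
  proof (rule integral_cong_AE)
    have "AE r in lborel. r \<noteq> v" by (rule AE_lborel_singleton)
    then show "AE r in lborel. indicator {0..v} r *\<^sub>R c r = indicator {0..u} r *\<^sub>R c r + indicator {u<..<v} r *\<^sub>R c r"
      by eventually_elim (use u uv in \<open>auto simp: indicator_def\<close>)
  qed auto
  also have "\<dots> = (LINT r:{0..u}|lborel. c r) + (LINT r:{u<..<v}|lborel. c r)"
    using i[of 0 u] o unfolding set_lebesgue_integral_def set_integrable_def
    by (rule Bochner_Integration.integral_add)
  finally show "(LINT r:{0..v}|lborel. c r) - (LINT r:{0..u}|lborel. c r) = (LINT r:{u<..<v}|lborel. c r)" by simp
qed

lemma heat_joint_measurable [measurable]:
  "(\<lambda>p. heat (fst p) (snd p :: 'a::euclidean_space)) \<in> borel_measurable (borel \<Otimes>\<^sub>M borel)"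
  "(\<lambda>p. heat_grad (fst p) (snd p :: 'a::euclidean_space)) \<in> borel_measurable (borel \<Otimes>\<^sub>M borel)"
  unfolding heat_grad_def heat_def by measurable

lemma heat_C2_bounded:
  fixes z :: "'a::euclidean_space"
  assumes "0 < \<tau>" obtains C where "C2_bounded C (\<lambda>x. heat \<tau> (x - z))"
proof -
  obtain M where M: "0 < M" "\<And>x::'a. \<bar>heat \<tau> x\<bar> \<le> M" "\<And>x::'a. norm (heat_grad \<tau> x) \<le> M"
    using heat_regularity[OF assms order_refl, where 'a='a] by (metis order_refl)
  obtain m where m: "0 < m" "\<And>x::'a. (1 + norm x) ^ 4 * heat \<tau> x \<le> m"
    using heat_moment_bound[OF assms assms, where 'a='a] by (metis order_refl)
  define C where "C = M + (m / (4 * \<tau>\<^sup>2) + m / (2 * \<tau>))"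
  have b2: "\<bar>dd b (dd b (\<lambda>x. heat \<tau> (x - z))) x\<bar> \<le> m / (4 * \<tau>\<^sup>2) + m / (2 * \<tau>)" if b: "b \<in> Basis" for x b
  proof -
    have h0: "0 \<le> heat \<tau> (x - z)" by (rule heat_nonneg)
    have "((x - z) \<bullet> b)\<^sup>2 \<le> norm (x - z) ^ 2"
      using inner_Basis_abs_le[OF b, of "x - z"] by (metis abs_ge_zero power2_abs power_mono)
    then have "((x - z) \<bullet> b)\<^sup>2 * heat \<tau> (x - z) \<le> norm (x - z) ^ 2 * heat \<tau> (x - z)"
      using h0 by (rule mult_right_mono)
    also have "\<dots> \<le> m" by (rule heat_moment_le[OF m(2)]) simp
    finally have 1: "((x - z) \<bullet> b)\<^sup>2 * heat \<tau> (x - z) \<le> m" .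
    have 2: "heat \<tau> (x - z) \<le> m" using heat_moment_le[OF m(2), of 0 "x - z"] by simp
    have eq: "dd b (dd b (\<lambda>x. heat \<tau> (x - z))) x
      = (((x - z) \<bullet> b)\<^sup>2 * heat \<tau> (x - z)) / (4 * \<tau>\<^sup>2) - heat \<tau> (x - z) / (2 * \<tau>)"
      unfolding dd_dd_heat[OF assms] using b by (simp add: algebra_simps)
    have "\<bar>(((x - z) \<bullet> b)\<^sup>2 * heat \<tau> (x - z)) / (4 * \<tau>\<^sup>2)\<bar> \<le> m / (4 * \<tau>\<^sup>2)"
      using 1 h0 assms by (simp add: divide_right_mono)
    moreover have "\<bar>heat \<tau> (x - z) / (2 * \<tau>)\<bar> \<le> m / (2 * \<tau>)"
      using 2 h0 assms by (simp add: divide_right_mono)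
    ultimately show ?thesis unfolding eq by linarith
  qed
  have C: "M \<le> C" "m / (4 * \<tau>\<^sup>2) + m / (2 * \<tau>) \<le> C"
    using M(1) m(1) assms by (simp_all add: C_def)
  have "C2_bounded C (\<lambda>x. heat \<tau> (x - z))"
    unfolding C2_bounded_def
  proof (intro conjI allI ballI smooth_heat)
    fix x b :: 'a assume b: "b \<in> Basis"
    have "\<bar>heat_grad \<tau> (x - z) \<bullet> b\<bar> \<le> M"
      using inner_Basis_abs_le[OF b] M(3) by (rule order_trans)
    then show "\<bar>dd b (\<lambda>x. heat \<tau> (x - z)) x\<bar> \<le> C"
      unfolding dd_heat[OF assms] using C(1) by (rule order_trans)
    show "\<bar>dd b (dd b (\<lambda>x. heat \<tau> (x - z))) x\<bar> \<le> C"
      using b2[OF b] C(2) by (rule order_trans)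
  next
    show "\<bar>heat \<tau> (x - z)\<bar> \<le> C" for x using M(2) C(1) by (rule order_trans)
  qed
  then show thesis by (rule that)
qed

lemma heat_time_lipschitz:
  assumes \<delta>: "0 < \<delta>" and M: "\<And>u x::'a::euclidean_space. \<delta> \<le> u \<Longrightarrow> u \<le> D \<Longrightarrow> \<bar>heat_lap u x\<bar> \<le> M"
    and ts: "\<delta> \<le> \<tau>" "\<tau> \<le> D" "\<delta> \<le> \<sigma>" "\<sigma> \<le> D"
  shows "\<bar>heat \<tau> x - heat \<sigma> (x::'a)\<bar> \<le> M * \<bar>\<tau> - \<sigma>\<bar>"
proof -
  define f where "f u = heat u x" for u
  have "norm (f \<tau> - f \<sigma>) \<le> M * norm (\<tau> - \<sigma>)"
  proof (rule field_differentiable_bound[where S="{\<delta>..D}" and f'="\<lambda>u. heat_lap u x"])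
    fix u assume u: "u \<in> {\<delta>..D}"
    then have "0 < u" using \<delta> by simp
    then show "(f has_field_derivative heat_lap u x) (at u within {\<delta>..D})"
      unfolding f_def[abs_def]
      by (rule has_field_derivative_at_within[OF heat_has_derivative_time])
    show "norm (heat_lap u x) \<le> M" using M u by simp
  qed (use ts in auto)
  then show ?thesis by (simp add: f_def)
qed

text \<open>What the two equations share once time is clamped. The weak equation speaks only of
  times strictly between 0 and \<open>T\<close>; \<open>N_cont\<close> is what carries it to the
  endpoints, where the initial and final comparisons take place.\<close>

locale drift_curve =
  fixes T B :: real and N :: "real \<Rightarrow> 'b::euclidean_space measure" and y :: "'b \<Rightarrow> 'a::euclidean_space"
    and V :: "real \<Rightarrow> 'b \<Rightarrow> 'a"
  assumes N_kernel: "N \<in> borel \<rightarrow>\<^sub>M prob_algebra borel"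
    and y_borel [measurable]: "y \<in> borel_measurable borel"
    and V_borel [measurable]: "(\<lambda>(r, p). V r p) \<in> borel_measurable (borel \<Otimes>\<^sub>M borel)"
    and V_bound: "\<And>r p. norm (V r p) \<le> B"
    and N_cont: "\<And>L C f. L-lipschitz_on UNIV f \<Longrightarrow> (\<And>x. \<bar>f x\<bar> \<le> C) \<Longrightarrow> continuous_on {0..T} (\<lambda>r. \<integral>p. (f (y p) :: real) \<partial>N r)"
    and weak: "drift_diffusion T N y V"
begin

lemma N_prob: "prob_space (N r)" and N_sets: "sets (N r) = sets borel"
  using measurable_space[OF N_kernel, of r] by (auto simp: space_prob_algebra)

lemma N_subprob: "N \<in> borel \<rightarrow>\<^sub>M subprob_algebra borel"
  by (rule measurable_prob_algebraD[OF N_kernel])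

lemma B_nonneg: "0 \<le> B"
  using V_bound norm_ge_zero order_trans by blast

lemma V_borel' [measurable]: "V r \<in> borel_measurable borel"
  using measurable_compose[OF measurable_Pair1'[of r] V_borel] by simp

lemma borel_N: "f \<in> borel_measurable borel \<Longrightarrow> f \<in> borel_measurable (N r)"
  using N_sets by (simp cong: measurable_cong_sets)

lemma integrable_N:
  assumes "f \<in> borel_measurable borel" "\<And>p. \<bar>f p\<bar> \<le> (C::real)" shows "integrable (N r) f"
proof -
  interpret prob_space "N r" by (rule N_prob)
  show ?thesis
    by (rule integrable_const_bound[of _ C]) (use assms borel_N in auto)
qed

lemma integral_diff_le:
  assumes f: "f \<in> borel_measurable borel" "\<And>p. \<bar>f p\<bar> \<le> (C::real)"
    and g: "g \<in> borel_measurable borel" "\<And>p. \<bar>g p\<bar> \<le> (D::real)"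
    and fg: "\<And>p. \<bar>f p - g p\<bar> \<le> E"
  shows "\<bar>(\<integral>p. f p \<partial>N r) - (\<integral>p. g p \<partial>N r)\<bar> \<le> E"
proof -
  interpret prob_space "N r" by (rule N_prob)
  have "\<bar>(\<integral>p. f p \<partial>N r) - (\<integral>p. g p \<partial>N r)\<bar> = \<bar>\<integral>p. f p - g p \<partial>N r\<bar>"
    using integrable_N[OF f] integrable_N[OF g] by simp
  also have "\<dots> \<le> (\<integral>p. \<bar>f p - g p\<bar> \<partial>N r)" by (rule integral_abs_bound)
  also have "\<dots> \<le> E"
    by (rule integral_le_const) (use integrable_N[OF f] integrable_N[OF g] fg in auto)
  finally show ?thesis .
qed

lemma integral_abs_le:
  assumes f: "f \<in> borel_measurable borel" "\<And>p. \<bar>f p\<bar> \<le> (C::real)"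
  shows "\<bar>\<integral>p. f p \<partial>N r\<bar> \<le> C"
proof -
  have "\<bar>0::real\<bar> \<le> 0" by simp
  from integral_diff_le[OF f _ this, where E=C] f(2) show ?thesis by simp
qed

text \<open>Duhamel's formula for a single backward heat kernel: the quantity \<open>H\<close> below
  is shown to be constant. The drift pairing is merely measurable in time, so it is never
  differentiated on its own; over a short interval it is compared with the increment of its own
  integral. The Laplacian pairing is continuous in time and cancels against the time derivative of
  the kernel. The shift \<open>\<delta>\<close> keeps all kernels regular, and
  \<open>clamp_time t\<close> keeps their time argument at least \<open>\<delta>\<close> for every
  real \<open>r\<close>.\<close>

lemma mild_pointwise:
  assumes \<delta>: "0 < \<delta>" and t: "0 \<le> t" "t \<le> T"
  shows "(\<integral>p. heat \<delta> (y p - z) \<partial>N t) = (\<integral>p. heat (\<delta> + t) (y p - z) \<partial>N 0)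
    + (LINT r:{0..t}|lborel. \<integral>p. heat_grad (\<delta> + t - clamp_time t r) (y p - z) \<bullet> V r p \<partial>N r)"
proof (cases "t = 0")
  case True
  have "(LINT r:{0..0}|lborel. c r) = 0" for c :: "real \<Rightarrow> real"
  proof -
    have "AE r in lborel. indicator {0..0} r *\<^sub>R c r = 0"
      using AE_lborel_singleton[of "0::real"] by eventually_elim (auto simp: indicator_def)
    then show ?thesis unfolding set_lebesgue_integral_def by (rule integral_eq_zero_AE)
  qed
  with True show ?thesis by simp
next
  case False
  with t have t0: "0 < t" by simp
  have \<delta>t: "\<delta> \<le> \<delta> + t" using t by simp
  obtain M where M: "0 < M"
    and h0: "\<And>\<tau> x::'a. \<delta> \<le> \<tau> \<Longrightarrow> \<tau> \<le> \<delta> + t \<Longrightarrow> \<bar>heat \<tau> x\<bar> \<le> M"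
    and h1: "\<And>\<tau> x::'a. \<delta> \<le> \<tau> \<Longrightarrow> \<tau> \<le> \<delta> + t \<Longrightarrow> norm (heat_grad \<tau> x) \<le> M"
    and h2: "\<And>\<tau> x::'a. \<delta> \<le> \<tau> \<Longrightarrow> \<tau> \<le> \<delta> + t \<Longrightarrow> \<bar>heat_lap \<tau> x\<bar> \<le> M"
    and h3: "\<And>\<tau> \<sigma> x::'a. \<delta> \<le> \<tau> \<Longrightarrow> \<tau> \<le> \<delta> + t \<Longrightarrow> \<delta> \<le> \<sigma> \<Longrightarrow> \<sigma> \<le> \<delta> + t \<Longrightarrow> \<bar>heat_lap \<tau> x - heat_lap \<sigma> x\<bar> \<le> M * \<bar>\<tau> - \<sigma>\<bar>"
    and h4: "\<And>\<tau> \<sigma> x::'a. \<delta> \<le> \<tau> \<Longrightarrow> \<tau> \<le> \<delta> + t \<Longrightarrow> \<delta> \<le> \<sigma> \<Longrightarrow> \<sigma> \<le> \<delta> + t \<Longrightarrow> norm (heat_grad \<tau> x - heat_grad \<sigma> x) \<le> M * \<bar>\<tau> - \<sigma>\<bar>"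
    and h5: "\<And>\<tau> (x::'a) x'. \<delta> \<le> \<tau> \<Longrightarrow> \<tau> \<le> \<delta> + t \<Longrightarrow> \<bar>heat_lap \<tau> x - heat_lap \<tau> x'\<bar> \<le> M * norm (x - x')"
    and h6: "\<And>\<tau> (x::'a) x'. \<delta> \<le> \<tau> \<Longrightarrow> \<tau> \<le> \<delta> + t \<Longrightarrow> \<bar>heat \<tau> x - heat \<tau> x'\<bar> \<le> M * norm (x - x')"
    using heat_regularity[OF \<delta> \<delta>t, where 'a='a] by blast
  define \<theta> where "\<theta> s = \<delta> + t - s" for s
  have \<theta>: "\<delta> \<le> \<theta> s" "\<theta> s \<le> \<delta> + t" "0 < \<theta> s" if "s \<in> {0..t}" for s
    using that \<delta> by (auto simp: \<theta>_def)
  define a where "a \<tau> s = (\<integral>p. heat \<tau> (y p - z) \<partial>N s)" for \<tau> s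
  define A where "A \<tau> s = (\<integral>p. heat_lap \<tau> (y p - z) \<partial>N s)" for \<tau> s
  define b where "b \<tau> r = (\<integral>p. heat_grad \<tau> (y p - z) \<bullet> V r p \<partial>N r)" for \<tau> r
  define c where "c r = b (\<delta> + t - clamp_time t r) r" for r
  define H where "H s = a (\<theta> s) s - (LINT r:{0..s}|lborel. c r)" for s
  have m0: "(\<lambda>p. heat \<tau> (y p - z)) \<in> borel_measurable borel" "(\<lambda>p. heat_lap \<tau> (y p - z)) \<in> borel_measurable borel"
    "(\<lambda>p. heat_grad \<tau> (y p - z) \<bullet> V r p) \<in> borel_measurable borel" for \<tau> r by measurable
  have b_bd: "\<bar>heat_grad \<tau> (y p - z) \<bullet> V r p\<bar> \<le> M * B" if "\<delta> \<le> \<tau>" "\<tau> \<le> \<delta> + t" for \<tau> r p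
    by (rule order_trans[OF Cauchy_Schwarz_ineq2]) (intro mult_mono h1 V_bound that, use M in auto)
  have ct: "clamp_time t r \<in> {0..t}" for r using t0 clamp_time_in[of t r] by simp
  have c_bd: "\<bar>c r\<bar> \<le> M * B" for r
    unfolding c_def b_def using \<theta>[OF ct] unfolding \<theta>_def by (intro integral_abs_le m0 b_bd)
  have [measurable]: "clamp_time t \<in> borel_measurable borel"
    unfolding clamp_time_def[abs_def] by measurable
  have c_m: "c \<in> borel_measurable borel"
    unfolding c_def[abs_def] b_def
  proof (rule integral_measurable_kernel[OF _ N_subprob])
    have "(\<lambda>q. heat_grad (fst q) (snd q)) \<circ> (\<lambda>(r, p). (\<delta> + t - clamp_time t r, y p - z)) \<in> borel_measurable (borel \<Otimes>\<^sub>M borel)"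
      by (rule measurable_comp[OF _ heat_joint_measurable(2)]) measurable
    then have [measurable]: "(\<lambda>(r, p). heat_grad (\<delta> + t - clamp_time t r) (y p - z)) \<in> borel_measurable (borel \<Otimes>\<^sub>M borel)"
      by (simp add: comp_def case_prod_beta)
    show "(\<lambda>(r, p). heat_grad (\<delta> + t - clamp_time t r) (y p - z) \<bullet> V r p) \<in> borel_measurable (borel \<Otimes>\<^sub>M borel)"
      by measurable
  qed
  note ci = bounded_interval_integral[OF c_m c_bd]
  have A_lip: "\<bar>A \<tau> r - A \<sigma> r\<bar> \<le> M * \<bar>\<tau> - \<sigma>\<bar>" if "\<delta> \<le> \<tau>" "\<tau> \<le> \<delta> + t" "\<delta> \<le> \<sigma>" "\<sigma> \<le> \<delta> + t" for \<tau> \<sigma> r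
    unfolding A_def by (rule integral_diff_le) (use that h2 h3 m0 in auto)
  have b_lip: "\<bar>b \<tau> r - b \<sigma> r\<bar> \<le> M * \<bar>\<tau> - \<sigma>\<bar> * B" if "\<delta> \<le> \<tau>" "\<tau> \<le> \<delta> + t" "\<delta> \<le> \<sigma>" "\<sigma> \<le> \<delta> + t" for \<tau> \<sigma> r
    unfolding b_def
  proof (rule integral_diff_le[OF m0(3) b_bd m0(3) b_bd])
    fix p
    have "\<bar>(heat_grad \<tau> (y p - z) - heat_grad \<sigma> (y p - z)) \<bullet> V r p\<bar> \<le> M * \<bar>\<tau> - \<sigma>\<bar> * B"
      by (rule order_trans[OF Cauchy_Schwarz_ineq2]) (intro mult_mono h4 V_bound that, use M in auto)
    then show "\<bar>heat_grad \<tau> (y p - z) \<bullet> V r p - heat_grad \<sigma> (y p - z) \<bullet> V r p\<bar> \<le> M * \<bar>\<tau> - \<sigma>\<bar> * B"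
      by (simp add: inner_diff_left)
  qed (use that in auto)
  \<comment> \<open>Second-order Taylor estimate in the kernel time: after subtraction of the linear
    part at \<open>\<sigma>\<close>, the derivative is a difference of values of
    \<open>heat_lap\<close>, which is Lipschitz in time.\<close>
  have a_taylor: "\<bar>a \<tau> s - a \<sigma> s - (\<tau> - \<sigma>) * A \<sigma> s\<bar> \<le> M * \<bar>\<tau> - \<sigma>\<bar> * \<bar>\<tau> - \<sigma>\<bar>"
    if ts: "\<delta> \<le> \<tau>" "\<tau> \<le> \<delta> + t" "\<delta> \<le> \<sigma>" "\<sigma> \<le> \<delta> + t" for \<tau> \<sigma> s
  proof -
    have pw: "\<bar>(heat \<tau> x - \<tau> * heat_lap \<sigma> x) - (heat \<sigma> x - \<sigma> * heat_lap \<sigma> x)\<bar> \<le> M * \<bar>\<tau> - \<sigma>\<bar> * \<bar>\<tau> - \<sigma>\<bar>" for x :: 'a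
      unfolding real_norm_def[symmetric]
    proof (rule field_differentiable_bound[where S="closed_segment \<sigma> \<tau>" and f'="\<lambda>u. heat_lap u x - heat_lap \<sigma> x"])
      fix u assume u: "u \<in> closed_segment \<sigma> \<tau>"
      then have u': "\<delta> \<le> u" "u \<le> \<delta> + t" "\<bar>u - \<sigma>\<bar> \<le> \<bar>\<tau> - \<sigma>\<bar>"
        using ts by (auto simp: closed_segment_eq_real_ivl split: if_splits)
      have "((\<lambda>u. heat u x - u * heat_lap \<sigma> x) has_real_derivative heat_lap u x - 1 * heat_lap \<sigma> x) (at u)"
        using u' \<delta> by (intro DERIV_diff heat_has_derivative_time DERIV_cmult_right DERIV_ident) auto
      then show "((\<lambda>u. heat u x - u * heat_lap \<sigma> x) has_field_derivative heat_lap u x - heat_lap \<sigma> x) (at u within closed_segment \<sigma> \<tau>)"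
        by (simp add: has_field_derivative_at_within)
      have "\<bar>heat_lap u x - heat_lap \<sigma> x\<bar> \<le> M * \<bar>u - \<sigma>\<bar>" using h3 u' ts by simp
      also have "\<dots> \<le> M * \<bar>\<tau> - \<sigma>\<bar>" using u' M by (intro mult_left_mono) auto
      finally show "norm (heat_lap u x - heat_lap \<sigma> x) \<le> M * norm (\<tau> - \<sigma>)" by simp
    qed auto
    have "a \<tau> s - a \<sigma> s - (\<tau> - \<sigma>) * A \<sigma> s
      = (\<integral>p. heat \<tau> (y p - z) - \<tau> * heat_lap \<sigma> (y p - z) \<partial>N s) - (\<integral>p. heat \<sigma> (y p - z) - \<sigma> * heat_lap \<sigma> (y p - z) \<partial>N s)"
      using integrable_N[OF m0(1) h0[OF ts(1,2)]] integrable_N[OF m0(1) h0[OF ts(3,4)]] integrable_N[OF m0(2) h2[OF ts(3,4)]]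
      by (simp add: a_def A_def algebra_simps)
    also have "\<bar>\<dots>\<bar> \<le> M * \<bar>\<tau> - \<sigma>\<bar> * \<bar>\<tau> - \<sigma>\<bar>"
    proof (rule integral_diff_le[OF _ _ _ _ pw])
      have bb: "\<bar>heat u x - u * heat_lap \<sigma> x\<bar> \<le> M + \<bar>u\<bar> * M" if "\<delta> \<le> u" "u \<le> \<delta> + t" for u and x :: 'a
      proof -
        have "\<bar>heat u x - u * heat_lap \<sigma> x\<bar> \<le> \<bar>heat u x\<bar> + \<bar>u\<bar> * \<bar>heat_lap \<sigma> x\<bar>"
          using abs_triangle_ineq4[of "heat u x" "u * heat_lap \<sigma> x"] by (simp add: abs_mult)
        also have "\<dots> \<le> M + \<bar>u\<bar> * M" using that ts by (intro add_mono h0 mult_left_mono h2) auto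
        finally show ?thesis .
      qed
      show "\<bar>heat \<tau> (y p - z) - \<tau> * heat_lap \<sigma> (y p - z)\<bar> \<le> M + \<bar>\<tau>\<bar> * M" for p using ts by (intro bb)
      show "\<bar>heat \<sigma> (y p - z) - \<sigma> * heat_lap \<sigma> (y p - z)\<bar> \<le> M + \<bar>\<sigma>\<bar> * M" for p using ts by (intro bb)
    qed measurable
    finally show ?thesis .
  qed
  have step: "a \<tau> v - a \<tau> u = (LINT r:{u<..<v}|lborel. b \<tau> r + A \<tau> r) \<and> set_integrable lborel {u<..<v} (\<lambda>r. b \<tau> r + A \<tau> r)"
    if uv: "0 < u" "u \<le> v" "v < t" and \<tau>: "\<delta> \<le> \<tau>" "\<tau> \<le> \<delta> + t" for u v \<tau>
  proof -
    have \<tau>0: "0 < \<tau>" using \<tau> \<delta> by simp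
    obtain C where C: "C2_bounded C (\<lambda>x. heat \<tau> (x - z))" by (rule heat_C2_bounded[OF \<tau>0])
    have eq: "(\<integral>p. (\<Sum>e\<in>Basis. (V r p \<bullet> e) * dd e (\<lambda>x. heat \<tau> (x - z)) (y p)
        + dd e (dd e (\<lambda>x. heat \<tau> (x - z))) (y p)) \<partial>N r) = b \<tau> r + A \<tau> r" for r
    proof -
      have "(\<Sum>e\<in>Basis. (V r p \<bullet> e) * dd e (\<lambda>x. heat \<tau> (x - z)) (y p) + dd e (dd e (\<lambda>x. heat \<tau> (x - z))) (y p))
        = heat_grad \<tau> (y p - z) \<bullet> V r p + heat_lap \<tau> (y p - z)" for p
      proof -
        have "heat_lap \<tau> (y p - z) = (\<Sum>e\<in>Basis. dd e (dd e (\<lambda>x. heat \<tau> (x - z))) (y p))"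
          using lap_heat[OF \<tau>0, of z "y p"] unfolding lap_def by simp
        moreover have "heat_grad \<tau> (y p - z) \<bullet> V r p = (\<Sum>e\<in>Basis. (V r p \<bullet> e) * dd e (\<lambda>x. heat \<tau> (x - z)) (y p))"
          unfolding dd_heat[OF \<tau>0] by (subst euclidean_inner) (simp only: mult.commute)
        ultimately show ?thesis unfolding sum.distrib by simp
      qed
      then show ?thesis
        unfolding b_def A_def
        using integrable_N[OF m0(3) b_bd[OF \<tau>]] integrable_N[OF m0(2) h2[OF \<tau>]] by simp
    qed
    have "v < T" using uv t by simp
    from weak[unfolded drift_diffusion_def Let_def, rule_format, OF uv(1,2) this C, unfolded eq]
    show ?thesis by (simp add: a_def)
  qed
  have A_cont: "continuous_on {0..T} (A \<tau>)" and a_cont: "continuous_on {0..T} (a \<tau>)" if \<tau>: "\<delta> \<le> \<tau>" "\<tau> \<le> \<delta> + t" for \<tau>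
  proof -
    have l: "M-lipschitz_on UNIV (\<lambda>x. heat_lap \<tau> (x - z))" "M-lipschitz_on UNIV (\<lambda>x. heat \<tau> (x - z))"
    proof -
      have "dist (heat_lap \<tau> (x - z)) (heat_lap \<tau> (x' - z)) \<le> M * dist x x'"
        "dist (heat \<tau> (x - z)) (heat \<tau> (x' - z)) \<le> M * dist x x'" for x x'
        using h5[OF \<tau>, of "x - z" "x' - z"] h6[OF \<tau>, of "x - z" "x' - z"] by (simp_all add: dist_norm)
      then show "M-lipschitz_on UNIV (\<lambda>x. heat_lap \<tau> (x - z))" "M-lipschitz_on UNIV (\<lambda>x. heat \<tau> (x - z))"
        using M by (simp_all add: lipschitz_on_def)
    qed
    show "continuous_on {0..T} (A \<tau>)" unfolding A_def[abs_def] by (rule N_cont[OF l(1) h2[OF \<tau>]])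
    show "continuous_on {0..T} (a \<tau>)" unfolding a_def[abs_def] by (rule N_cont[OF l(2) h0[OF \<tau>]])
  qed
  \<comment> \<open>All errors are quadratic in the length of the interval except for
    \<open>e\<close>, the oscillation of the Laplacian pairing about \<open>s0\<close>. Allowing
    \<open>s0\<close> to be either endpoint serves the difference quotients from both sides.\<close>
  have incr: "\<bar>H v - H u\<bar> \<le> (v - u) * (M * B * (v - u) + 4 * M * (v - u) + 2 * e)"
    if uv: "0 < u" "u \<le> v" "v < t" and s0: "s0 \<in> {u, v}" and e: "\<And>r. r \<in> {u..v} \<Longrightarrow> \<bar>A (\<theta> s0) r - A (\<theta> s0) s0\<bar> \<le> e"
    for u v s0 e
  proof -
    have in0: "u \<in> {0..t}" "v \<in> {0..t}" "s0 \<in> {0..t}" using uv s0 by auto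
    have s0u: "\<bar>s0 - u\<bar> \<le> v - u" "\<bar>s0 - v\<bar> \<le> v - u" using s0 uv by auto
    note \<theta>u = \<theta>[OF in0(1)] and \<theta>v = \<theta>[OF in0(2)] and \<theta>s = \<theta>[OF in0(3)]
    note st = step[OF uv \<theta>v(1,2)]
    define A0 where "A0 = A (\<theta> s0) s0"
    have A_near: "\<bar>A \<tau> r - A0\<bar> \<le> M * (v - u) + e" if "\<tau> \<in> {\<theta> u, \<theta> v}" "r \<in> {u..v}" for \<tau> r
    proof -
      have "\<bar>A \<tau> r - A (\<theta> s0) r\<bar> \<le> M * \<bar>\<tau> - \<theta> s0\<bar>"
        using that(1) \<theta>u \<theta>v \<theta>s by (intro A_lip) auto
      also have "\<dots> \<le> M * (v - u)"
        using that(1) s0u M by (intro mult_left_mono) (auto simp: \<theta>_def)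
      finally show ?thesis using e[OF that(2)] unfolding A0_def by linarith
    qed
    define g where "g r = (b (\<theta> v) r - c r) + (A (\<theta> v) r - A0)" for r
    have sc: "set_integrable lborel {u<..<v} c" by (rule ci(2)[OF uv(2)])
    have sA: "set_integrable lborel {u<..<v} (\<lambda>r. A0)" by (simp add: set_integrable_def uv)
    have g_eq: "g r = (b (\<theta> v) r + A (\<theta> v) r) - (c r + A0)" for r by (simp add: g_def)
    have sg: "set_integrable lborel {u<..<v} g"
      unfolding g_eq[abs_def] by (rule set_integral_diff(1)[OF conjunct2[OF st] set_integral_add(1)[OF sc sA]])
    have Ig: "(LINT r:{u<..<v}|lborel. g r) = (a (\<theta> v) v - a (\<theta> v) u) - ((LINT r:{u<..<v}|lborel. c r) + (v - u) * A0)"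
    proof -
      have "(LINT r:{u<..<v}|lborel. g r) = (LINT r:{u<..<v}|lborel. b (\<theta> v) r + A (\<theta> v) r) - ((LINT r:{u<..<v}|lborel. c r) + (LINT r:{u<..<v}|lborel. A0))"
        unfolding g_eq set_integral_diff(2)[OF conjunct2[OF st] set_integral_add(1)[OF sc sA]] set_integral_add(2)[OF sc sA] ..
      also have "(LINT r:{u<..<v}|lborel. A0) = (v - u) * A0"
        using uv by (simp add: set_lebesgue_integral_def)
      finally show ?thesis using st by simp
    qed
    have g_bd: "\<bar>g r\<bar> \<le> M * B * (v - u) + (M * (v - u) + e)" if r: "r \<in> {u<..<v}" for r
    proof -
      have r': "r \<in> {0..t}" "r \<in> {u..v}" using r uv by auto
      have "\<bar>b (\<theta> v) r - c r\<bar> \<le> M * \<bar>\<theta> v - \<theta> r\<bar> * B"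
        unfolding c_def clamp_time_id[OF r'(1)] \<theta>_def[symmetric] using \<theta>v \<theta>[OF r'(1)] by (intro b_lip) auto
      also have "\<dots> \<le> M * (v - u) * B"
        using r M B_nonneg by (intro mult_right_mono mult_left_mono) (auto simp: \<theta>_def)
      finally show ?thesis using A_near[of "\<theta> v" r] r' unfolding g_def by (simp add: mult_ac)
    qed
    have "\<bar>LINT r:{u<..<v}|lborel. g r\<bar> \<le> (\<integral>r. \<bar>indicator {u<..<v} r *\<^sub>R g r\<bar> \<partial>lborel)"
      unfolding set_lebesgue_integral_def by (rule integral_abs_bound)
    also have "\<dots> \<le> (\<integral>r. indicator {u<..<v} r * (M * B * (v - u) + (M * (v - u) + e)) \<partial>lborel)"
    proof (rule integral_mono)
      show "integrable lborel (\<lambda>r. \<bar>indicator {u<..<v} r *\<^sub>R g r\<bar>)"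
        using sg unfolding set_integrable_def by (rule integrable_abs)
      show "integrable lborel (\<lambda>r. indicator {u<..<v} r * (M * B * (v - u) + (M * (v - u) + e)))"
        using uv by (intro integrable_mult_left integrable_real_indicator) auto
    qed (use g_bd in \<open>auto simp: indicator_def\<close>)
    also have "\<dots> = (v - u) * (M * B * (v - u) + (M * (v - u) + e))" using uv by simp
    finally have 1: "\<bar>LINT r:{u<..<v}|lborel. g r\<bar> \<le> (v - u) * (M * B * (v - u) + (M * (v - u) + e))" .
    have 2: "\<bar>a (\<theta> v) u - a (\<theta> u) u - (\<theta> v - \<theta> u) * A (\<theta> u) u\<bar> \<le> M * \<bar>\<theta> v - \<theta> u\<bar> * \<bar>\<theta> v - \<theta> u\<bar>"
      using \<theta>u \<theta>v by (intro a_taylor) auto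
    have \<theta>d: "\<theta> v - \<theta> u = - (v - u)" by (simp add: \<theta>_def)
    have 3: "\<bar>(v - u) * (A (\<theta> u) u - A0)\<bar> \<le> (v - u) * (M * (v - u) + e)"
      using A_near[of "\<theta> u" u] uv by (simp add: abs_mult mult_left_mono)
    \<comment> \<open>Three errors: the evolution over the interval with the kernel frozen at time
      \<open>\<theta> v\<close>, the Taylor remainder in the kernel time, and the variation of the
      Laplacian pairing from the reference value \<open>A0\<close>.\<close>
    have "H v - H u = (LINT r:{u<..<v}|lborel. g r) + (a (\<theta> v) u - a (\<theta> u) u + (v - u) * A (\<theta> u) u)
      - (v - u) * (A (\<theta> u) u - A0)"
      unfolding H_def Ig using ci(4)[OF uv(2)] uv by (simp add: algebra_simps)
    moreover have "\<bar>a (\<theta> v) u - a (\<theta> u) u + (v - u) * A (\<theta> u) u\<bar> \<le> M * (v - u) * (v - u)"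
      using 2 uv unfolding \<theta>d by (simp add: algebra_simps)
    ultimately have "\<bar>H v - H u\<bar> \<le> (v - u) * (M * B * (v - u) + (M * (v - u) + e)) + M * (v - u) * (v - u) + (v - u) * (M * (v - u) + e)"
      using 1 3 by linarith
    also have "\<dots> = (v - u) * (M * B * (v - u) + 3 * M * (v - u) + 2 * e)"
      by (simp add: algebra_simps)
    also have "\<dots> \<le> (v - u) * (M * B * (v - u) + 4 * M * (v - u) + 2 * e)"
      using M uv by (intro mult_left_mono add_mono mult_right_mono) auto
    finally show ?thesis .
  qed
  have deriv: "(H has_real_derivative 0) (at s)" if s: "0 < s" "s < t" for s
  proof -
    have "\<exists>d>0. \<forall>x. x \<noteq> s \<and> \<bar>x - s\<bar> < d \<longrightarrow> \<bar>(H x - H s) / (x - s)\<bar> < e" if e: "0 < e" for e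
    proof -
      have sT: "s \<in> {0..t}" "s \<in> {0..T}" using s t by auto
      from A_cont[OF \<theta>(1,2)[OF sT(1)]] obtain d1 where d1: "0 < d1"
        "\<And>r. r \<in> {0..T} \<Longrightarrow> \<bar>r - s\<bar> < d1 \<Longrightarrow> \<bar>A (\<theta> s) r - A (\<theta> s) s\<bar> < e / 8"
        unfolding continuous_on_iff dist_real_def using sT e by (metis zero_less_divide_iff zero_less_numeral)
      define K where "K = M * B + 4 * M"
      have K: "0 < K" unfolding K_def using M B_nonneg by (intro add_nonneg_pos mult_nonneg_nonneg) auto
      \<comment> \<open>In the difference quotient the quadratic terms then contribute at most e / 4
        and the oscillation another e / 4, strictly less than \<open>e\<close>. The other entries of
        the minimum keep the interval inside the open time range and within the continuity radius
        \<open>d1\<close>.\<close>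
      define d where "d = min d1 (min (min s (t - s)) (e / (4 * K)))"
      have d: "0 < d" using d1 s e K by (simp add: d_def)
      moreover have "\<bar>(H x - H s) / (x - s)\<bar> < e" if x: "x \<noteq> s" "\<bar>x - s\<bar> < d" for x
      proof -
        define u v where "u = min x s" and "v = max x s"
        have dd: "d \<le> d1" "d \<le> s" "d \<le> t - s" "d \<le> e / (4 * K)" by (simp_all add: d_def)
        have uv: "0 < u" "u \<le> v" "v < t" "s \<in> {u, v}" "v - u = \<bar>x - s\<bar>"
          using x s dd by (auto simp: u_def v_def min_def max_def)
        have near: "\<bar>A (\<theta> s) r - A (\<theta> s) s\<bar> \<le> e / 8" if "r \<in> {u..v}" for r
        proof -
          have "\<bar>r - s\<bar> < d1" "r \<in> {0..T}" using that uv x t dd by auto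
          then show ?thesis using d1(2) by (intro less_imp_le) auto
        qed
        have "\<bar>H v - H u\<bar> \<le> (v - u) * (M * B * (v - u) + 4 * M * (v - u) + 2 * (e / 8))"
          by (rule incr[OF uv(1-4) near])
        also have "M * B * (v - u) + 4 * M * (v - u) = K * (v - u)" by (simp add: K_def algebra_simps)
        also have "(v - u) * (K * (v - u) + 2 * (e / 8)) < (v - u) * e"
        proof (rule mult_strict_left_mono)
          have "K * (v - u) \<le> K * (e / (4 * K))"
            using uv x K dd by (intro mult_left_mono) auto
          then show "K * (v - u) + 2 * (e / 8) < e" using K e by simp
          show "0 < v - u" using uv x by simp
        qed
        finally have "\<bar>H v - H u\<bar> < \<bar>x - s\<bar> * e" using uv by simp
        moreover have "\<bar>H v - H u\<bar> = \<bar>H x - H s\<bar>" by (auto simp: u_def v_def min_def max_def)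
        ultimately show ?thesis using x by (simp add: abs_divide divide_less_eq mult.commute)
      qed
      ultimately show ?thesis by blast
    qed
    then show ?thesis
      unfolding has_field_derivative_iff LIM_def dist_real_def by simp
  qed
  \<comment> \<open>The derivative is known to vanish only at interior times, because the weak
    equation excludes the endpoints. Continuity on the closed interval closes the gap.\<close>
  have "continuous_on {0..t} H"
    unfolding continuous_on_iff
  proof (intro ballI allI impI)
    fix s e :: real assume s: "s \<in> {0..t}" and e: "0 < e"
    then have sT: "s \<in> {0..T}" using t by auto
    have "0 < e / 2" using e by simp
    from a_cont[OF \<theta>(1,2)[OF s], unfolded continuous_on_iff dist_real_def, rule_format, OF sT this]
    obtain d1 where d1: "0 < d1"
      "\<And>r. r \<in> {0..T} \<Longrightarrow> \<bar>r - s\<bar> < d1 \<Longrightarrow> \<bar>a (\<theta> s) r - a (\<theta> s) s\<bar> < e / 2"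
      by auto
    define K where "K = M * B + M"
    have K: "0 < K"
      unfolding K_def
      by (rule add_nonneg_pos[OF mult_nonneg_nonneg[OF less_imp_le[OF M] B_nonneg] M])
    have a_lip: "\<bar>a \<tau> r - a \<sigma> r\<bar> \<le> M * \<bar>\<tau> - \<sigma>\<bar>"
      if ts: "\<delta> \<le> \<tau>" "\<tau> \<le> \<delta> + t" "\<delta> \<le> \<sigma>" "\<sigma> \<le> \<delta> + t" for \<tau> \<sigma> r
    proof -
      have hl: "\<bar>heat \<tau> x - heat \<sigma> x\<bar> \<le> M * \<bar>\<tau> - \<sigma>\<bar>" for x :: 'a
        by (rule heat_time_lipschitz[OF \<delta> h2 ts])
      show ?thesis unfolding a_def
        by (rule integral_diff_le[where C=M and D=M]) (use ts h0 m0 hl in auto)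
    qed
    show "\<exists>d>0. \<forall>x'\<in>{0..t}. dist x' s < d \<longrightarrow> dist (H x') (H s) < e"
    proof (intro exI[of _ "min d1 (e / (2 * K))"] conjI ballI impI)
      show "0 < min d1 (e / (2 * K))" using d1 e K by simp
      fix r assume r: "r \<in> {0..t}" "dist r s < min d1 (e / (2 * K))"
      then have r': "\<bar>r - s\<bar> < d1" "\<bar>r - s\<bar> < e / (2 * K)" by (auto simp: dist_real_def)
      have "\<bar>a (\<theta> r) r - a (\<theta> s) r\<bar> \<le> M * \<bar>\<theta> r - \<theta> s\<bar>" using \<theta>[OF r(1)] \<theta>[OF s] by (intro a_lip) auto
      then have 1: "\<bar>a (\<theta> r) r - a (\<theta> s) r\<bar> \<le> M * \<bar>r - s\<bar>" by (simp add: \<theta>_def abs_minus_commute)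
      have 2: "\<bar>a (\<theta> s) r - a (\<theta> s) s\<bar> < e / 2" using d1(2) r r' t by auto
      have 3: "\<bar>(LINT r:{0..r}|lborel. c r) - (LINT r:{0..s}|lborel. c r)\<bar> \<le> M * B * \<bar>r - s\<bar>"
      proof (cases "r \<le> s")
        case True
        then show ?thesis using ci(3)[OF True] ci(4)[OF True] r by (simp add: abs_minus_commute)
      next
        case False
        then have "s \<le> r" by simp
        then show ?thesis using ci(3)[OF \<open>s \<le> r\<close>] ci(4)[OF \<open>s \<le> r\<close>] s by simp
      qed
      have "K * \<bar>r - s\<bar> < K * (e / (2 * K))" using r'(2) K by (intro mult_strict_left_mono)
      moreover have "K * (e / (2 * K)) = e / 2" using K by simp
      moreover have "K * \<bar>r - s\<bar> = M * B * \<bar>r - s\<bar> + M * \<bar>r - s\<bar>"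
        unfolding K_def by (rule distrib_right)
      ultimately have "M * B * \<bar>r - s\<bar> + M * \<bar>r - s\<bar> < e / 2" by linarith
      then show "dist (H r) (H s) < e" using 1 2 3 unfolding H_def dist_real_def by linarith
    qed
  qed
  then have "H t = H 0"
    using deriv t0 by (intro DERIV_isconst_end) auto
  moreover have "(LINT r:{0..0}|lborel. c r) = 0"
  proof -
    have "AE r in lborel. indicator {0..0} r *\<^sub>R c r = 0"
      using AE_lborel_singleton[of "0::real"] by eventually_elim (auto simp: indicator_def)
    then show ?thesis unfolding set_lebesgue_integral_def by (rule integral_eq_zero_AE)
  qed
  ultimately show ?thesis
    by (simp add: H_def a_def c_def b_def \<theta>_def)
qed

end

section \<open>The heat flow of a bounded function and the dual Duhamel formula\<close>

lemma heat_uniform_bounds: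
  assumes "0 < \<delta>" "\<delta> \<le> D"
  shows "\<exists>M>0. \<forall>\<tau> x::'a::euclidean_space. \<delta> \<le> \<tau> \<longrightarrow> \<tau> \<le> D \<longrightarrow> \<bar>heat \<tau> x\<bar> \<le> M \<and> norm (heat_grad \<tau> x) \<le> M"
proof (rule heat_regularity[OF assms, where 'a='a])
  fix M :: real
  assume M: "0 < M" and h: "\<And>\<tau> x::'a. \<delta> \<le> \<tau> \<Longrightarrow> \<tau> \<le> D \<Longrightarrow> \<bar>heat \<tau> x\<bar> \<le> M"
    "\<And>\<tau> x::'a. \<delta> \<le> \<tau> \<Longrightarrow> \<tau> \<le> D \<Longrightarrow> norm (heat_grad \<tau> x) \<le> M"
  show ?thesis by (rule exI[of _ M]) (use M h in simp)
qed

definition heat_conv :: "('a::euclidean_space \<Rightarrow> real) \<Rightarrow> real \<Rightarrow> 'a \<Rightarrow> real" where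
  "heat_conv h \<tau> x = (\<integral>z. h z * heat \<tau> (x - z) \<partial>lborel)"

text \<open>The gradient of the heat flow with the derivative placed on the kernel. It appears in
  exactly this form when \<open>mild_pointwise\<close> is integrated against
  \<open>h\<close>.\<close>

definition heat_conv_grad :: "('a::euclidean_space \<Rightarrow> real) \<Rightarrow> real \<Rightarrow> 'a \<Rightarrow> 'a" where
  "heat_conv_grad h \<tau> x = (\<integral>z. h z *\<^sub>R heat_grad \<tau> (x - z) \<partial>lborel)"

lemma heat_conv_borel:
  assumes [measurable]: "h \<in> borel_measurable borel"
  shows "heat_conv h \<tau> \<in> borel_measurable borel" "heat_conv_grad h \<tau> \<in> borel_measurable borel"
  unfolding heat_conv_def[abs_def] heat_conv_grad_def[abs_def]
  by (rule lborel.borel_measurable_lebesgue_integral, measurable)+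

lemma heat_conv_abs_le:
  fixes h :: "'a::euclidean_space \<Rightarrow> real"
  assumes [measurable]: "h \<in> borel_measurable borel" and h: "\<And>x. \<bar>h x\<bar> \<le> 1" and \<tau>: "0 < \<tau>"
  shows "\<bar>heat_conv h \<tau> x\<bar> \<le> 1"
proof -
  note i = heat_integral[OF \<tau>, of x]
  have le: "\<bar>h z * heat \<tau> (x - z)\<bar> \<le> heat \<tau> (x - z)" for z
    using mult_right_mono[OF h[of z] heat_nonneg[of \<tau> "x - z"]] by (simp add: abs_mult heat_nonneg)
  have ih: "integrable lborel (\<lambda>z. h z * heat \<tau> (x - z))"
  proof (rule Bochner_Integration.integrable_bound[OF i(1)])
    show "AE z in lborel. norm (h z * heat \<tau> (x - z)) \<le> norm (heat \<tau> (x - z))"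
      using le by (simp add: heat_nonneg)
  qed measurable
  have "\<bar>heat_conv h \<tau> x\<bar> \<le> (\<integral>z. \<bar>h z * heat \<tau> (x - z)\<bar> \<partial>lborel)"
    unfolding heat_conv_def by (rule integral_abs_bound)
  also have "\<dots> \<le> (\<integral>z. heat \<tau> (x - z) \<partial>lborel)"
    by (rule integral_mono[OF integrable_abs[OF ih] i(1) le])
  finally show ?thesis using i(2) by simp
qed

lemma heat_conv_grad_norm_le:
  obtains C where "0 < C" "\<And>h \<tau> (x::'a::euclidean_space). h \<in> borel_measurable borel \<Longrightarrow> (\<And>x. \<bar>h x\<bar> \<le> 1) \<Longrightarrow> 0 < \<tau>
    \<Longrightarrow> norm (heat_conv_grad h \<tau> x) \<le> C / sqrt \<tau>"
proof -
  obtain C where C: "0 < C"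
    "\<And>\<tau> x. 0 < \<tau> \<Longrightarrow> integrable lborel (\<lambda>z::'a. norm (heat_grad \<tau> (x - z)))
      \<and> (\<integral>z. norm (heat_grad \<tau> (x - z)) \<partial>lborel) \<le> C / sqrt \<tau>"
    using heat_grad_integral[where 'a='a] by blast
  have "norm (heat_conv_grad h \<tau> x) \<le> C / sqrt \<tau>"
    if [measurable]: "h \<in> borel_measurable borel" and h: "\<And>x. \<bar>h x\<bar> \<le> 1" and \<tau>: "0 < \<tau>"
    for h \<tau> and x :: 'a
  proof -
    have i: "integrable lborel (\<lambda>z::'a. norm (heat_grad \<tau> (x - z)))" using C(2)[OF \<tau>] by blast
    have le: "norm (h z *\<^sub>R heat_grad \<tau> (x - z)) \<le> norm (heat_grad \<tau> (x - z))" for z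
      using mult_right_mono[OF h[of z] norm_ge_zero[of "heat_grad \<tau> (x - z)"]] by simp
    have ih: "integrable lborel (\<lambda>z. h z *\<^sub>R heat_grad \<tau> (x - z))"
    proof (rule Bochner_Integration.integrable_bound[OF i])
      show "AE z in lborel. norm (h z *\<^sub>R heat_grad \<tau> (x - z)) \<le> norm (norm (heat_grad \<tau> (x - z)))"
        using le by simp
    qed measurable
    have "norm (heat_conv_grad h \<tau> x) \<le> (\<integral>z. norm (h z *\<^sub>R heat_grad \<tau> (x - z)) \<partial>lborel)"
      unfolding heat_conv_grad_def by (rule integral_norm_bound)
    also have "\<dots> \<le> (\<integral>z. norm (heat_grad \<tau> (x - z)) \<partial>lborel)"
      by (rule integral_mono[OF integrable_norm[OF ih] i le])
    also have "\<dots> \<le> C / sqrt \<tau>" using C(2)[OF \<tau>] by blast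
    finally show ?thesis .
  qed
  with C(1) show thesis by (rule that)
qed

lemma heat_conv_tendsto:
  fixes h :: "'a::euclidean_space \<Rightarrow> real"
  assumes cont: "continuous_on UNIV h" and h: "\<And>x. \<bar>h x\<bar> \<le> 1"
  shows "(\<lambda>n. heat_conv h (1 / real (Suc n)) x) \<longlonglongrightarrow> h x"
proof -
  have [measurable]: "h \<in> borel_measurable borel" by (rule borel_measurable_continuous_onI[OF cont])
  have "(\<lambda>n. \<integral>w. h (x + sqrt (1 / real (Suc n)) *\<^sub>R w) * heat 1 w \<partial>lborel) \<longlonglongrightarrow> (\<integral>w. h x * heat 1 (w::'a) \<partial>lborel)"
  proof (rule integral_dominated_convergence[where w="heat 1 :: 'a \<Rightarrow> real"])
    show "integrable lborel (heat 1 :: 'a \<Rightarrow> real)" by (rule heat_1_integral)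
    have "(\<lambda>n. h (x + sqrt (1 / real (Suc n)) *\<^sub>R w) * heat 1 w) \<longlonglongrightarrow> h x * heat 1 w" for w
    proof -
      have "(\<lambda>n. x + sqrt (1 / real (Suc n)) *\<^sub>R w) \<longlonglongrightarrow> x + sqrt 0 *\<^sub>R w"
        using LIMSEQ_inverse_real_of_nat by (intro tendsto_intros) (simp add: inverse_eq_divide)
      then have "(\<lambda>n. h (x + sqrt (1 / real (Suc n)) *\<^sub>R w)) \<longlonglongrightarrow> h (x + sqrt 0 *\<^sub>R w)"
        using cont continuous_on_tendsto_compose[OF cont] by simp
      from tendsto_mult_right[OF this, of "heat 1 w"] show ?thesis by simp
    qed
    then show "AE w in lborel. (\<lambda>n. h (x + sqrt (1 / real (Suc n)) *\<^sub>R w) * heat 1 w) \<longlonglongrightarrow> h x * heat 1 w" by simp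
    have "norm (h v * heat 1 w) \<le> heat 1 w" for v w :: 'a
      using mult_right_mono[OF h[of v] heat_nonneg[of 1 w]] by (simp add: abs_mult heat_nonneg)
    then show "AE w in lborel. norm (h (x + sqrt (1 / real (Suc n)) *\<^sub>R w) * heat 1 w) \<le> heat 1 w" for n by simp
  qed measurable
  moreover have "heat_conv h (1 / real (Suc n)) x = (\<integral>w. h (x + sqrt (1 / real (Suc n)) *\<^sub>R w) * heat 1 w \<partial>lborel)" for n
    unfolding heat_conv_def by (rule heat_convolution) simp_all
  moreover have "(\<integral>w. h x * heat 1 (w::'a) \<partial>lborel) = h x"
    unfolding integral_mult_right_zero heat_1_integral(2) by simp
  ultimately show ?thesis by (simp only:)
qed

lemma Fubini_bounded_kernel_integrable:
  fixes h :: "'a::euclidean_space \<Rightarrow> real" and k :: "'a \<Rightarrow> 'c \<Rightarrow> real"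
  assumes Q: "sigma_finite_measure Q" and h: "integrable lborel h" and w: "integrable Q w"
    and k: "(\<lambda>(z, q). k z q) \<in> borel_measurable (lborel \<Otimes>\<^sub>M Q)"
    and kw: "\<And>z q. q \<in> space Q \<Longrightarrow> \<bar>k z q\<bar> \<le> w q"
  shows "integrable lborel (\<lambda>z. h z * (\<integral>q. k z q \<partial>Q))"
proof (rule Bochner_Integration.integrable_bound)
  interpret Q: sigma_finite_measure Q by (rule Q)
  note [measurable] = borel_measurable_integrable[OF h] k
  show "integrable lborel (\<lambda>z. \<bar>h z\<bar> * (\<integral>q. w q \<partial>Q))" using h by simp
  have "(\<lambda>z. \<integral>q. k z q \<partial>Q) \<in> borel_measurable lborel"
    by (rule Q.borel_measurable_lebesgue_integral) (rule k)
  then show "(\<lambda>z. h z * (\<integral>q. k z q \<partial>Q)) \<in> borel_measurable lborel" by measurable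
  have kQ: "\<bar>\<integral>q. k z q \<partial>Q\<bar> \<le> (\<integral>q. w q \<partial>Q)" for z
  proof (rule order_trans[OF integral_abs_bound])
    have km: "k z \<in> borel_measurable Q"
      using measurable_compose[OF measurable_Pair1'[of z lborel Q] k] by simp
    have "integrable Q (k z)"
      by (rule Bochner_Integration.integrable_bound[OF w km])
        (auto intro!: AE_I2 order_trans[OF kw abs_ge_self])
    then show "(\<integral>q. \<bar>k z q\<bar> \<partial>Q) \<le> (\<integral>q. w q \<partial>Q)"
      using w kw by (intro integral_mono) auto
  qed
  have "norm (h z * (\<integral>q. k z q \<partial>Q)) \<le> norm (\<bar>h z\<bar> * (\<integral>q. w q \<partial>Q))" for z
  proof -
    have "norm (h z * (\<integral>q. k z q \<partial>Q)) \<le> \<bar>h z\<bar> * (\<integral>q. w q \<partial>Q)"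
      unfolding real_norm_def abs_mult by (rule mult_left_mono) (simp_all add: kQ)
    also have "\<dots> \<le> norm (\<bar>h z\<bar> * (\<integral>q. w q \<partial>Q))" by simp
    finally show ?thesis .
  qed
  then show "AE z in lborel. norm (h z * (\<integral>q. k z q \<partial>Q)) \<le> norm (\<bar>h z\<bar> * (\<integral>q. w q \<partial>Q))" by simp
qed

lemma test_fun_integrable:
  assumes "test_fun h" shows "integrable lborel h"
proof -
  obtain R where R: "\<And>x. h x \<noteq> 0 \<Longrightarrow> norm x \<le> R" using test_funE[OF assms] by blast
  obtain C where C: "0 \<le> C" "\<And>x. \<bar>h x\<bar> \<le> C" using test_fun_bounded[OF assms] by blast
  show ?thesis
  proof (rule Bochner_Integration.integrable_bound)
    show "integrable lborel (\<lambda>x. indicator (cball 0 R) x * C)"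
      by (intro integrable_mult_left integrable_real_indicator) (use emeasure_bounded_finite[OF bounded_cball] in \<open>auto simp: less_top\<close>)
    show "h \<in> borel_measurable lborel" using smooth_borel[OF test_fun_smooth[OF assms]] by simp
    have "norm (h x) \<le> norm (indicator (cball 0 R) x * C)" for x
      using R[of x] C(2)[of x] C(1) by (cases "h x = 0") auto
    then show "AE x in lborel. norm (h x) \<le> norm (indicator (cball 0 R) x * C)" by simp
  qed
qed

context drift_curve
begin

text \<open>The formula for single kernels is integrated over their centres \<open>z\<close> with
  weight \<open>h\<close>. Fubini moves this integral inside the measures and inside the time
  integral; constant majorants are available because \<open>\<delta>\<close> is positive.\<close>

lemma mild_dual:
  assumes h: "test_fun h" and \<delta>: "0 < \<delta>" and t: "0 \<le> t" "t \<le> T"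
  shows "(\<integral>p. heat_conv h \<delta> (y p) \<partial>N t) = (\<integral>p. heat_conv h (\<delta> + t) (y p) \<partial>N 0)
    + (LINT r:{0..t}|lborel. \<integral>p. heat_conv_grad h (\<delta> + t - clamp_time t r) (y p) \<bullet> V r p \<partial>N r)"
    and "set_integrable lborel {0..t} (\<lambda>r. \<integral>p. heat_conv_grad h (\<delta> + t - clamp_time t r) (y p) \<bullet> V r p \<partial>N r)"
proof -
  have \<delta>t: "\<delta> \<le> \<delta> + t" using t by simp
  obtain M where M: "0 < M"
    and h0: "\<And>\<tau> x::'a. \<delta> \<le> \<tau> \<Longrightarrow> \<tau> \<le> \<delta> + t \<Longrightarrow> \<bar>heat \<tau> x\<bar> \<le> M"
    and h1: "\<And>\<tau> x::'a. \<delta> \<le> \<tau> \<Longrightarrow> \<tau> \<le> \<delta> + t \<Longrightarrow> norm (heat_grad \<tau> x) \<le> M"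
    using heat_uniform_bounds[OF \<delta> \<delta>t, where 'a='a] by blast
  define \<theta> where "\<theta> r = \<delta> + t - clamp_time t r" for r
  have \<theta>: "\<delta> \<le> \<theta> r" "\<theta> r \<le> \<delta> + t" for r using clamp_time_in[OF t(1), of r] by (auto simp: \<theta>_def)
  have [measurable]: "\<theta> \<in> borel_measurable borel"
    unfolding \<theta>_def[abs_def] clamp_time_def[abs_def] by measurable
  have hi: "integrable lborel h" by (rule test_fun_integrable[OF h])
  have hm [measurable]: "h \<in> borel_measurable borel" by (rule smooth_borel[OF test_fun_smooth[OF h]])
  define k where "k z r p = heat_grad (\<theta> r) (y p - z) \<bullet> V r p" for z r p
  define c where "c z r = (\<integral>p. k z r p \<partial>N r)" for z r
  have k_bd: "\<bar>k z r p\<bar> \<le> M * B" for z r p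
    unfolding k_def by (rule order_trans[OF Cauchy_Schwarz_ineq2]) (intro mult_mono h1 V_bound \<theta>, use M in auto)
  have kN: "(\<lambda>(z, p). k z r p) \<in> borel_measurable (lborel \<Otimes>\<^sub>M N r)"
    and hN: "(\<lambda>(z, p). heat \<tau> (y p - z)) \<in> borel_measurable (lborel \<Otimes>\<^sub>M N r)" for r \<tau>
  proof -
    have s: "sets (lborel \<Otimes>\<^sub>M N r) = sets (borel \<Otimes>\<^sub>M borel)"
      by (rule sets_pair_measure_cong) (simp_all add: N_sets)
    have "(\<lambda>(z, p). k z r p) \<in> borel_measurable (borel \<Otimes>\<^sub>M borel)"
      unfolding k_def by measurable
    then show "(\<lambda>(z, p). k z r p) \<in> borel_measurable (lborel \<Otimes>\<^sub>M N r)"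
      unfolding measurable_cong_sets[OF s refl] .
    have "(\<lambda>(z, p). heat \<tau> (y p - z)) \<in> borel_measurable (borel \<Otimes>\<^sub>M borel)"
      by measurable
    then show "(\<lambda>(z, p). heat \<tau> (y p - z)) \<in> borel_measurable (lborel \<Otimes>\<^sub>M N r)"
      unfolding measurable_cong_sets[OF s refl] .
  qed
  have sf: "sigma_finite_measure (N r)" and ic: "integrable (N r) (\<lambda>_. C)" for r and C :: real
  proof -
    interpret prob_space "N r" by (rule N_prob)
    show "sigma_finite_measure (N r)" by unfold_locales
    show "integrable (N r) (\<lambda>_. C)" by simp
  qed
  have F1: "(\<integral>z. h z * (\<integral>p. heat \<tau> (y p - z) \<partial>N r) \<partial>lborel) = (\<integral>p. heat_conv h \<tau> (y p) \<partial>N r)"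
    and F1i: "integrable lborel (\<lambda>z. h z * (\<integral>p. heat \<tau> (y p - z) \<partial>N r))"
    if "\<delta> \<le> \<tau>" "\<tau> \<le> \<delta> + t" for \<tau> r
    unfolding heat_conv_def
    by (rule Fubini_bounded_kernel(1)[OF sf hi ic hN h0[OF that]])
      (rule Fubini_bounded_kernel_integrable[OF sf hi ic hN h0[OF that]])
  have F2: "(\<integral>z. h z * c z r \<partial>lborel) = (\<integral>p. heat_conv_grad h (\<theta> r) (y p) \<bullet> V r p \<partial>N r)" for r
  proof -
    have "(\<integral>z. h z * k z r p \<partial>lborel) = heat_conv_grad h (\<theta> r) (y p) \<bullet> V r p" for p
    proof -
      have "integrable lborel (\<lambda>z. h z *\<^sub>R heat_grad (\<theta> r) (y p - z))"
      proof (rule Bochner_Integration.integrable_bound)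
        show "integrable lborel (\<lambda>z. M * h z)" using hi by simp
        have "norm (h z *\<^sub>R heat_grad (\<theta> r) (y p - z)) \<le> norm (M * h z)" for z
          using mult_left_mono[OF h1[OF \<theta>, of r "y p - z"] abs_ge_zero[of "h z"]] M
          by (simp add: abs_mult mult.commute)
        then show "AE z in lborel. norm (h z *\<^sub>R heat_grad (\<theta> r) (y p - z)) \<le> norm (M * h z)" by simp
      qed measurable
      from integral_inner_left[OF this, of "V r p"] show ?thesis
        unfolding heat_conv_grad_def k_def by simp
    qed
    moreover have "(\<integral>z. h z * c z r \<partial>lborel) = (\<integral>p. (\<integral>z. h z * k z r p \<partial>lborel) \<partial>N r)"
      unfolding c_def by (rule Fubini_bounded_kernel(1)[OF sf hi ic kN k_bd])
    ultimately show ?thesis by simp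
  qed
  have c_bd: "\<bar>indicator {0..t} r * c z r\<bar> \<le> indicator {0..t} r * (M * B)" for z r
  proof -
    have "k z r \<in> borel_measurable borel" unfolding k_def[abs_def] by measurable
    from integral_abs_le[OF this k_bd] show ?thesis by (simp add: c_def indicator_def)
  qed
  have c_m: "(\<lambda>(z, r). indicator {0..t} r * c z r) \<in> borel_measurable (lborel \<Otimes>\<^sub>M lborel)"
  proof -
    have s: "sets (lborel \<Otimes>\<^sub>M lborel) = sets (borel \<Otimes>\<^sub>M borel)"
      by (rule sets_pair_measure_cong) simp_all
    have L: "(\<lambda>q. N (snd q)) \<in> (borel :: 'a measure) \<Otimes>\<^sub>M (borel :: real measure) \<rightarrow>\<^sub>M subprob_algebra borel"
      by (rule measurable_compose[OF measurable_snd N_subprob])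
    have Vm: "(\<lambda>q. V (snd (fst q)) (snd q)) \<in> borel_measurable (((borel :: 'a measure) \<Otimes>\<^sub>M borel) \<Otimes>\<^sub>M borel)"
    proof -
      have "(\<lambda>q. (snd (fst q), snd q)) \<in> ((borel :: 'a measure) \<Otimes>\<^sub>M (borel :: real measure)) \<Otimes>\<^sub>M (borel :: 'b measure) \<rightarrow>\<^sub>M borel \<Otimes>\<^sub>M borel"
        by measurable
      from measurable_compose[OF this V_borel] show ?thesis by simp
    qed
    have hm: "(\<lambda>q. heat_grad (\<theta> (snd (fst q))) (y (snd q) - fst (fst q))) \<in> borel_measurable (((borel :: 'a measure) \<Otimes>\<^sub>M borel) \<Otimes>\<^sub>M borel)"
    proof -
      have "(\<lambda>q. (\<theta> (snd (fst q)), y (snd q) - fst (fst q))) \<in> ((borel :: 'a measure) \<Otimes>\<^sub>M (borel :: real measure)) \<Otimes>\<^sub>M (borel :: 'b measure) \<rightarrow>\<^sub>M borel \<Otimes>\<^sub>M borel"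
        by measurable
      from measurable_compose[OF this heat_joint_measurable(2)] show ?thesis by simp
    qed
    have "(\<lambda>q. \<integral>p. k (fst q) (snd q) p \<partial>N (snd q)) \<in> borel_measurable ((borel :: 'a measure) \<Otimes>\<^sub>M borel)"
    proof (rule integral_measurable_kernel[OF _ L])
      show "(\<lambda>(q, p). k (fst q) (snd q) p) \<in> borel_measurable (((borel :: 'a measure) \<Otimes>\<^sub>M borel) \<Otimes>\<^sub>M borel)"
        unfolding k_def case_prod_beta using hm Vm by (rule borel_measurable_inner)
    qed
    then have "(\<lambda>(z, r). indicator {0..t} r * c z r) \<in> borel_measurable (borel \<Otimes>\<^sub>M borel)"
      unfolding c_def case_prod_beta by measurable
    then show ?thesis unfolding measurable_cong_sets[OF s refl] .
  qed
  have wi: "integrable lborel (\<lambda>r. indicator {0..t} r * (M * B))"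
    using t by (intro integrable_mult_left integrable_real_indicator) auto
  have sl: "sigma_finite_measure (lborel :: real measure)" by unfold_locales
  have F3: "(\<integral>z. h z * (\<integral>r. indicator {0..t} r * c z r \<partial>lborel) \<partial>lborel)
      = (\<integral>r. (\<integral>z. h z * (indicator {0..t} r * c z r) \<partial>lborel) \<partial>lborel)"
    by (rule Fubini_bounded_kernel(1)[OF sl hi wi c_m c_bd])
  have F3i: "integrable lborel (\<lambda>z. h z * (\<integral>r. indicator {0..t} r * c z r \<partial>lborel))"
    by (rule Fubini_bounded_kernel_integrable[OF sl hi wi c_m c_bd])
  have F3': "(\<integral>z. h z * (indicator {0..t} r * c z r) \<partial>lborel)
    = indicator {0..t} r *\<^sub>R (\<integral>p. heat_conv_grad h (\<theta> r) (y p) \<bullet> V r p \<partial>N r)" for r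
    unfolding F2[symmetric] by (simp add: indicator_def)
  have pw: "h z * (\<integral>p. heat \<delta> (y p - z) \<partial>N t) = h z * (\<integral>p. heat (\<delta> + t) (y p - z) \<partial>N 0)
      + h z * (\<integral>r. indicator {0..t} r * c z r \<partial>lborel)" for z
    unfolding mild_pointwise[OF \<delta> t, of z] set_lebesgue_integral_def c_def k_def \<theta>_def
    by (simp add: distrib_left)
  have "(\<integral>p. heat_conv h \<delta> (y p) \<partial>N t) = (\<integral>z. h z * (\<integral>p. heat \<delta> (y p - z) \<partial>N t) \<partial>lborel)"
    by (rule F1[symmetric]) (use t in auto)
  also have "\<dots> = (\<integral>z. h z * (\<integral>p. heat (\<delta> + t) (y p - z) \<partial>N 0) \<partial>lborel)
      + (\<integral>z. h z * (\<integral>r. indicator {0..t} r * c z r \<partial>lborel) \<partial>lborel)"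
    unfolding pw by (rule Bochner_Integration.integral_add[OF F1i F3i]) (use t in auto)
  also have "(\<integral>z. h z * (\<integral>p. heat (\<delta> + t) (y p - z) \<partial>N 0) \<partial>lborel) = (\<integral>p. heat_conv h (\<delta> + t) (y p) \<partial>N 0)"
    by (rule F1) (use t in auto)
  finally show "(\<integral>p. heat_conv h \<delta> (y p) \<partial>N t) = (\<integral>p. heat_conv h (\<delta> + t) (y p) \<partial>N 0)
    + (LINT r:{0..t}|lborel. \<integral>p. heat_conv_grad h (\<delta> + t - clamp_time t r) (y p) \<bullet> V r p \<partial>N r)"
    unfolding F3 F3' set_lebesgue_integral_def \<theta>_def .
  show "set_integrable lborel {0..t} (\<lambda>r. \<integral>p. heat_conv_grad h (\<delta> + t - clamp_time t r) (y p) \<bullet> V r p \<partial>N r)"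
    using Fubini_bounded_kernel(2)[OF sl hi wi c_m c_bd] unfolding F3' set_integrable_def \<theta>_def .
qed

end

section \<open>Gronwall estimate in total variation\<close>

lemma set_integral_abs_le_FTC:
  fixes X D \<Phi> :: "real \<Rightarrow> real"
  assumes t: "0 \<le> t" and X: "set_integrable lborel {0..t} X" and le: "\<And>r. r \<in> {0..t} \<Longrightarrow> \<bar>X r\<bar> \<le> D r"
    and \<Phi>: "\<And>r. r \<in> {0..t} \<Longrightarrow> (\<Phi> has_real_derivative D r) (at r)" and D: "\<And>r. r \<in> {0..t} \<Longrightarrow> isCont D r"
  shows "\<bar>LINT r:{0..t}|lborel. X r\<bar> \<le> \<Phi> t - \<Phi> 0"
proof -
  have FTC: "has_bochner_integral lborel (\<lambda>r. D r * indicator {0..t} r) (\<Phi> t - \<Phi> 0)"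
    by (rule has_bochner_integral_FTC_Icc_real[OF t]) (use \<Phi> D in auto)
  have "\<bar>LINT r:{0..t}|lborel. X r\<bar> \<le> (\<integral>r. \<bar>indicator {0..t} r *\<^sub>R X r\<bar> \<partial>lborel)"
    unfolding set_lebesgue_integral_def by (rule integral_abs_bound)
  also have "\<dots> \<le> (\<integral>r. D r * indicator {0..t} r \<partial>lborel)"
  proof (rule integral_mono)
    show "integrable lborel (\<lambda>r. \<bar>indicator {0..t} r *\<^sub>R X r\<bar>)"
      using X unfolding set_integrable_def by (rule integrable_abs)
    show "integrable lborel (\<lambda>r. D r * indicator {0..t} r)"
      using FTC by (rule integrable.intros)
    show "\<bar>indicator {0..t} r *\<^sub>R X r\<bar> \<le> D r * indicator {0..t} r" for r
      using le[of r] by (cases "r \<in> {0..t}") simp_all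
  qed
  also have "\<dots> = \<Phi> t - \<Phi> 0" by (rule has_bochner_integral_integral_eq[OF FTC])
  finally show ?thesis .
qed

text \<open>The singular weight is absorbed by \<open>y\<^sup>2 \<le> \<epsilon> y\<^sup>3 + 1 / \<epsilon>\<^sup>2\<close> with \<open>y = s powr (-1/4)\<close>:
  the first part is integrable with a small factor, the second one is small for large \<open>\<kappa>\<close>.\<close>

lemma singular_convolution_le:
  fixes X :: "real \<Rightarrow> real"
  assumes t: "0 \<le> t" and \<delta>: "0 < \<delta>" and pos: "0 < \<epsilon>" "0 < \<kappa>" "0 \<le> e" "0 \<le> c"
    and X: "set_integrable lborel {0..t} X"
    and le: "\<And>r. r \<in> {0..t} \<Longrightarrow> \<bar>X r\<bar> \<le> (e + c * exp (\<kappa> * r)) / sqrt (\<delta> + t - r)"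
  shows "\<bar>LINT r:{0..t}|lborel. X r\<bar>
    \<le> 2 * e * sqrt (\<delta> + t) + c * exp (\<kappa> * t) * (4 * \<epsilon> * sqrt (sqrt (\<delta> + t)) + 1 / (\<epsilon>\<^sup>2 * \<kappa>))"
proof -
  \<comment> \<open>The fourth root of the remaining time: 1 / w^2 is the singular weight and - 4 w
    is a primitive of 1 / w^3, which makes \<open>\<Phi>\<close> explicit.\<close>
  define w where "w r = sqrt (sqrt (\<delta> + t - r))" for r
  define D where "D r = e * (1 / sqrt (\<delta> + t - r)) + c * (\<epsilon> * exp (\<kappa> * t) * (1 / w r ^ 3) + exp (\<kappa> * r) / \<epsilon>\<^sup>2)" for r
  define \<Phi> where "\<Phi> r = e * (- 2 * sqrt (\<delta> + t - r))
    + c * (\<epsilon> * exp (\<kappa> * t) * (- 4 * w r) + exp (\<kappa> * r) / (\<epsilon>\<^sup>2 * \<kappa>))" for r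
  have "\<bar>LINT r:{0..t}|lborel. X r\<bar> \<le> \<Phi> t - \<Phi> 0"
  proof (rule set_integral_abs_le_FTC[OF t X])
    fix r assume r: "r \<in> {0..t}"
    then have s: "0 < \<delta> + t - r" using \<delta> by simp
    then have sq: "0 < sqrt (\<delta> + t - r)" by simp
    then have w: "0 < w r" and w2: "w r ^ 2 = sqrt (\<delta> + t - r)" by (simp_all add: w_def)
    define y where "y = 1 / w r"
    have y: "0 < y" using w by (simp add: y_def)
    have young: "y ^ 2 \<le> \<epsilon> * y ^ 3 + 1 / \<epsilon>\<^sup>2"
    proof (cases "1 \<le> \<epsilon> * y")
      case True
      then have "1 * y ^ 2 \<le> (\<epsilon> * y) * y ^ 2" by (rule mult_right_mono) simp
      then have "y ^ 2 \<le> \<epsilon> * y ^ 3" by (simp add: power2_eq_square power3_eq_cube)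
      moreover have "0 \<le> 1 / \<epsilon>\<^sup>2" by simp
      ultimately show ?thesis by linarith
    next
      case False
      then have "y \<le> 1 / \<epsilon>" using pos by (simp add: field_simps)
      then have "y ^ 2 \<le> (1 / \<epsilon>) ^ 2" using y by (intro power_mono) auto
      then have "y ^ 2 \<le> 1 / \<epsilon>\<^sup>2" by (simp add: power_divide)
      moreover have "0 \<le> \<epsilon> * y ^ 3" using y pos by simp
      ultimately show ?thesis by linarith
    qed
    have inv: "1 / sqrt (\<delta> + t - r) = y ^ 2" "1 / w r ^ 3 = y ^ 3"
      unfolding w2[symmetric] y_def by (simp_all add: power_divide)
    have "\<bar>X r\<bar> \<le> e * y ^ 2 + c * (exp (\<kappa> * r) * y ^ 2)"
      using le[OF r] unfolding inv(1)[symmetric] by (simp add: algebra_simps add_divide_distrib)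
    also have "\<dots> \<le> e * y ^ 2 + c * (exp (\<kappa> * r) * (\<epsilon> * y ^ 3 + 1 / \<epsilon>\<^sup>2))"
      using young pos by (intro add_left_mono mult_left_mono) auto
    also have "\<dots> = e * y ^ 2 + c * (\<epsilon> * exp (\<kappa> * r) * y ^ 3 + exp (\<kappa> * r) / \<epsilon>\<^sup>2)"
      by (simp add: algebra_simps)
    \<comment> \<open>The exponential is frozen at its final value only in front of y^3, where the
      factor \<open>\<epsilon>\<close> provides smallness. The other part keeps exp (\<kappa> r),
      whose integral yields the factor 1 / \<kappa>.\<close>
    also have "\<dots> \<le> e * y ^ 2 + c * (\<epsilon> * exp (\<kappa> * t) * y ^ 3 + exp (\<kappa> * r) / \<epsilon>\<^sup>2)"
      using r y pos by (intro add_left_mono mult_left_mono add_right_mono mult_right_mono) auto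
    finally show "\<bar>X r\<bar> \<le> D r" unfolding D_def inv .
    have d0: "((\<lambda>r. \<delta> + t - r) has_real_derivative - 1) (at r)"
      by (auto intro!: derivative_eq_intros)
    have d1: "((\<lambda>r. sqrt (\<delta> + t - r)) has_real_derivative inverse (sqrt (\<delta> + t - r)) / 2 * - 1) (at r)"
      by (rule DERIV_chain2[OF DERIV_real_sqrt[OF s] d0])
    have d2: "(w has_real_derivative inverse (sqrt (sqrt (\<delta> + t - r))) / 2 * (inverse (sqrt (\<delta> + t - r)) / 2 * - 1)) (at r)"
      unfolding w_def[abs_def] by (rule DERIV_chain2[OF DERIV_real_sqrt[OF sq] d1])
    have d3: "((\<lambda>r. exp (\<kappa> * r)) has_real_derivative exp (\<kappa> * r) * \<kappa>) (at r)"
      by (auto intro!: derivative_eq_intros)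
    have v1: "- 2 * (inverse (sqrt (\<delta> + t - r)) / 2 * - 1) = 1 / sqrt (\<delta> + t - r)"
      by (simp add: inverse_eq_divide)
    have v2: "- 4 * (inverse (sqrt (sqrt (\<delta> + t - r))) / 2 * (inverse (sqrt (\<delta> + t - r)) / 2 * - 1)) = 1 / w r ^ 3"
      unfolding w2[symmetric] w_def[symmetric] using w by (simp add: field_simps power2_eq_square power3_eq_cube)
    have v3: "exp (\<kappa> * r) * \<kappa> / (\<epsilon>\<^sup>2 * \<kappa>) = exp (\<kappa> * r) / \<epsilon>\<^sup>2" using pos by simp
    show "(\<Phi> has_real_derivative D r) (at r)"
      unfolding \<Phi>_def[abs_def] D_def v1[symmetric] v2[symmetric] v3[symmetric]
      by (intro DERIV_add DERIV_cmult DERIV_cdivide d1 d2 d3)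
    have c1: "isCont (\<lambda>r. sqrt (\<delta> + t - r)) r" "isCont w r" "isCont (\<lambda>r. exp (\<kappa> * r)) r"
      using DERIV_isCont[OF d1] DERIV_isCont[OF d2] DERIV_isCont[OF d3] by auto
    show "isCont D r"
      unfolding D_def[abs_def]
      by (intro continuous_add continuous_mult continuous_const continuous_divide continuous_power c1)
        (use sq w pos in auto)
  qed
  also have "\<Phi> t - \<Phi> 0 = (e * (- 2 * sqrt \<delta>) + c * (\<epsilon> * exp (\<kappa> * t) * (- 4 * w t)) - c * (1 / (\<epsilon>\<^sup>2 * \<kappa>)))
      + (2 * e * sqrt (\<delta> + t) + c * exp (\<kappa> * t) * (4 * \<epsilon> * sqrt (sqrt (\<delta> + t)) + 1 / (\<epsilon>\<^sup>2 * \<kappa>)))"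
    by (simp add: \<Phi>_def w_def algebra_simps)
  also have "\<dots> \<le> 0 + (2 * e * sqrt (\<delta> + t) + c * exp (\<kappa> * t) * (4 * \<epsilon> * sqrt (sqrt (\<delta> + t)) + 1 / (\<epsilon>\<^sup>2 * \<kappa>)))"
  proof (rule add_right_mono)
    have "0 \<le> e * (2 * sqrt \<delta>)" "0 \<le> c * (\<epsilon> * exp (\<kappa> * t) * (4 * w t))" "0 \<le> c * (1 / (\<epsilon>\<^sup>2 * \<kappa>))"
      using pos \<delta> by (auto simp: w_def)
    moreover have "e * (- 2 * sqrt \<delta>) = - (e * (2 * sqrt \<delta>))"
      "c * (\<epsilon> * exp (\<kappa> * t) * (- 4 * w t)) = - (c * (\<epsilon> * exp (\<kappa> * t) * (4 * w t)))" by simp_all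
    ultimately show "e * (- 2 * sqrt \<delta>) + c * (\<epsilon> * exp (\<kappa> * t) * (- 4 * w t)) - c * (1 / (\<epsilon>\<^sup>2 * \<kappa>)) \<le> 0"
      by linarith
  qed
  finally show ?thesis by simp
qed

section \<open>Comparison of two drift-diffusion curves in total variation\<close>

lemma tv_le_mono: "tv_le M N c \<Longrightarrow> c \<le> d \<Longrightarrow> tv_le M N d"
  unfolding tv_le_def using order_trans by blast

lemma tv_le_2:
  fixes M N :: "'a::euclidean_space measure"
  assumes "prob_space M" "prob_space N" "sets M = sets borel" "sets N = sets borel"
  shows "tv_le M N 2"
  unfolding tv_le_def
proof (intro allI impI)
  fix h :: "'a \<Rightarrow> real" assume h: "h \<in> borel_measurable borel" and h1: "\<forall>x. \<bar>h x\<bar> \<le> 1"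
  have *: "\<bar>\<integral>x. h x \<partial>L\<bar> \<le> 1" if "prob_space L" "sets L = sets borel" for L
  proof -
    interpret prob_space L by fact
    have hL: "h \<in> borel_measurable L" using h that(2) by (simp cong: measurable_cong_sets)
    have "integrable L h" by (rule integrable_const_bound[of _ 1]) (use hL h1 in auto)
    then have "(\<integral>x. \<bar>h x\<bar> \<partial>L) \<le> 1" by (intro integral_le_const) (use h1 in auto)
    then show ?thesis using integral_abs_bound[of L h] by linarith
  qed
  show "\<bar>(\<integral>x. h x \<partial>M) - (\<integral>x. h x \<partial>N)\<bar> \<le> 2"
    using *[OF assms(1,3)] *[OF assms(2,4)] by linarith
qed

lemma (in drift_curve) distr_facts:
  shows "prob_space (distr (N r) borel y)" "sets (distr (N r) borel y) = sets borel"
    "f \<in> borel_measurable borel \<Longrightarrow> (\<integral>x. f x \<partial>distr (N r) borel y) = (\<integral>p. (f (y p) :: real) \<partial>N r)"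
proof -
  interpret prob_space "N r" by (rule N_prob)
  have y: "y \<in> measurable (N r) borel" by (rule borel_N[OF y_borel])
  then show "prob_space (distr (N r) borel y)" by (rule prob_space_distr)
  show "sets (distr (N r) borel y) = sets borel" by simp
  show "(\<integral>x. f x \<partial>distr (N r) borel y) = (\<integral>p. f (y p) \<partial>N r)" if "f \<in> borel_measurable borel"
    by (rule integral_distr[OF y that])
qed

text \<open>The Duhamel formulas are subtracted. Their drift terms differ by a difference of drifts
  along the first curve, measured by \<open>E\<close>, and by one bounded function tested against
  two measures, measured by the current total variation bound. A bound c exp (\<kappa> t) put in
  thus comes back with a factor in front of c that is small once \<open>\<epsilon>\<close> is small
  and \<open>\<kappa>\<close> is large.\<close>

lemma two_curve_step:
  fixes Na :: "real \<Rightarrow> 'b::euclidean_space measure" and Nr :: "real \<Rightarrow> 'a::euclidean_space measure"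
  assumes A: "drift_curve T BA Na ya Va" and R: "drift_curve T B Nr (\<lambda>x. x) F"
    and C: "0 < C" "\<And>h \<tau> (x::'a). h \<in> borel_measurable borel \<Longrightarrow> (\<And>x. \<bar>h x\<bar> \<le> 1) \<Longrightarrow> 0 < \<tau> \<Longrightarrow> norm (heat_conv_grad h \<tau> x) \<le> C / sqrt \<tau>"
    and L: "0 \<le> L" and e: "0 \<le> e"
    and E: "\<And>r m. r \<in> {0..T} \<Longrightarrow> tv_le (distr (Na r) borel ya) (Nr r) m \<Longrightarrow> (\<integral>p. norm (Va r p - F r (ya p)) \<partial>Na r) \<le> e + L * m"
    and a: "tv_le (distr (Na 0) borel ya) (Nr 0) a"
    and eps: "0 < \<epsilon>" "0 < \<kappa>" and c: "0 \<le> c"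
    and tv: "\<And>r. r \<in> {0..T} \<Longrightarrow> tv_le (distr (Na r) borel ya) (Nr r) (c * exp (\<kappa> * r))"
    and h: "test_fun h" "\<And>x. \<bar>h x\<bar> \<le> 1" and t: "t \<in> {0..T}" and \<delta>: "0 < \<delta>" "\<delta> \<le> 1"
  shows "\<bar>(\<integral>p. heat_conv h \<delta> (ya p) \<partial>Na t) - (\<integral>x. heat_conv h \<delta> x \<partial>Nr t)\<bar>
    \<le> a + (2 * (C * e) * sqrt (T + 1) + C * (L + B) * c * exp (\<kappa> * t) * (4 * \<epsilon> * sqrt (sqrt (T + 1)) + 1 / (\<epsilon>\<^sup>2 * \<kappa>)))"
proof -
  interpret A: drift_curve T BA Na ya Va by (rule A)
  interpret R: drift_curve T B Nr "\<lambda>x. x" F by (rule R)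
  have t0: "0 \<le> t" "t \<le> T" using t by auto
  have hm: "h \<in> borel_measurable borel" by (rule smooth_borel[OF test_fun_smooth[OF h(1)]])
  define \<theta> where "\<theta> r = \<delta> + t - clamp_time t r" for r
  define g where "g r = heat_conv_grad h (\<theta> r)" for r
  have gm: "g r \<in> borel_measurable borel" for r
    unfolding g_def by (rule heat_conv_borel(2)[OF hm])
  define X where "X r = (\<integral>p. g r (ya p) \<bullet> Va r p \<partial>Na r)" for r
  define Z where "Z r = (\<integral>x. g r x \<bullet> F r x \<partial>Nr r)" for r
  note mA = A.mild_dual[OF h(1) \<delta>(1) t0, folded \<theta>_def, folded g_def, folded X_def]
  note mR = R.mild_dual[OF h(1) \<delta>(1) t0, folded \<theta>_def, folded g_def, folded Z_def]
  have init: "\<bar>(\<integral>p. heat_conv h (\<delta> + t) (ya p) \<partial>Na 0) - (\<integral>x. heat_conv h (\<delta> + t) x \<partial>Nr 0)\<bar> \<le> 1 * a"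
  proof -
    have pos: "0 < \<delta> + t" using \<delta> t0 by simp
    from tv_leD[OF a heat_conv_borel(1)[OF hm] heat_conv_abs_le[OF hm h(2) pos]]
    show ?thesis unfolding A.distr_facts(3)[OF heat_conv_borel(1)[OF hm]] .
  qed
  have XZ: "\<bar>X r - Z r\<bar> \<le> (C * e + C * (L + B) * c * exp (\<kappa> * r)) / sqrt (\<delta> + t - r)" if r: "r \<in> {0..t}" for r
  proof -
    interpret pA: prob_space "Na r" by (rule A.N_prob)
    have rT: "r \<in> {0..T}" using r t0 by auto
    have \<theta>r: "\<theta> r = \<delta> + t - r" using clamp_time_id[OF r] by (simp add: \<theta>_def)
    have s: "0 < \<theta> r" using r \<delta> unfolding \<theta>r by simp
    define G where "G = C / sqrt (\<theta> r)"
    have G0: "0 \<le> G" using C(1) s by (simp add: G_def)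
    have gb: "norm (g r x) \<le> G" for x unfolding g_def G_def by (rule C(2)[OF hm h(2) s])
    note gy = measurable_compose[OF A.y_borel gm] and Fy = measurable_compose[OF A.y_borel R.V_borel']
    note m1 = borel_measurable_inner[OF gy A.V_borel'] borel_measurable_inner[OF gm R.V_borel']
      borel_measurable_inner[OF gy Fy]
      measurable_compose[OF borel_measurable_diff[OF A.V_borel' Fy] borel_measurable_norm]
    have q_bd: "\<bar>g r x \<bullet> F r x\<bar> \<le> G * B" for x
      by (rule order_trans[OF Cauchy_Schwarz_ineq2]) (intro mult_mono gb R.V_bound, use G0 in auto)
    have v_bd: "\<bar>g r (ya p) \<bullet> Va r p\<bar> \<le> G * BA" for p
      by (rule order_trans[OF Cauchy_Schwarz_ineq2]) (intro mult_mono gb A.V_bound, use G0 in auto)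
    have d_bd: "\<bar>norm (Va r p - F r (ya p))\<bar> \<le> BA + B" for p
      using norm_triangle_ineq4[of "Va r p" "F r (ya p)"] A.V_bound[of r p] R.V_bound[of r "ya p"] by simp
    have i1: "integrable (Na r) (\<lambda>p. g r (ya p) \<bullet> Va r p)" by (rule A.integrable_N[OF m1(1) v_bd])
    have i2: "integrable (Na r) (\<lambda>p. g r (ya p) \<bullet> F r (ya p))" by (rule A.integrable_N[OF m1(3) q_bd])
    have i3: "integrable (Na r) (\<lambda>p. norm (Va r p - F r (ya p)))" by (rule A.integrable_N[OF m1(4) d_bd])
    define m where "m = c * exp (\<kappa> * r)"
    have m: "tv_le (distr (Na r) borel ya) (Nr r) m" unfolding m_def by (rule tv[OF rT])
    have one: "\<bar>X r - (\<integral>p. g r (ya p) \<bullet> F r (ya p) \<partial>Na r)\<bar> \<le> G * (e + L * m)"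
    proof -
      have "X r - (\<integral>p. g r (ya p) \<bullet> F r (ya p) \<partial>Na r) = (\<integral>p. g r (ya p) \<bullet> (Va r p - F r (ya p)) \<partial>Na r)"
        unfolding X_def inner_diff_right by (rule Bochner_Integration.integral_diff[OF i1 i2, symmetric])
      also have "\<bar>\<dots>\<bar> \<le> (\<integral>p. \<bar>g r (ya p) \<bullet> (Va r p - F r (ya p))\<bar> \<partial>Na r)" by (rule integral_abs_bound)
      also have "\<dots> \<le> (\<integral>p. G * norm (Va r p - F r (ya p)) \<partial>Na r)"
      proof (rule integral_mono)
        show "integrable (Na r) (\<lambda>p. \<bar>g r (ya p) \<bullet> (Va r p - F r (ya p))\<bar>)"
          unfolding inner_diff_right by (rule integrable_abs[OF Bochner_Integration.integrable_diff[OF i1 i2]])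
        show "integrable (Na r) (\<lambda>p. G * norm (Va r p - F r (ya p)))" using i3 by simp
        show "\<bar>g r (ya p) \<bullet> (Va r p - F r (ya p))\<bar> \<le> G * norm (Va r p - F r (ya p))" for p
          by (rule order_trans[OF Cauchy_Schwarz_ineq2]) (rule mult_right_mono[OF gb norm_ge_zero])
      qed
      also have "\<dots> = G * (\<integral>p. norm (Va r p - F r (ya p)) \<partial>Na r)" by (rule integral_mult_right_zero)
      also have "\<dots> \<le> G * (e + L * m)" by (rule mult_left_mono[OF E[OF rT m] G0])
      finally show ?thesis .
    qed
    have two: "\<bar>(\<integral>p. g r (ya p) \<bullet> F r (ya p) \<partial>Na r) - Z r\<bar> \<le> G * B * m"
      using tv_leD[OF m m1(2) q_bd] unfolding A.distr_facts(3)[OF m1(2)] Z_def .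
    have "\<bar>X r - Z r\<bar> \<le> G * (e + L * m) + G * B * m" using one two by linarith
    also have "\<dots> = (C * e + C * (L + B) * c * exp (\<kappa> * r)) / sqrt (\<delta> + t - r)"
      unfolding G_def m_def \<theta>r by (simp add: algebra_simps add_divide_distrib)
    finally show ?thesis .
  qed
  have cc: "0 \<le> C * (L + B) * c" using C(1) L R.B_nonneg c by simp
  have Ce: "0 \<le> C * e" using C(1) e by simp
  have sXZ: "set_integrable lborel {0..t} (\<lambda>r. X r - Z r)"
    by (rule set_integral_diff(1)[OF mA(2) mR(2)])
  have sc: "\<bar>LINT r:{0..t}|lborel. X r - Z r\<bar> \<le> 2 * (C * e) * sqrt (\<delta> + t)
      + C * (L + B) * c * exp (\<kappa> * t) * (4 * \<epsilon> * sqrt (sqrt (\<delta> + t)) + 1 / (\<epsilon>\<^sup>2 * \<kappa>))"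
    by (rule singular_convolution_le[OF t0(1) \<delta>(1) eps Ce cc sXZ XZ])
  have le: "sqrt (\<delta> + t) \<le> sqrt (T + 1)" "sqrt (sqrt (\<delta> + t)) \<le> sqrt (sqrt (T + 1))"
    using \<delta> t0 by simp_all
  have "2 * (C * e) * sqrt (\<delta> + t) + C * (L + B) * c * exp (\<kappa> * t) * (4 * \<epsilon> * sqrt (sqrt (\<delta> + t)) + 1 / (\<epsilon>\<^sup>2 * \<kappa>))
    \<le> 2 * (C * e) * sqrt (T + 1) + C * (L + B) * c * exp (\<kappa> * t) * (4 * \<epsilon> * sqrt (sqrt (T + 1)) + 1 / (\<epsilon>\<^sup>2 * \<kappa>))"
    using cc Ce eps le by (intro add_mono mult_left_mono add_right_mono) auto
  note sc' = order_trans[OF sc this]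
  have "(\<integral>p. heat_conv h \<delta> (ya p) \<partial>Na t) - (\<integral>x. heat_conv h \<delta> x \<partial>Nr t)
    = ((\<integral>p. heat_conv h (\<delta> + t) (ya p) \<partial>Na 0) - (\<integral>x. heat_conv h (\<delta> + t) x \<partial>Nr 0)) + (LINT r:{0..t}|lborel. X r - Z r)"
    unfolding mA(1) mR(1) set_integral_diff(2)[OF mA(2) mR(2)] by simp
  then show ?thesis using init sc' by linarith
qed

text \<open>Gronwall's inequality is run as an iteration: starting from the trivial bound 2, each
  application of \<open>two_curve_step\<close> replaces \<open>c\<close> by
  \<open>a' + c / 2\<close>, whose fixed point is \<open>2 * a'\<close>. This asks for no regularity
  of the total variation distance in time. The constant is fixed before the curves are, from
  \<open>T\<close>, \<open>L\<close>, \<open>B\<close> and the dimension alone; this is the source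
  of uniformity in \<gamma>.\<close>

lemma tv_gronwall:
  assumes T: "0 < T" and L: "0 \<le> L" and B: "0 \<le> B"
  obtains K where "0 \<le> K"
    "\<And>(Na :: real \<Rightarrow> 'b::euclidean_space measure) ya Va BA (Nr :: real \<Rightarrow> 'a::euclidean_space measure) F a e t.
      \<lbrakk>drift_curve T BA Na ya Va; drift_curve T B Nr (\<lambda>x. x) F;
       \<And>r. r \<in> {0..T} \<Longrightarrow> absolutely_continuous lborel (distr (Na r) borel ya);
       \<And>r. r \<in> {0..T} \<Longrightarrow> absolutely_continuous lborel (Nr r); 0 \<le> e;
       \<And>r m. r \<in> {0..T} \<Longrightarrow> tv_le (distr (Na r) borel ya) (Nr r) m \<Longrightarrow>
         (\<integral>p. norm (Va r p - F r (ya p)) \<partial>Na r) \<le> e + L * m;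
       tv_le (distr (Na 0) borel ya) (Nr 0) a; t \<in> {0..T}\<rbrakk>
      \<Longrightarrow> tv_le (distr (Na t) borel ya) (Nr t) (K * (a + e))"
proof -
  obtain C where C: "0 < C" "\<And>h \<tau> (x::'a). h \<in> borel_measurable borel \<Longrightarrow> (\<And>x. \<bar>h x\<bar> \<le> 1) \<Longrightarrow> 0 < \<tau>
    \<Longrightarrow> norm (heat_conv_grad h \<tau> x) \<le> C / sqrt \<tau>"
    using heat_conv_grad_norm_le[where 'a='a] by blast
  define Q where "Q = C * (L + B) + 1"
  define S where "S = sqrt (sqrt (T + 1))"
  have Q: "1 \<le> Q" using C(1) L B by (simp add: Q_def)
  have S: "0 < S" using T by (simp add: S_def)
  \<comment> \<open>Chosen in this order so that, after multiplication by \<open>Q\<close>, the two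
    parts of the singular convolution contribute 1 / 4 each.\<close>
  define \<epsilon> where "\<epsilon> = 1 / (16 * Q * S)"
  define \<kappa> where "\<kappa> = 4 * Q / \<epsilon>\<^sup>2"
  have eps: "0 < \<epsilon>" using Q S by (simp add: \<epsilon>_def)
  have lam: "0 < \<kappa>" using Q eps by (simp add: \<kappa>_def)
  have half: "Q * (4 * \<epsilon> * S + 1 / (\<epsilon>\<^sup>2 * \<kappa>)) \<le> 1 / 2"
  proof -
    have "Q * (4 * \<epsilon> * S) = 1 / 4" using Q S by (simp add: \<epsilon>_def)
    moreover have "Q * (1 / (\<epsilon>\<^sup>2 * \<kappa>)) = 1 / 4" using Q eps by (simp add: \<kappa>_def)
    ultimately show ?thesis by (simp add: distrib_left)
  qed
  \<comment> \<open>\<open>W\<close> covers the initial error, which enters with factor 1, and the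
    drift error, which enters with factor 2 C sqrt (T + 1).\<close>
  define W where "W = 1 + 2 * C * sqrt (T + 1)"
  have W: "1 \<le> W" using C(1) T by (simp add: W_def)
  define K where "K = 2 * W * exp (\<kappa> * T)"
  have "0 \<le> K" using W by (simp add: K_def)
  moreover have "tv_le (distr (Na t) borel ya) (Nr t) (K * (a + e))"
    if A: "drift_curve T BA Na ya Va" and R: "drift_curve T B Nr (\<lambda>x. x) F"
      and acA: "\<And>r. r \<in> {0..T} \<Longrightarrow> absolutely_continuous lborel (distr (Na r) borel ya)"
      and acR: "\<And>r. r \<in> {0..T} \<Longrightarrow> absolutely_continuous lborel (Nr r)" and e: "0 \<le> e"
      and E: "\<And>r m. r \<in> {0..T} \<Longrightarrow> tv_le (distr (Na r) borel ya) (Nr r) m \<Longrightarrow>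
         (\<integral>p. norm (Va r p - F r (ya p)) \<partial>Na r) \<le> e + L * m"
      and a: "tv_le (distr (Na 0) borel ya) (Nr 0) a" and t: "t \<in> {0..T}"
    for Na :: "real \<Rightarrow> 'b measure" and ya Va BA and Nr :: "real \<Rightarrow> 'a measure" and F a e t
  proof -
    interpret A: drift_curve T BA Na ya Va by (rule A)
    interpret R: drift_curve T B Nr "\<lambda>x. x" F by (rule R)
    have a0: "0 \<le> a" by (rule tv_le_nonneg[OF a])
    define a' where "a' = W * (a + e)"
    have a': "0 \<le> a'" using a0 e W by (simp add: a'_def)
    have improve: "tv_le (distr (Na t) borel ya) (Nr t) ((a' + c / 2) * exp (\<kappa> * t))"
      if c: "0 \<le> c" and tv: "\<And>r. r \<in> {0..T} \<Longrightarrow> tv_le (distr (Na r) borel ya) (Nr r) (c * exp (\<kappa> * r))"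
        and t: "t \<in> {0..T}" for c t
    proof (rule tv_leI_test_fun[OF A.distr_facts(1,2) acA[OF t] R.N_prob R.N_sets acR[OF t]])
      fix h :: "'a \<Rightarrow> real" assume h: "test_fun h" "\<And>x. \<bar>h x\<bar> \<le> 1"
      have hm: "h \<in> borel_measurable borel" by (rule smooth_borel[OF test_fun_smooth[OF h(1)]])
      have hc: "continuous_on UNIV h" by (rule smooth_continuous[OF test_fun_smooth[OF h(1)]])
      define d where "d n = 1 / real (Suc n)" for n
      have d: "0 < d n" "d n \<le> 1" for n by (simp_all add: d_def)
      have bound: "\<bar>(\<integral>p. heat_conv h (d n) (ya p) \<partial>Na t) - (\<integral>x. heat_conv h (d n) x \<partial>Nr t)\<bar> \<le> (a' + c / 2) * exp (\<kappa> * t)" for n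
      proof -
        have "\<bar>(\<integral>p. heat_conv h (d n) (ya p) \<partial>Na t) - (\<integral>x. heat_conv h (d n) x \<partial>Nr t)\<bar>
          \<le> a + (2 * (C * e) * sqrt (T + 1) + C * (L + B) * c * exp (\<kappa> * t) * (4 * \<epsilon> * S + 1 / (\<epsilon>\<^sup>2 * \<kappa>)))"
          unfolding S_def by (rule two_curve_step[OF A R C L e E a eps lam c tv h t d])
        also have "C * (L + B) * c * exp (\<kappa> * t) * (4 * \<epsilon> * S + 1 / (\<epsilon>\<^sup>2 * \<kappa>))
          \<le> c / 2 * exp (\<kappa> * t)"
        proof -
          have "C * (L + B) * (4 * \<epsilon> * S + 1 / (\<epsilon>\<^sup>2 * \<kappa>)) \<le> Q * (4 * \<epsilon> * S + 1 / (\<epsilon>\<^sup>2 * \<kappa>))"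
            using eps lam S by (intro mult_right_mono) (auto simp: Q_def)
          then have "C * (L + B) * (4 * \<epsilon> * S + 1 / (\<epsilon>\<^sup>2 * \<kappa>)) \<le> 1 / 2" using half by linarith
          then have "(c * exp (\<kappa> * t)) * (C * (L + B) * (4 * \<epsilon> * S + 1 / (\<epsilon>\<^sup>2 * \<kappa>))) \<le> (c * exp (\<kappa> * t)) * (1 / 2)"
            using c by (intro mult_left_mono) auto
          then show ?thesis by (simp only: mult_ac times_divide_eq_right times_divide_eq_left mult_1_right)
        qed
        also have "a + (2 * (C * e) * sqrt (T + 1) + c / 2 * exp (\<kappa> * t)) \<le> a' + c / 2 * exp (\<kappa> * t)"
        proof -
          have "a' = a + e + 2 * C * sqrt (T + 1) * a + 2 * (C * e) * sqrt (T + 1)"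
            by (simp add: a'_def W_def algebra_simps)
          moreover have "0 \<le> 2 * C * sqrt (T + 1) * a" using C(1) T a0 by simp
          ultimately show ?thesis using e by linarith
        qed
        also have "\<dots> \<le> a' * exp (\<kappa> * t) + c / 2 * exp (\<kappa> * t)"
          using a' lam t by (intro add_right_mono mult_right_le_one_le[THEN order_trans] mult_le_cancel_left1[THEN iffD2]) auto
        finally show ?thesis by (simp add: distrib_right)
      qed
      have lim: "(\<lambda>n. \<integral>p. heat_conv h (d n) (f p) \<partial>M) \<longlonglongrightarrow> (\<integral>p. h (f p) \<partial>M)"
        if "prob_space M" "f \<in> borel_measurable M" for M and f :: "'c \<Rightarrow> 'a"
      proof (rule integral_dominated_convergence[where w="\<lambda>_. 1"])
        interpret prob_space M by (rule that(1))
        show "integrable M (\<lambda>_. 1 :: real)" by simp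
        show "(\<lambda>p. h (f p)) \<in> borel_measurable M" by (rule measurable_compose[OF that(2) hm])
        show "(\<lambda>p. heat_conv h (d n) (f p)) \<in> borel_measurable M" for n
          by (rule measurable_compose[OF that(2) heat_conv_borel(1)[OF hm]])
        show "AE p in M. (\<lambda>n. heat_conv h (d n) (f p)) \<longlonglongrightarrow> h (f p)"
          unfolding d_def using heat_conv_tendsto[OF hc h(2)] by simp
        show "AE p in M. norm (heat_conv h (d n) (f p)) \<le> 1" for n
          using heat_conv_abs_le[OF hm h(2) d(1)] by simp
      qed
      have "(\<lambda>n. \<bar>(\<integral>p. heat_conv h (d n) (ya p) \<partial>Na t) - (\<integral>x. heat_conv h (d n) x \<partial>Nr t)\<bar>)
          \<longlonglongrightarrow> \<bar>(\<integral>p. h (ya p) \<partial>Na t) - (\<integral>x. h x \<partial>Nr t)\<bar>"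
        by (intro tendsto_rabs tendsto_diff lim A.N_prob R.N_prob A.borel_N[OF A.y_borel] R.borel_N[OF R.y_borel])
      then have "\<bar>(\<integral>p. h (ya p) \<partial>Na t) - (\<integral>x. h x \<partial>Nr t)\<bar> \<le> (a' + c / 2) * exp (\<kappa> * t)"
        by (rule LIMSEQ_le_const2) (use bound in auto)
      then show "\<bar>(\<integral>x. h x \<partial>distr (Na t) borel ya) - (\<integral>x. h x \<partial>Nr t)\<bar> \<le> (a' + c / 2) * exp (\<kappa> * t)"
        unfolding A.distr_facts(3)[OF hm] .
    qed
    have iter: "\<forall>t\<in>{0..T}. tv_le (distr (Na t) borel ya) (Nr t) ((2 * a' + 2 / 2 ^ n) * exp (\<kappa> * t))" for n
    proof (induction n)
      case 0
      show ?case
      proof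
        fix t assume t: "t \<in> {0..T}"
        have "2 * 1 \<le> (2 * a' + 2) * exp (\<kappa> * t)" using a' lam t by (intro mult_mono) auto
        then show "tv_le (distr (Na t) borel ya) (Nr t) ((2 * a' + 2 / 2 ^ 0) * exp (\<kappa> * t))"
          using tv_le_mono[OF tv_le_2[OF A.distr_facts(1) R.N_prob A.distr_facts(2) R.N_sets]] by simp
      qed
    next
      case (Suc n)
      show ?case
      proof
        fix t assume t: "t \<in> {0..T}"
        have "tv_le (distr (Na t) borel ya) (Nr t) ((a' + (2 * a' + 2 / 2 ^ n) / 2) * exp (\<kappa> * t))"
          by (rule improve[OF _ _ t]) (use Suc a' in auto)
        moreover have "a' + (2 * a' + 2 / 2 ^ n) / 2 = 2 * a' + 2 / 2 ^ Suc n" by (simp add: add_divide_distrib)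
        ultimately show "tv_le (distr (Na t) borel ya) (Nr t) ((2 * a' + 2 / 2 ^ Suc n) * exp (\<kappa> * t))" by simp
      qed
    qed
    have "tv_le (distr (Na t) borel ya) (Nr t) ((2 * a' + 0) * exp (\<kappa> * t))"
      unfolding tv_le_def
    proof (intro allI impI)
      fix h :: "'a \<Rightarrow> real" assume h: "h \<in> borel_measurable borel" "\<forall>x. \<bar>h x\<bar> \<le> 1"
      have "(\<lambda>n. (2 * a' + 2 * (1 / 2) ^ n) * exp (\<kappa> * t)) \<longlonglongrightarrow> (2 * a' + 2 * 0) * exp (\<kappa> * t)"
        by (intro tendsto_intros LIMSEQ_power_zero) simp
      moreover have "\<bar>(\<integral>x. h x \<partial>distr (Na t) borel ya) - (\<integral>x. h x \<partial>Nr t)\<bar> \<le> (2 * a' + 2 * (1 / 2) ^ n) * exp (\<kappa> * t)" for n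
        using iter[of n, rule_format, OF t, unfolded tv_le_def, rule_format, OF h(1)] h(2) by (simp add: power_divide)
      ultimately show "\<bar>(\<integral>x. h x \<partial>distr (Na t) borel ya) - (\<integral>x. h x \<partial>Nr t)\<bar> \<le> (2 * a' + 0) * exp (\<kappa> * t)"
        using LIMSEQ_le_const by (metis (no_types, lifting) mult_zero_right)
    qed
    moreover have "(2 * a' + 0) * exp (\<kappa> * t) \<le> K * (a + e)"
    proof -
      have "(2 * a') * exp (\<kappa> * t) \<le> (2 * a') * exp (\<kappa> * T)" using a' lam t by (intro mult_left_mono) auto
      moreover have "(2 * a') * exp (\<kappa> * T) = K * (a + e)"
        unfolding K_def a'_def by (simp only: mult_ac)
      ultimately show ?thesis by simp
    qed
    ultimately show ?thesis by (rule tv_le_mono)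
  qed
  ultimately show thesis by (rule that)
qed

section \<open>The two equations as drift-diffusion curves\<close>

text \<open>Carries the weak equation over to the time-clamped curves, which agree with the original
  ones on \<open>{0..T}\<close>.\<close>

lemma drift_diffusion_cong:
  fixes N N' :: "real \<Rightarrow> 'b::euclidean_space measure" and y :: "'b \<Rightarrow> 'a::euclidean_space"
  assumes d: "drift_diffusion T N y V" and N: "\<And>r. r \<in> {0..T} \<Longrightarrow> N' r = N r"
    and V: "\<And>r. r \<in> {0..T} \<Longrightarrow> V' r = V r"
  shows "drift_diffusion T N' y V'"
  unfolding drift_diffusion_def Let_def
proof (intro allI impI)
  fix s t C :: real and \<psi> :: "'a \<Rightarrow> real" assume st: "0 < s" "s \<le> t" "t < T" and \<psi>: "C2_bounded C \<psi>"
  define I where "I N V r = (\<integral>p. (\<Sum>b\<in>Basis. (V r p \<bullet> b) * dd b \<psi> (y p) + dd b (dd b \<psi>) (y p)) \<partial>N r)"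
    for N :: "real \<Rightarrow> 'b measure" and V :: "real \<Rightarrow> 'b \<Rightarrow> 'a" and r
  note dd = d[unfolded drift_diffusion_def Let_def, rule_format, OF st \<psi>]
  have 1: "set_integrable lborel {s<..<t} (I N V)"
    unfolding I_def[abs_def] using dd by (rule conjunct1)
  have 2: "(\<integral>p. \<psi> (y p) \<partial>N t) - (\<integral>p. \<psi> (y p) \<partial>N s) = (LINT r:{s<..<t}|lborel. I N V r)"
    unfolding I_def[abs_def] using dd by (rule conjunct2)
  have eq: "I N' V' r = I N V r" if "r \<in> {s<..<t}" for r
    using N[of r] V[of r] that st by (simp add: I_def)
  have "set_integrable lborel {s<..<t} (I N' V')"
    using 1 set_integrable_cong[of lborel lborel "{s<..<t}" "{s<..<t}" "I N' V'" "I N V"] eq by simp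
  moreover have "(LINT r:{s<..<t}|lborel. I N' V' r) = (LINT r:{s<..<t}|lborel. I N V r)"
    using eq by (intro set_lebesgue_integral_cong) auto
  moreover have "N' t = N t" "N' s = N s" using N st by auto
  ultimately have "set_integrable lborel {s<..<t} (I N' V') \<and>
    (\<integral>p. \<psi> (y p) \<partial>N' t) - (\<integral>p. \<psi> (y p) \<partial>N' s) = (LINT r:{s<..<t}|lborel. I N' V' r)"
    using 2 by simp
  then show "set_integrable lborel {s<..<t} (\<lambda>r. \<integral>p. (\<Sum>b\<in>Basis. (V' r p \<bullet> b) * dd b \<psi> (y p) + dd b (dd b \<psi>) (y p)) \<partial>N' r) \<and>
    (\<integral>p. \<psi> (y p) \<partial>N' t) - (\<integral>p. \<psi> (y p) \<partial>N' s)
      = (LINT r:{s<..<t}|lborel. \<integral>p. (\<Sum>b\<in>Basis. (V' r p \<bullet> b) * dd b \<psi> (y p) + dd b (dd b \<psi>) (y p)) \<partial>N' r)"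
    unfolding I_def[abs_def] .
qed

text \<open>If the Bochner integral does not exist, its default value 0 satisfies the bound as
  well.\<close>

lemma norm_integral_prob_le:
  fixes f :: "'b \<Rightarrow> 'c::{banach, second_countable_topology}"
  assumes "prob_space \<sigma>" and f: "\<And>x. norm (f x) \<le> B"
  shows "norm (\<integral>x. f x \<partial>\<sigma>) \<le> B"
proof (cases "integrable \<sigma> f")
  case True
  interpret prob_space \<sigma> by fact
  have "norm (\<integral>x. f x \<partial>\<sigma>) \<le> (\<integral>x. norm (f x) \<partial>\<sigma>)" by (rule integral_norm_bound)
  also have "\<dots> \<le> (\<integral>x. B \<partial>\<sigma>)" using True f by (intro integral_mono) auto
  finally show ?thesis by (simp add: prob_space)
next
  case False
  have "0 \<le> B" using f[of undefined] norm_ge_zero order_trans by blast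
  then show ?thesis using False by (simp add: not_integrable_integral_eq)
qed

text \<open>The convolution with \<open>gradK\<close> is at most \<open>M\<close>, so a force bound
  at a single time bounds \<open>gradPhi\<close> almost everywhere; a closed set of full Lebesgue
  measure is the whole space. In this way the bound assumed for the limit equation reaches the
  forces of the kinetic equations.\<close>

lemma gradPhi_bounded_of_force:
  fixes gradPhi gradK :: "'a::euclidean_space \<Rightarrow> 'a"
  assumes \<sigma>: "prob_space \<sigma>" and cont: "continuous_on UNIV gradPhi" and K: "\<And>x. norm (gradK x) \<le> M"
    and F: "AE x in lborel. norm (Fforce gradPhi gradK \<sigma> x) \<le> B"
  shows "norm (gradPhi x) \<le> B + M"
proof -
  have "norm (gradPhi x) \<le> B + M" if "norm (Fforce gradPhi gradK \<sigma> x) \<le> B" for x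
  proof -
    have "norm (\<integral>y. gradK (x - y) \<partial>\<sigma>) \<le> M" by (rule norm_integral_prob_le[OF \<sigma>]) (rule K)
    moreover have "gradPhi x = - Fforce gradPhi gradK \<sigma> x - (\<integral>y. gradK (x - y) \<partial>\<sigma>)"
      by (simp add: Fforce_def)
    moreover have "norm (- Fforce gradPhi gradK \<sigma> x - (\<integral>y. gradK (x - y) \<partial>\<sigma>))
      \<le> norm (Fforce gradPhi gradK \<sigma> x) + norm (\<integral>y. gradK (x - y) \<partial>\<sigma>)"
      using norm_triangle_ineq4[of "- Fforce gradPhi gradK \<sigma> x"] by simp
    ultimately show ?thesis using that by simp
  qed
  then have "AE x in lborel. x \<in> {x. norm (gradPhi x) \<le> B + M}" using F by auto
  then have "AE x in lebesgue. x \<in> {x. norm (gradPhi x) \<le> B + M}" by (rule AE_completion)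
  moreover have "closed {x. norm (gradPhi x) \<le> B + M}"
    using cont by (intro closed_Collect_le continuous_intros)
  ultimately have "x \<in> {x. norm (gradPhi x) \<le> B + M}" by (rule mem_closed_if_AE_lebesgue[rotated])
  then show ?thesis by simp
qed

lemma Fforce_bounded:
  assumes "prob_space \<sigma>" "\<And>x. norm (gradPhi x) \<le> P" "\<And>x. norm (gradK x) \<le> M"
  shows "norm (Fforce gradPhi gradK \<sigma> x) \<le> P + M"
proof -
  have "norm (\<integral>y. gradK (x - y) \<partial>\<sigma>) \<le> M" by (rule norm_integral_prob_le) (use assms in auto)
  moreover have "norm (- gradPhi x - (\<integral>y. gradK (x - y) \<partial>\<sigma>)) \<le> norm (gradPhi x) + norm (\<integral>y. gradK (x - y) \<partial>\<sigma>)"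
    using norm_triangle_ineq4[of "- gradPhi x"] by simp
  ultimately show ?thesis unfolding Fforce_def using assms(2)[of x] by simp
qed

text \<open>Measurability is checked by components, because
  \<open>integral_measurable_kernel\<close> concerns real integrands.\<close>

lemma Fforce_kernel_borel:
  fixes gradPhi gradK :: "'a::euclidean_space \<Rightarrow> 'a"
  assumes m: "gradPhi \<in> borel_measurable borel" "gradK \<in> borel_measurable borel"
    and K: "\<And>x. norm (gradK x) \<le> M" and \<sigma>: "\<sigma> \<in> borel \<rightarrow>\<^sub>M prob_algebra borel"
  shows "(\<lambda>(r::real, x). Fforce gradPhi gradK (\<sigma> r) x) \<in> borel_measurable (borel \<Otimes>\<^sub>M borel)"
proof (rule iffD2[OF borel_measurable_euclidean_space], intro ballI)
  fix b :: 'a assume "b \<in> Basis"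
  have \<sigma>P: "prob_space (\<sigma> r)" "sets (\<sigma> r) = sets borel" for r
    using measurable_space[OF \<sigma>, of r] by (auto simp: space_prob_algebra)
  have \<sigma>1: "(\<lambda>z. \<sigma> (fst z)) \<in> (borel \<Otimes>\<^sub>M borel) \<rightarrow>\<^sub>M subprob_algebra borel"
    by (rule measurable_compose[OF measurable_fst measurable_prob_algebraD[OF \<sigma>]])
  have sub: "(\<lambda>p::'a \<times> 'a. fst p - snd p) \<in> borel_measurable borel"
    by (intro borel_measurable_continuous_onI continuous_intros)
  have "(\<lambda>w::(real \<times> 'a) \<times> 'a. (snd (fst w), snd w)) \<in> (borel \<Otimes>\<^sub>M borel) \<Otimes>\<^sub>M borel \<rightarrow>\<^sub>M borel \<Otimes>\<^sub>M borel"
    by measurable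
  then have "(\<lambda>w::(real \<times> 'a) \<times> 'a. (snd (fst w), snd w)) \<in> (borel \<Otimes>\<^sub>M borel) \<Otimes>\<^sub>M borel \<rightarrow>\<^sub>M borel"
    by (simp add: borel_prod)
  from measurable_compose[OF measurable_compose[OF this sub] m(2)]
  have "(\<lambda>w::(real \<times> 'a) \<times> 'a. gradK (snd (fst w) - snd w)) \<in> borel_measurable ((borel \<Otimes>\<^sub>M borel) \<Otimes>\<^sub>M borel)"
    by simp
  then have "(\<lambda>w::(real \<times> 'a) \<times> 'a. gradK (snd (fst w) - snd w) \<bullet> b) \<in> borel_measurable ((borel \<Otimes>\<^sub>M borel) \<Otimes>\<^sub>M borel)"
    by (intro borel_measurable_inner) auto
  then have "(\<lambda>(z, y). gradK (snd (z::real \<times> 'a) - y) \<bullet> b) \<in> borel_measurable ((borel \<Otimes>\<^sub>M borel) \<Otimes>\<^sub>M borel)"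
    by (simp add: case_prod_beta')
  from integral_measurable_kernel[OF this \<sigma>1]
  have 1: "(\<lambda>z. \<integral>y. gradK (snd z - y) \<bullet> b \<partial>\<sigma> (fst z)) \<in> borel_measurable (borel \<Otimes>\<^sub>M borel)" .
  have 2: "(\<lambda>z::real \<times> 'a. gradPhi (snd z) \<bullet> b) \<in> borel_measurable (borel \<Otimes>\<^sub>M borel)"
    by (intro borel_measurable_inner measurable_compose[OF measurable_snd m(1)]) auto
  have 3: "Fforce gradPhi gradK (\<sigma> r) x \<bullet> b = - (gradPhi x \<bullet> b) - (\<integral>y. gradK (x - y) \<bullet> b \<partial>\<sigma> r)" for r x
  proof -
    interpret prob_space "\<sigma> r" by (rule \<sigma>P)
    have "(\<lambda>y. gradK (x - y)) \<in> borel_measurable borel"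
      by (rule measurable_compose[OF _ m(2)]) (intro borel_measurable_continuous_onI continuous_intros)
    then have "(\<lambda>y. gradK (x - y)) \<in> borel_measurable (\<sigma> r)" using \<sigma>P(2) by (simp cong: measurable_cong_sets)
    then have "integrable (\<sigma> r) (\<lambda>y. gradK (x - y))"
      using K by (intro integrable_const_bound[where B=M]) auto
    then show ?thesis by (simp add: Fforce_def inner_diff_left)
  qed
  have "(\<lambda>z::real \<times> 'a. - (gradPhi (snd z) \<bullet> b) - (\<integral>y. gradK (snd z - y) \<bullet> b \<partial>\<sigma> (fst z))) \<in> borel_measurable (borel \<Otimes>\<^sub>M borel)"
    by (intro borel_measurable_diff borel_measurable_uminus 1 2)
  then show "(\<lambda>z::real \<times> 'a. (case z of (r, x) \<Rightarrow> Fforce gradPhi gradK (\<sigma> r) x) \<bullet> b) \<in> borel_measurable (borel \<Otimes>\<^sub>M borel)"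
    by (simp add: case_prod_beta' 3)
qed

lemma agg_drift_curve:
  fixes gradPhi gradK :: "'a::euclidean_space \<Rightarrow> 'a"
  assumes T: "0 < T" and sol: "agg_weak_sol gradPhi gradK T \<rho>"
    and m: "gradPhi \<in> borel_measurable borel" "gradK \<in> borel_measurable borel"
    and P: "\<And>x. norm (gradPhi x) \<le> P" and K: "\<And>x. norm (gradK x) \<le> M"
  shows "drift_curve T (P + M) (\<lambda>t. \<rho> (clamp_time T t)) (\<lambda>x. x) (\<lambda>r. Fforce gradPhi gradK (\<rho> (clamp_time T r)))"
proof
  have cur: "P2_curve T \<rho>" using sol by (simp add: agg_weak_sol_def)
  have P2: "P2 (\<rho> (clamp_time T r))" for r using cur clamp_time_in[of T r] T by (auto simp: P2_curve_def)
  show ker: "(\<lambda>t. \<rho> (clamp_time T t)) \<in> borel \<rightarrow>\<^sub>M prob_algebra borel"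
    using P2_curve_kernel[OF cur] T by simp
  show "(\<lambda>(r, x). Fforce gradPhi gradK (\<rho> (clamp_time T r)) x) \<in> borel_measurable (borel \<Otimes>\<^sub>M borel)"
    by (rule Fforce_kernel_borel[OF m K ker])
  have F: "norm (Fforce gradPhi gradK (\<rho> (clamp_time T r)) x) \<le> P + M" for r x
    by (rule Fforce_bounded[OF P2D(1)[OF P2] P K])
  then show "norm (Fforce gradPhi gradK (\<rho> (clamp_time T r)) x) \<le> P + M" for r x .
  fix L C :: real and f :: "'a \<Rightarrow> real" assume "L-lipschitz_on UNIV f" "\<And>x. \<bar>f x\<bar> \<le> C"
  from P2_curve_continuous[OF cur this]
  show "continuous_on {0..T} (\<lambda>r. \<integral>p. f p \<partial>\<rho> (clamp_time T r))"
    by (rule continuous_on_eq) (simp add: clamp_time_id)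
next
  have "norm (Fforce gradPhi gradK (\<rho> r) x) \<le> P + M" if "r \<in> {0..T}" for r x
  proof (rule Fforce_bounded[OF _ P K])
    have "P2 (\<rho> r)" using sol that unfolding agg_weak_sol_def P2_curve_def by blast
    then show "prob_space (\<rho> r)" by (rule P2D(1))
  qed
  from agg_drift_diffusion[OF sol m this]
  show "drift_diffusion T (\<lambda>t. \<rho> (clamp_time T t)) (\<lambda>x. x) (\<lambda>r. Fforce gradPhi gradK (\<rho> (clamp_time T r)))"
    by (rule drift_diffusion_cong) (simp_all add: clamp_time_id)
qed simp

lemma lipschitz_skew:
  assumes "1 \<le> \<gamma>"
  shows "2-lipschitz_on UNIV (\<lambda>p::'a::euclidean_space \<times> 'a. fst p + snd p /\<^sub>R \<gamma>)"
proof (rule lipschitz_onI)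
  fix p q :: "'a \<times> 'a"
  have 1: "(fst p + snd p /\<^sub>R \<gamma>) - (fst q + snd q /\<^sub>R \<gamma>) = fst (p - q) + snd (p - q) /\<^sub>R \<gamma>"
    by (simp add: algebra_simps)
  have "norm (snd (p - q) /\<^sub>R \<gamma>) \<le> 1 * norm (snd (p - q))"
    unfolding norm_scaleR using assms by (intro mult_right_mono) (auto simp: field_simps)
  then have "norm (fst (p - q) + snd (p - q) /\<^sub>R \<gamma>) \<le> norm (p - q) + norm (p - q)"
    using norm_triangle_ineq[of "fst (p - q)" "snd (p - q) /\<^sub>R \<gamma>"] norm_fst_le[of "fst (p - q)" "snd (p - q)"]
      norm_snd_le[of "snd (p - q)" "fst (p - q)"]
    unfolding prod.collapse by linarith
  then show "dist (fst p + snd p /\<^sub>R \<gamma>) (fst q + snd q /\<^sub>R \<gamma>) \<le> 2 * dist p q"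
    unfolding dist_norm 1 by simp
qed simp

text \<open>The drift bound \<open>P + M\<close> is the one obtained from the limit equation and is
  the same for every \<gamma>. The projection to the position is again a measurable kernel in time,
  which gives joint measurability of the force.\<close>

lemma kin_drift_curve:
  fixes gradPhi gradK :: "'a::euclidean_space \<Rightarrow> 'a"
  assumes T: "0 < T" and sol: "kin_weak_sol gradPhi gradK \<gamma> T \<mu>" and \<gamma>: "1 \<le> \<gamma>"
    and m: "gradPhi \<in> borel_measurable borel" "gradK \<in> borel_measurable borel"
    and P: "\<And>x. norm (gradPhi x) \<le> P" and K: "\<And>x. norm (gradK x) \<le> M"
  shows "drift_curve T (P + M) (\<lambda>t. \<mu> (clamp_time T t)) (\<lambda>p. fst p + snd p /\<^sub>R \<gamma>)
    (\<lambda>r p. Fforce gradPhi gradK (distr (\<mu> (clamp_time T r)) borel fst) (fst p))"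
proof
  have cur: "P2_curve T \<mu>" using sol by (simp add: kin_weak_sol_def)
  have P2: "P2 (\<mu> (clamp_time T r))" for r using cur clamp_time_in[of T r] T by (auto simp: P2_curve_def)
  have fst_m: "fst \<in> borel_measurable (borel :: ('a \<times> 'a) measure)"
    by (intro borel_measurable_continuous_onI continuous_intros)
  have prob: "prob_space (distr \<sigma> borel fst)" if "P2 \<sigma>" for \<sigma> :: "('a \<times> 'a) measure"
    using P2D[OF that] fst_m by (intro prob_space.prob_space_distr) (simp_all cong: measurable_cong_sets)
  show ker: "(\<lambda>t. \<mu> (clamp_time T t)) \<in> borel \<rightarrow>\<^sub>M prob_algebra borel"
    using P2_curve_kernel[OF cur] T by simp
  show "(\<lambda>p::'a \<times> 'a. fst p + snd p /\<^sub>R \<gamma>) \<in> borel_measurable borel"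
    by (intro borel_measurable_continuous_onI continuous_intros)
  have ker': "(\<lambda>r. distr (\<mu> (clamp_time T r)) borel fst) \<in> borel \<rightarrow>\<^sub>M prob_algebra borel"
    by (rule measurable_compose[OF ker measurable_distr_prob_space[OF fst_m]])
  have "(\<lambda>z::real \<times> ('a \<times> 'a). (fst z, fst (snd z))) \<in> borel \<Otimes>\<^sub>M borel \<rightarrow>\<^sub>M borel \<Otimes>\<^sub>M borel"
    by (intro measurable_Pair measurable_fst measurable_compose[OF measurable_snd fst_m])
  from measurable_compose[OF this Fforce_kernel_borel[OF m K ker']]
  show "(\<lambda>(r, p::'a \<times> 'a). Fforce gradPhi gradK (distr (\<mu> (clamp_time T r)) borel fst) (fst p)) \<in> borel_measurable (borel \<Otimes>\<^sub>M borel)"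
    by (simp add: case_prod_beta')
  show "norm (Fforce gradPhi gradK (distr (\<mu> (clamp_time T r)) borel fst) (fst p)) \<le> P + M" for r p
    by (rule Fforce_bounded[OF prob[OF P2] P K])
  show "continuous_on {0..T} (\<lambda>r. \<integral>p. f (fst p + snd p /\<^sub>R \<gamma>) \<partial>\<mu> (clamp_time T r))"
    if f: "L-lipschitz_on UNIV f" "\<And>x. \<bar>f x\<bar> \<le> C" for L C and f :: "'a \<Rightarrow> real"
  proof -
    have "(L * 2)-lipschitz_on UNIV (\<lambda>p. f (fst p + snd p /\<^sub>R \<gamma>))"
      by (rule lipschitz_on_compose2[OF lipschitz_skew[OF \<gamma>] lipschitz_on_subset[OF f(1)]]) simp
    from P2_curve_continuous[OF cur this f(2)] show ?thesis
      by (rule continuous_on_eq) (simp add: clamp_time_id)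
  qed
  have "norm (Fforce gradPhi gradK (distr (\<mu> r) borel fst) x) \<le> P + M" if "r \<in> {0..T}" for r x
    by (rule Fforce_bounded[OF prob P K]) (use cur that in \<open>auto simp: P2_curve_def\<close>)
  from kin_drift_diffusion[OF sol \<gamma> m this]
  show "drift_diffusion T (\<lambda>t. \<mu> (clamp_time T t)) (\<lambda>p. fst p + snd p /\<^sub>R \<gamma>)
    (\<lambda>r p. Fforce gradPhi gradK (distr (\<mu> (clamp_time T r)) borel fst) (fst p))"
    by (rule drift_diffusion_cong) (simp_all add: clamp_time_id)
qed

text \<open>\<open>Ent\<close> is infinite without a density, and the other two terms of the energy
  cannot compensate: one is nonnegative and the other a real number.\<close>

lemma Energy_absolutely_continuous:
  assumes "Energy Phi K \<sigma> \<le> ereal B" shows "absolutely_continuous lborel \<sigma>"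
proof (rule ccontr)
  assume "\<not> absolutely_continuous lborel \<sigma>"
  then have "Ent \<sigma> lborel = \<infinity>" by (simp add: Ent_def)
  then have "Energy Phi K \<sigma> = \<infinity>" by (simp add: Energy_def)
  then show False using assms by simp
qed

text \<open>The vector-valued integrand is tested in the direction of the difference itself, which
  reduces it to the scalar case without a factor of the dimension.\<close>

lemma norm_integral_diff_tv_le:
  fixes h :: "'b::euclidean_space \<Rightarrow> 'a::euclidean_space"
  assumes tv: "tv_le \<sigma> \<nu> c" and \<sigma>: "prob_space \<sigma>" "sets \<sigma> = sets borel"
    and \<nu>: "prob_space \<nu>" "sets \<nu> = sets borel" and h: "h \<in> borel_measurable borel" "\<And>x. norm (h x) \<le> B"
  shows "norm ((\<integral>x. h x \<partial>\<sigma>) - (\<integral>x. h x \<partial>\<nu>)) \<le> B * c"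
proof -
  have int: "integrable \<tau> h" if "prob_space \<tau>" "sets \<tau> = sets borel" for \<tau>
  proof -
    interpret prob_space \<tau> by fact
    have "h \<in> borel_measurable \<tau>" using h(1) that(2) by (simp cong: measurable_cong_sets)
    then show ?thesis using h(2) by (intro integrable_const_bound[where B=B]) auto
  qed
  define z where "z = (\<integral>x. h x \<partial>\<sigma>) - (\<integral>x. h x \<partial>\<nu>)"
  have "\<bar>(\<integral>x. h x \<bullet> sgn z \<partial>\<sigma>) - (\<integral>x. h x \<bullet> sgn z \<partial>\<nu>)\<bar> \<le> B * c"
  proof (rule tv_leD[OF tv])
    show "(\<lambda>x. h x \<bullet> sgn z) \<in> borel_measurable borel" using h(1) by (intro borel_measurable_inner) auto
    fix x
    have "\<bar>h x \<bullet> sgn z\<bar> \<le> norm (h x) * norm (sgn z)" by (rule Cauchy_Schwarz_ineq2)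
    also have "\<dots> \<le> norm (h x) * 1" by (intro mult_left_mono) (auto simp: norm_sgn)
    finally show "\<bar>h x \<bullet> sgn z\<bar> \<le> B" using h(2)[of x] by simp
  qed
  moreover have "(\<integral>x. h x \<bullet> sgn z \<partial>\<sigma>) - (\<integral>x. h x \<bullet> sgn z \<partial>\<nu>) = z \<bullet> sgn z"
    using int[OF \<sigma>] int[OF \<nu>] by (simp add: z_def inner_diff_left)
  moreover have "z \<bullet> sgn z = norm z"
    by (cases "z = 0") (simp_all add: sgn_div_norm dot_square_norm power2_eq_square)
  ultimately show ?thesis by (simp flip: z_def)
qed

text \<open>Nonnegativity is what allows the bound to be squared. Since \<open>dBL\<close> is a
  supremum of reals, it too rests on the common bound \<open>D\<close>.\<close>

lemma dBL_le:
  fixes \<sigma> \<nu> :: "'a::euclidean_space measure"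
  assumes "\<And>f. 1-lipschitz_on UNIV f \<Longrightarrow> (\<And>x. \<bar>f x\<bar> \<le> 1) \<Longrightarrow> \<bar>(\<integral>x. f x \<partial>\<sigma>) - (\<integral>x. f x \<partial>\<nu>)\<bar> \<le> D"
  shows "0 \<le> dBL \<sigma> \<nu>" and "dBL \<sigma> \<nu> \<le> D"
proof -
  define S where "S = {\<bar>(\<integral>x. f x \<partial>\<sigma>) - (\<integral>x. f x \<partial>\<nu>)\<bar> | f :: 'a \<Rightarrow> real. 1-lipschitz_on UNIV f \<and> (\<forall>x. \<bar>f x\<bar> \<le> 1)}"
  have le: "s \<le> D" if "s \<in> S" for s using that assms by (auto simp: S_def)
  have "1-lipschitz_on UNIV (\<lambda>x::'a. 0::real)" by (rule lipschitz_onI) auto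
  then have 0: "0 \<in> S" unfolding S_def by (intro CollectI exI[of _ "\<lambda>x::'a. 0::real"]) simp
  show "dBL \<sigma> \<nu> \<le> D" unfolding dBL_def S_def[symmetric] using 0 le by (intro cSup_least) auto
  show "0 \<le> dBL \<sigma> \<nu>" unfolding dBL_def S_def[symmetric] using 0 le by (intro cSup_upper bdd_aboveI) auto
qed

section \<open>Shearing a density with integrable gradient\<close>

text \<open>Local integrability speaks only of truncations to compact sets; the truncations to
  growing balls converge pointwise.\<close>

lemma loc_integrable_borel:
  fixes g :: "'b::euclidean_space \<Rightarrow> 'c::{banach, second_countable_topology}"
  assumes "loc_integrable g" shows "g \<in> borel_measurable borel"
proof (rule borel_measurable_LIMSEQ_metric)
  show "(\<lambda>x. indicator (cball 0 (real n)) x *\<^sub>R g x) \<in> borel_measurable borel" for n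
  proof -
    have "integrable lborel (\<lambda>x. indicator (cball 0 (real n)) x *\<^sub>R g x)"
      using assms compact_cball[of 0 "real n"] unfolding loc_integrable_def set_integrable_def by simp
    from borel_measurable_integrable[OF this] show ?thesis by simp
  qed
  fix x :: 'b
  obtain k where "norm x \<le> real k" using real_arch_simple by blast
  then have "\<forall>n\<ge>k. indicator (cball 0 (real n)) x *\<^sub>R g x = g x" by (auto simp: indicator_def)
  then have "\<forall>\<^sub>F n in sequentially. indicator (cball 0 (real n)) x *\<^sub>R g x = g x"
    unfolding eventually_sequentially by blast
  then show "(\<lambda>n. indicator (cball 0 (real n)) x *\<^sub>R g x) \<longlonglongrightarrow> g x" by (rule tendsto_eventually)
qed

lemma emeasure_lborel_translate:
  fixes A :: "'a::euclidean_space set"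
  assumes "A \<in> sets borel" shows "emeasure lborel ((\<lambda>x. x + a) -` A) = emeasure lborel A"
proof -
  have eq: "(\<lambda>x. x + a) = (+) a" by (simp add: fun_eq_iff add.commute)
  have "emeasure lborel A = emeasure (distr lborel borel ((+) a)) A" by (simp add: lborel_distr_plus)
  also have "\<dots> = emeasure lborel ((+) a -` A)" using assms by (subst emeasure_distr) auto
  finally show ?thesis by (simp add: eq)
qed

lemma emeasure_lborel_pair_sections:
  fixes A :: "('a::euclidean_space \<times> 'b::euclidean_space) set"
  assumes "A \<in> sets borel"
  shows "emeasure lborel A = (\<integral>\<^sup>+v. emeasure lborel ((\<lambda>x. (x, v)) -` A) \<partial>lborel)"
proof -
  have "A \<in> sets (lborel \<Otimes>\<^sub>M lborel)" using assms by (simp only: lborel_prod sets_lborel)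
  from lborel_pair.emeasure_pair_measure_alt2[OF this] show ?thesis by (simp only: lborel_prod)
qed

lemma fst_snd_borel [measurable]:
  "fst \<in> borel_measurable (borel :: ('a::second_countable_topology \<times> 'b::second_countable_topology) measure)"
  "snd \<in> borel_measurable (borel :: ('a::second_countable_topology \<times> 'b::second_countable_topology) measure)"
  by (intro borel_measurable_continuous_onI continuous_intros)+

text \<open>At fixed velocity each map is a translation in the position. The sections of a preimage
  are therefore translates, and Fubini shows that the preimage of a null set is null.\<close>

lemma absolutely_continuous_distr_shear:
  fixes \<mu> :: "('a::euclidean_space \<times> 'a) measure"
  assumes ac: "absolutely_continuous lborel \<mu>" and s: "sets \<mu> = sets borel"
  shows "absolutely_continuous lborel (distr \<mu> borel (\<lambda>p. (fst p + c *\<^sub>R (snd p - v0), snd p)))"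
    and "absolutely_continuous lborel (distr \<mu> borel (\<lambda>p. fst p + c *\<^sub>R snd p))"
proof -
  have *: "absolutely_continuous lborel (distr \<mu> borel S)"
    if S: "S \<in> borel_measurable borel" and null: "\<And>A. A \<in> null_sets lborel \<Longrightarrow> emeasure lborel (S -` A) = 0"
    for S :: "'a \<times> 'a \<Rightarrow> 'c::euclidean_space"
    unfolding absolutely_continuous_def
  proof
    fix A :: "'c set" assume A: "A \<in> null_sets lborel"
    then have Ab: "A \<in> sets borel" by (auto simp: null_sets_def)
    have S\<mu>: "S \<in> measurable \<mu> borel" using S s by (simp cong: measurable_cong_sets)
    have "S -` A \<in> sets borel" using measurable_sets[OF S Ab] by simp
    then have "S -` A \<in> null_sets lborel" using null[OF A] by (intro null_setsI) auto
    then have "emeasure \<mu> (S -` A) = 0" using ac by (auto simp: absolutely_continuous_def)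
    then have "emeasure (distr \<mu> borel S) A = 0"
      using Ab S\<mu> sets_eq_imp_space_eq[OF s] by (simp add: emeasure_distr)
    then show "A \<in> null_sets (distr \<mu> borel S)" using Ab by (intro null_setsI) auto
  qed
  show "absolutely_continuous lborel (distr \<mu> borel (\<lambda>p. (fst p + c *\<^sub>R (snd p - v0), snd p)))"
  proof (rule *)
    show m: "(\<lambda>p::'a \<times> 'a. (fst p + c *\<^sub>R (snd p - v0), snd p)) \<in> borel_measurable borel"
      by (intro borel_measurable_continuous_onI continuous_intros)
    fix A :: "('a \<times> 'a) set" assume A: "A \<in> null_sets lborel"
    then have Ab: "A \<in> sets borel" by (auto simp: null_sets_def)
    have sec: "(\<lambda>x. (x, v)) -` A \<in> sets borel" for v
      by (rule measurable_sets_borel[OF _ Ab]) (intro borel_measurable_continuous_onI continuous_intros)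
    have pre: "(\<lambda>p. (fst p + c *\<^sub>R (snd p - v0), snd p)) -` A \<in> sets borel"
      by (rule measurable_sets_borel[OF m Ab])
    have "emeasure lborel ((\<lambda>x. (x, v)) -` ((\<lambda>p. (fst p + c *\<^sub>R (snd p - v0), snd p)) -` A))
      = emeasure lborel ((\<lambda>x. (x, v)) -` A)" for v
      using emeasure_lborel_translate[OF sec[of v], of "c *\<^sub>R (v - v0)"] by (simp add: vimage_def)
    then have "emeasure lborel ((\<lambda>p. (fst p + c *\<^sub>R (snd p - v0), snd p)) -` A) = emeasure lborel A"
      unfolding emeasure_lborel_pair_sections[OF pre] emeasure_lborel_pair_sections[OF Ab] by simp
    then show "emeasure lborel ((\<lambda>p. (fst p + c *\<^sub>R (snd p - v0), snd p)) -` A) = 0"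
      using A by (simp add: null_sets_def)
  qed
  show "absolutely_continuous lborel (distr \<mu> borel (\<lambda>p. fst p + c *\<^sub>R snd p))"
  proof (rule *)
    show m: "(\<lambda>p::'a \<times> 'a. fst p + c *\<^sub>R snd p) \<in> borel_measurable borel"
      by (intro borel_measurable_continuous_onI continuous_intros)
    fix A :: "'a set" assume A: "A \<in> null_sets lborel"
    then have Ab: "A \<in> sets borel" by (auto simp: null_sets_def)
    have pre: "(\<lambda>p::'a \<times> 'a. fst p + c *\<^sub>R snd p) -` A \<in> sets borel"
      by (rule measurable_sets_borel[OF m Ab])
    have "emeasure lborel ((\<lambda>x. (x, v)) -` ((\<lambda>p. fst p + c *\<^sub>R snd p) -` A)) = 0" for v
      using emeasure_lborel_translate[OF Ab, of "c *\<^sub>R v"] A by (simp add: vimage_def null_sets_def)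
    then show "emeasure lborel ((\<lambda>p::'a \<times> 'a. fst p + c *\<^sub>R snd p) -` A) = 0"
      unfolding emeasure_lborel_pair_sections[OF pre] by simp
  qed
qed

text \<open>The pairing of the sheared measure with a test function is differentiated in the shear
  parameter \<open>\<theta>\<close>: the velocity difference v - v0 then multiplies the x-gradient
  of the test function. Since v - v0 does not depend on x, this gradient can be moved onto the
  density through its weak x-gradient, and |v - v0| \<le> (1 + |v0|) (1 + |v|) leaves the weighted
  norm bounded by \<open>C0\<close>. The mean value inequality supplies the factor
  \<open>c\<close>.\<close>

lemma shear_tv_le:
  fixes f :: "'a::euclidean_space \<times> 'a \<Rightarrow> real" and g :: "'a \<times> 'a \<Rightarrow> 'a"
  assumes f [measurable]: "f \<in> borel_measurable borel" and f0: "\<And>p. 0 \<le> f p"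
    and \<mu>: "\<mu> = density lborel (\<lambda>p. ennreal (f p))" and prob: "prob_space \<mu>"
    and wg: "weak_grad_x f g"
    and G: "integrable lborel (\<lambda>p. (1 + norm (snd p)) * norm (g p))"
      "(\<integral>p. (1 + norm (snd p)) * norm (g p) \<partial>lborel) \<le> C0"
    and c: "0 \<le> c"
  shows "tv_le \<mu> (distr \<mu> borel (\<lambda>p. (fst p + c *\<^sub>R (snd p - v0), snd p))) (c * ((1 + norm v0) * C0))"
proof -
  interpret prob_space \<mu> by (rule prob)
  have sets_\<mu>: "sets \<mu> = sets borel" by (simp add: \<mu>)
  have gm [measurable]: "g \<in> borel_measurable borel" using wg by (intro loc_integrable_borel) (simp add: weak_grad_x_def)
  have ac: "absolutely_continuous lborel \<mu>" unfolding \<mu> by (rule absolutely_continuousI_density) simp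
  define S where "S \<theta> p = (fst p + \<theta> *\<^sub>R (snd p - v0), snd p)" for \<theta> and p :: "'a \<times> 'a"
  have S_m: "S \<theta> \<in> borel_measurable borel" for \<theta>
    unfolding S_def[abs_def] by (intro borel_measurable_continuous_onI continuous_intros)
  have S_\<mu>: "S \<theta> \<in> measurable \<mu> borel" for \<theta> using S_m sets_\<mu> by (simp cong: measurable_cong_sets)
  have fi: "integrable lborel f"
  proof (rule integrableI_nonneg)
    have "(\<integral>\<^sup>+p. ennreal (f p) \<partial>lborel) = emeasure \<mu> (space \<mu>)"
      unfolding \<mu> by (simp add: emeasure_density)
    then show "(\<integral>\<^sup>+p. ennreal (f p) \<partial>lborel) < \<infinity>" using emeasure_space_1 by simp
  qed (use f0 in auto)
  have int_\<mu>: "(\<integral>p. h p \<partial>\<mu>) = (\<integral>p. f p * h p \<partial>lborel)" if "h \<in> borel_measurable borel" for h :: "'a \<times> 'a \<Rightarrow> real"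
    unfolding \<mu> using that f0 by (subst integral_density) auto
  show ?thesis
  proof (rule tv_leI_test_fun[OF prob sets_\<mu> ac])
    show "prob_space (distr \<mu> borel (\<lambda>p. (fst p + c *\<^sub>R (snd p - v0), snd p)))"
      using prob_space_distr[OF S_\<mu>[of c]] unfolding S_def[abs_def] .
    show "absolutely_continuous lborel (distr \<mu> borel (\<lambda>p. (fst p + c *\<^sub>R (snd p - v0), snd p)))"
      by (rule absolutely_continuous_distr_shear(1)[OF ac sets_\<mu>])
    fix \<Phi> :: "'a \<times> 'a \<Rightarrow> real" assume \<Phi>: "test_fun \<Phi>" and \<Phi>1: "\<And>x. \<bar>\<Phi> x\<bar> \<le> 1"
    have sm: "smooth \<Phi>" by (rule test_fun_smooth[OF \<Phi>])
    have \<Phi>m [measurable]: "\<Phi> \<in> borel_measurable borel" by (rule smooth_borel[OF sm])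
    have sm_v: "smooth (\<lambda>q::'a \<times> 'a. (snd q - v0) \<bullet> b)" for b
    proof -
      have "bounded_linear (\<lambda>q::'a \<times> 'a. snd q \<bullet> b)"
        by (rule bounded_linear_compose[OF bounded_linear_inner_left bounded_linear_snd])
      from smooth_add[OF smooth_linear[OF this] smooth_const[of "- (v0 \<bullet> b)"]]
      show ?thesis by (simp add: inner_diff_left)
    qed
    \<comment> \<open>The unbounded factor v - v0 is multiplied by a derivative of a compactly
      supported function. The product is therefore bounded, which gives the majorant
      \<open>K\<close> for the difference quotients below.\<close>
    define d where "d b q = ((snd q - v0) \<bullet> b) * dd (b, 0) \<Phi> q" for b q
    have td: "test_fun (d b)" for b
      unfolding d_def[abs_def] by (rule test_fun_mult'[OF sm_v test_fun_dd[OF \<Phi>]])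
    define D where "D q = (\<Sum>b\<in>Basis. d b q)" for q
    have d_m: "d b \<in> borel_measurable borel" for b by (rule smooth_borel[OF test_fun_smooth[OF td]])
    have D_m: "D \<in> borel_measurable borel" unfolding D_def[abs_def] by (rule borel_measurable_sum) (rule d_m)
    have "\<exists>k\<ge>0. \<forall>q. \<bar>d b q\<bar> \<le> k" for b using test_fun_bounded[OF td[of b]] by metis
    then obtain k where k: "\<And>b. 0 \<le> k b" "\<And>b q. \<bar>d b q\<bar> \<le> k b" by metis
    define K where "K = (\<Sum>b\<in>(Basis::'a set). k b)"
    have D_bd: "\<bar>D q\<bar> \<le> K" for q
      unfolding D_def K_def by (rule order_trans[OF sum_abs sum_mono]) (rule k(2))
    have deriv: "((\<lambda>\<theta>. \<Phi> (S \<theta> p)) has_real_derivative D (S \<theta> p)) (at \<theta>)" for \<theta> p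
    proof -
      define u :: "'a \<times> 'a" where "u = (snd p - v0, 0)"
      have S_eq: "S \<theta> p = p + \<theta> *\<^sub>R u" for \<theta> by (simp add: S_def u_def prod_eq_iff)
      have "((\<lambda>\<theta>. p + \<theta> *\<^sub>R u) has_derivative (\<lambda>h. h *\<^sub>R u)) (at \<theta>)"
        by (auto intro!: derivative_eq_intros)
      from has_derivative_compose[OF this smooth_has_dd[OF sm]]
      have 1: "((\<lambda>\<theta>. \<Phi> (S \<theta> p)) has_derivative (\<lambda>h. dd (h *\<^sub>R u) \<Phi> (S \<theta> p))) (at \<theta>)"
        unfolding S_eq .
      interpret l: bounded_linear "\<lambda>u. dd u \<Phi> (S \<theta> p)"
        using smooth_has_dd[OF sm] by (rule has_derivative_bounded_linear)
      have "u = (\<Sum>b\<in>Basis. ((snd p - v0) \<bullet> b) *\<^sub>R (b, 0))"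
        using euclidean_representation[of "snd p - v0"] by (simp add: u_def prod_eq_iff fst_sum snd_sum)
      then have "dd u \<Phi> (S \<theta> p) = (\<Sum>b\<in>Basis. ((snd p - v0) \<bullet> b) * dd (b, 0) \<Phi> (S \<theta> p))"
        by (simp only: l.sum l.scaleR real_scaleR_def)
      also have "\<dots> = D (S \<theta> p)" by (simp add: D_def d_def S_def)
      finally have 2: "dd (h *\<^sub>R u) \<Phi> (S \<theta> p) = D (S \<theta> p) * h" for h
        by (simp only: l.scaleR real_scaleR_def mult.commute)
      from 1 show ?thesis unfolding 2 has_field_derivative_def .
    qed
    define \<Psi> where "\<Psi> \<theta> = (\<integral>p. f p * \<Phi> (S \<theta> p) \<partial>lborel)" for \<theta>
    have i\<Phi>: "integrable lborel (\<lambda>p. f p * \<Phi> (S \<theta> p))" for \<theta>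
    proof (rule Bochner_Integration.integrable_bound[OF fi])
      show "(\<lambda>p. f p * \<Phi> (S \<theta> p)) \<in> borel_measurable lborel"
        using measurable_compose[OF S_m \<Phi>m] by simp
      show "AE p in lborel. norm (f p * \<Phi> (S \<theta> p)) \<le> norm (f p)"
        using \<Phi>1 by (simp add: abs_mult mult_left_le)
    qed
    have \<Psi>_deriv: "(\<Psi> has_real_derivative (\<integral>p. f p * D (S \<theta> p) \<partial>lborel)) (at \<theta>)" for \<theta>
      unfolding DERIV_def tendsto_at_iff_sequentially comp_def
    proof (intro allI impI)
      fix X :: "nat \<Rightarrow> real" assume X: "\<forall>i. X i \<in> UNIV - {0}" and X0: "X \<longlonglongrightarrow> 0"
      have eq: "(\<Psi> (\<theta> + X i) - \<Psi> \<theta>) / X i = (\<integral>p. f p * ((\<Phi> (S (\<theta> + X i) p) - \<Phi> (S \<theta> p)) / X i) \<partial>lborel)" for i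
      proof -
        have "\<Psi> (\<theta> + X i) - \<Psi> \<theta> = (\<integral>p. f p * \<Phi> (S (\<theta> + X i) p) - f p * \<Phi> (S \<theta> p) \<partial>lborel)"
          unfolding \<Psi>_def by (rule Bochner_Integration.integral_diff[OF i\<Phi> i\<Phi>, symmetric])
        then show ?thesis by (simp add: right_diff_distrib diff_divide_distrib flip: integral_divide_zero)
      qed
      show "(\<lambda>i. (\<Psi> (\<theta> + X i) - \<Psi> \<theta>) / X i) \<longlonglongrightarrow> (\<integral>p. f p * D (S \<theta> p) \<partial>lborel)"
        unfolding eq
      proof (rule integral_dominated_convergence[where w="\<lambda>p. f p * K"])
        show "integrable lborel (\<lambda>p. f p * K)" using fi by simp
        show "(\<lambda>p. f p * D (S \<theta> p)) \<in> borel_measurable lborel"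
          using measurable_compose[OF S_m D_m] by simp
        show "(\<lambda>p. f p * ((\<Phi> (S (\<theta> + X i) p) - \<Phi> (S \<theta> p)) / X i)) \<in> borel_measurable lborel" for i
          using measurable_compose[OF S_m \<Phi>m, of "\<theta> + X i"] measurable_compose[OF S_m \<Phi>m, of \<theta>] by simp
        have "(\<lambda>i. (\<Phi> (S (\<theta> + X i) p) - \<Phi> (S \<theta> p)) / X i) \<longlonglongrightarrow> D (S \<theta> p)" for p
          using deriv[of p \<theta>] X X0 unfolding DERIV_def tendsto_at_iff_sequentially comp_def by blast
        then show "AE p in lborel. (\<lambda>i. f p * ((\<Phi> (S (\<theta> + X i) p) - \<Phi> (S \<theta> p)) / X i)) \<longlonglongrightarrow> f p * D (S \<theta> p)"
          by (intro AE_I2 tendsto_mult_left)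
        have "\<bar>(\<Phi> (S (\<theta> + X i) p) - \<Phi> (S \<theta> p)) / X i\<bar> \<le> K" for i p
        proof -
          have "norm (\<Phi> (S (\<theta> + X i) p) - \<Phi> (S \<theta> p)) \<le> K * norm (\<theta> + X i - \<theta>)"
          proof (rule field_differentiable_bound[where S=UNIV and f="\<lambda>\<theta>. \<Phi> (S \<theta> p)" and f'="\<lambda>\<theta>. D (S \<theta> p)"])
            show "((\<lambda>\<theta>. \<Phi> (S \<theta> p)) has_field_derivative D (S z p)) (at z within UNIV)" for z using deriv by simp
            show "norm (D (S z p)) \<le> K" for z using D_bd by simp
          qed auto
          then show ?thesis using X by (simp add: abs_divide divide_le_eq)
        qed
        then have "norm (f p * ((\<Phi> (S (\<theta> + X i) p) - \<Phi> (S \<theta> p)) / X i)) \<le> f p * K" for i p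
          unfolding real_norm_def abs_mult abs_of_nonneg[OF f0] by (rule mult_left_mono[OF _ f0])
        then show "AE p in lborel. norm (f p * ((\<Phi> (S (\<theta> + X i) p) - \<Phi> (S \<theta> p)) / X i)) \<le> f p * K" for i
          by simp
      qed
    qed
    have ibp: "\<bar>\<integral>p. f p * D (S \<theta> p) \<partial>lborel\<bar> \<le> (1 + norm v0) * C0" for \<theta>
    proof -
      define L :: "'a \<times> 'a \<Rightarrow> 'a \<times> 'a" where "L p = (fst p + \<theta> *\<^sub>R snd p, snd p)" for p
      have Ll: "bounded_linear L"
        unfolding L_def[abs_def]
        by (intro bounded_linear_Pair bounded_linear_add bounded_linear_fst bounded_linear_snd
            bounded_linear_scaleR_right[THEN bounded_linear_compose])
      have SL: "S \<theta> p = L p + (- (\<theta> *\<^sub>R v0), 0)" for p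
        by (simp add: S_def L_def prod_eq_iff scaleR_diff_right)
      have sS: "smooth (\<lambda>p. \<Phi> (S \<theta> p))" unfolding SL by (rule smooth_affine[OF sm Ll])
      have ddS: "dd (b, 0) (\<lambda>p. \<Phi> (S \<theta> p)) p = dd (b, 0) \<Phi> (S \<theta> p)" for b p
      proof -
        have "dd (b, 0) (\<lambda>p. \<Phi> (L p + (- (\<theta> *\<^sub>R v0), 0))) p = dd (L (b, 0)) \<Phi> (L p + (- (\<theta> *\<^sub>R v0), 0))"
          by (rule dd_affine[OF Ll smooth_differentiable[OF sm]])
        then show ?thesis unfolding SL by (simp add: L_def)
      qed
      \<comment> \<open>The test function for the weak x-gradient. Its derivative along
        \<open>b\<close> in the position is \<open>d b\<close> at the sheared point, because the
        shear acts on the position as a translation and v - v0 is constant in x. Its support stays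
        bounded because the shear can be undone.\<close>
      define \<phi> where "\<phi> b p = ((snd p - v0) \<bullet> b) * \<Phi> (S \<theta> p)" for b p
      have t\<phi>: "test_fun (\<phi> b)" for b
      proof -
        obtain R where R: "\<And>q. \<Phi> q \<noteq> 0 \<Longrightarrow> norm q \<le> R" using test_funE[OF \<Phi>] by blast
        show ?thesis
        proof (rule test_funI)
          show "smooth (\<phi> b)" unfolding \<phi>_def[abs_def] by (rule smooth_mult[OF sm_v sS])
          fix p assume "\<phi> b p \<noteq> 0"
          then have n: "norm (S \<theta> p) \<le> R" using R by (auto simp: \<phi>_def)
          have v: "norm (snd p) \<le> R"
            using norm_snd_le[of "snd (S \<theta> p)" "fst (S \<theta> p)"] n by (simp add: S_def)
          have x: "norm (fst p + \<theta> *\<^sub>R (snd p - v0)) \<le> R"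
            using norm_fst_le[of "fst (S \<theta> p)" "snd (S \<theta> p)"] n by (simp add: S_def)
          have "norm (fst p) \<le> norm (fst p + \<theta> *\<^sub>R (snd p - v0)) + norm (\<theta> *\<^sub>R (snd p - v0))"
            using norm_triangle_ineq4[of "fst p + \<theta> *\<^sub>R (snd p - v0)" "\<theta> *\<^sub>R (snd p - v0)"] by simp
          also have "norm (\<theta> *\<^sub>R (snd p - v0)) \<le> \<bar>\<theta>\<bar> * (R + norm v0)"
            using norm_triangle_ineq4[of "snd p" v0] v by (auto intro!: mult_left_mono)
          finally have "norm (fst p) \<le> R + \<bar>\<theta>\<bar> * (R + norm v0)" using x by simp
          then show "norm p \<le> (R + \<bar>\<theta>\<bar> * (R + norm v0)) + R"
            using norm_Pair_le[of "fst p" "snd p"] v by simp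
        qed
      qed
      have dd\<phi>: "dd (b, 0) (\<phi> b) p = d b (S \<theta> p)" for b p
      proof -
        have dv: "dd (b, 0) (\<lambda>q::'a \<times> 'a. (snd q - v0) \<bullet> b) p = 0"
        proof -
          have "((\<lambda>q::'a \<times> 'a. (snd q - v0) \<bullet> b) has_derivative (\<lambda>u. snd u \<bullet> b)) (at p)"
            by (auto intro!: derivative_eq_intros)
          from dd_eq[OF this, of "(b, 0)"] show ?thesis by simp
        qed
        have "dd (b, 0) (\<phi> b) p = ((snd p - v0) \<bullet> b) * dd (b, 0) (\<lambda>p. \<Phi> (S \<theta> p)) p
          + dd (b, 0) (\<lambda>q. (snd q - v0) \<bullet> b) p * \<Phi> (S \<theta> p)"
          unfolding \<phi>_def[abs_def] by (rule dd_mult[OF smooth_differentiable[OF sm_v] smooth_differentiable[OF sS]])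
        then show ?thesis unfolding dv ddS d_def by (simp add: S_def)
      qed
      have id: "integrable lborel (\<lambda>p. f p * d b (S \<theta> p))" for b
      proof (rule Bochner_Integration.integrable_bound)
        show "integrable lborel (\<lambda>p. f p * k b)" using fi by simp
        show "(\<lambda>p. f p * d b (S \<theta> p)) \<in> borel_measurable lborel"
          using measurable_compose[OF S_m d_m] by simp
        have "norm (f p * d b (S \<theta> p)) \<le> norm (f p * k b)" for p
          unfolding real_norm_def abs_mult using k[of b] by (intro mult_left_mono order_trans[OF k(2) abs_ge_self]) auto
        then show "AE p in lborel. norm (f p * d b (S \<theta> p)) \<le> norm (f p * k b)" by simp
      qed
      have W: "norm (snd p - v0) \<le> (1 + norm v0) * (1 + norm (snd p))" for p :: "'a \<times> 'a"
      proof -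
        have "norm (snd p - v0) \<le> norm (snd p) + norm v0" by (rule norm_triangle_ineq4)
        also have "\<dots> \<le> (1 + norm v0) * (1 + norm (snd p))" by (simp add: algebra_simps)
        finally show ?thesis .
      qed
      have \<phi>_bd: "\<bar>(g p \<bullet> b) * \<phi> b p\<bar> \<le> (1 + norm v0) * ((1 + norm (snd p)) * norm (g p))" if b: "b \<in> Basis" for b p
      proof -
        have "\<bar>(g p \<bullet> b) * \<phi> b p\<bar> \<le> norm (g p) * (norm (snd p - v0) * 1)"
          unfolding \<phi>_def abs_mult by (intro mult_mono Basis_le_norm b \<Phi>1) auto
        also have "\<dots> \<le> norm (g p) * ((1 + norm v0) * (1 + norm (snd p)))"
          using W[of p] by (intro mult_left_mono) auto
        finally show ?thesis by (simp add: mult_ac)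
      qed
      have ig: "integrable lborel (\<lambda>p. (g p \<bullet> b) * \<phi> b p)" if b: "b \<in> Basis" for b
      proof (rule Bochner_Integration.integrable_bound)
        show "integrable lborel (\<lambda>p. (1 + norm v0) * ((1 + norm (snd p)) * norm (g p)))" using G(1) by simp
        have [measurable]: "\<phi> b \<in> borel_measurable borel" by (rule smooth_borel[OF test_fun_smooth[OF t\<phi>]])
        show "(\<lambda>p. (g p \<bullet> b) * \<phi> b p) \<in> borel_measurable lborel" by measurable
        show "AE p in lborel. norm ((g p \<bullet> b) * \<phi> b p) \<le> norm ((1 + norm v0) * ((1 + norm (snd p)) * norm (g p)))"
          using order_trans[OF \<phi>_bd[OF b] abs_ge_self] by simp
      qed
      have "(\<integral>p. f p * D (S \<theta> p) \<partial>lborel) = (\<Sum>b\<in>Basis. \<integral>p. f p * d b (S \<theta> p) \<partial>lborel)"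
        unfolding D_def sum_distrib_left by (rule Bochner_Integration.integral_sum) (rule id)
      also have "\<dots> = (\<Sum>b\<in>Basis. - (\<integral>p. (g p \<bullet> b) * \<phi> b p \<partial>lborel))"
      proof (rule sum.cong[OF refl])
        fix b :: 'a assume b: "b \<in> Basis"
        from wg[unfolded weak_grad_x_def, THEN conjunct2, THEN conjunct2, rule_format, OF t\<phi>[of b] b]
        show "(\<integral>p. f p * d b (S \<theta> p) \<partial>lborel) = - (\<integral>p. (g p \<bullet> b) * \<phi> b p \<partial>lborel)"
          unfolding dd\<phi> .
      qed
      also have "\<dots> = - (\<integral>p. (\<Sum>b\<in>Basis. (g p \<bullet> b) * \<phi> b p) \<partial>lborel)"
        unfolding sum_negf by (subst Bochner_Integration.integral_sum) (use ig in auto)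
      finally have e1: "\<bar>\<integral>p. f p * D (S \<theta> p) \<partial>lborel\<bar> = \<bar>\<integral>p. (\<Sum>b\<in>Basis. (g p \<bullet> b) * \<phi> b p) \<partial>lborel\<bar>"
        by simp
      \<comment> \<open>Summing over the basis before estimating restores the full inner product of
        \<open>g\<close> with v - v0 and so avoids a factor of the dimension.\<close>
      have e2: "\<bar>\<Sum>b\<in>Basis. (g p \<bullet> b) * \<phi> b p\<bar> \<le> (1 + norm v0) * ((1 + norm (snd p)) * norm (g p))" for p
      proof -
        have "(\<Sum>b\<in>Basis. (g p \<bullet> b) * \<phi> b p) = (g p \<bullet> (snd p - v0)) * \<Phi> (S \<theta> p)"
          unfolding \<phi>_def by (subst euclidean_inner) (simp add: sum_distrib_right mult.assoc)
        also have "\<bar>\<dots>\<bar> \<le> norm (g p) * norm (snd p - v0) * 1"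
          unfolding abs_mult by (intro mult_mono Cauchy_Schwarz_ineq2 \<Phi>1) auto
        also have "\<dots> \<le> norm (g p) * ((1 + norm v0) * (1 + norm (snd p)))"
          using W[of p] by (simp add: mult_left_mono)
        finally show ?thesis by (simp add: mult_ac)
      qed
      have "\<bar>\<integral>p. (\<Sum>b\<in>Basis. (g p \<bullet> b) * \<phi> b p) \<partial>lborel\<bar>
        \<le> (\<integral>p. \<bar>\<Sum>b\<in>Basis. (g p \<bullet> b) * \<phi> b p\<bar> \<partial>lborel)" by (rule integral_abs_bound)
      also have "\<dots> \<le> (\<integral>p. (1 + norm v0) * ((1 + norm (snd p)) * norm (g p)) \<partial>lborel)"
        using e2 G(1) ig by (intro integral_mono) auto
      also have "\<dots> \<le> (1 + norm v0) * C0"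
        unfolding integral_mult_right_zero by (rule mult_left_mono[OF G(2)]) simp
      finally show ?thesis unfolding e1 .
    qed
    have "norm (\<Psi> 0 - \<Psi> c) \<le> ((1 + norm v0) * C0) * norm (0 - c)"
    proof (rule field_differentiable_bound[where S=UNIV and f=\<Psi> and f'="\<lambda>\<theta>. \<integral>p. f p * D (S \<theta> p) \<partial>lborel"])
      show "(\<Psi> has_field_derivative (\<integral>p. f p * D (S \<theta> p) \<partial>lborel)) (at \<theta> within UNIV)" for \<theta> using \<Psi>_deriv by simp
      show "norm (\<integral>p. f p * D (S \<theta> p) \<partial>lborel) \<le> (1 + norm v0) * C0" for \<theta> using ibp by simp
    qed auto
    moreover have "\<Psi> 0 = (\<integral>p. \<Phi> p \<partial>\<mu>)" unfolding int_\<mu>[OF \<Phi>m] \<Psi>_def by (simp add: S_def)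
    moreover have "\<Psi> c = (\<integral>p. \<Phi> p \<partial>distr \<mu> borel (S c))"
      unfolding integral_distr[OF S_\<mu> \<Phi>m] int_\<mu>[OF measurable_compose[OF S_m \<Phi>m]] \<Psi>_def ..
    ultimately show "\<bar>(\<integral>p. \<Phi> p \<partial>\<mu>) - (\<integral>p. \<Phi> p \<partial>distr \<mu> borel (\<lambda>p. (fst p + c *\<^sub>R (snd p - v0), snd p)))\<bar>
      \<le> c * ((1 + norm v0) * C0)"
      using c unfolding S_def[abs_def] by (simp add: mult.commute)
  qed simp
qed

text \<open>The product (1 + |v|) |g| is split into (1 + |v|)^2 exp (- H) and |g|^2 exp H. The first
  is integrable because exp (- Phi) is and the velocity factor is Gaussian. A single
  \<open>C0\<close> serves all measures with the same bound \<open>B\<close>, hence all \<gamma> and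
  all times.\<close>

lemma weighted_gradient_L1_bound:
  fixes Phi :: "'a::euclidean_space \<Rightarrow> real"
  assumes Phi: "Phi \<in> borel_measurable borel" and int: "integrable lborel (\<lambda>x. exp (- Phi x))"
  shows "\<exists>C0\<ge>0. \<forall>\<sigma>. grad_x_L2H_sq Phi \<sigma> \<le> ennreal B \<longrightarrow>
    (\<exists>f g. f \<in> borel_measurable borel \<and> (\<forall>p. 0 \<le> f p) \<and> \<sigma> = density lborel (\<lambda>p. ennreal (f p)) \<and> weak_grad_x f g \<and>
      integrable lborel (\<lambda>p. (1 + norm (snd p)) * norm (g p)) \<and> (\<integral>p. (1 + norm (snd p)) * norm (g p) \<partial>lborel) \<le> C0)"
proof -
  define H where "H p = Phi (fst p) + (norm (snd p))\<^sup>2 / 2" for p :: "'a \<times> 'a"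
  have "(\<lambda>p::'a \<times> 'a. Phi (fst p)) \<in> borel_measurable borel"
    by (rule measurable_compose[OF fst_snd_borel(1) Phi])
  then have H_m: "H \<in> borel_measurable borel" unfolding H_def[abs_def] by measurable
  define W where "W p = (1 + norm (snd p))\<^sup>2 * exp (- H p)" for p :: "'a \<times> 'a"
  have W_m: "W \<in> borel_measurable borel" unfolding W_def[abs_def] using H_m by measurable
  define w where "w v = (1 + norm v)\<^sup>2 * exp (- (norm v)\<^sup>2 / 2)" for v :: 'a
  have w_m: "w \<in> borel_measurable borel" unfolding w_def[abs_def] by measurable
  have w0: "0 \<le> w v" for v by (simp add: w_def)
  have half: "0 < (1/2 :: real)" by simp
  have w_int: "integrable lborel w"
  proof (rule Bochner_Integration.integrable_bound[OF integrable_poly_exp[OF half]])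
    show "w \<in> borel_measurable lborel" using w_m by simp
    show "AE v in lborel. norm (w v) \<le> norm ((1 + norm (v::'a)) ^ 4 * exp (- (1/2) * (norm v)\<^sup>2))"
    proof (rule AE_I2)
      fix v :: 'a
      have "(1 + norm v)\<^sup>2 \<le> (1 + norm v) ^ 4" by (rule power_increasing) auto
      then show "norm (w v) \<le> norm ((1 + norm v) ^ 4 * exp (- (1/2) * (norm v)\<^sup>2))"
        by (simp add: w_def mult_right_mono)
    qed
  qed
  have w_fin: "(\<integral>\<^sup>+v. ennreal (w v) \<partial>lborel) < \<infinity>"
    using w0 by (subst nn_integral_eq_integral[OF w_int]) (rule AE_I2, auto)
  have e_fin: "(\<integral>\<^sup>+x. ennreal (exp (- Phi x)) \<partial>lborel) < \<infinity>"
    by (subst nn_integral_eq_integral[OF int]) (rule AE_I2, auto)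
  have "(\<integral>\<^sup>+p. ennreal (W p) \<partial>(lborel \<Otimes>\<^sub>M lborel)) = (\<integral>\<^sup>+x. \<integral>\<^sup>+v. ennreal (W (x, v)) \<partial>lborel \<partial>lborel)"
    by (rule lborel.nn_integral_fst[symmetric]) (use W_m in \<open>simp add: lborel_prod\<close>)
  also have "\<dots> = (\<integral>\<^sup>+x. \<integral>\<^sup>+v. ennreal (exp (- Phi x)) * ennreal (w v) \<partial>lborel \<partial>lborel)"
  proof -
    have "ennreal (W (x, v)) = ennreal (exp (- Phi x)) * ennreal (w v)" for x v
    proof -
      have "- H (x, v) = - Phi x + (- (norm v)\<^sup>2 / 2)" by (simp add: H_def)
      then have "W (x, v) = exp (- Phi x) * w v" by (simp only: W_def w_def snd_conv exp_add mult.left_commute)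
      then show ?thesis using w0[of v] by (simp only: ennreal_mult exp_ge_zero)
    qed
    then show ?thesis by (simp only:)
  qed
  also have "\<dots> = (\<integral>\<^sup>+x. ennreal (exp (- Phi x)) \<partial>lborel) * (\<integral>\<^sup>+v. ennreal (w v) \<partial>lborel)"
    using w_m Phi by (simp add: nn_integral_cmult nn_integral_multc)
  also have "\<dots> < \<infinity>" using w_fin e_fin by (simp add: ennreal_mult_less_top)
  finally have W_fin: "(\<integral>\<^sup>+p. ennreal (W p) \<partial>lborel) < \<infinity>" by (simp only: lborel_prod)
  \<comment> \<open>\<open>max 0 B + 1\<close> lies strictly above \<open>ennreal B\<close>, also
    for negative \<open>B\<close>. The strict inequality is what extracts an actual density and
    gradient from the infimum in \<open>grad_x_L2H_sq\<close>.\<close>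
  define C where "C = (\<integral>\<^sup>+p. ennreal (W p) \<partial>lborel) + ennreal (max 0 B + 1)"
  have C_fin: "C < \<infinity>" using W_fin by (simp add: C_def)
  have "\<exists>f g. f \<in> borel_measurable borel \<and> (\<forall>p. 0 \<le> f p) \<and> \<sigma> = density lborel (\<lambda>p. ennreal (f p)) \<and> weak_grad_x f g \<and>
      integrable lborel (\<lambda>p. (1 + norm (snd p)) * norm (g p)) \<and> (\<integral>p. (1 + norm (snd p)) * norm (g p) \<partial>lborel) \<le> enn2real C"
    if le: "grad_x_L2H_sq Phi \<sigma> \<le> ennreal B" for \<sigma>
  proof -
    have "ennreal B < ennreal (max 0 B + 1)" by (simp add: ennreal_less_iff ennreal_neg max_def)
    then have "grad_x_L2H_sq Phi \<sigma> < ennreal (max 0 B + 1)" using le by (rule le_less_trans[rotated])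
    then obtain f g where fg: "f \<in> borel_measurable borel" "\<forall>p. 0 \<le> f p" "\<sigma> = density lborel (\<lambda>p. ennreal (f p))" "weak_grad_x f g"
      and lt: "(\<integral>\<^sup>+ p. ennreal ((norm (g p))\<^sup>2 * exp (Phi (fst p) + (norm (snd p))\<^sup>2 / 2)) \<partial>lborel) < ennreal (max 0 B + 1)"
      unfolding grad_x_L2H_sq_def INF_less_iff by blast
    have g_m: "g \<in> borel_measurable borel" using fg(4) by (intro loc_integrable_borel) (simp add: weak_grad_x_def)
    define G where "G p = (1 + norm (snd p)) * norm (g p)" for p
    have G_m: "G \<in> borel_measurable borel" unfolding G_def[abs_def] using g_m by measurable
    have G0: "0 \<le> G p" for p by (simp add: G_def)
    have "G p \<le> W p + (norm (g p))\<^sup>2 * exp (H p)" for p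
    proof -
      define a where "a = (1 + norm (snd p)) * exp (- (H p / 2))"
      define b where "b = norm (g p) * exp (H p / 2)"
      have "G p = a * b" by (simp add: a_def b_def G_def exp_minus)
      also have "\<dots> \<le> a\<^sup>2 + b\<^sup>2"
        using sum_squares_bound[of a b] zero_le_power2[of a] zero_le_power2[of b] by linarith
      also have "a\<^sup>2 = W p" by (simp add: a_def W_def power_mult_distrib flip: exp_double)
      also have "b\<^sup>2 = (norm (g p))\<^sup>2 * exp (H p)" by (simp add: b_def power_mult_distrib flip: exp_double)
      finally show ?thesis .
    qed
    then have "ennreal (G p) \<le> ennreal (W p + (norm (g p))\<^sup>2 * exp (H p))" for p by (rule ennreal_leI)
    then have "ennreal (G p) \<le> ennreal (W p) + ennreal ((norm (g p))\<^sup>2 * exp (H p))" for p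
      by (subst ennreal_plus[symmetric]) (simp_all add: W_def)
    then have "(\<integral>\<^sup>+p. ennreal (G p) \<partial>lborel) \<le> (\<integral>\<^sup>+p. ennreal (W p) + ennreal ((norm (g p))\<^sup>2 * exp (H p)) \<partial>lborel)"
      by (intro nn_integral_mono)
    also have "\<dots> = (\<integral>\<^sup>+p. ennreal (W p) \<partial>lborel) + (\<integral>\<^sup>+p. ennreal ((norm (g p))\<^sup>2 * exp (H p)) \<partial>lborel)"
      using W_m H_m g_m by (intro nn_integral_add) simp_all
    also have "\<dots> \<le> C" unfolding C_def using lt by (intro add_left_mono) (simp add: H_def)
    finally have le: "(\<integral>\<^sup>+p. ennreal (G p) \<partial>lborel) \<le> C" .
    have "integrable lborel G"
      using G_m G0 le C_fin by (intro integrableI_nonneg) (auto intro: le_less_trans)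
    moreover have "(\<integral>p. G p \<partial>lborel) \<le> enn2real C"
      using G_m G0 enn2real_mono[OF le] C_fin by (subst integral_eq_nn_integral) auto
    ultimately show ?thesis using fg unfolding G_def by blast
  qed
  then show ?thesis by (intro exI[of _ "enn2real C"] conjI allI impI) auto
qed

text \<open>With y = x + c v one has y - (x' + c v') = x - (x' + c (v' - v)), so the interaction at
  y of the coarse-grained measure equals the interaction at x of \<open>\<sigma>\<close> sheared
  about the velocity \<open>v\<close>. The step from \<open>k1\<close> to \<open>k2\<close> is
  therefore a shear error, the step from \<open>k2\<close> to \<open>k3\<close> is the total
  variation distance in the coarse-grained variable, and only the confinement is compared through a
  Lipschitz constant.\<close>

lemma force_difference_le:
  fixes gradPhi gradK :: "'a::euclidean_space \<Rightarrow> 'a" and \<sigma> :: "('a \<times> 'a) measure"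
  assumes \<sigma>: "prob_space \<sigma>" "sets \<sigma> = sets borel" and \<nu>: "prob_space \<nu>" "sets \<nu> = sets borel"
    and lip: "c\<^sub>P-lipschitz_on UNIV gradPhi" and K_m: "gradK \<in> borel_measurable borel" and K: "\<And>x. norm (gradK x) \<le> M"
    and c: "0 \<le> c"
    and shear: "tv_le \<sigma> (distr \<sigma> borel (\<lambda>q. (fst q + c *\<^sub>R (snd q - v), snd q))) (c * ((1 + norm v) * C0))"
    and tv: "tv_le (distr \<sigma> borel (\<lambda>q. fst q + c *\<^sub>R snd q)) \<nu> m"
  shows "norm (Fforce gradPhi gradK (distr \<sigma> borel fst) x - Fforce gradPhi gradK \<nu> (x + c *\<^sub>R v))
    \<le> c\<^sub>P * (c * norm v) + M * (c * ((1 + norm v) * C0)) + M * m"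
proof -
  have \<sigma>m: "f \<in> measurable \<sigma> borel" if "continuous_on UNIV f" for f :: "'a \<times> 'a \<Rightarrow> 'z::topological_space"
    using borel_measurable_continuous_onI[OF that] \<sigma>(2) by (simp cong: measurable_cong_sets)
  have S: "(\<lambda>q. (fst q + c *\<^sub>R (snd q - v), snd q)) \<in> measurable \<sigma> borel" by (intro \<sigma>m continuous_intros)
  have Y: "(\<lambda>q. fst q + c *\<^sub>R snd q) \<in> measurable \<sigma> borel" by (intro \<sigma>m continuous_intros)
  have F: "fst \<in> measurable \<sigma> borel" by (intro \<sigma>m continuous_intros)
  have Kx: "(\<lambda>y. gradK (z - y)) \<in> borel_measurable borel" for z
    by (rule measurable_compose[OF _ K_m]) (intro borel_measurable_continuous_onI continuous_intros)
  have Kf: "(\<lambda>q::'a \<times> 'a. gradK (z - fst q)) \<in> borel_measurable borel" for z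
    by (rule measurable_compose[OF fst_snd_borel(1) Kx])
  define y where "y = x + c *\<^sub>R v"
  define k1 where "k1 = (\<integral>q. gradK (x - fst q) \<partial>\<sigma>)"
  define k2 where "k2 = (\<integral>q. gradK (y - (fst q + c *\<^sub>R snd q)) \<partial>\<sigma>)"
  define k3 where "k3 = (\<integral>w. gradK (y - w) \<partial>\<nu>)"
  have "norm ((\<integral>q. gradK (x - fst q) \<partial>\<sigma>) - (\<integral>q. gradK (x - fst q) \<partial>distr \<sigma> borel (\<lambda>q. (fst q + c *\<^sub>R (snd q - v), snd q))))
    \<le> M * (c * ((1 + norm v) * C0))"
    by (rule norm_integral_diff_tv_le[OF shear \<sigma> prob_space.prob_space_distr[OF \<sigma>(1) S] sets_distr Kf K])
  moreover have "(\<integral>q. gradK (x - fst q) \<partial>distr \<sigma> borel (\<lambda>q. (fst q + c *\<^sub>R (snd q - v), snd q))) = k2"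
    unfolding integral_distr[OF S Kf] k2_def y_def by (simp add: algebra_simps)
  ultimately have 1: "norm (k1 - k2) \<le> M * (c * ((1 + norm v) * C0))" by (simp add: k1_def)
  have "norm ((\<integral>w. gradK (y - w) \<partial>distr \<sigma> borel (\<lambda>q. fst q + c *\<^sub>R snd q)) - (\<integral>w. gradK (y - w) \<partial>\<nu>)) \<le> M * m"
    by (rule norm_integral_diff_tv_le[OF tv prob_space.prob_space_distr[OF \<sigma>(1) Y] sets_distr \<nu> Kx K])
  then have 2: "norm (k2 - k3) \<le> M * m" unfolding integral_distr[OF Y Kx] k2_def k3_def .
  have "norm (gradPhi y - gradPhi x) \<le> c\<^sub>P * norm (y - x)"
    using lipschitz_onD[OF lip, of y x] by (simp add: dist_norm)
  then have 3: "norm (gradPhi y - gradPhi x) \<le> c\<^sub>P * (c * norm v)" using c by (simp add: y_def)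
  have "Fforce gradPhi gradK (distr \<sigma> borel fst) x - Fforce gradPhi gradK \<nu> y
    = (gradPhi y - gradPhi x) - ((k1 - k2) + (k2 - k3))"
    unfolding Fforce_def integral_distr[OF F Kx] k1_def k3_def by simp
  also have "norm \<dots> \<le> norm (gradPhi y - gradPhi x) + (norm (k1 - k2) + norm (k2 - k3))"
    using norm_triangle_ineq4[of "gradPhi y - gradPhi x" "(k1 - k2) + (k2 - k3)"] norm_triangle_ineq[of "k1 - k2" "k2 - k3"]
    by linarith
  also have "\<dots> \<le> c\<^sub>P * (c * norm v) + M * (c * ((1 + norm v) * C0)) + M * m" using 1 2 3 by linarith
  finally show ?thesis unfolding y_def .
qed

section \<open>Mean speed and the final estimate\<close>

lemma velocity_moment:
  fixes \<sigma> :: "('a::euclidean_space \<times> 'a) measure"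
  assumes P2: "P2 \<sigma>" and B: "(\<integral>\<^sup>+ p. ennreal ((norm (snd p))\<^sup>2) \<partial>\<sigma>) \<le> ennreal B"
  shows "integrable \<sigma> (\<lambda>p. norm (snd p))" and "(\<integral>p. norm (snd p) \<partial>\<sigma>) \<le> 1 + max 0 B"
proof -
  interpret prob_space \<sigma> by (rule P2D(1)[OF P2])
  have m: "(\<lambda>p. norm (snd p)) \<in> borel_measurable \<sigma>"
  proof -
    have "(\<lambda>p::'a \<times> 'a. norm (snd p)) \<in> borel_measurable borel"
      by (intro borel_measurable_continuous_onI continuous_intros)
    then show ?thesis using P2D(2)[OF P2] by (simp cong: measurable_cong_sets)
  qed
  have young: "norm (snd p) \<le> 1 + (norm (snd p))\<^sup>2" for p :: "'a \<times> 'a"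
    using sum_squares_bound[of 1 "norm (snd p)"] norm_ge_zero[of "snd p"]
    unfolding power_one by linarith
  have fin: "(\<integral>\<^sup>+p. ennreal (norm (snd p)) \<partial>\<sigma>) \<le> ennreal (1 + max 0 B)"
  proof -
    have "(\<integral>\<^sup>+p. ennreal (norm (snd p)) \<partial>\<sigma>) \<le> (\<integral>\<^sup>+p. 1 + ennreal ((norm (snd p))\<^sup>2) \<partial>\<sigma>)"
      using ennreal_leI[OF young] by (intro nn_integral_mono) simp
    also have "\<dots> = 1 + (\<integral>\<^sup>+p. ennreal ((norm (snd p))\<^sup>2) \<partial>\<sigma>)"
      using m by (subst nn_integral_add) (simp_all add: emeasure_space_1)
    also have "\<dots> \<le> 1 + ennreal (max 0 B)"
      using B by (intro add_left_mono) (auto intro: order_trans ennreal_leI)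
    finally show ?thesis by simp
  qed
  show "integrable \<sigma> (\<lambda>p. norm (snd p))"
    using m fin by (intro integrableI_nonneg) (auto intro: le_less_trans)
  have "(\<integral>p. norm (snd p) \<partial>\<sigma>) = enn2real (\<integral>\<^sup>+p. ennreal (norm (snd p)) \<partial>\<sigma>)"
    using m by (intro integral_eq_nn_integral) auto
  also have "\<dots> \<le> enn2real (ennreal (1 + max 0 B))" by (rule enn2real_mono[OF fin]) (rule ennreal_less_top)
  also have "\<dots> = 1 + max 0 B" by (rule enn2real_ennreal) simp
  finally show "(\<integral>p. norm (snd p) \<partial>\<sigma>) \<le> 1 + max 0 B" .
qed

theorem theorem1p9:
  fixes Phi :: "'a::euclidean_space \<Rightarrow> real" and gradPhi :: "'a \<Rightarrow> 'a" and cPhi :: real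
    and K :: "'a \<Rightarrow> real" and gradK :: "'a \<Rightarrow> 'a"
    and T :: real
    and \<mu> :: "real \<Rightarrow> real \<Rightarrow> ('a \<times> 'a) measure"
    and \<rho> :: "real \<Rightarrow> 'a measure"
  assumes Phi_nonneg: "\<forall>x. 0 \<le> Phi x"
    and Phi_loc_lip: "\<forall>x. \<exists>r>0. \<exists>L. L-lipschitz_on (ball x r) Phi"
    and Phi_grad: "\<forall>x. (Phi has_derivative (\<lambda>h. gradPhi x \<bullet> h)) (at x)"
    and Phi_grad_growth: "\<forall>x. norm (gradPhi x) \<le> cPhi * (1 + norm x)"
    and Phi_grad_lip: "cPhi-lipschitz_on UNIV gradPhi"
    and Phi_moments: "\<forall>r::real. 1 \<le> r \<longrightarrow> (\<exists>B. \<forall>x. norm (gradPhi x) powr r * exp (- Phi x) \<le> B)"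
    and Phi_integrable: "integrable lborel (\<lambda>x. exp (- Phi x))"
    and K_meas: "K \<in> borel_measurable borel"
    and K_grad: "weak_grad K gradK"
    and gradK_meas: "gradK \<in> borel_measurable borel"
    and gradK_bounded: "\<exists>M. \<forall>x. norm (gradK x) \<le> M"
    and T_pos: "0 < T"
    and kin_sol: "\<forall>\<gamma>\<ge>1. kin_weak_sol gradPhi gradK \<gamma> T (\<mu> \<gamma>)"
    and unif_bound: "\<exists>B::real. \<forall>\<gamma>\<ge>1. \<forall>t\<in>{0..T}.
         grad_x_L2H_sq Phi (\<mu> \<gamma> t) \<le> ennreal B \<and>
         (\<integral>\<^sup>+ p. ennreal ((norm (snd p))\<^sup>2) \<partial>(\<mu> \<gamma> t)) \<le> ennreal B"
    and rho_reg: "E_regular Phi gradPhi K gradK T \<rho>"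
  shows "\<exists>C>0. \<forall>\<gamma>\<ge>1. \<forall>t\<in>{0..T}.
           ereal ((dBL (distr (\<mu> \<gamma> t) borel fst) (\<rho> t))\<^sup>2)
             \<le> ereal C * (Ent (distr (\<mu> \<gamma> 0) borel (\<lambda>(x, v). x + v /\<^sub>R \<gamma>)) (\<rho> 0) + ereal (1 / \<gamma>\<^sup>2))"
proof -
  obtain M where M: "\<And>x. norm (gradK x) \<le> M" using gradK_bounded by blast
  have M0: "0 \<le> M" using M[of 0] norm_ge_zero[of "gradK 0"] by linarith
  have Phi_m: "Phi \<in> borel_measurable borel"
    using has_derivative_continuous[OF Phi_grad[rule_format]]
    by (intro borel_measurable_continuous_onI continuous_at_imp_continuous_on ballI)
  have cont: "continuous_on UNIV gradPhi" using Phi_grad_lip by (rule lipschitz_on_continuous_on)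
  have gPhi_m: "gradPhi \<in> borel_measurable borel" using cont by (rule borel_measurable_continuous_onI)
  have cPhi: "0 \<le> cPhi" using Phi_grad_lip by (rule lipschitz_on_nonneg)
  have sol: "agg_weak_sol gradPhi gradK T \<rho>" using rho_reg unfolding E_regular_def by (rule conjunct1)
  have cur\<rho>: "P2_curve T \<rho>" using sol unfolding agg_weak_sol_def by (rule conjunct1)
  have P2\<rho>: "P2 (\<rho> r)" if "r \<in> {0..T}" for r using cur\<rho> that unfolding P2_curve_def by blast
  have in0: "0 \<in> {0..T}" using T_pos by simp
  have "\<exists>B. \<forall>t\<in>{0..T}. Energy Phi K (\<rho> t) \<le> ereal B" using rho_reg unfolding E_regular_def by (elim conjE)
  then have ac\<rho>: "absolutely_continuous lborel (\<rho> r)" if "r \<in> {0..T}" for r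
    using that Energy_absolutely_continuous by blast
  have "\<exists>B. \<forall>t\<in>{0..T}. AE x in lborel. norm (Fforce gradPhi gradK (\<rho> t) x) \<le> B"
    using rho_reg unfolding E_regular_def by (elim conjE)
  then obtain BF where BF: "AE x in lborel. norm (Fforce gradPhi gradK (\<rho> 0) x) \<le> BF" using in0 by blast
  define P where "P = BF + M"
  have P: "norm (gradPhi x) \<le> P" for x
    unfolding P_def by (rule gradPhi_bounded_of_force[OF P2D(1)[OF P2\<rho>[OF in0]] cont M BF])
  have PM: "0 \<le> P + M" using P[of 0] norm_ge_zero[of "gradPhi 0"] M0 by linarith
  obtain B where B: "\<forall>\<gamma>\<ge>1. \<forall>t\<in>{0..T}. grad_x_L2H_sq Phi (\<mu> \<gamma> t) \<le> ennreal B \<and>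
    (\<integral>\<^sup>+ p. ennreal ((norm (snd p))\<^sup>2) \<partial>(\<mu> \<gamma> t)) \<le> ennreal B"
    using unif_bound by (elim exE)
  obtain C0 where C0: "0 \<le> C0" and dens: "\<forall>\<sigma>. grad_x_L2H_sq Phi \<sigma> \<le> ennreal B \<longrightarrow>
    (\<exists>f g. f \<in> borel_measurable borel \<and> (\<forall>p. 0 \<le> f p) \<and> \<sigma> = density lborel (\<lambda>p. ennreal (f p)) \<and> weak_grad_x f g \<and>
      integrable lborel (\<lambda>p. (1 + norm (snd p)) * norm (g p)) \<and> (\<integral>p. (1 + norm (snd p)) * norm (g p) \<partial>lborel) \<le> C0)"
    using weighted_gradient_L1_bound[OF Phi_m Phi_integrable, of B] by (elim exE conjE)
  define V where "V = 1 + max 0 B"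
  have V: "0 \<le> V" by (simp add: V_def)
  \<comment> \<open>The drift error in units of 1 / \<gamma>: the confinement costs
    \<open>cPhi\<close> times the mean speed, the interaction \<open>M * C0\<close> times the mean
    of 1 + |v|.\<close>
  define cE where "cE = cPhi * V + M * C0 * (1 + V)"
  have cE: "0 \<le> cE" using cPhi V M0 C0 by (simp add: cE_def)
  show ?thesis
  proof (rule tv_gronwall[OF T_pos M0 PM, where 'b="'a \<times> 'a" and 'a='a])
    fix Kg :: real
    assume Kg: "0 \<le> Kg" and gronwall:
      "\<And>(Na :: real \<Rightarrow> ('a \<times> 'a) measure) ya Va BA (Nr :: real \<Rightarrow> 'a measure) F a e t.
      \<lbrakk>drift_curve T BA Na ya Va; drift_curve T (P + M) Nr (\<lambda>x. x) F;
       \<And>r. r \<in> {0..T} \<Longrightarrow> absolutely_continuous lborel (distr (Na r) borel ya);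
       \<And>r. r \<in> {0..T} \<Longrightarrow> absolutely_continuous lborel (Nr r); 0 \<le> e;
       \<And>r m. r \<in> {0..T} \<Longrightarrow> tv_le (distr (Na r) borel ya) (Nr r) m \<Longrightarrow>
         (\<integral>p. norm (Va r p - F r (ya p)) \<partial>Na r) \<le> e + M * m;
       tv_le (distr (Na 0) borel ya) (Nr 0) a; t \<in> {0..T}\<rbrakk>
      \<Longrightarrow> tv_le (distr (Na t) borel ya) (Nr t) (Kg * (a + e))"
    \<comment> \<open>The distance will be at most c c1 + 2 Kg sqrt e with c = 1 / \<gamma>:
      \<open>V\<close> comes from passing between the two position variables, \<open>Kg * cE\<close>
      from the drift error, and 2 sqrt e from the entropy. Squaring with (p + q)^2 \<le> 2 p^2 + 2
      q^2 gives the coefficients 2 c1^2 and 8 Kg^2; the 1 makes \<open>C\<close> positive.\<close>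
    define c1 where "c1 = V + Kg * cE"
    define C where "C = 2 * c1\<^sup>2 + 8 * Kg\<^sup>2 + 1"
    have C: "0 < C" unfolding C_def using zero_le_power2[of c1] zero_le_power2[of Kg] by linarith
    have main: "ereal ((dBL (distr (\<mu> \<gamma> t) borel fst) (\<rho> t))\<^sup>2)
      \<le> ereal C * (Ent (distr (\<mu> \<gamma> 0) borel (\<lambda>(x, v). x + v /\<^sub>R \<gamma>)) (\<rho> 0) + ereal (1 / \<gamma>\<^sup>2))"
      if \<gamma>: "1 \<le> \<gamma>" and t: "t \<in> {0..T}" for \<gamma> t
    proof -
      define y where "y p = fst p + snd p /\<^sub>R \<gamma>" for p :: "'a \<times> 'a"
      have y_eq: "(\<lambda>(x, v). x + v /\<^sub>R \<gamma>) = y" by (simp add: y_def fun_eq_iff)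
      define c where "c = inverse \<gamma>"
      have c: "0 \<le> c" using \<gamma> by (simp add: c_def)
      have kin: "kin_weak_sol gradPhi gradK \<gamma> T (\<mu> \<gamma>)" using kin_sol \<gamma> by blast
      have P2\<mu>: "P2 (\<mu> \<gamma> r)" if "r \<in> {0..T}" for r
        using kin that unfolding kin_weak_sol_def P2_curve_def by blast
      have y_b: "y \<in> borel_measurable borel"
        unfolding y_def[abs_def] by (intro borel_measurable_continuous_onI continuous_intros)
      have meas: "h \<in> measurable (\<mu> \<gamma> r) borel" if "r \<in> {0..T}" "h \<in> borel_measurable borel"
        for r and h :: "'a \<times> 'a \<Rightarrow> 'z::topological_space"
        using P2D(2)[OF P2\<mu>[OF that(1)]] that(2) by (simp cong: measurable_cong_sets)
      have vel: "integrable (\<mu> \<gamma> r) (\<lambda>p. norm (snd p))" "(\<integral>p. norm (snd p) \<partial>\<mu> \<gamma> r) \<le> V" if "r \<in> {0..T}" for r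
      proof -
        have "(\<integral>\<^sup>+ p. ennreal ((norm (snd p))\<^sup>2) \<partial>\<mu> \<gamma> r) \<le> ennreal B" using B \<gamma> that by blast
        from velocity_moment[OF P2\<mu>[OF that] this]
        show "integrable (\<mu> \<gamma> r) (\<lambda>p. norm (snd p))" "(\<integral>p. norm (snd p) \<partial>\<mu> \<gamma> r) \<le> V"
          by (simp_all add: V_def)
      qed
      have reg: "absolutely_continuous lborel (distr (\<mu> \<gamma> r) borel y) \<and>
        (\<forall>v. tv_le (\<mu> \<gamma> r) (distr (\<mu> \<gamma> r) borel (\<lambda>q. (fst q + c *\<^sub>R (snd q - v), snd q))) (c * ((1 + norm v) * C0)))"
        if r: "r \<in> {0..T}" for r
      proof -
        have "grad_x_L2H_sq Phi (\<mu> \<gamma> r) \<le> ennreal B" using B \<gamma> r by blast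
        then obtain f g where f: "f \<in> borel_measurable borel" "\<forall>p. 0 \<le> f p"
          and d: "\<mu> \<gamma> r = density lborel (\<lambda>p. ennreal (f p))" and g: "weak_grad_x f g"
            "integrable lborel (\<lambda>p. (1 + norm (snd p)) * norm (g p))" "(\<integral>p. (1 + norm (snd p)) * norm (g p) \<partial>lborel) \<le> C0"
          using dens by blast
        have ac: "absolutely_continuous lborel (\<mu> \<gamma> r)"
          unfolding d by (rule absolutely_continuousI_density) (use f in simp)
        show ?thesis
        proof (intro conjI allI)
          show "absolutely_continuous lborel (distr (\<mu> \<gamma> r) borel y)"
            unfolding y_def[abs_def] by (rule absolutely_continuous_distr_shear(2)[OF ac P2D(2)[OF P2\<mu>[OF r]]])
          show "tv_le (\<mu> \<gamma> r) (distr (\<mu> \<gamma> r) borel (\<lambda>q. (fst q + c *\<^sub>R (snd q - v), snd q))) (c * ((1 + norm v) * C0))" for v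
            by (rule shear_tv_le[OF f(1) f(2)[rule_format] d P2D(1)[OF P2\<mu>[OF r]] g c])
        qed
      qed
      \<comment> \<open>The pointwise force difference is averaged over the position and velocity at
        which it is evaluated. The shear is centred at that velocity, and the resulting growth in
        |v| is paid for by the mean speed.\<close>
      have error: "(\<integral>p. norm (Fforce gradPhi gradK (distr (\<mu> \<gamma> r) borel fst) (fst p) - Fforce gradPhi gradK (\<rho> r) (y p)) \<partial>\<mu> \<gamma> r)
        \<le> c * cE + M * m" if r: "r \<in> {0..T}" and tv: "tv_le (distr (\<mu> \<gamma> r) borel y) (\<rho> r) m" for r m
      proof -
        interpret prob_space "\<mu> \<gamma> r" by (rule P2D(1)[OF P2\<mu>[OF r]])
        have m0: "0 \<le> m" by (rule tv_le_nonneg[OF tv])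
        define A where "A = c * (cPhi + M * C0)"
        define D where "D = M * c * C0 + M * m"
        have A: "0 \<le> A" using c cPhi M0 C0 by (simp add: A_def)
        have D: "0 \<le> D" using c M0 C0 m0 by (simp add: D_def)
        have le: "norm (Fforce gradPhi gradK (distr (\<mu> \<gamma> r) borel fst) (fst p) - Fforce gradPhi gradK (\<rho> r) (y p)) \<le> A * norm (snd p) + D" for p
        proof -
          have "norm (Fforce gradPhi gradK (distr (\<mu> \<gamma> r) borel fst) (fst p) - Fforce gradPhi gradK (\<rho> r) (fst p + c *\<^sub>R snd p))
            \<le> cPhi * (c * norm (snd p)) + M * (c * ((1 + norm (snd p)) * C0)) + M * m"
          proof (rule force_difference_le[OF P2D(1,2)[OF P2\<mu>[OF r]] P2D(1,2)[OF P2\<rho>[OF r]] Phi_grad_lip gradK_meas M c])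
            show "tv_le (\<mu> \<gamma> r) (distr (\<mu> \<gamma> r) borel (\<lambda>q. (fst q + c *\<^sub>R (snd q - snd p), snd q))) (c * ((1 + norm (snd p)) * C0))"
              using reg[OF r] by blast
            show "tv_le (distr (\<mu> \<gamma> r) borel (\<lambda>q. fst q + c *\<^sub>R snd q)) (\<rho> r) m"
              using tv unfolding y_def[abs_def] c_def .
          qed
          also have "\<dots> = A * norm (snd p) + D" by (simp add: A_def D_def algebra_simps)
          finally show ?thesis by (simp add: y_def c_def)
        qed
        have "(\<integral>p. norm (Fforce gradPhi gradK (distr (\<mu> \<gamma> r) borel fst) (fst p) - Fforce gradPhi gradK (\<rho> r) (y p)) \<partial>\<mu> \<gamma> r)
          \<le> (\<integral>p. A * norm (snd p) + D \<partial>\<mu> \<gamma> r)"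
          using vel(1)[OF r] A D le by (intro integral_mono') auto
        also have "\<dots> = A * (\<integral>p. norm (snd p) \<partial>\<mu> \<gamma> r) + D"
          using vel(1)[OF r] by (simp add: prob_space)
        also have "\<dots> \<le> A * V + D" using vel(2)[OF r] A by (intro add_right_mono mult_left_mono)
        also have "\<dots> = c * cE + M * m" by (simp add: A_def D_def cE_def algebra_simps)
        finally show ?thesis .
      qed
      have tv_t: "tv_le (distr (\<mu> \<gamma> t) borel y) (\<rho> t) (Kg * (a + c * cE))"
        if a: "tv_le (distr (\<mu> \<gamma> 0) borel y) (\<rho> 0) a" for a
      proof -
        have cl: "clamp_time T r \<in> {0..T}" for r using T_pos clamp_time_in[of T r] by simp
        have "tv_le (distr (\<mu> \<gamma> (clamp_time T t)) borel y) (\<rho> (clamp_time T t)) (Kg * (a + c * cE))"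
        proof (rule gronwall[OF kin_drift_curve[OF T_pos kin \<gamma> gPhi_m gradK_meas P M, folded y_def]
              agg_drift_curve[OF T_pos sol gPhi_m gradK_meas P M] _ ac\<rho>[OF cl] _ error[OF cl] _ t])
          show "absolutely_continuous lborel (distr (\<mu> \<gamma> (clamp_time T r)) borel y)" for r using reg[OF cl] by blast
          show "0 \<le> c * cE" using c cE by simp
          show "tv_le (distr (\<mu> \<gamma> (clamp_time T 0)) borel y) (\<rho> (clamp_time T 0)) a"
            using a clamp_time_id[OF in0] by simp
        qed
        then show ?thesis using clamp_time_id[OF t] by simp
      qed
      have prob: "prob_space (distr (\<mu> \<gamma> r) borel y)" if "r \<in> {0..T}" for r
        by (rule prob_space.prob_space_distr[OF P2D(1)[OF P2\<mu>[OF that]] meas[OF that y_b]])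
      consider "Ent (distr (\<mu> \<gamma> 0) borel y) (\<rho> 0) = \<infinity>"
        | e where "0 \<le> e" "Ent (distr (\<mu> \<gamma> 0) borel y) (\<rho> 0) = ereal e" "tv_le (distr (\<mu> \<gamma> 0) borel y) (\<rho> 0) (2 * sqrt e)"
        using tv_le_Ent[OF prob[OF in0] P2D(1,2)[OF P2\<rho>[OF in0]]] by blast
      then show ?thesis
      proof cases
        \<comment> \<open>Infinite initial entropy makes the right side infinite, because
          \<open>C\<close> is positive.\<close>
        case 1
        then show ?thesis using C by (simp add: y_eq)
      next
        case 2
        have tv: "tv_le (distr (\<mu> \<gamma> t) borel y) (\<rho> t) (Kg * (2 * sqrt e + c * cE))" by (rule tv_t[OF 2(3)])
        define d where "d = dBL (distr (\<mu> \<gamma> t) borel fst) (\<rho> t)"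
        \<comment> \<open>The Lipschitz property serves only to pass from x to x + v / \<gamma>, at
          the cost of the mean speed over \<gamma>. From there on boundedness is enough for the
          total variation bound.\<close>
        have BL: "\<bar>(\<integral>x. f x \<partial>distr (\<mu> \<gamma> t) borel fst) - (\<integral>x. f x \<partial>\<rho> t)\<bar> \<le> c * V + Kg * (2 * sqrt e + c * cE)"
          if f: "1-lipschitz_on UNIV f" "\<And>x. \<bar>f x\<bar> \<le> 1" for f :: "'a \<Rightarrow> real"
        proof -
          interpret prob_space "\<mu> \<gamma> t" by (rule P2D(1)[OF P2\<mu>[OF t]])
          have fm: "f \<in> borel_measurable borel"
            by (rule borel_measurable_continuous_onI[OF lipschitz_on_continuous_on[OF f(1)]])
          have i: "integrable (\<mu> \<gamma> t) (\<lambda>p. f (z p))" if "z \<in> borel_measurable borel" for z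
            using meas[OF t measurable_compose[OF that fm]] f(2) by (intro integrable_const_bound[where B=1]) auto
          have le: "\<bar>f (fst p) - f (y p)\<bar> \<le> c * norm (snd p)" for p
            using lipschitz_onD[OF f(1), of "fst p" "y p"] c by (simp add: y_def c_def dist_norm)
          have "\<bar>(\<integral>p. f (fst p) \<partial>\<mu> \<gamma> t) - (\<integral>p. f (y p) \<partial>\<mu> \<gamma> t)\<bar> = \<bar>\<integral>p. f (fst p) - f (y p) \<partial>\<mu> \<gamma> t\<bar>"
            using i[OF fst_snd_borel(1)] i[OF y_b] by simp
          also have "\<dots> \<le> (\<integral>p. \<bar>f (fst p) - f (y p)\<bar> \<partial>\<mu> \<gamma> t)" by (rule integral_abs_bound)
          also have "\<dots> \<le> (\<integral>p. c * norm (snd p) \<partial>\<mu> \<gamma> t)"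
            using vel(1)[OF t] le c by (intro integral_mono') auto
          also have "\<dots> \<le> c * V" using mult_left_mono[OF vel(2)[OF t] c] by simp
          finally have 1: "\<bar>(\<integral>p. f (fst p) \<partial>\<mu> \<gamma> t) - (\<integral>p. f (y p) \<partial>\<mu> \<gamma> t)\<bar> \<le> c * V" .
          have "\<bar>(\<integral>x. f x \<partial>distr (\<mu> \<gamma> t) borel y) - (\<integral>x. f x \<partial>\<rho> t)\<bar> \<le> 1 * (Kg * (2 * sqrt e + c * cE))"
            by (rule tv_leD[OF tv fm f(2)])
          then have 2: "\<bar>(\<integral>p. f (y p) \<partial>\<mu> \<gamma> t) - (\<integral>x. f x \<partial>\<rho> t)\<bar> \<le> Kg * (2 * sqrt e + c * cE)"
            unfolding integral_distr[OF meas[OF t y_b] fm] by simp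
          have 3: "(\<integral>x. f x \<partial>distr (\<mu> \<gamma> t) borel fst) = (\<integral>p. f (fst p) \<partial>\<mu> \<gamma> t)"
            by (rule integral_distr[OF meas[OF t fst_snd_borel(1)] fm])
          show "\<bar>(\<integral>x. f x \<partial>distr (\<mu> \<gamma> t) borel fst) - (\<integral>x. f x \<partial>\<rho> t)\<bar> \<le> c * V + Kg * (2 * sqrt e + c * cE)"
            unfolding 3 using 1 2 by linarith
        qed
        have d: "0 \<le> d" "d \<le> c * V + Kg * (2 * sqrt e + c * cE)"
          unfolding d_def using dBL_le[OF BL] by blast+
        have "d\<^sup>2 \<le> (c * V + Kg * (2 * sqrt e + c * cE))\<^sup>2" using d by (intro power_mono) auto
        also have "c * V + Kg * (2 * sqrt e + c * cE) = c * c1 + 2 * Kg * sqrt e" by (simp add: c1_def algebra_simps)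
        also have "(c * c1 + 2 * Kg * sqrt e)\<^sup>2 \<le> 2 * (c * c1)\<^sup>2 + 2 * (2 * Kg * sqrt e)\<^sup>2"
          using zero_le_power2[of "c * c1 - 2 * Kg * sqrt e"] unfolding power2_sum power2_diff by linarith
        also have "\<dots> = 2 * c1\<^sup>2 * c\<^sup>2 + 8 * Kg\<^sup>2 * e" using 2(1) by (simp add: power_mult_distrib)
        also have "\<dots> \<le> C * c\<^sup>2 + C * e"
          using 2(1) by (intro add_mono mult_right_mono) (simp_all add: C_def)
        also have "\<dots> = C * (e + 1 / \<gamma>\<^sup>2)" by (simp add: c_def power_inverse field_simps)
        finally show ?thesis using 2(2) unfolding y_eq d_def[symmetric] by simp
      qed
    qed
    show ?thesis using C main by blast
  qed
qed

end
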